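(* Let $(X,\mu)$ be a probability space, let $T$ be an ergodic additive action on $(X,\mu)$ and let $S$ be a pretentiously ergodic finitely generated multiplicative action on $(X,\mu)$. Then $T$ and $S$ are jointly ergodic if and only if $\sigma_{\mathrm{rat}}(T)\cap\widetilde{\sigma}_{\mathrm{pr.rat}}(S)=\{0\}$.
   Context: $\mathbb{N}=\{1,2,\dots\}$, $\mathbb{P}$ is the set of primes, $\mathbb{S}^1$ is the complex unit circle, $e(t)=e^{2\pi i t}$. Every probability space $(X,\mu)$ is assumed regular: $X$ is a compact metric space with its Borel $\sigma$-algebra. An additive action $T$ on $(X,\mu)$ is the action $(T^n)_{n\in\mathbb{N}}$ of a single invertible measure-preserving transformation $T$; $T^nF=F\circ T^n$. Its rational spectrum is $\sigma_{\mathrm{rat}}(T)=\{\alpha\in[0,1)\cap\mathbb{Q}: e(\alpha)\text{ is an eigenvalue of }T\text{ on }L^2(X)\}$. A multiplicative action on $(X,\mu)$ is a sequence $S=(S_n)_{n\in\mathbb{N}}$ of commuting invertible measure-preserving transformations of $(X,\mu)$ with $S_{nm}=S_n\circ S_m$ for all $n,m\in\mathbb{N}$. It is finitely generated if $\{S_p:p\in\mathbb{P}\}$ is finite; $S_nF=F\circ S_n$. It is pretentiously ergodic if every measurable $A\subseteq X$ with $\sum_{p\in\mathbb{P}}\frac{\|S_p\mathbf{1}_A-\mathbf{1}_A\|_2^2}{p}<\infty$ satisfies $\mu(A)\in\{0,1\}$. No commutation between $T$ and $S$ is assumed. $T$ and $S$ are jointly ergodic if for all $F,G\in L^\infty(X)$,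 $\lim_{N\to\infty}\frac1N\sum_{n=1}^N T^nF\cdot S_nG=\int_X F\,d\mu\int_X G\,d\mu$ in $L^2(X)$. Let $\mathcal{M}^{\mathrm c}$ be the set of completely multiplicative functions $f:\mathbb{N}\to\mathbb{S}^1$. For multiplicative $f,g:\mathbb{N}\to\mathbb{C}$ bounded by $1$ in modulus, $\mathbb{D}(f,g)=\big(\sum_{p\in\mathbb{P}}\frac{1-\mathrm{Re}(f(p)\overline{g(p)})}{p}\big)^{1/2}\in[0,\infty]$. For a Dirichlet character $\chi$, its modified character $\chi^\ast\in\mathcal{M}^{\mathrm c}$ is $\chi^\ast(n)=\chi(n)$ if $\chi(n)\neq0$ and the completely multiplicative function with value $1$ at the primes $p$ where $\chi(p)=0$. For $f\in\mathcal{M}^{\mathrm c}$, $\mathbb{D}_F(S,f)=\big(\frac12\sum_{p\in\mathbb{P}}\frac{\|S_pF-f(p)F\|_2^2}{p}\big)^{1/2}$ and $\mathbb{D}(S,f)=\inf_{\|F\|_2=1}\mathbb{D}_F(S,f)$; $\mathbb{D}(S,\chi)$ means $\mathbb{D}(S,\chi^\ast)$. Put $\mathcal{A}_\chi=\{g\in\mathcal{M}^{\mathrm c}:\mathbb{D}(\chi,g)<\infty\}$ and $\sigma_{\mathrm{pr.rat}}(S)=\bigcup_{\chi:\,\mathbb{D}(S,\chi)<\infty}\mathcal{A}_\chi$, the union over Dirichlet characters $\chi$. One writes $\chi\in\sigma_{\mathrm{pr.rat}}(S)$ to mean $\chi^\ast\in\sigma_{\mathrm{pr.rat}}(S)$.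 Finally, $$\widetilde{\sigma}_{\mathrm{pr.rat}}(S)=\Big\{\tfrac rq\in\mathbb{Q}:\gcd(r,q)=1\text{ and there is a primitive Dirichlet character }\chi\text{ mod }q\text{ with }\chi\in\sigma_{\mathrm{pr.rat}}(S)\Big\}\cup\{0\}.$$ *)

theory Defs
  imports "HOL-Probability.Probability" "HOL-Computational_Algebra.Primes"
begin

definition regular_prob_space :: "'a::metric_space measure \<Rightarrow> bool" where
  "regular_prob_space M \<longleftrightarrow>
     prob_space M \<and> compact (space M) \<and> sets M = sets (restrict_space borel (space M))"

definition L2 :: "'a measure \<Rightarrow> ('a \<Rightarrow> complex) set" where
  "L2 M = {F. F \<in> borel_measurable M \<and> integrable M (\<lambda>x. (norm (F x))\<^sup>2)}"

definition L2_norm :: "'a measure \<Rightarrow> ('a \<Rightarrow> complex) \<Rightarrow> real" where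
  "L2_norm M F = sqrt (LINT x|M. (norm (F x))\<^sup>2)"

definition Linf :: "'a measure \<Rightarrow> ('a \<Rightarrow> complex) set" where
  "Linf M = {F. F \<in> borel_measurable M \<and> (\<exists>C. AE x in M. norm (F x) \<le> C)}"

definition invertible_measure_preserving :: "'a measure \<Rightarrow> ('a \<Rightarrow> 'a) \<Rightarrow> bool" where
  "invertible_measure_preserving M T \<longleftrightarrow>
     T \<in> M \<rightarrow>\<^sub>M M \<and> bij_betw T (space M) (space M) \<and>
     the_inv_into (space M) T \<in> M \<rightarrow>\<^sub>M M \<and> distr M M T = M"

text \<open>The additive action generated by \<open>T\<close> is the family of iterates \<open>T ^^ n\<close>; it is represented by
  \<open>T\<close> itself.\<close>

definition additive_action :: "'a measure \<Rightarrow> ('a \<Rightarrow> 'a) \<Rightarrow> bool" where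
  "additive_action M T \<longleftrightarrow> invertible_measure_preserving M T"

definition ergodic :: "'a measure \<Rightarrow> ('a \<Rightarrow> 'a) \<Rightarrow> bool" where
  "ergodic M T \<longleftrightarrow> (\<forall>A\<in>sets M. T -` A \<inter> space M = A \<longrightarrow> measure M A \<in> {0, 1})"

definition L2_eigenvalue :: "'a measure \<Rightarrow> ('a \<Rightarrow> 'a) \<Rightarrow> complex \<Rightarrow> bool" where
  "L2_eigenvalue M T c \<longleftrightarrow>
     (\<exists>F\<in>L2 M. \<not> (AE x in M. F x = 0) \<and> (AE x in M. F (T x) = c * F x))"

definition rational_spectrum :: "'a measure \<Rightarrow> ('a \<Rightarrow> 'a) \<Rightarrow> real set" where
  "rational_spectrum M T = {\<alpha> \<in> {0..<1} \<inter> \<rat>. L2_eigenvalue M T (cis (2 * pi * \<alpha>))}"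

text \<open>The index set is the positive integers: \<open>S 0\<close> plays no role.\<close>

definition multiplicative_action :: "'a measure \<Rightarrow> (nat \<Rightarrow> 'a \<Rightarrow> 'a) \<Rightarrow> bool" where
  "multiplicative_action M S \<longleftrightarrow>
     (\<forall>n\<ge>1. invertible_measure_preserving M (S n)) \<and>
     (\<forall>m\<ge>1. \<forall>n\<ge>1. \<forall>x\<in>space M. S m (S n x) = S n (S m x)) \<and>
     (\<forall>m\<ge>1. \<forall>n\<ge>1. \<forall>x\<in>space M. S (n * m) x = S n (S m x))"

text \<open>Restriction to \<open>space M\<close> identifies maps that differ only outside the underlying space.\<close>

definition finitely_generated :: "'a measure \<Rightarrow> (nat \<Rightarrow> 'a \<Rightarrow> 'a) \<Rightarrow> bool" where
  "finitely_generated M S \<longleftrightarrow> finite {restrict (S p) (space M) | p. prime p}"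

definition pretentiously_ergodic :: "'a measure \<Rightarrow> (nat \<Rightarrow> 'a \<Rightarrow> 'a) \<Rightarrow> bool" where
  "pretentiously_ergodic M S \<longleftrightarrow>
     (\<forall>A\<in>sets M.
        (\<lambda>p. (L2_norm M (\<lambda>x. indicator A (S p x) - indicator A x))\<^sup>2 / real p)
          summable_on {p. prime p}
        \<longrightarrow> measure M A \<in> {0, 1})"

definition jointly_ergodic ::
  "'a measure \<Rightarrow> ('a \<Rightarrow> 'a) \<Rightarrow> (nat \<Rightarrow> 'a \<Rightarrow> 'a) \<Rightarrow> bool" where
  "jointly_ergodic M T S \<longleftrightarrow>
     (\<forall>F\<in>Linf M. \<forall>G\<in>Linf M.
        (\<lambda>N. L2_norm M (\<lambda>x. (\<Sum>n=1..N. F ((T ^^ n) x) * G (S n x)) / of_nat N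
                             - (LINT y|M. F y) * (LINT y|M. G y))) \<longlonglongrightarrow> 0)"

text \<open>Arithmetic functions are modelled on \<open>nat\<close>; their value at \<open>0\<close> is irrelevant.\<close>

definition unimodular_cmult :: "(nat \<Rightarrow> complex) set" where
  "unimodular_cmult =
     {f. (\<forall>n\<ge>1. norm (f n) = 1) \<and> (\<forall>m\<ge>1. \<forall>n\<ge>1. f (m * n) = f m * f n)}"

definition sqrt_ennreal :: "ennreal \<Rightarrow> ennreal" where
  "sqrt_ennreal x = (if x = \<infinity> then \<infinity> else ennreal (sqrt (enn2real x)))"

definition pret_dist :: "(nat \<Rightarrow> complex) \<Rightarrow> (nat \<Rightarrow> complex) \<Rightarrow> ennreal" where
  "pret_dist f g =
     sqrt_ennreal (\<Sum>\<^sub>\<infinity>p\<in>{p. prime p}. ennreal ((1 - Re (f p * cnj (g p))) / real p))"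

definition dirichlet_character :: "nat \<Rightarrow> (nat \<Rightarrow> complex) \<Rightarrow> bool" where
  "dirichlet_character q chi \<longleftrightarrow>
     q \<ge> 1 \<and> (\<forall>m n. chi (m * n) = chi m * chi n) \<and> (\<forall>n. chi (n + q) = chi n) \<and>
     (\<forall>n. chi n \<noteq> 0 \<longleftrightarrow> coprime n q)"

text \<open>Primitive: not induced by a character of a proper divisor of the modulus. In particular the
  constant character modulo 1 is primitive.\<close>

definition primitive_character :: "nat \<Rightarrow> (nat \<Rightarrow> complex) \<Rightarrow> bool" where
  "primitive_character q chi \<longleftrightarrow>
     dirichlet_character q chi \<and>
     \<not> (\<exists>d \<psi>. d dvd q \<and> d < q \<and> dirichlet_character d \<psi> \<and> (\<forall>n. coprime n q \<longrightarrow> chi n = \<psi> n))"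

text \<open>The completely multiplicative function with value \<open>chi p\<close> at primes with \<open>chi p \<noteq> 0\<close> and \<open>1\<close> at the
  remaining primes.\<close>

definition modified_character :: "(nat \<Rightarrow> complex) \<Rightarrow> nat \<Rightarrow> complex" where
  "modified_character chi n = (\<Prod>p\<in>#prime_factorization n. if chi p = 0 then 1 else chi p)"

lemma modified_character_prime:
  "prime p \<Longrightarrow> modified_character chi p = (if chi p = 0 then 1 else chi p)"
  by (simp add: modified_character_def prime_factorization_prime)

lemma modified_character_mult:
  "m \<ge> 1 \<Longrightarrow> n \<ge> 1 \<Longrightarrow>
     modified_character chi (m * n) = modified_character chi m * modified_character chi n"
  by (simp add: modified_character_def prime_factorization_mult)

lemma modified_character_eq:
  assumes "dirichlet_character q chi" "n \<ge> 1" "chi n \<noteq> 0"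
  shows "modified_character chi n = chi n"
  using assms(2,3)
proof (induction n rule: prime_divisors_induct)
  case zero
  then show ?case by simp
next
  case (unit n)
  have "chi (1 * 1) = chi 1 * chi 1"
    using assms(1) unfolding dirichlet_character_def by blast
  then have "chi 1 = chi 1 * chi 1" by simp
  moreover have "chi 1 \<noteq> 0"
    using assms(1) coprime_1_left unfolding dirichlet_character_def by blast
  ultimately have "chi 1 = 1" by simp
  with unit show ?case by (simp add: modified_character_def)
next
  case (factor p n)
  have "chi (p * n) = chi p * chi n"
    using assms(1) unfolding dirichlet_character_def by blast
  moreover from this factor.prems(2) have nz: "chi p \<noteq> 0" "chi n \<noteq> 0"
    by simp_all
  moreover have pos: "n \<ge> 1" "p \<ge> 1"
    using factor.prems(1) by (cases n; cases p; simp)+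
  moreover have "modified_character chi n = chi n"
    using factor.IH pos nz by blast
  moreover have "modified_character chi p = chi p"
    using modified_character_prime[OF factor.hyps] nz by simp
  ultimately show ?case
    using modified_character_mult[OF pos(2,1)] by simp
qed

definition action_dist_at ::
  "'a measure \<Rightarrow> (nat \<Rightarrow> 'a \<Rightarrow> 'a) \<Rightarrow> ('a \<Rightarrow> complex) \<Rightarrow> (nat \<Rightarrow> complex) \<Rightarrow> ennreal" where
  "action_dist_at M S F f =
     sqrt_ennreal ((1 / 2) * (\<Sum>\<^sub>\<infinity>p\<in>{p. prime p}.
        ennreal ((L2_norm M (\<lambda>x. F (S p x) - f p * F x))\<^sup>2 / real p)))"

definition action_dist ::
  "'a measure \<Rightarrow> (nat \<Rightarrow> 'a \<Rightarrow> 'a) \<Rightarrow> (nat \<Rightarrow> complex) \<Rightarrow> ennreal" where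
  "action_dist M S f = (INF F\<in>{F \<in> L2 M. L2_norm M F = 1}. action_dist_at M S F f)"

definition pretentious_class :: "(nat \<Rightarrow> complex) \<Rightarrow> (nat \<Rightarrow> complex) set" where
  "pretentious_class chi = {g \<in> unimodular_cmult. pret_dist chi g < \<infinity>}"

definition pret_rational_spectrum ::
  "'a measure \<Rightarrow> (nat \<Rightarrow> 'a \<Rightarrow> 'a) \<Rightarrow> (nat \<Rightarrow> complex) set" where
  "pret_rational_spectrum M S =
     (\<Union>chi\<in>{chi. (\<exists>q. dirichlet_character q chi) \<and> action_dist M S (modified_character chi) < \<infinity>}.
        pretentious_class chi)"

definition pret_rational_spectrum_fractions ::
  "'a measure \<Rightarrow> (nat \<Rightarrow> 'a \<Rightarrow> 'a) \<Rightarrow> real set" where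
  "pret_rational_spectrum_fractions M S =
     {real_of_int r / real q | r q. q \<ge> 1 \<and> coprime r (int q) \<and>
        (\<exists>chi. primitive_character q chi \<and> modified_character chi \<in> pret_rational_spectrum M S)}
     \<union> {0}"

end

(* Averages of S_n G with G of mean zero, possibly twisted by a Dirichlet character chi, are asymptotically
invariant under every twisted S_p whose colour (the pair of S_p and chi(p), which takes finitely many values)
is shared by a divergent set of primes. This follows from the dual Turan-Kubilius inequality together with
pairs of primes of equal colour whose ratio is close to 1; such pairs exist by a sieve upper bound. Hence the
averages tend to 0 unless there is an invariant function, that is, unless the conjugate of chi lies in the
pretentious rational spectrum.

If the spectra are disjoint, replace F, for D = m!, by its projection w to the T^D-invariant functions. Up to a
small error, F - w has bounded sums along T^d for all d dividing D, in particular for all differences d of primes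
up to m, and is handled by Katai's criterion on a colour class of such primes; w is a sum of eigenfunctions of
T with root-of-unity eigenvalues, which reduce to averages of e(na/q) S_n G and, by Fourier analysis on the
units, to averages twisted by characters.

Conversely, let r/q lie in both spectra and let chi be a character mod q that is pretentious for S. An
eigenfunction G of all S_p outside a sparse set of primes exists, and testing joint ergodicity with G and the
powers of the eigenfunction of T shows, after summing over residues, that the averages of conj(chi)(n) S_n G
vanish asymptotically. A finite sieve shows that they do not. *)

theory Submission
  imports Defs "HOL-Number_Theory.Prime_Powers" "HOL-Number_Theory.Residues" "HOL-Real_Asymp.Real_Asymp"
begin

section \<open>Chebyshev and Mertens bounds\<close>

text \<open>The obstacle is a change of scale. The dual Turan-Kubilius inequality compares the
  average at \<open>y\<close> with averages at \<open>y / p\<close>, and the averages of n^(it)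
  satisfy all these relations asymptotically without being invariant. Two primes of one colour and
  nearly equal size exclude this: they force the averages to vary slowly with the scale. The primes
  that the inequality fails to control depend on \<open>y\<close>. Hence such a pair must exist
  below a bound fixed in advance, for every colouring with at most \<open>k\<close> colours and
  every exceptional set whose reciprocal sum is at most \<open>K\<close>. That uniformity shapes the
  first half of the file.

  Invariant parts, for the twisted action and for the powers of T alike, are limits of
  norm-minimising sequences in hulls of orbits. Bounded sums are available for elements
  \<open>c\<close> of the hull but need not survive the limit \<open>w\<close>. The small error is
  therefore c - w, in the decomposition F = (F - c) + (c - w) + w.\<close>

lemma multiples_eq_image: "{n\<in>{1..N}. d dvd n} = (\<lambda>k. d * k) ` {1..N div d}" if "d \<ge> 1" for d N :: nat
proof (rule Set.set_eqI)
  fix n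
  show "n \<in> {n\<in>{1..N}. d dvd n} \<longleftrightarrow> n \<in> (\<lambda>k. d * k) ` {1..N div d}"
  proof
    assume n: "n \<in> {n\<in>{1..N}. d dvd n}"
    then obtain k where k: "n = d * k" by blast
    with n have "k \<ge> 1" by (cases k) auto
    moreover have "k \<le> N div d"
      using n k that by (simp add: less_eq_div_iff_mult_less_eq mult.commute)
    ultimately show "n \<in> (\<lambda>k. d * k) ` {1..N div d}"
      using k by (intro image_eqI[of _ _ k]) auto
  next
    assume "n \<in> (\<lambda>k. d * k) ` {1..N div d}"
    then obtain k where "n = d * k" "k \<in> {1..N div d}" by (rule imageE)
    then have k: "n = d * k" "k \<ge> 1" "k \<le> N div d" by simp_all
    then have "k * d \<le> N" using that by (simp add: less_eq_div_iff_mult_less_eq)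
    then show "n \<in> {n\<in>{1..N}. d dvd n}" using k that by (simp add: mult.commute)
  qed
qed

lemma card_multiples: "card {n\<in>{1..N}. d dvd n} = N div d" if "d \<ge> 1" for d N :: nat
proof -
  have "{n\<in>{1..N}. d dvd n} = (\<lambda>k. d * k) ` {1..N div d}" using that by (rule multiples_eq_image)
  moreover have "inj_on (\<lambda>k. d * k) {1..N div d}" using that by (intro inj_onI) simp
  ultimately show ?thesis by (simp add: card_image)
qed

text \<open>The identity ln n = sum of Lambda(d) over d | n, summed over n <= N with the order of
  summation exchanged. The Chebyshev and Mertens estimates below are read off from it.\<close>

lemma ln_fact_eq_sum_mangoldt:
  "ln (fact N :: real) = (\<Sum>d=1..N. mangoldt d * real (N div d))"
proof -
  have "ln (fact N :: real) = (\<Sum>n=1..N. ln (real n))"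
    by (induction N) (auto simp: ln_mult)
  also have "\<dots> = (\<Sum>n=1..N. \<Sum>d | d dvd n. mangoldt d)"
    by (intro sum.cong refl) (subst mangoldt_sum, auto)
  also have "\<dots> = (\<Sum>n=1..N. \<Sum>d=1..N. if d dvd n then mangoldt d else 0)"
  proof (rule sum.cong[OF refl])
    fix n assume n: "n \<in> {1..N}"
    have "{d. d dvd n} = {d\<in>{1..N}. d dvd n}"
      using n by (auto dest: dvd_imp_le intro!: Nat.gr0I simp: Suc_le_eq)
    then have "(\<Sum>d | d dvd n. mangoldt d :: real) = (\<Sum>d\<in>{d\<in>{1..N}. d dvd n}. mangoldt d)"
      by simp
    also have "\<dots> = (\<Sum>d=1..N. if d dvd n then mangoldt d else 0)"
      by (rule sum.inter_filter) simp
    finally show "(\<Sum>d | d dvd n. mangoldt d) = (\<Sum>d=1..N. if d dvd n then mangoldt d else 0 :: real)" .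
  qed
  also have "\<dots> = (\<Sum>d=1..N. \<Sum>n=1..N. if d dvd n then mangoldt d else 0)"
    by (rule sum.swap)
  also have "\<dots> = (\<Sum>d=1..N. mangoldt d * real (N div d))"
  proof (rule sum.cong[OF refl])
    fix d assume "d \<in> {1..N}"
    then have "(\<Sum>n\<in>{n\<in>{1..N}. d dvd n}. mangoldt d) = (mangoldt d * real (N div d) :: real)"
      by (subst sum_constant, subst card_multiples) auto
    then show "(\<Sum>n=1..N. if d dvd n then mangoldt d else 0) = (mangoldt d * real (N div d) :: real)"
      by (subst (asm) sum.inter_filter) auto
  qed
  finally show ?thesis .
qed

definition psi :: "nat \<Rightarrow> real" where "psi N = (\<Sum>d=1..N. mangoldt d)"

lemma psi_mono: "M \<le> N \<Longrightarrow> psi M \<le> psi N"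
  unfolding psi_def by (intro sum_mono2) (auto simp: mangoldt_nonneg)

text \<open>Chebyshev's argument: floor(2N/d) - 2 floor(N/d) is never negative and is at least 1 for
  N < d <= 2N. The weights between N and 2N are therefore dominated by the logarithm of the central
  binomial coefficient, which is at most 4^N.\<close>

lemma psi_double: "psi (2 * N) \<le> psi N + 2 * real N * ln 2"
proof -
  have "psi (2 * N) - psi N = (\<Sum>d\<in>{1..2*N} - {1..N}. mangoldt d)"
    unfolding psi_def by (subst sum_diff) auto
  also have "\<dots> = (\<Sum>d=1..2*N. if N < d then mangoldt d else 0)"
    by (intro sum.mono_neutral_cong_left) auto
  also have "\<dots> \<le> (\<Sum>d=1..2*N. mangoldt d * (real (2 * N div d) - 2 * real (N div d)))"
  proof (intro sum_mono)
    fix d assume d: "d \<in> {1..2*N}"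
    have "real (2 * N div d) - 2 * real (N div d) \<ge> (if N < d then 1 else 0)"
    proof (cases "N < d")
      case True
      then have "2 * N div d \<ge> 1" using d by (simp add: div_greater_zero_iff Suc_le_eq)
      then show ?thesis using True by simp
    next
      case False
      have "2 * (N div d) \<le> 2 * N div d"
        using d by (simp add: less_eq_div_iff_mult_less_eq mult.assoc)
      then show ?thesis using False by simp
    qed
    then have "mangoldt d * (if N < d then 1 else 0)
        \<le> mangoldt d * (real (2 * N div d) - 2 * real (N div d))"
      by (intro mult_left_mono) (auto simp: mangoldt_nonneg)
    then show "(if N < d then mangoldt d else 0)
        \<le> mangoldt d * (real (2 * N div d) - 2 * real (N div d))" by (auto split: if_splits)
  qed
  also have "\<dots> = ln (fact (2 * N)) - 2 * (\<Sum>d=1..2*N. mangoldt d * real (N div d))"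
    by (simp add: ln_fact_eq_sum_mangoldt right_diff_distrib sum_subtractf sum_distrib_left mult_ac)
  also have "(\<Sum>d=1..2*N. mangoldt d * real (N div d)) = ln (fact N)"
    unfolding ln_fact_eq_sum_mangoldt by (intro sum.mono_neutral_right) auto
  also have "ln (fact (2 * N)) - 2 * ln (fact N :: real) = ln (real ((2 * N) choose N))"
    by (simp add: binomial_fact ln_div ln_mult)
  also have "\<dots> \<le> ln (2 ^ (2 * N))"
    using binomial_le_pow2[of "2 * N" N]
    by (metis (mono_tags, lifting) le_add2 ln_le_cancel_iff mult_2 of_nat_0_less_iff of_nat_le_iff of_nat_numeral of_nat_power zero_less_binomial zero_less_numeral zero_less_power)
  also have "\<dots> = 2 * real N * ln 2" by (simp add: ln_realpow)
  finally show ?thesis by simp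
qed

text \<open>Halving induction on \<open>psi_double\<close>, with an odd N = 2m + 1 rounded up to 2(m
  + 1); the bound ln 2 <= 1 suffices for the constant 4.\<close>

lemma psi_le: "psi N \<le> 4 * real N"
proof (induction N rule: less_induct)
  case (less N)
  have ln2: "ln 2 \<le> (1::real)" using ln_le_minus_one[of "2::real"] by simp
  consider "N = 0" | "N = 1" | m where "N = 2 * m" "m \<ge> 1" | m where "N = 2 * m + 1" "m \<ge> 1"
    by (metis One_nat_def Suc_eq_plus1 bot_nat_0.not_eq_extremum evenE leI less_Suc0 mult_zero_right oddE add_0)
  then show ?case
  proof cases
    case (3 m)
    have "psi N \<le> psi m + 2 * real m * ln 2" using 3 psi_double by simp
    also have "\<dots> \<le> 4 * real m + 2 * real m * 1"
      using less.IH[of m] 3 ln2 by (intro add_mono mult_left_mono) auto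
    finally show ?thesis using 3 by simp
  next
    case (4 m)
    have "psi N \<le> psi (2 * (m + 1))" using 4 by (intro psi_mono) auto
    also have "\<dots> \<le> psi (m + 1) + 2 * real (m + 1) * ln 2" by (rule psi_double)
    also have "\<dots> \<le> 4 * real (m + 1) + 2 * real (m + 1) * 1"
    using less.IH[of "m+1"] 4 ln2 by (intro add_mono mult_left_mono) auto
    finally have *: "psi N \<le> 6 * real m + 6" by simp
    show ?thesis
    proof (cases "m = 1")
      case True
      then have "N = 3" using 4 by simp
      have "psi 3 \<le> psi 4" by (rule psi_mono) simp
      moreover have "psi 4 \<le> psi 2 + 4 * ln 2" using psi_double[of 2] by simp
      moreover have "psi 2 \<le> 2 * ln 2" using psi_double[of 1] by (simp add: psi_def)
      ultimately show ?thesis using \<open>N = 3\<close> ln2 by simp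
    next
      case False
      then have "real m \<ge> 2" using 4 by simp
      then show ?thesis using * 4 by simp
    qed
  qed (auto simp: psi_def)
qed

lemma sum_mangoldt_over_ge: "(\<Sum>d=1..N. mangoldt d / real d) \<ge> ln N - 1" if "N \<ge> 1"
proof -
  have "real n * ln n - real n \<le> ln (fact n)" for n
  proof (induction n)
    case (Suc n)
    have "real n * (ln (real (Suc n)) - ln (real n)) \<le> 1"
    proof (cases "n = 0")
      case False
      then have "ln (real (Suc n)) - ln (real n) = ln (1 + 1 / real n)"
        by (subst ln_divide_pos[symmetric]) (auto simp: field_simps)
      also have "\<dots> \<le> 1 / real n" by (rule ln_add_one_self_le_self) simp
      finally show ?thesis using False by (simp add: field_simps)
    qed simp
    moreover have "ln (fact (Suc n) :: real) = ln (real (Suc n)) + ln (fact n)"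
      by (simp add: ln_mult del: of_nat_Suc)
    ultimately show ?case using Suc.IH by (simp add: algebra_simps)
  qed simp
  then have "real N * ln N - real N \<le> ln (fact N)" .
  also have "ln (fact N) \<le> (\<Sum>d=1..N. mangoldt d * (real N / real d))"
    unfolding ln_fact_eq_sum_mangoldt
    by (intro sum_mono mult_left_mono of_nat_div_le_of_nat) (auto simp: mangoldt_nonneg)
  also have "\<dots> = real N * (\<Sum>d=1..N. mangoldt d / real d)"
    by (simp add: sum_distrib_left mult_ac)
  finally have "real N * (ln N - 1) \<le> real N * (\<Sum>d=1..N. mangoldt d / real d)"
    by (simp add: algebra_simps)
  then show ?thesis using that by simp
qed

text \<open>Replacing floor(N/d) by N/d costs at most 1 for each d, hence \<open>psi N\<close> in
  total; the 4 is the constant of \<open>psi_le\<close>.\<close>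

lemma sum_mangoldt_over_le: "(\<Sum>d=1..N. mangoldt d / real d) \<le> ln N + 4" if "N \<ge> 1"
proof -
  have "real N * (\<Sum>d=1..N. mangoldt d / real d) - psi N
      = (\<Sum>d=1..N. mangoldt d * (real N / real d - 1))"
    by (simp add: psi_def sum_distrib_left sum_subtractf right_diff_distrib mult_ac)
  also have "\<dots> \<le> (\<Sum>d=1..N. mangoldt d * real (N div d))"
  proof (intro sum_mono mult_left_mono)
    fix d assume "d \<in> {1..N}"
    show "real N / real d - 1 \<le> real (N div d)"
      using floor_correct[of "real N / real d"] by (simp add: floor_divide_of_nat_eq)
  qed (auto simp: mangoldt_nonneg)
  also have "\<dots> = ln (fact N)" by (simp add: ln_fact_eq_sum_mangoldt)
  also have "\<dots> \<le> ln (real N ^ N)"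
    using that fact_le_power[of N, where ?'a = real] by (subst ln_le_cancel_iff) auto
  also have "\<dots> = real N * ln N" using that by (simp add: ln_realpow)
  finally have "real N * (\<Sum>d=1..N. mangoldt d / real d) \<le> real N * (ln N + 4)"
    using psi_le[of N] by (simp add: algebra_simps)
  then show ?thesis using that by simp
qed

lemma sum_powers_from_2_le: "(\<Sum>a=2..n. x ^ a) \<le> 2 * x ^ 2" if "0 \<le> x" "x \<le> 1/2" for x :: real
proof -
  have "n \<ge> 1 \<Longrightarrow> (\<Sum>a=2..n. x ^ a) + 2 * x ^ (n + 1) \<le> 2 * x ^ 2"
  proof (induction n rule: nat_induct_at_least)
    case (Suc n)
    have "2 * x ^ (Suc n + 1) \<le> x ^ (n + 1)"
      using that mult_right_mono[of "2 * x" 1 "x ^ (n + 1)"] by simp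
    with Suc show ?case by simp
  qed (simp add: power2_eq_square)
  moreover have "x ^ (n + 1) \<ge> 0" using that by simp
  ultimately show ?thesis by (cases "n \<ge> 1") auto
qed

lemma mertens_lower:
  obtains C :: real where "C \<ge> 0"
    "\<And>N. N \<ge> 1 \<Longrightarrow> (\<Sum>p | prime p \<and> p \<le> N. ln (real p) / real p) \<ge> ln (real N) - C"
proof -
  \<comment> \<open>Dominates the contribution of the powers p^a with a >= 2: ln p is at most 2 sqrt
    p, and the geometric tail is at most 2 / p^2.\<close>
  define h where "h = (\<lambda>n::nat. 4 * real n powr (- 3 / 2))"
  have sh: "summable h"
    unfolding h_def by (intro summable_mult) (simp add: summable_real_powr_iff)
  have h0: "h n \<ge> 0" for n by (simp add: h_def)
  have "(\<Sum>p | prime p \<and> p \<le> N. ln (real p) / real p) \<ge> ln (real N) - (1 + suminf h)"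
    if N: "N \<ge> 1" for N
  proof -
    define E where "E = {d\<in>{1..N}. primepow d \<and> \<not> prime d}"
    have "(\<Sum>d\<in>E. mangoldt d / real d) \<le> (\<Sum>(p, a)\<in>{2..N} \<times> {2..N}. ln (real p) * (1 / real p) ^ a)"
    proof (rule sum_le_included[where i = "\<lambda>(p, a). p ^ a"])
      show "\<forall>d\<in>E. \<exists>y\<in>{2..N} \<times> {2..N}. (case y of (p, a) \<Rightarrow> p ^ a) = d \<and>
          mangoldt d / real d \<le> (case y of (p, a) \<Rightarrow> ln (real p) * (1 / real p) ^ a)"
      proof
        fix d assume d: "d \<in> E"
        then obtain p a where pa: "prime p" "a > 0" "d = p ^ a"
          unfolding E_def primepow_def by auto
        with d have a: "a \<ge> 2" unfolding E_def by (cases "a = 1") auto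
        have p2: "p \<ge> 2" using pa(1) prime_ge_2_nat by blast
        have "p ^ a \<le> N" using d pa unfolding E_def by simp
        moreover have "p \<le> p ^ a" using pa(2) p2 by (intro self_le_power) auto
        moreover have "a < p ^ a" using p2 by (intro power_gt_expt) simp
        ultimately have "(p, a) \<in> {2..N} \<times> {2..N}" using a p2 by auto
        then show "\<exists>y\<in>{2..N} \<times> {2..N}. (case y of (p, a) \<Rightarrow> p ^ a) = d \<and>
          mangoldt d / real d \<le> (case y of (p, a) \<Rightarrow> ln (real p) * (1 / real p) ^ a)"
          using pa by (intro bexI[of _ "(p, a)"]) (auto simp: divide_inverse power_inverse)
      qed
    qed (auto simp: E_def)
    also have "\<dots> = (\<Sum>p=2..N. ln (real p) * (\<Sum>a=2..N. (1 / real p) ^ a))"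
      by (subst sum.cartesian_product[symmetric]) (simp only: sum_distrib_left)
    also have "\<dots> \<le> (\<Sum>p=2..N. h p)"
    proof (intro sum_mono)
      fix p assume p: "p \<in> {2..N}"
      have "ln (real p) = 2 * ln (sqrt (real p))" using p by (simp add: ln_sqrt)
      also have "\<dots> \<le> 2 * sqrt (real p)" using p ln_le_minus_one[of "sqrt (real p)"] by simp
      finally have "ln (real p) * (\<Sum>a=2..N. (1 / real p) ^ a)
          \<le> 2 * sqrt (real p) * (2 * (1 / real p) ^ 2)"
        using p by (intro mult_mono sum_powers_from_2_le) (auto intro!: sum_nonneg)
      also have "\<dots> = h p"
      proof -
        have "real p powr (- 3 / 2) = real p powr (1/2) * real p powr (-2)"
          by (simp add: powr_add[symmetric])
        also have "\<dots> = sqrt (real p) * (1 / real p) ^ 2"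
          using p by (simp add: powr_half_sqrt powr_minus_divide power_one_over)
        finally show ?thesis by (simp add: h_def)
      qed
      finally show "ln (real p) * (\<Sum>a=2..N. (1 / real p) ^ a) \<le> h p" .
    qed
    also have "\<dots> \<le> suminf h" using sh h0 by (intro sum_le_suminf) auto
    finally have E: "(\<Sum>d\<in>E. mangoldt d / real d) \<le> suminf h" .
    have "(\<Sum>d=1..N. mangoldt d / real d)
        = (\<Sum>d\<in>{d\<in>{1..N}. prime d} \<union> E. mangoldt d / real d :: real)"
      unfolding E_def by (intro sum.mono_neutral_right) (auto simp: mangoldt_def)
    also have "\<dots> = (\<Sum>d\<in>{d\<in>{1..N}. prime d}. mangoldt d / real d) + (\<Sum>d\<in>E. mangoldt d / real d)"
      unfolding E_def by (intro sum.union_disjoint) auto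
    also have "(\<Sum>d\<in>{d\<in>{1..N}. prime d}. mangoldt d / real d)
        = (\<Sum>p | prime p \<and> p \<le> N. ln (real p) / real p)"
      by (intro sum.cong) (auto simp: prime_gt_0_nat Suc_le_eq)
    finally show ?thesis using E sum_mangoldt_over_ge[OF N] by simp
  qed
  then show ?thesis using that[of "1 + suminf h"] suminf_nonneg[OF sh h0] by simp
qed

lemma mertens_upper:
  assumes "N \<ge> 1"
  shows "(\<Sum>p | prime p \<and> p \<le> N. ln (real p) / real p) \<le> ln (real N) + 4"
proof -
  have "(\<Sum>p | prime p \<and> p \<le> N. ln (real p) / real p)
      = (\<Sum>p | prime p \<and> p \<le> N. mangoldt p / real p)"
    by (intro sum.cong) auto
  also have "\<dots> \<le> (\<Sum>d=1..N. mangoldt d / real d)"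
    by (intro sum_mono2) (auto simp: mangoldt_nonneg prime_gt_0_nat Suc_le_eq)
  also have "\<dots> \<le> ln (real N) + 4" by (rule sum_mangoldt_over_le[OF assms])
  finally show ?thesis .
qed

section \<open>A sieve bound for primes in short intervals\<close>

text \<open>With L = ln N and P the prime factors of n, this is Selberg's sum of mu(d) (ln (N/d))^2
  over the squarefree d dividing n. Adding a prime p to P takes a finite difference in L with step
  ln p. A quadratic polynomial is killed by three differences, so the sum vanishes once n has three
  distinct prime factors.\<close>

definition quad_diff :: "real \<Rightarrow> nat set \<Rightarrow> real" where
  "quad_diff L P = (\<Sum>D\<in>Pow P. (-1) ^ card D * (L - (\<Sum>p\<in>D. ln (real p)))\<^sup>2)"

lemma quad_diff_insert:
  assumes "finite P" "p \<notin> P"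
  shows "quad_diff L (insert p P) = quad_diff L P - quad_diff (L - ln (real p)) P"
proof -
  have fin: "finite D" if "D \<subseteq> P" for D using assms(1) that finite_subset by blast
  have "quad_diff L (insert p P) = quad_diff L P +
      (\<Sum>D\<in>insert p ` Pow P. (-1) ^ card D * (L - (\<Sum>p\<in>D. ln (real p)))\<^sup>2)"
    unfolding quad_diff_def Pow_insert using assms by (intro sum.union_disjoint) auto
  also have "(\<Sum>D\<in>insert p ` Pow P. (-1) ^ card D * (L - (\<Sum>p\<in>D. ln (real p)))\<^sup>2)
      = (\<Sum>D\<in>Pow P. (-1) ^ card (insert p D) * (L - (\<Sum>p\<in>insert p D. ln (real p)))\<^sup>2)"
    using assms(2) by (intro sum.reindex_cong[OF _ refl refl]) (auto intro!: inj_onI)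
  also have "\<dots> = (\<Sum>D\<in>Pow P. - ((-1) ^ card D * (L - ln (real p) - (\<Sum>p\<in>D. ln (real p)))\<^sup>2))"
  proof (intro sum.cong refl)
    fix D assume "D \<in> Pow P"
    then have "finite D" "p \<notin> D" using fin assms(2) by auto
    then show "(-1) ^ card (insert p D) * (L - (\<Sum>p\<in>insert p D. ln (real p)))\<^sup>2
        = - ((-1) ^ card D * (L - ln (real p) - (\<Sum>p\<in>D. ln (real p)))\<^sup>2)"
      by (simp add: algebra_simps)
  qed
  finally show ?thesis by (simp add: quad_diff_def sum_negf)
qed

lemma quad_diff_empty: "quad_diff L {} = L\<^sup>2"
  by (simp add: quad_diff_def)

lemma quad_diff_1: "quad_diff L {p} = 2 * L * ln (real p) - (ln (real p))\<^sup>2"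
  by (subst quad_diff_insert) (auto simp: quad_diff_empty power2_eq_square algebra_simps)

lemma quad_diff_2: "p \<noteq> q \<Longrightarrow> quad_diff L {p, q} = 2 * ln (real p) * ln (real q)"
  by (subst quad_diff_insert) (auto simp: quad_diff_1 power2_eq_square algebra_simps)

lemma quad_diff_ge_3: "finite P \<Longrightarrow> card P \<ge> 3 \<Longrightarrow> quad_diff L P = 0"
proof (induction P arbitrary: L rule: finite_induct)
  case (insert p P)
  show ?case
  proof (cases "card P = 2")
    case True
    then obtain a b where "P = {a, b}" "a \<noteq> b" by (auto simp: card_2_iff)
    then show ?thesis using insert.hyps quad_diff_insert[of P p L] by (simp add: quad_diff_2)
  next
    case False
    with insert.prems insert.hyps have "card P \<ge> 3" by simp
    then show ?thesis using insert quad_diff_insert[of P p L] by simp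
  qed
qed simp

lemma prime_factors_cases_card:
  fixes n :: nat
  assumes "n \<ge> 1"
  obtains "n = 1" "prime_factors n = {}"
    | p a where "prime p" "a \<ge> 1" "n = p ^ a" "prime_factors n = {p}"
    | p q a b where "prime p" "prime q" "p \<noteq> q" "a \<ge> 1" "b \<ge> 1" "n = p ^ a * q ^ b" "prime_factors n = {p, q}"
    | "card (prime_factors n) \<ge> 3"
proof -
  have n: "n = (\<Prod>p\<in>prime_factors n. p ^ multiplicity p n)"
    using assms prime_factorization_nat[of n] by simp
  have m: "multiplicity p n \<ge> 1" if "p \<in> prime_factors n" for p
    using that by (simp add: prime_factors_multiplicity Suc_le_eq)
  have pr: "prime p" if "p \<in> prime_factors n" for p using that by auto
  consider "card (prime_factors n) = 0" | "card (prime_factors n) = 1" | "card (prime_factors n) = 2"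
    | "card (prime_factors n) \<ge> 3" by linarith
  then show thesis
  proof cases
    case 1
    then have e: "prime_factors n = {}" by simp
    then have "n = 1" using n by simp
    then show thesis using that(1) e by blast
  next
    case 2
    then obtain p where e: "prime_factors n = {p}" by (auto simp: card_1_singleton_iff)
    then have "n = p ^ multiplicity p n" using n by simp
    then show thesis using that(2)[OF pr m _ e] e by blast
  next
    case 3
    then obtain p q where e: "prime_factors n = {p, q}" "p \<noteq> q" by (auto simp: card_2_iff)
    then have "n = p ^ multiplicity p n * q ^ multiplicity q n" using n by simp
    then show thesis using that(3)[OF pr pr e(2) m m _ e(1)] e(1) by blast
  next
    case 4
    then show thesis using that by blast
  qed
qed

lemma quad_diff_prime_factors_nonneg:
  assumes "1 \<le> n" "n \<le> N"
  shows "quad_diff (ln (real N)) (prime_factors n) \<ge> 0"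
  using assms(1)
proof (cases rule: prime_factors_cases_card)
  case (2 p a)
  have "p \<le> n" using 2 assms by (metis dvd_imp_le in_prime_factors_imp_dvd insertI1 less_le_trans zero_less_one)
  then have "ln (real p) \<le> ln (real N)" "ln (real p) \<ge> 0"
    using assms 2(1) prime_gt_0_nat[of p] by (auto simp: Suc_le_eq)
  then have "ln (real p) * (2 * ln (real N) - ln (real p)) \<ge> 0" by (intro mult_nonneg_nonneg) auto
  then show ?thesis unfolding 2(4) quad_diff_1 by (simp add: algebra_simps power2_eq_square)
next
  case (3 p q a b)
  then show ?thesis using prime_gt_0_nat[of p] prime_gt_0_nat[of q]
    by (auto simp: quad_diff_2 Suc_le_eq)
qed (auto simp: quad_diff_empty quad_diff_ge_3)

lemma quad_diff_prime_ge:
  assumes "prime p" "p \<le> N"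
  shows "quad_diff (ln (real N)) (prime_factors p) \<ge> (ln (real p))\<^sup>2"
proof -
  have "prime_factors p = {p}" using assms(1) by (simp add: prime_factorization_prime)
  moreover have "ln (real p) \<le> ln (real N)" "ln (real p) \<ge> 0"
    using assms prime_gt_0_nat[of p] by (auto simp: Suc_le_eq)
  then have "ln (real p) * (ln (real N) - ln (real p)) \<ge> 0" by (intro mult_nonneg_nonneg) auto
  ultimately show ?thesis by (simp add: quad_diff_1 algebra_simps power2_eq_square)
qed

lemma ln_square_le: "(ln x)\<^sup>2 \<le> 16 * sqrt x" if "x \<ge> 1" for x :: real
proof -
  have "ln x = 4 * ln (sqrt (sqrt x))" using that by (simp add: ln_sqrt)
  also have "\<dots> \<le> 4 * sqrt (sqrt x)" using that ln_le_minus_one[of "sqrt (sqrt x)"] by simp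
  finally have "(ln x)\<^sup>2 \<le> (4 * sqrt (sqrt x))\<^sup>2" using that by (intro power_mono) auto
  also have "\<dots> = 16 * sqrt x" using that by (simp add: power_mult_distrib)
  finally show ?thesis .
qed

lemma sum_inverse_sqrt_le: "(\<Sum>d=1..N. 1 / sqrt (real d)) \<le> 2 * sqrt (real N)"
proof (induction N)
  case (Suc N)
  have "1 / sqrt (real (Suc N)) \<le> 2 * (sqrt (real (Suc N)) - sqrt (real N))"
  proof -
    define a b where "a = sqrt (real (Suc N))" and "b = sqrt (real N)"
    have ab: "a > 0" "b \<ge> 0" "b \<le> a" "a\<^sup>2 = b\<^sup>2 + 1" by (auto simp: a_def b_def)
    then have "(a - b) * (a + b) = 1" by (simp add: power2_eq_square algebra_simps)
    moreover have "(a - b) * (a + b) \<le> (a - b) * (2 * a)" using ab by (intro mult_left_mono) auto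
    ultimately have "1 \<le> 2 * (a - b) * a" by (simp add: mult_ac)
    then have "1 / a \<le> 2 * (a - b)" using ab by (simp add: divide_le_eq)
    then show ?thesis by (simp add: a_def b_def)
  qed
  with Suc.IH show ?case by simp
qed simp

text \<open>The squared logarithm is bounded for most d up to N, so its sum is linear in N. This
  keeps the total rounding error of the sieve linear although all squarefree d <= N enter
  it.\<close>

lemma sum_ln_quotient_square_le: "(\<Sum>d=1..N. (ln (real N) - ln (real d))\<^sup>2) \<le> 32 * real N"
proof -
  have "(\<Sum>d=1..N. (ln (real N) - ln (real d))\<^sup>2) \<le> (\<Sum>d=1..N. 16 * sqrt (real N) * (1 / sqrt (real d)))"
  proof (intro sum_mono)
    fix d assume d: "d \<in> {1..N}"
    have "(ln (real N) - ln (real d))\<^sup>2 = (ln (real N / real d))\<^sup>2"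
      using d by (subst ln_divide_pos) auto
    also have "\<dots> \<le> 16 * sqrt (real N / real d)" using d by (intro ln_square_le) (auto simp: field_simps)
    finally show "(ln (real N) - ln (real d))\<^sup>2 \<le> 16 * sqrt (real N) * (1 / sqrt (real d))"
      by (simp add: real_sqrt_divide)
  qed
  also have "\<dots> = 16 * sqrt (real N) * (\<Sum>d=1..N. 1 / sqrt (real d))" by (simp add: sum_distrib_left)
  also have "\<dots> \<le> 16 * sqrt (real N) * (2 * sqrt (real N))"
    by (intro mult_left_mono sum_inverse_sqrt_le) auto
  finally show ?thesis by simp
qed

text \<open>On prime powers \<open>quad_diff\<close> is at most 2 L Lambda(n), on products of two
  prime powers it is at most twice the convolution of Lambda with itself (the \<open>c\<close> of
  the proof), and elsewhere it vanishes except at n = 1. By \<open>psi_le\<close> and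
  \<open>sum_mangoldt_over_le\<close> each of the two has leading term at most 8 N ln N.\<close>

lemma sum_quad_diff_le:
  assumes "N \<ge> 1"
  shows "(\<Sum>n=1..N. quad_diff (ln (real N)) (prime_factors n)) \<le> 16 * real N * ln (real N) + 48 * real N"
proof -
  define L where "L = ln (real N)"
  have L0: "L \<ge> 0" using assms by (simp add: L_def)
  define Q where "Q = (SIGMA d:{1..N}. {1..N div d})"
  define c where "c = (\<lambda>n. \<Sum>x\<in>{x\<in>Q. fst x * snd x = n}. mangoldt (fst x) * mangoldt (snd x) :: real)"
  have finQ: "finite Q" by (simp add: Q_def)
  have Q_iff: "(d, m) \<in> Q \<longleftrightarrow> d \<ge> 1 \<and> m \<ge> 1 \<and> d * m \<le> N" for d m
  proof (cases "d \<ge> 1 \<and> m \<ge> 1")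
    case True
    moreover have "d * m \<le> N \<Longrightarrow> d \<le> N" using True by (intro order_trans[of d "d * m" N]) simp_all
    ultimately show ?thesis by (auto simp: Q_def less_eq_div_iff_mult_less_eq mult.commute)
  qed (auto simp: Q_def)
  have c0: "c n \<ge> 0" for n unfolding c_def by (intro sum_nonneg) (auto simp: mangoldt_nonneg)
  have bound: "quad_diff L (prime_factors n) \<le> (if n = 1 then L\<^sup>2 else 0) + 2 * L * mangoldt n + 2 * c n"
    if n: "n \<in> {1..N}" for n
  proof -
    have "1 \<le> n" using n by simp
    then show ?thesis
    proof (cases rule: prime_factors_cases_card)
      case 1
      then show ?thesis using c0[of n] by (simp add: quad_diff_empty)
    next
      case (2 p a)
      then show ?thesis using c0[of n] L0 unfolding 2(4) quad_diff_1 by (auto simp: algebra_simps power2_eq_square)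
    next
      case (3 p q a b)
      have pa: "p ^ a \<ge> 1" "q ^ b \<ge> 1" using 3 prime_gt_0_nat[of p] prime_gt_0_nat[of q] by auto
      have mem: "(p ^ a, q ^ b) \<in> {x\<in>Q. fst x * snd x = n}" using pa 3(6) n by (auto simp: Q_iff)
      have "(\<Sum>x\<in>{(p ^ a, q ^ b)}. mangoldt (fst x) * mangoldt (snd x) :: real) \<le> c n"
        unfolding c_def by (rule sum_mono2) (use mem finQ in \<open>auto simp: mangoldt_nonneg\<close>)
      moreover have "2 * L * mangoldt n \<ge> 0" using L0 by (simp add: mangoldt_nonneg)
      ultimately show ?thesis using 3 by (auto simp: quad_diff_2)
    next
      case 4
      moreover have "2 * L * mangoldt n \<ge> 0" using L0 by (simp add: mangoldt_nonneg)
      ultimately show ?thesis using c0[of n] by (simp add: quad_diff_ge_3)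
    qed
  qed
  have "(\<Sum>n=1..N. c n) = (\<Sum>x\<in>Q. mangoldt (fst x) * mangoldt (snd x))"
    unfolding c_def by (rule sum.group) (use finQ Q_iff in \<open>force+\<close>)
  also have "\<dots> = (\<Sum>d=1..N. mangoldt d * psi (N div d))"
    unfolding Q_def by (subst sum.Sigma[symmetric, where g = "\<lambda>d m. mangoldt d * mangoldt m", unfolded split_def])
       (auto simp: psi_def sum_distrib_left)
  also have "\<dots> \<le> (\<Sum>d=1..N. mangoldt d * (4 * (real N / real d)))"
  proof (intro sum_mono mult_left_mono)
    fix d assume "d \<in> {1..N}"
    have "psi (N div d) \<le> 4 * real (N div d)" by (rule psi_le)
    also have "\<dots> \<le> 4 * (real N / real d)" by (intro mult_left_mono of_nat_div_le_of_nat) auto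
    finally show "psi (N div d) \<le> 4 * (real N / real d)" .
  qed (auto simp: mangoldt_nonneg)
  also have "\<dots> = 4 * real N * (\<Sum>d=1..N. mangoldt d / real d)" by (simp add: sum_distrib_left mult_ac)
  also have "\<dots> \<le> 4 * real N * (ln (real N) + 4)"
    by (intro mult_left_mono sum_mangoldt_over_le assms) auto
  finally have csum: "(\<Sum>n=1..N. c n) \<le> 4 * real N * (L + 4)" by (simp add: L_def)
  have "(\<Sum>n=1..N. quad_diff L (prime_factors n))
      \<le> (\<Sum>n=1..N. (if n = 1 then L\<^sup>2 else 0) + 2 * L * mangoldt n + 2 * c n)"
    by (intro sum_mono bound)
  also have "\<dots> = (\<Sum>n=1..N. (if n = 1 then L\<^sup>2 else 0)) + 2 * L * psi N + 2 * (\<Sum>n=1..N. c n)"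
    by (simp add: sum.distrib sum_distrib_left psi_def)
  also have "(\<Sum>n=1..N. (if n = 1 then L\<^sup>2 else 0)) = L\<^sup>2" using assms by (simp add: sum.delta)
  also have "L\<^sup>2 \<le> 16 * real N"
  proof -
    have "L\<^sup>2 \<le> 16 * sqrt (real N)" unfolding L_def by (rule ln_square_le) (use assms in auto)
    also have "sqrt (real N) \<le> real N" using assms by (simp add: sqrt_le_D real_le_lsqrt power2_eq_square)
    finally show ?thesis by simp
  qed
  also have "2 * L * psi N \<le> 2 * L * (4 * real N)" using L0 psi_le by (intro mult_left_mono) auto
  finally show ?thesis using csum unfolding L_def[symmetric] by (simp add: algebra_simps)
qed

section \<open>Sieve sums over squarefree divisors\<close>

lemma prime_set_prod:
  fixes D :: "nat set"
  assumes "finite D" "\<forall>p\<in>D. prime p"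
  shows "prime_factors (\<Prod>D) = D" "\<Prod>D \<ge> 1" "ln (real (\<Prod>D)) = (\<Sum>p\<in>D. ln (real p))"
    "n \<ge> 1 \<Longrightarrow> \<Prod>D dvd n \<longleftrightarrow> D \<subseteq> prime_factors n"
proof -
  show pf: "prime_factors (\<Prod>D) = D"
    using assms by (subst prime_factors_prod) (auto simp: prime_factorization_prime)
  show "\<Prod>D \<ge> 1" using assms by (intro prod_ge_1) (auto dest: prime_gt_0_nat simp: Suc_le_eq)
  show "ln (real (\<Prod>D)) = (\<Sum>p\<in>D. ln (real p))"
    using assms by (subst of_nat_prod, subst ln_prod) (auto simp: prime_gt_0_nat)
  assume n: "n \<ge> 1"
  show "\<Prod>D dvd n \<longleftrightarrow> D \<subseteq> prime_factors n"
  proof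
    assume "\<Prod>D dvd n"
    then show "D \<subseteq> prime_factors n" using pf dvd_prime_factors[of n "\<Prod>D"] n by simp
  next
    assume sub: "D \<subseteq> prime_factors n"
    have "E \<subseteq> D \<Longrightarrow> \<Prod>E dvd n" if "finite E" for E
      using that
    proof (induction E rule: finite_induct)
      case (insert p E)
      have "p dvd n" using insert.prems sub by auto
      moreover have "coprime p (\<Prod>E)"
      proof (rule prod_coprime_right)
        fix r assume "r \<in> E"
        then show "coprime p r" using insert.prems insert.hyps assms by (intro primes_coprime) auto
      qed
      ultimately show ?case using insert by (auto intro: divides_mult)
    qed simp
    then show "\<Prod>D dvd n" using assms(1) by blast
  qed
qed

text \<open>Squarefree integers are encoded by their sets of prime factors, so that a sum over the
  squarefree divisors of n matches the power set in \<open>quad_diff\<close>.\<close>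

definition sieve_sets :: "nat \<Rightarrow> nat set set" where
  "sieve_sets N = {D. D \<subseteq> {p. prime p \<and> p \<le> N} \<and> \<Prod>D \<le> N}"

definition sieve_coeff :: "nat \<Rightarrow> nat set \<Rightarrow> real" where
  "sieve_coeff N D = (-1) ^ card D * (ln (real N) - ln (real (\<Prod>D)))\<^sup>2"

lemma sieve_setsD:
  assumes "D \<in> sieve_sets N"
  shows "finite D" "\<forall>p\<in>D. prime p" "\<Prod>D \<le> N"
  using assms finite_subset[of D "{..N}"] by (auto simp: sieve_sets_def)

lemma finite_sieve_sets: "finite (sieve_sets N)"
  by (rule finite_subset[of _ "Pow {..N}"]) (auto simp: sieve_sets_def)

lemma quad_diff_eq_sieve_sum:
  assumes "1 \<le> n" "n \<le> N"
  shows "quad_diff (ln (real N)) (prime_factors n)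
    = (\<Sum>D\<in>sieve_sets N. if \<Prod>D dvd n then sieve_coeff N D else 0)"
proof -
  have eq: "{D\<in>sieve_sets N. \<Prod>D dvd n} = Pow (prime_factors n)"
  proof (rule Set.set_eqI)
    fix D show "D \<in> {D\<in>sieve_sets N. \<Prod>D dvd n} \<longleftrightarrow> D \<in> Pow (prime_factors n)"
    proof
      assume "D \<in> {D\<in>sieve_sets N. \<Prod>D dvd n}"
      then show "D \<in> Pow (prime_factors n)" using prime_set_prod(4)[of D n] sieve_setsD[of D N] assms by auto
    next
      assume D: "D \<in> Pow (prime_factors n)"
      then have fin: "finite D" and pr: "\<forall>p\<in>D. prime p" by (auto intro: finite_subset)
      have dvd: "\<Prod>D dvd n" using prime_set_prod(4)[OF fin pr assms(1)] D by blast
      then have "\<Prod>D \<le> N" using assms by (auto dest: dvd_imp_le)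
      moreover have "p \<le> N" if "p \<in> D" for p
      proof -
        have "p dvd n" using that D by auto
        then show ?thesis using assms by (auto dest: dvd_imp_le)
      qed
      ultimately show "D \<in> {D\<in>sieve_sets N. \<Prod>D dvd n}" using pr dvd by (auto simp: sieve_sets_def)
    qed
  qed
  have "quad_diff (ln (real N)) (prime_factors n) = (\<Sum>D\<in>Pow (prime_factors n). sieve_coeff N D)"
    unfolding quad_diff_def sieve_coeff_def
  proof (rule sum.cong[OF refl])
    fix D assume "D \<in> Pow (prime_factors n)"
    then have "finite D" "\<forall>p\<in>D. prime p" by (auto intro: finite_subset)
    then show "(- 1) ^ card D * (ln (real N) - (\<Sum>p\<in>D. ln (real p)))\<^sup>2
        = (- 1) ^ card D * (ln (real N) - ln (real (\<Prod>D)))\<^sup>2" by (simp only: prime_set_prod(3))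
  qed
  also have "\<dots> = (\<Sum>D\<in>sieve_sets N. if \<Prod>D dvd n then sieve_coeff N D else 0)"
    unfolding eq[symmetric] by (rule sum.inter_filter[OF finite_sieve_sets])
  finally show ?thesis .
qed

lemma card_multiples_interval: "\<bar>real (card {n\<in>{a<..N}. d dvd n}) - (real N - real a) / real d\<bar> \<le> 1"
  if "a \<le> N" "d \<ge> 1" for a N d :: nat
proof -
  have "{n\<in>{1..N}. d dvd n} = {n\<in>{1..a}. d dvd n} \<union> {n\<in>{a<..N}. d dvd n}" using that by auto
  then have "card {n\<in>{1..N}. d dvd n} = card {n\<in>{1..a}. d dvd n} + card {n\<in>{a<..N}. d dvd n}"
    by (simp only:) (rule card_Un_disjoint, auto)
  then have c: "real (card {n\<in>{a<..N}. d dvd n}) = real (N div d) - real (a div d)"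
    unfolding card_multiples[OF that(2)] by simp
  have *: "real m / real d - 1 \<le> real (m div d)" "real (m div d) \<le> real m / real d" for m
    using floor_correct[of "real m / real d"] by (simp_all add: floor_divide_of_nat_eq)
  show ?thesis using *[of N] *[of a] unfolding c diff_divide_distrib by linarith
qed

text \<open>Each divisor d contributes its density 1/d times the length of the interval, with a
  rounding error of at most 1; the weighted errors add up to the sum of (ln (N/d))^2. The
  coefficient of N - a does not depend on a, which \<open>sum_ln_square_primes_le\<close>
  exploits.\<close>

lemma sieve_sum_approx:
  assumes "a \<le> N"
  shows "\<bar>(\<Sum>n\<in>{a<..N}. quad_diff (ln (real N)) (prime_factors n))
      - (real N - real a) * (\<Sum>D\<in>sieve_sets N. sieve_coeff N D / real (\<Prod>D))\<bar> \<le> 32 * real N"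
proof -
  have "(\<Sum>n\<in>{a<..N}. quad_diff (ln (real N)) (prime_factors n))
      = (\<Sum>n\<in>{a<..N}. \<Sum>D\<in>sieve_sets N. if \<Prod>D dvd n then sieve_coeff N D else 0)"
    by (rule sum.cong[OF refl]) (simp add: quad_diff_eq_sieve_sum)
  also have "\<dots> = (\<Sum>D\<in>sieve_sets N. \<Sum>n\<in>{a<..N}. if \<Prod>D dvd n then sieve_coeff N D else 0)"
    by (rule sum.swap)
  also have "\<dots> = (\<Sum>D\<in>sieve_sets N. sieve_coeff N D * real (card {n\<in>{a<..N}. \<Prod>D dvd n}))"
    by (rule sum.cong[OF refl]) (subst sum.inter_filter[symmetric], simp_all)
  finally have "(\<Sum>n\<in>{a<..N}. quad_diff (ln (real N)) (prime_factors n))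
      - (real N - real a) * (\<Sum>D\<in>sieve_sets N. sieve_coeff N D / real (\<Prod>D))
    = (\<Sum>D\<in>sieve_sets N. sieve_coeff N D *
        (real (card {n\<in>{a<..N}. \<Prod>D dvd n}) - (real N - real a) / real (\<Prod>D)))"
    by (simp only: sum_distrib_left sum_subtractf[symmetric]) (simp add: algebra_simps)
  also have "\<bar>\<dots>\<bar> \<le> (\<Sum>D\<in>sieve_sets N. \<bar>sieve_coeff N D *
        (real (card {n\<in>{a<..N}. \<Prod>D dvd n}) - (real N - real a) / real (\<Prod>D))\<bar>)"
    by (rule sum_abs)
  also have "\<dots> \<le> (\<Sum>D\<in>sieve_sets N. (ln (real N) - ln (real (\<Prod>D)))\<^sup>2)"
  proof (intro sum_mono)
    fix D assume D: "D \<in> sieve_sets N"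
    have "\<bar>sieve_coeff N D\<bar> = (ln (real N) - ln (real (\<Prod>D)))\<^sup>2"
      unfolding sieve_coeff_def abs_mult power_abs by simp
    moreover have "\<bar>real (card {n\<in>{a<..N}. \<Prod>D dvd n}) - (real N - real a) / real (\<Prod>D)\<bar> \<le> 1"
      using prime_set_prod(2)[of D] sieve_setsD[OF D] by (intro card_multiples_interval assms) auto
    ultimately show "\<bar>sieve_coeff N D *
        (real (card {n\<in>{a<..N}. \<Prod>D dvd n}) - (real N - real a) / real (\<Prod>D))\<bar>
        \<le> (ln (real N) - ln (real (\<Prod>D)))\<^sup>2"
      unfolding abs_mult by (simp only:) (rule mult_left_le, simp_all)
  qed
  also have "\<dots> \<le> (\<Sum>d=1..N. (ln (real N) - ln (real d))\<^sup>2)"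
  proof (rule sum_le_included[where i = prime_factors])
    show "\<forall>D\<in>sieve_sets N. \<exists>d\<in>{1..N}. prime_factors d = D \<and>
        (ln (real N) - ln (real (\<Prod>D)))\<^sup>2 \<le> (ln (real N) - ln (real d))\<^sup>2"
    proof
      fix D assume D: "D \<in> sieve_sets N"
      note D' = sieve_setsD[OF D]
      show "\<exists>d\<in>{1..N}. prime_factors d = D \<and>
        (ln (real N) - ln (real (\<Prod>D)))\<^sup>2 \<le> (ln (real N) - ln (real d))\<^sup>2"
        using prime_set_prod(1,2)[OF D'(1,2)] D'(3) by (intro bexI[of _ "\<Prod>D"]) auto
    qed
  qed (auto simp: finite_sieve_sets)
  also have "\<dots> \<le> 32 * real N" by (rule sum_ln_quotient_square_le)
  finally show ?thesis .
qed

text \<open>The coefficient \<open>G\<close> of the main term is never evaluated. The case a = 0 of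
  \<open>sieve_sum_approx\<close>, compared with \<open>sum_quad_diff_le\<close>, bounds it from
  above, and this bound is then used on the short interval. Nonnegativity of
  \<open>quad_diff\<close> lets the sum over primes be enlarged to all integers.\<close>

lemma sum_ln_square_primes_le:
  assumes "1 \<le> N" "a \<le> N"
  shows "(\<Sum>p | prime p \<and> a < p \<and> p \<le> N. (ln (real p))\<^sup>2)
    \<le> (real N - real a) * (16 * ln (real N) + 80) + 32 * real N"
proof -
  define G where "G = (\<Sum>D\<in>sieve_sets N. sieve_coeff N D / real (\<Prod>D))"
  have "{0<..N} = {1..N}" by auto
  then have "real N * G \<le> real N * (16 * ln (real N) + 80)"
    using sieve_sum_approx[of 0 N] sum_quad_diff_le[OF assms(1)]
    unfolding G_def[symmetric] by (simp add: algebra_simps)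
  then have G: "G \<le> 16 * ln (real N) + 80" using assms by simp
  have "(\<Sum>p | prime p \<and> a < p \<and> p \<le> N. (ln (real p))\<^sup>2)
      \<le> (\<Sum>p | prime p \<and> a < p \<and> p \<le> N. quad_diff (ln (real N)) (prime_factors p))"
    by (intro sum_mono quad_diff_prime_ge) auto
  also have "\<dots> \<le> (\<Sum>n\<in>{a<..N}. quad_diff (ln (real N)) (prime_factors n))"
    by (intro sum_mono2) (auto intro: quad_diff_prime_factors_nonneg)
  also have "\<dots> \<le> (real N - real a) * G + 32 * real N"
    using sieve_sum_approx[OF assms(2)] by (simp add: G_def)
  also have "(real N - real a) * G \<le> (real N - real a) * (16 * ln (real N) + 80)"
    using assms by (intro mult_left_mono G) auto
  finally show ?thesis by simp
qed

text \<open>A Brun--Titchmarsh bound. Its point is that the constant does not depend on \<open>\<eta>\<close>.\<close>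

lemma primes_short_interval:
  fixes \<eta> :: real
  assumes "0 < \<eta>" "\<eta> \<le> 1"
  shows "\<forall>\<^sub>F x in at_top. (\<Sum>p | prime p \<and> x < real p \<and> real p \<le> exp \<eta> * x. ln (real p) / real p) \<le> 33 * \<eta>"
proof -
  have "\<eta>\<^sup>2 \<le> \<eta>" using assms by (simp add: power2_eq_square mult_left_le)
  then have e1: "exp \<eta> \<le> 1 + 2 * \<eta>" using exp_bound[of \<eta>] assms by simp
  then have e: "exp \<eta> \<le> 1 + 2 * \<eta>" "exp \<eta> \<le> 3" using assms by auto
  \<comment> \<open>This is the bound of \<open>sum_ln_square_primes_le\<close> with N - a at most 2
    \<eta> x + 1, ln N at most ln x + 2 and N at most 3 x, divided by x ln x. The limit 32 \<eta>
    leaves room below 33 \<eta>.\<close>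
  have "((\<lambda>x::real. (2 * \<eta> + 1 / x) * (16 + 112 / ln x) + 96 / ln x) \<longlongrightarrow> 32 * \<eta>) at_top"
    using assms by real_asymp
  then have "\<forall>\<^sub>F x in at_top. (2 * \<eta> + 1 / x) * (16 + 112 / ln x) + 96 / ln x < 33 * \<eta>"
    using assms by (intro order_tendstoD) auto
  moreover have "\<forall>\<^sub>F x in at_top. (x::real) > 3" by (rule eventually_gt_at_top)
  ultimately show ?thesis
  proof eventually_elim
    case (elim x)
    define a N where "a = nat \<lfloor>x\<rfloor>" and "N = nat \<lfloor>exp \<eta> * x\<rfloor>"
    have a: "real a \<le> x" "x < real a + 1" using elim by (auto simp: a_def)
    have xe: "x \<le> exp \<eta> * x" using elim assms by simp
    then have N: "real N \<le> exp \<eta> * x" "exp \<eta> * x < real N + 1" using elim by (auto simp: N_def)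
    have aN: "a \<le> N" unfolding a_def N_def using xe by (intro nat_mono floor_mono)
    have N1: "N \<ge> 1" using a aN elim by linarith
    have lx: "ln x > 0" using elim by simp
    have iff: "x < real p \<and> real p \<le> exp \<eta> * x \<longleftrightarrow> a < p \<and> p \<le> N" for p
      using a N by linarith
    have N3: "real N \<le> 3 * x" using N(1) mult_right_mono[OF e(2), of x] elim by linarith
    have "ln (real N) \<le> ln (3 * x)" using N3 N1 elim by (subst ln_le_cancel_iff) auto
    also have "\<dots> = ln x + ln 3" using elim by (simp add: ln_mult)
    also have "ln (3::real) \<le> 2" using ln_le_minus_one[of "3::real"] by simp
    finally have lN: "ln (real N) \<le> ln x + 2" by simp
    have "real N - real a \<le> 2 * \<eta> * x + 1"
      using N(1) a(2) mult_right_mono[OF e(1), of x] elim by (simp add: algebra_simps)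
    have "(\<Sum>p | prime p \<and> x < real p \<and> real p \<le> exp \<eta> * x. ln (real p) / real p)
        = (\<Sum>p | prime p \<and> a < p \<and> p \<le> N. ln (real p) / real p)" by (simp only: iff)
    also have "\<dots> \<le> (\<Sum>p | prime p \<and> a < p \<and> p \<le> N. (ln (real p))\<^sup>2 / (x * ln x))"
    proof (intro sum_mono)
      fix p assume "p \<in> {p. prime p \<and> a < p \<and> p \<le> N}"
      then have p: "x < real p" using iff by blast
      then have "ln x \<le> ln (real p)" using elim by simp
      then have "ln (real p) * (x * ln x) \<le> ln (real p) * (real p * ln (real p))"
        using p lx elim by (intro mult_left_mono mult_mono) auto
      then show "ln (real p) / real p \<le> (ln (real p))\<^sup>2 / (x * ln x)"
        using p lx elim by (simp add: field_simps power2_eq_square)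
    qed
    also have "\<dots> = (\<Sum>p | prime p \<and> a < p \<and> p \<le> N. (ln (real p))\<^sup>2) / (x * ln x)"
      by (simp add: sum_divide_distrib)
    also have "\<dots> \<le> ((real N - real a) * (16 * ln (real N) + 80) + 32 * real N) / (x * ln x)"
      using lx elim by (intro divide_right_mono sum_ln_square_primes_le N1 aN) auto
    also have "\<dots> \<le> ((2 * \<eta> * x + 1) * (16 * (ln x + 2) + 80) + 32 * (3 * x)) / (x * ln x)"
    proof (intro divide_right_mono add_mono)
      have "0 \<le> ln (real N)" using N1 by simp
      then show "(real N - real a) * (16 * ln (real N) + 80) \<le> (2 * \<eta> * x + 1) * (16 * (ln x + 2) + 80)"
        using lN \<open>real N - real a \<le> _\<close> assms elim by (intro mult_mono) simp_all
    qed (use N3 lx elim in simp_all)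
    also have "\<dots> = (2 * \<eta> + 1 / x) * (16 + 112 / ln x) + 96 / ln x"
      using lx elim by (simp add: field_simps)
    finally show ?case using elim by linarith
  qed
qed

section \<open>Monochromatic pairs of primes\<close>

text \<open>With the weight ln p / p the primes between exp u and exp v have total mass v - u up to
  a bounded error, so windows of primes can be measured by their logarithmic length.\<close>

definition prime_mass :: "nat set \<Rightarrow> real \<Rightarrow> real \<Rightarrow> real" where
  "prime_mass G x y = (\<Sum>p | prime p \<and> p \<in> G \<and> x < real p \<and> real p \<le> y. ln (real p) / real p)"

lemma finite_nat_le_real: "(\<And>p::nat. p \<in> A \<Longrightarrow> real p \<le> y) \<Longrightarrow> finite A"
  by (rule finite_subset[of _ "{..nat \<lfloor>y\<rfloor>}"]) (auto simp: le_nat_floor)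

lemma finite_primes_le_real: "finite {p::nat. prime p \<and> p \<in> G \<and> x < real p \<and> real p \<le> y}"
  by (rule finite_nat_le_real[of _ y]) simp

lemma ln_over_prime_nonneg: "prime p \<Longrightarrow> ln (real p) / real p \<ge> 0"
  using prime_gt_0_nat[of p] by (simp add: Suc_le_eq)

lemma prime_mass_split:
  assumes "x \<le> y" "y \<le> z"
  shows "prime_mass G x z = prime_mass G x y + prime_mass G y z"
proof -
  have "{p. prime p \<and> p \<in> G \<and> x < real p \<and> real p \<le> z}
      = {p. prime p \<and> p \<in> G \<and> x < real p \<and> real p \<le> y} \<union> {p. prime p \<and> p \<in> G \<and> y < real p \<and> real p \<le> z}"
    using assms by auto
  then show ?thesis unfolding prime_mass_def
    by (simp only:) (rule sum.union_disjoint, auto simp: finite_primes_le_real)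
qed

lemma prime_mass_compl: "prime_mass UNIV x y = prime_mass G x y + prime_mass (- G) x y"
proof -
  have "{p. prime p \<and> p \<in> UNIV \<and> x < real p \<and> real p \<le> y}
      = {p. prime p \<and> p \<in> G \<and> x < real p \<and> real p \<le> y} \<union> {p. prime p \<and> p \<in> - G \<and> x < real p \<and> real p \<le> y}"
    by auto
  then show ?thesis unfolding prime_mass_def
    by (simp only:) (rule sum.union_disjoint[OF finite_primes_le_real finite_primes_le_real], auto)
qed

lemma prime_mass_lower:
  obtains C where "C \<ge> 0" "\<And>u v. 0 \<le> u \<Longrightarrow> u \<le> v \<Longrightarrow> prime_mass UNIV (exp u) (exp v) \<ge> v - u - C"
proof -
  obtain C where C: "C \<ge> 0"
    "\<And>N. N \<ge> 1 \<Longrightarrow> (\<Sum>p | prime p \<and> p \<le> N. ln (real p) / real p) \<ge> ln (real N) - C"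
    using mertens_lower by blast
  have "prime_mass UNIV (exp u) (exp v) \<ge> v - u - (C + 5)" if uv: "0 \<le> u" "u \<le> v" for u v
  proof -
    define A where "A = (\<lambda>w::real. nat \<lfloor>exp w\<rfloor>)"
    have A: "real (A w) \<le> exp w" "exp w < real (A w) + 1" "A w \<ge> 1" if "w \<ge> 0" for w :: real
    proof -
      have "exp w \<ge> 1" using that(1) by simp
      then show "real (A w) \<le> exp w" "exp w < real (A w) + 1" "A w \<ge> 1"
        unfolding A_def by linarith+
    qed
    have eq: "(\<Sum>p | prime p \<and> p \<le> A w. ln (real p) / real p) = prime_mass UNIV 0 (exp w)" if "w \<ge> 0" for w
      unfolding prime_mass_def
    proof (rule sum.cong)
      have "p \<le> A w \<longleftrightarrow> real p \<le> exp w" for p using A(1,2)[OF that] by linarith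
      then show "{p. prime p \<and> p \<le> A w} = {p. prime p \<and> p \<in> UNIV \<and> 0 < real p \<and> real p \<le> exp w}"
        by (auto simp: prime_gt_0_nat)
    qed simp
    have v0: "v \<ge> 0" using uv by simp
    have "ln (real (A u)) \<le> ln (exp u)" using A[OF uv(1)] by (subst ln_le_cancel_iff) auto
    then have up: "prime_mass UNIV 0 (exp u) \<le> u + 4"
      using mertens_upper[OF A(3)[OF uv(1)]] eq[OF uv(1)] by simp
    \<comment> \<open>Rounding exp v down to an integer loses at most a factor e, absorbed as 1 in
      the exponent.\<close>
    have "exp (v - 1) \<le> real (A v)"
    proof -
      have "exp (v - 1) * exp 1 = exp v" by (simp add: exp_add[symmetric])
      moreover have "exp (1::real) \<ge> 2" using exp_ge_add_one_self[of 1] by simp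
      then have "exp (v - 1) * 2 \<le> exp (v - 1) * exp 1" by (intro mult_left_mono) auto
      ultimately have "exp (v - 1) * 2 \<le> exp v" by simp
      then show ?thesis using A(2,3)[OF v0] by linarith
    qed
    then have "ln (exp (v - 1)) \<le> ln (real (A v))" using A(3)[OF v0] by (subst ln_le_cancel_iff) auto
    then have "prime_mass UNIV 0 (exp v) \<ge> v - 1 - C"
      using C(2)[OF A(3)[OF v0]] eq[OF v0] by simp
    moreover have "prime_mass UNIV 0 (exp v) = prime_mass UNIV 0 (exp u) + prime_mass UNIV (exp u) (exp v)"
      by (rule prime_mass_split) (use uv in auto)
    ultimately show ?thesis using up by simp
  qed
  then show ?thesis using that[of "C + 5"] C(1) by simp
qed

definition no_close_pair :: "(nat \<Rightarrow> 'c) \<Rightarrow> nat set \<Rightarrow> real \<Rightarrow> real \<Rightarrow> real \<Rightarrow> bool" where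
  "no_close_pair col Bd \<eta> \<rho> Y \<longleftrightarrow> (\<forall>p p'. prime p \<longrightarrow> prime p' \<longrightarrow> p \<notin> Bd \<longrightarrow> p' \<notin> Bd \<longrightarrow>
     real p' \<le> Y \<longrightarrow> col p = col p' \<longrightarrow> \<eta> \<le> ln (real p') - ln (real p) \<longrightarrow> ln (real p') - ln (real p) \<le> \<rho> \<longrightarrow> False)"

text \<open>Two good primes in a window of ratio exp \<rho> differ in logarithm by at most \<rho>;
  if they share a colour, then by less than \<eta>. So each colour sits in an interval of ratio exp
  \<eta> that starts at its least prime. The half-open interval in \<open>bt\<close> omits that
  prime, whose own mass, at most \<eta>, turns 33 into 34.\<close>

lemma good_mass_cell:
  fixes col :: "nat \<Rightarrow> 'c"
  assumes \<eta>: "0 < \<eta>" and x: "x \<ge> x0" "x > 0"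
    and bt: "\<And>x. x \<ge> x0 \<Longrightarrow> (\<Sum>p | prime p \<and> x < real p \<and> real p \<le> exp \<eta> * x. ln (real p) / real p) \<le> 33 * \<eta>"
    and small: "\<And>p. real p \<ge> x0 \<Longrightarrow> ln (real p) / real p \<le> \<eta>"
    and fin: "finite (col ` {p. prime p})" "card (col ` {p. prime p}) \<le> k"
    and np: "no_close_pair col Bd \<eta> \<rho> Y" and Y: "exp \<rho> * x \<le> Y"
  shows "prime_mass (- Bd) x (exp \<rho> * x) \<le> 34 * \<eta> * real k"
proof -
  define S where "S = {p. prime p \<and> p \<in> - Bd \<and> x < real p \<and> real p \<le> exp \<rho> * x}"
  have finS: "finite S" unfolding S_def by (rule finite_primes_le_real)
  have le: "(\<Sum>p\<in>{p\<in>S. col p = c}. ln (real p) / real p) \<le> 34 * \<eta>" for c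
  proof (cases "{p\<in>S. col p = c} = {}")
    case False
    define p0 where "p0 = Min {p\<in>S. col p = c}"
    have fin': "finite {p\<in>S. col p = c}" using finS by simp
    have p0: "p0 \<in> S" "col p0 = c" using Min_in[OF fin' False] by (auto simp: p0_def)
    have min: "p0 \<le> p" if "p \<in> S" "col p = c" for p using that fin' by (simp add: p0_def)
    have p0x: "real p0 \<ge> x0" "real p0 > 0" "x < real p0" using p0 x by (auto simp: S_def)
    have "{p\<in>S. col p = c} \<subseteq> insert p0 {p. prime p \<and> real p0 < real p \<and> real p \<le> exp \<eta> * real p0}"
    proof
      fix p assume p: "p \<in> {p\<in>S. col p = c}"
      then have pp: "prime p" "p \<notin> Bd" "x < real p" "real p \<le> exp \<rho> * x" "col p = col p0"
        using p0 by (auto simp: S_def)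
      have pos: "real p > 0" using pp x by simp
      have "real p \<le> exp \<rho> * real p0"
        using pp(4) mult_left_mono[of x "real p0" "exp \<rho>"] p0x(3) exp_ge_zero[of \<rho>] by linarith
      then have "ln (real p) \<le> ln (exp \<rho> * real p0)" using pos p0x by (subst ln_le_cancel_iff) auto
      then have "ln (real p) - ln (real p0) \<le> \<rho>" using p0x by (simp add: ln_mult)
      moreover have "real p \<le> Y" using pp Y by simp
      moreover have "prime p0" "p0 \<notin> Bd" using p0 by (auto simp: S_def)
      ultimately have "ln (real p) - ln (real p0) < \<eta>"
        using np[unfolded no_close_pair_def, rule_format, of p0 p] pp
        by (cases "\<eta> \<le> ln (real p) - ln (real p0)") simp_all
      then have "ln (real p) < ln (exp \<eta> * real p0)" using p0x by (simp add: ln_mult)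
      then have "real p < exp \<eta> * real p0" using pos p0x by (subst (asm) ln_less_cancel_iff) auto
      then show "p \<in> insert p0 {p. prime p \<and> real p0 < real p \<and> real p \<le> exp \<eta> * real p0}"
        using pp min p by (cases "p = p0") (auto simp: le_less)
    qed
    then have "(\<Sum>p\<in>{p\<in>S. col p = c}. ln (real p) / real p)
        \<le> (\<Sum>p\<in>insert p0 {p. prime p \<and> real p0 < real p \<and> real p \<le> exp \<eta> * real p0}. ln (real p) / real p)"
      using p0
      by (intro sum_mono2) (auto simp: S_def intro!: ln_over_prime_nonneg finite_nat_le_real[of _ "exp \<eta> * real p0"])
    also have "\<dots> = ln (real p0) / real p0 +
        (\<Sum>p | prime p \<and> real p0 < real p \<and> real p \<le> exp \<eta> * real p0. ln (real p) / real p)"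
      by (subst sum.insert) (auto intro!: finite_nat_le_real[of _ "exp \<eta> * real p0"])
    also have "\<dots> \<le> \<eta> + 33 * \<eta>" using bt[OF p0x(1)] small[OF p0x(1)] by (rule add_mono[rotated])
    finally show ?thesis by simp
  next
    case True
    show ?thesis unfolding True using \<eta> by simp
  qed
  have "prime_mass (- Bd) x (exp \<rho> * x) = (\<Sum>p\<in>S. ln (real p) / real p)"
    by (simp add: prime_mass_def S_def)
  also have "\<dots> = (\<Sum>c\<in>col ` {p. prime p}. \<Sum>p\<in>{p\<in>S. col p = c}. ln (real p) / real p)"
    by (rule sum.group[symmetric]) (use finS fin S_def in auto)
  also have "\<dots> \<le> (\<Sum>c\<in>col ` {p. prime p}. 34 * \<eta>)" by (intro sum_mono le)
  also have "\<dots> = real (card (col ` {p. prime p})) * (34 * \<eta>)" by simp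
  also have "\<dots> \<le> real k * (34 * \<eta>)" using fin(2) \<eta> by (intro mult_right_mono) auto
  finally show ?thesis by (simp add: mult_ac)
qed

text \<open>In a logarithmic window of length \<open>100 * k * \<eta>\<close> without such a pair, the good primes of each colour
  would lie in one cell of length \<open>\<eta>\<close>, so by Brun--Titchmarsh they would carry only a fixed proportion of
  the mass that Mertens' theorem provides. The exceptional primes would have to carry the rest, and their sum of
  reciprocals would diverge.\<close>

lemma monochromatic_prime_pair:
  fixes \<eta> K :: real and k :: nat
  assumes \<eta>: "0 < \<eta>" "\<eta> \<le> 1" and k: "k \<ge> 1"
  obtains Y :: nat where
    "\<And>(col :: nat \<Rightarrow> 'c) Bd. finite (col ` {p. prime p}) \<Longrightarrow> card (col ` {p. prime p}) \<le> k \<Longrightarrow>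
       (\<Sum>p | prime p \<and> p \<in> Bd \<and> p \<le> Y. 1 / real p) \<le> K \<Longrightarrow>
       \<exists>p p'. prime p \<and> prime p' \<and> p \<notin> Bd \<and> p' \<notin> Bd \<and> p \<le> Y \<and> p' \<le> Y \<and> col p = col p' \<and>
         \<eta> \<le> ln (real p') - ln (real p) \<and> ln (real p') - ln (real p) \<le> 100 * real k * \<eta>"
proof -
  \<comment> \<open>By \<open>good_mass_cell\<close> the good primes fill at most 34 \<eta> k of a
    window of length \<rho>; the factor 100 makes this 34/100 of its length.\<close>
  define \<rho> where "\<rho> = 100 * real k * \<eta>"
  have \<rho>0: "\<rho> > 0" using \<eta> k by (simp add: \<rho>_def)
  have "\<forall>\<^sub>F x in at_top. ln (x::real) / x < \<eta>"
    by (rule order_tendstoD(2)[of _ 0]) (real_asymp, rule \<eta>)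
  with primes_short_interval[OF \<eta>]
  have "\<forall>\<^sub>F x in at_top. (\<Sum>p | prime p \<and> x < real p \<and> real p \<le> exp \<eta> * x. ln (real p) / real p) \<le> 33 * \<eta>
      \<and> ln x / x \<le> \<eta>"
    by eventually_elim auto
  then obtain x0 where x0: "\<And>x. x \<ge> x0 \<Longrightarrow> (\<Sum>p | prime p \<and> x < real p \<and> real p \<le> exp \<eta> * x. ln (real p) / real p) \<le> 33 * \<eta>"
      "\<And>x. x \<ge> x0 \<Longrightarrow> ln x / x \<le> \<eta>"
    by (auto simp: eventually_at_top_linorder)
  obtain C where C: "C \<ge> 0" "\<And>u v. 0 \<le> u \<Longrightarrow> u \<le> v \<Longrightarrow> prime_mass UNIV (exp u) (exp v) \<ge> v - u - C"
    using prime_mass_lower by blast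
  have good: "prime_mass (- Bd) (exp u) (exp (u + real J * \<rho>)) \<le> 34 / 100 * (real J * \<rho>)"
    if "exp u \<ge> x0" "finite (col ` {p. prime p})" "card (col ` {p. prime p}) \<le> k"
      "no_close_pair col Bd \<eta> \<rho> Y" "exp (u + real J * \<rho>) \<le> Y" for u J and col :: "nat \<Rightarrow> 'c" and Bd Y
    using that(5)
  proof (induction J)
    case (Suc J)
    have e: "exp \<rho> * exp (u + real J * \<rho>) = exp (u + real (Suc J) * \<rho>)"
      by (simp add: exp_add[symmetric] algebra_simps)
    have mono: "exp u \<le> exp (u + real J * \<rho>)" "exp (u + real J * \<rho>) \<le> exp (u + real (Suc J) * \<rho>)"
      using \<rho>0 by (auto simp: algebra_simps)
    have "prime_mass (- Bd) (exp (u + real J * \<rho>)) (exp \<rho> * exp (u + real J * \<rho>)) \<le> 34 * \<eta> * real k"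
    proof (rule good_mass_cell[OF \<eta>(1) _ _ x0 that(2-4)])
      show "x0 \<le> exp (u + real J * \<rho>)" using that(1) mono(1) by (rule order_trans)
      show "exp \<rho> * exp (u + real J * \<rho>) \<le> Y" using Suc.prems by (simp only: e)
    qed auto
    moreover have "prime_mass (- Bd) (exp u) (exp (u + real J * \<rho>)) \<le> 34 / 100 * (real J * \<rho>)"
      by (rule Suc.IH) (use mono(2) Suc.prems in \<open>rule order_trans\<close>)
    moreover have "prime_mass (- Bd) (exp u) (exp (u + real (Suc J) * \<rho>)) = 
        prime_mass (- Bd) (exp u) (exp (u + real J * \<rho>)) + 
        prime_mass (- Bd) (exp (u + real J * \<rho>)) (exp (u + real (Suc J) * \<rho>))"
      by (rule prime_mass_split) (use mono in auto)
    moreover have "34 * \<eta> * real k = 34 / 100 * \<rho>" by (simp add: \<rho>_def)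
    ultimately show ?case unfolding e by (simp add: algebra_simps)
  next
    case 0
    have "{p. prime p \<and> p \<in> - Bd \<and> exp u < real p \<and> real p \<le> exp u} = {}" by auto
    then have "prime_mass (- Bd) (exp u) (exp u) = 0" unfolding prime_mass_def by (simp only: sum.empty)
    then show ?case by simp
  qed
  \<comment> \<open>Of a mass of at least v - u - C, at most 34/100 (v - u) is good. Taking v - u
    larger than u + 4 C leaves at least v / 4 to the exceptional primes, and as ln p <= v there,
    their reciprocals sum to at least 1/4. The point v is fixed before the colouring and the
    exceptional set.\<close>
  have scale: "\<exists>v\<ge>u. \<forall>(col :: nat \<Rightarrow> 'c) Bd Y. finite (col ` {p. prime p}) \<longrightarrow> card (col ` {p. prime p}) \<le> k \<longrightarrow>
       no_close_pair col Bd \<eta> \<rho> Y \<longrightarrow> exp v \<le> Y \<longrightarrow>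
       (\<Sum>p | prime p \<and> p \<in> Bd \<and> exp u < real p \<and> real p \<le> exp v. 1 / real p) \<ge> 1 / 4"
    if u: "exp u \<ge> x0" "u \<ge> 1" for u
  proof -
    obtain J :: nat where "real J > (u + 4 * C) / \<rho>" using reals_Archimedean2 by blast
    then have J: "real J * \<rho> > u + 4 * C" using \<rho>0 by (simp add: divide_less_eq)
    define v where "v = u + real J * \<rho>"
    have "real J * \<rho> \<ge> 0" using \<rho>0 by simp
    then have uv: "u \<le> v" "v > 0" using u by (auto simp: v_def)
    show ?thesis
    proof (intro exI[of _ v] conjI allI impI uv)
      fix col :: "nat \<Rightarrow> 'c" and Bd Y
      assume asm: "finite (col ` {p. prime p})" "card (col ` {p. prime p}) \<le> k"
        "no_close_pair col Bd \<eta> \<rho> Y" "exp v \<le> Y"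
      have "prime_mass (- Bd) (exp u) (exp v) \<le> 34 / 100 * (v - u)"
        using good[OF u(1) asm(1-3), of J] asm(4) unfolding v_def by simp
      then have "prime_mass Bd (exp u) (exp v) \<ge> 66 / 100 * (v - u) - C"
        using C(2)[OF _ uv(1)] u(2) prime_mass_compl[of "exp u" "exp v" Bd] by (simp add: algebra_simps)
      also have "66 / 100 * (v - u) - C \<ge> v / 4"
      proof -
        define t where "t = real J * \<rho>"
        have "t > u + 4 * C" using J by (simp add: t_def)
        then have "66 / 100 * t - C \<ge> (u + t) / 4" using u(2) C(1) by (simp add: field_simps)
        then show ?thesis by (simp add: v_def t_def)
      qed
      finally have m: "v / 4 \<le> prime_mass Bd (exp u) (exp v)" .
      also have "\<dots> \<le> (\<Sum>p | prime p \<and> p \<in> Bd \<and> exp u < real p \<and> real p \<le> exp v. v * (1 / real p))"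
        unfolding prime_mass_def
      proof (intro sum_mono)
        fix p assume p: "p \<in> {p. prime p \<and> p \<in> Bd \<and> exp u < real p \<and> real p \<le> exp v}"
        then have "exp u < real p" by blast
        then have "real p > 0" by (rule less_trans[OF exp_gt_zero])
        moreover from p this have "ln (real p) \<le> ln (exp v)" by (subst ln_le_cancel_iff) auto
        ultimately show "ln (real p) / real p \<le> v * (1 / real p)" by (simp add: divide_right_mono)
      qed
      finally show "1 / 4 \<le> (\<Sum>p | prime p \<and> p \<in> Bd \<and> exp u < real p \<and> real p \<le> exp v. 1 / real p)"
        unfolding sum_distrib_left[symmetric] using uv by (simp add: field_simps del: sum_divide_distrib)
    qed
  qed
  \<comment> \<open>Each further window starts beyond the previous cutoff, so the contributions of
    1/4 are disjoint and add up. With more than 4 K windows they exceed the budget K.\<close>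
  have main: "\<exists>Y::nat. \<forall>(col :: nat \<Rightarrow> 'c) Bd. finite (col ` {p. prime p}) \<longrightarrow> card (col ` {p. prime p}) \<le> k \<longrightarrow>
       no_close_pair col Bd \<eta> \<rho> (real Y) \<longrightarrow> (\<Sum>p | prime p \<and> p \<in> Bd \<and> p \<le> Y. 1 / real p) \<ge> real m / 4" for m :: nat
  proof (induction m)
    case (Suc m)
    then obtain Y :: nat where Y: "\<And>(col :: nat \<Rightarrow> 'c) Bd. finite (col ` {p. prime p}) \<Longrightarrow> card (col ` {p. prime p}) \<le> k \<Longrightarrow>
       no_close_pair col Bd \<eta> \<rho> (real Y) \<Longrightarrow> (\<Sum>p | prime p \<and> p \<in> Bd \<and> p \<le> Y. 1 / real p) \<ge> real m / 4" by blast
    define u where "u = max 1 (ln (max 1 (max x0 (real Y))))"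
    have "exp u \<ge> exp (ln (max 1 (max x0 (real Y))))" unfolding u_def exp_le_cancel_iff by simp
    then have u: "exp u \<ge> x0" "exp u \<ge> real Y" "u \<ge> 1" by (auto simp: u_def)
    from scale[OF u(1,3)] obtain v where v: "v \<ge> u"
      "\<And>(col :: nat \<Rightarrow> 'c) Bd Y. finite (col ` {p. prime p}) \<Longrightarrow> card (col ` {p. prime p}) \<le> k \<Longrightarrow>
       no_close_pair col Bd \<eta> \<rho> Y \<Longrightarrow> exp v \<le> Y \<Longrightarrow>
       (\<Sum>p | prime p \<and> p \<in> Bd \<and> exp u < real p \<and> real p \<le> exp v. 1 / real p) \<ge> 1 / 4" by blast
    define Z where "Z = nat \<lceil>exp v\<rceil>"
    have Z: "exp v \<le> real Z" by (simp add: Z_def real_nat_ceiling_ge)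
    have uv: "exp u \<le> exp v" using v by simp
    have YZ: "real Y \<le> real Z" using u Z uv by linarith
    show ?case
    proof (intro exI[of _ Z] allI impI)
      fix col :: "nat \<Rightarrow> 'c" and Bd
      assume asm: "finite (col ` {p. prime p})" "card (col ` {p. prime p}) \<le> k" "no_close_pair col Bd \<eta> \<rho> (real Z)"
      have "no_close_pair col Bd \<eta> \<rho> (real Y)" using asm(3) YZ unfolding no_close_pair_def by (meson order_trans)
      then have 1: "(\<Sum>p | prime p \<and> p \<in> Bd \<and> p \<le> Y. 1 / real p) \<ge> real m / 4" using Y asm by blast
      have 2: "(\<Sum>p | prime p \<and> p \<in> Bd \<and> exp u < real p \<and> real p \<le> exp v. 1 / real p) \<ge> 1 / 4"
        by (rule v(2)[OF asm Z])
      have "(\<Sum>p | prime p \<and> p \<in> Bd \<and> p \<le> Y. 1 / real p) +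
          (\<Sum>p | prime p \<and> p \<in> Bd \<and> exp u < real p \<and> real p \<le> exp v. 1 / real p)
         = (\<Sum>p\<in>{p. prime p \<and> p \<in> Bd \<and> p \<le> Y} \<union> {p. prime p \<and> p \<in> Bd \<and> exp u < real p \<and> real p \<le> exp v}. 1 / real p)"
        using u by (intro sum.union_disjoint[symmetric]) (auto intro!: finite_primes_le_real)
      also have "\<dots> \<le> (\<Sum>p | prime p \<and> p \<in> Bd \<and> p \<le> Z. 1 / real p)"
      proof (intro sum_mono2)
        show "{p. prime p \<and> p \<in> Bd \<and> p \<le> Y} \<union> {p. prime p \<and> p \<in> Bd \<and> exp u < real p \<and> real p \<le> exp v}
            \<subseteq> {p. prime p \<and> p \<in> Bd \<and> p \<le> Z}"
        proof
          fix p assume "p \<in> {p. prime p \<and> p \<in> Bd \<and> p \<le> Y} \<union> {p. prime p \<and> p \<in> Bd \<and> exp u < real p \<and> real p \<le> exp v}"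
          then have "prime p" "p \<in> Bd" "real p \<le> real Y \<or> real p \<le> exp v" by auto
          moreover from this have "real p \<le> real Z" using YZ Z by linarith
          ultimately show "p \<in> {p. prime p \<and> p \<in> Bd \<and> p \<le> Z}" by simp
        qed
      qed auto
      finally show "real (Suc m) / 4 \<le> (\<Sum>p | prime p \<and> p \<in> Bd \<and> p \<le> Z. 1 / real p)"
        using 1 2 by simp
    qed
  next
    case 0
    show ?case by (intro exI[of _ 0]) (auto intro: sum_nonneg)
  qed
  obtain m :: nat where m: "real m > 4 * K" using reals_Archimedean2 by blast
  obtain Y :: nat where Y: "\<And>(col :: nat \<Rightarrow> 'c) Bd. finite (col ` {p. prime p}) \<Longrightarrow> card (col ` {p. prime p}) \<le> k \<Longrightarrow>
       no_close_pair col Bd \<eta> \<rho> (real Y) \<Longrightarrow> (\<Sum>p | prime p \<and> p \<in> Bd \<and> p \<le> Y. 1 / real p) \<ge> real m / 4"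
    using main[of m] by blast
  show ?thesis
  proof (rule that[of Y])
    fix col :: "nat \<Rightarrow> 'c" and Bd
    assume asm: "finite (col ` {p. prime p})" "card (col ` {p. prime p}) \<le> k"
       "(\<Sum>p | prime p \<and> p \<in> Bd \<and> p \<le> Y. 1 / real p) \<le> K"
    then have "\<not> no_close_pair col Bd \<eta> \<rho> (real Y)" using Y[OF asm(1,2), of Bd] m by force
    then obtain p p' where pp: "prime p" "prime p'" "p \<notin> Bd" "p' \<notin> Bd" "real p' \<le> real Y" "col p = col p'"
      "\<eta> \<le> ln (real p') - ln (real p)" "ln (real p') - ln (real p) \<le> \<rho>"
      unfolding no_close_pair_def not_all not_imp by (elim exE conjE) (rule that; assumption)
    then have "ln (real p) \<le> ln (real p')" using \<eta> by simp
    then have "p \<le> p'" using pp(1,2) by (simp add: prime_gt_0_nat)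
    then show "\<exists>p p'. prime p \<and> prime p' \<and> p \<notin> Bd \<and> p' \<notin> Bd \<and> p \<le> Y \<and> p' \<le> Y \<and> col p = col p' \<and>
         \<eta> \<le> ln (real p') - ln (real p) \<and> ln (real p') - ln (real p) \<le> 100 * real k * \<eta>"
      using pp unfolding \<rho>_def by (intro exI[of _ p] exI[of _ p']) simp
  qed
qed

section \<open>The dual Turan--Kubilius inequality\<close>

lemma floor_mult_bounds: "real m * real (N div m) \<le> real N" "real N - real m \<le> real m * real (N div m)" if "m \<ge> 1"
proof -
  have "real N = real m * real (N div m) + real (N mod m)"
    by (metis mult_div_mod_eq of_nat_add of_nat_mult)
  moreover have "N mod m < m" using that by simp
  ultimately show "real m * real (N div m) \<le> real N" "real N - real m \<le> real m * real (N div m)" by simp_all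
qed

text \<open>The indicator of divisibility by p, normalised to mean nearly 0; its variance over n <=
  N is about p - 1, and the kernels of distinct primes are nearly uncorrelated.\<close>

definition tk_kernel :: "nat \<Rightarrow> nat \<Rightarrow> real" where
  "tk_kernel p n = (if p dvd n then real p else 0) - 1"

text \<open>For distinct primes the four main terms N - N - N + N cancel and only rounding errors of
  size at most p r remain.\<close>

lemma tk_kernel_correlation:
  assumes "prime p" "prime r"
  shows "\<bar>\<Sum>n=1..N. tk_kernel p n * tk_kernel r n\<bar> \<le> (if p = r then real p * real N else 0) + real p * real r"
proof -
  have pr2: "p \<ge> 2" "r \<ge> 2" using assms prime_ge_2_nat by auto
  have s: "(\<Sum>n=1..N. if m dvd n then c else 0) = c * real (N div m)" if "m \<ge> 1" for m and c :: real
    by (subst sum.inter_filter[symmetric]) (auto simp: card_multiples[OF that, symmetric] simp del: One_nat_def)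
  show ?thesis
  proof (cases "p = r")
    case True
    have "(\<Sum>n=1..N. tk_kernel p n * tk_kernel r n) = (\<Sum>n=1..N. (if p dvd n then real p * real p - 2 * real p else 0) + 1)"
      by (intro sum.cong refl) (auto simp: tk_kernel_def True algebra_simps)
    also have "\<dots> = (real p * real p - 2 * real p) * real (N div p) + real N"
      unfolding sum.distrib using pr2 by (subst s) simp_all
    also have "\<dots> = (real p - 2) * (real p * real (N div p)) + real N" by (simp add: algebra_simps)
    finally have eq: "(\<Sum>n=1..N. tk_kernel p n * tk_kernel r n) = (real p - 2) * (real p * real (N div p)) + real N" .
    have "(real p - 2) * (real p * real (N div p)) \<le> (real p - 2) * real N"
      using pr2 floor_mult_bounds[of p N] by (intro mult_left_mono) auto
    moreover have "(real p - 2) * (real p * real (N div p)) \<ge> 0" using pr2 by simp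
    moreover have "(real p - 2) * real N + real N \<le> real p * real N" by (simp add: algebra_simps)
    moreover have "real p * real r \<ge> 0" by simp
    moreover have "0 \<le> real N" "0 \<le> real p * real N" by simp_all
    ultimately have "0 \<le> (real p - 2) * (real p * real (N div p)) + real N"
      "(real p - 2) * (real p * real (N div p)) + real N \<le> real p * real N + real p * real r"
      by linarith+
    then show ?thesis unfolding eq if_P[OF True] by (simp only: abs_of_nonneg)
  next
    case False
    have cop: "coprime p r" using assms False by (simp add: primes_coprime)
    have pr1: "p \<ge> 1" "r \<ge> 1" "p * r \<ge> 1" using pr2 by auto
    have "(\<Sum>n=1..N. tk_kernel p n * tk_kernel r n)
        = (\<Sum>n=1..N. (if p * r dvd n then real p * real r else 0) - (if p dvd n then real p else 0)
            - (if r dvd n then real r else 0) + 1)"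
    proof (intro sum.cong refl)
      fix n
      have "p * r dvd n \<longleftrightarrow> p dvd n \<and> r dvd n" using cop by (auto intro: divides_mult dvd_mult_left dvd_mult_right)
      then show "tk_kernel p n * tk_kernel r n = (if p * r dvd n then real p * real r else 0)
        - (if p dvd n then real p else 0) - (if r dvd n then real r else 0) + 1"
        by (auto simp: tk_kernel_def algebra_simps)
    qed
    also have "\<dots> = real (p * r) * real (N div (p * r)) - real p * real (N div p) - real r * real (N div r) + real N"
      unfolding sum.distrib sum_subtractf s[OF pr1(1)] s[OF pr1(2)] s[OF pr1(3)] by simp
    finally have eq: "(\<Sum>n=1..N. tk_kernel p n * tk_kernel r n)
        = real (p * r) * real (N div (p * r)) - real p * real (N div p) - real r * real (N div r) + real N" .
    have "(real p - 1) * (real r - 1) \<ge> 1 * 1" using pr2 by (intro mult_mono) auto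
    then have "real p + real r \<le> real p * real r" by (simp add: algebra_simps)
    then show ?thesis unfolding eq using floor_mult_bounds[OF pr1(1), of N] floor_mult_bounds[OF pr1(2), of N]
        floor_mult_bounds[OF pr1(3), of N] False by (simp add: abs_le_iff)
  qed
qed

text \<open>Duality: with coefficients \<open>c p\<close> proportional to the conjugated errors
  \<open>E p\<close>, the quantity \<open>Q\<close> to be bounded is 1 / y times the pairing of b
  with a combination \<open>w\<close> of kernels. Cauchy-Schwarz bounds (y Q)^2 by the square sums
  of b and w, and the correlations bound the latter by 2 y Q, half from the diagonal and half from
  rounding, so that one factor y Q cancels. The scale y is real because dilation by a prime turns it
  into y / p.\<close>

lemma dual_turan_kubilius:
  fixes b :: "nat \<Rightarrow> complex" and y :: real
  assumes fin: "finite P" and pr: "\<And>p. p \<in> P \<Longrightarrow> prime p" and y: "y \<ge> real (\<Sum>P)" "y > 0"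
    and N: "real N \<le> y"
  shows "(\<Sum>p\<in>P. (norm (of_real (real p / y) * (\<Sum>n\<in>{n\<in>{1..N}. p dvd n}. b n)
            - of_real (1 / y) * (\<Sum>n=1..N. b n)))\<^sup>2 / real p) \<le> 2 / y * (\<Sum>n=1..N. (norm (b n))\<^sup>2)"
proof -
  define E where "E = (\<lambda>p. of_real (1 / y) * (\<Sum>n=1..N. b n * of_real (tk_kernel p n)))"
  define c where "c = (\<lambda>p. cnj (E p) / of_real (real p))"
  define w where "w = (\<lambda>n. \<Sum>p\<in>P. c p * of_real (tk_kernel p n))"
  define Q where "Q = (\<Sum>p\<in>P. (norm (E p))\<^sup>2 / real p)"
  define B where "B = (\<Sum>n=1..N. (norm (b n))\<^sup>2)"
  have pos: "real p > 0" if "p \<in> P" for p using pr[OF that] prime_gt_0_nat by simp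
  have E_eq: "of_real (real p / y) * (\<Sum>n\<in>{n\<in>{1..N}. p dvd n}. b n) - of_real (1 / y) * (\<Sum>n=1..N. b n) = E p" for p
  proof -
    have "(\<Sum>n=1..N. b n * of_real (tk_kernel p n)) = (\<Sum>n=1..N. (if p dvd n then of_nat p * b n else 0) - b n)"
      by (intro sum.cong refl) (auto simp: tk_kernel_def algebra_simps)
    also have "\<dots> = of_nat p * (\<Sum>n\<in>{n\<in>{1..N}. p dvd n}. b n) - (\<Sum>n=1..N. b n)"
      unfolding sum_subtractf by (subst sum.inter_filter[symmetric]) (auto simp: sum_distrib_left)
    finally have e: "(\<Sum>n=1..N. b n * of_real (tk_kernel p n))
        = of_nat p * (\<Sum>n\<in>{n\<in>{1..N}. p dvd n}. b n) - (\<Sum>n=1..N. b n)" .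
    show ?thesis unfolding E_def e by (simp add: diff_divide_distrib right_diff_distrib)
  qed
  have Q0: "Q \<ge> 0" unfolding Q_def by (intro sum_nonneg) auto
  have B0: "B \<ge> 0" unfolding B_def by (intro sum_nonneg) auto
  have "complex_of_real Q = (\<Sum>p\<in>P. c p * E p)"
    unfolding Q_def of_real_sum c_def
    by (intro sum.cong refl) (simp add: complex_norm_square[symmetric] mult.commute flip: of_real_power)
  also have "\<dots> = of_real (1 / y) * (\<Sum>p\<in>P. \<Sum>n=1..N. b n * (c p * of_real (tk_kernel p n)))"
    unfolding E_def sum_distrib_left by (intro sum.cong refl) (simp add: mult_ac)
  also have "\<dots> = of_real (1 / y) * (\<Sum>n=1..N. b n * w n)"
    by (subst sum.swap) (simp add: w_def sum_distrib_left)
  finally have Qeq: "complex_of_real Q = of_real (1 / y) * (\<Sum>n=1..N. b n * w n)" .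
  have "y * Q = norm (of_real y * complex_of_real Q)" using Q0 y by (simp add: norm_mult)
  also have "of_real y * complex_of_real Q = (\<Sum>n=1..N. b n * w n)"
    unfolding Qeq using y by simp
  also have "norm \<dots> \<le> (\<Sum>n=1..N. norm (b n) * norm (w n))"
    by (rule order_trans[OF norm_sum]) (simp add: norm_mult)
  finally have "(y * Q)\<^sup>2 \<le> (\<Sum>n=1..N. norm (b n) * norm (w n))\<^sup>2"
    using Q0 y by (intro power_mono) auto
  also have "\<dots> \<le> B * (\<Sum>n=1..N. (norm (w n))\<^sup>2)"
    unfolding B_def by (rule Cauchy_Schwarz_ineq_sum)
  finally have 1: "(y * Q)\<^sup>2 \<le> B * (\<Sum>n=1..N. (norm (w n))\<^sup>2)" .
  have "complex_of_real (\<Sum>n=1..N. (norm (w n))\<^sup>2)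
      = (\<Sum>n=1..N. \<Sum>p\<in>P. \<Sum>r\<in>P. c p * cnj (c r) * of_real (tk_kernel p n * tk_kernel r n))"
    unfolding of_real_sum complex_norm_square w_def
    by (intro sum.cong refl) (simp add: sum_product mult_ac)
  also have "\<dots> = (\<Sum>p\<in>P. \<Sum>n=1..N. \<Sum>r\<in>P. c p * cnj (c r) * of_real (tk_kernel p n * tk_kernel r n))"
    by (rule sum.swap)
  also have "\<dots> = (\<Sum>p\<in>P. \<Sum>r\<in>P. \<Sum>n=1..N. c p * cnj (c r) * of_real (tk_kernel p n * tk_kernel r n))"
    by (intro sum.cong refl sum.swap)
  also have "\<dots> = (\<Sum>p\<in>P. \<Sum>r\<in>P. c p * cnj (c r) * of_real (\<Sum>n=1..N. tk_kernel p n * tk_kernel r n))"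
    by (simp add: sum_distrib_left)
  finally have "norm (complex_of_real (\<Sum>n=1..N. (norm (w n))\<^sup>2))
      \<le> (\<Sum>p\<in>P. \<Sum>r\<in>P. norm (c p) * norm (c r) * \<bar>\<Sum>n=1..N. tk_kernel p n * tk_kernel r n\<bar>)"
    by (simp only:) (intro order_trans[OF norm_sum] sum_mono, simp add: norm_mult flip: of_real_sum of_real_mult)
  then have "(\<Sum>n=1..N. (norm (w n))\<^sup>2)
      \<le> (\<Sum>p\<in>P. \<Sum>r\<in>P. norm (c p) * norm (c r) * \<bar>\<Sum>n=1..N. tk_kernel p n * tk_kernel r n\<bar>)"
    by (simp add: sum_nonneg del: of_real_sum)
  also have "\<dots> \<le> (\<Sum>p\<in>P. \<Sum>r\<in>P. norm (c p) * norm (c r) *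
      ((if p = r then real p * real N else 0) + real p * real r))"
    by (intro sum_mono mult_left_mono tk_kernel_correlation pr) auto
  also have "\<dots> = (\<Sum>p\<in>P. \<Sum>r\<in>P. (if r = p then (norm (c p))\<^sup>2 * real p * real N else 0)
      + (norm (c p) * real p) * (norm (c r) * real r))"
    by (intro sum.cong refl) (auto simp: algebra_simps power2_eq_square)
  also have "\<dots> = (\<Sum>p\<in>P. (norm (c p))\<^sup>2 * real p * real N) + (\<Sum>p\<in>P. norm (c p) * real p)\<^sup>2"
    using fin by (simp add: sum.distrib power2_eq_square sum_product)
  also have "(\<Sum>p\<in>P. (norm (c p))\<^sup>2 * real p * real N) = real N * Q"
    unfolding Q_def c_def sum_distrib_left
  proof (intro sum.cong refl)
    fix p assume "p \<in> P"
    then have "p > 0" using pos by force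
    then show "(norm (cnj (E p) / of_real (real p)))\<^sup>2 * real p * real N = real N * ((norm (E p))\<^sup>2 / real p)"
      by (simp add: norm_divide power2_eq_square field_simps)
  qed
  also have "(\<Sum>p\<in>P. norm (c p) * real p)\<^sup>2 = (\<Sum>p\<in>P. sqrt (real p) * (norm (E p) / sqrt (real p)))\<^sup>2"
    unfolding c_def using pos by (intro arg_cong[where f = "\<lambda>x. x\<^sup>2"] sum.cong refl) (simp add: norm_divide)
  also have "\<dots> \<le> (\<Sum>p\<in>P. (sqrt (real p))\<^sup>2) * (\<Sum>p\<in>P. (norm (E p) / sqrt (real p))\<^sup>2)"
    by (rule Cauchy_Schwarz_ineq_sum)
  also have "\<dots> = real (\<Sum>P) * Q" by (simp add: Q_def power_divide)
  also have "real N * Q + real (\<Sum>P) * Q \<le> y * Q + y * Q"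
    using Q0 y N by (intro add_mono mult_right_mono) auto
  finally have 2: "(\<Sum>n=1..N. (norm (w n))\<^sup>2) \<le> 2 * y * Q" by (simp add: mult_ac)
  have "(y * Q)\<^sup>2 \<le> B * (2 * y * Q)"
    using 1 mult_left_mono[OF 2 B0] by linarith
  then have "(y * Q) * (y * Q) \<le> (y * Q) * (2 * B)" by (simp add: power2_eq_square mult_ac)
  then have "y * Q \<le> 2 * B"
    using Q0 B0 y by (cases "Q = 0") (auto simp: mult_le_cancel_left)
  then have "Q \<le> 2 / y * B" using y by (simp add: field_simps)
  then show ?thesis unfolding E_eq by (simp add: Q_def B_def)
qed

section \<open>Square-integrable functions\<close>

lemma L2_norm_nonneg [simp]: "L2_norm M f \<ge> 0"
  by (simp add: L2_norm_def)

lemma L2_norm_square: "(L2_norm M f)\<^sup>2 = (LINT x|M. (norm (f x))\<^sup>2)"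
  by (simp add: L2_norm_def)

lemma L2_measurable [measurable_dest]: "f \<in> L2 M \<Longrightarrow> f \<in> borel_measurable M"
  by (simp add: L2_def)

lemma L2_integrable: "f \<in> L2 M \<Longrightarrow> integrable M (\<lambda>x. (norm (f x))\<^sup>2)"
  by (simp add: L2_def)

lemma L2I: "f \<in> borel_measurable M \<Longrightarrow> integrable M (\<lambda>x. (norm (f x))\<^sup>2) \<Longrightarrow> f \<in> L2 M"
  by (simp add: L2_def)

lemma L2_norm_cong_AE:
  assumes "f \<in> borel_measurable M" "g \<in> borel_measurable M" "AE x in M. f x = g x"
  shows "L2_norm M f = L2_norm M g"
  unfolding L2_norm_def by (intro arg_cong[where f = sqrt] integral_cong_AE) (use assms in auto)

lemma L2_norm_cong: "(\<And>x. x \<in> space M \<Longrightarrow> f x = g x) \<Longrightarrow> L2_norm M f = L2_norm M g"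
  unfolding L2_norm_def by (intro arg_cong[where f = sqrt] Bochner_Integration.integral_cong) auto

lemma L2_mono:
  assumes "g \<in> L2 M" "f \<in> borel_measurable M" "AE x in M. norm (f x) \<le> norm (g x)"
  shows "f \<in> L2 M" "L2_norm M f \<le> L2_norm M g"
proof -
  have ae: "AE x in M. (norm (f x))\<^sup>2 \<le> (norm (g x))\<^sup>2"
    using assms(3) by eventually_elim (rule power_mono, auto)
  have "integrable M (\<lambda>x. (norm (f x))\<^sup>2)"
    by (rule Bochner_Integration.integrable_bound[OF L2_integrable[OF assms(1)]]) (use assms(2) ae in auto)
  then show L: "f \<in> L2 M" using assms(2) by (simp add: L2_def)
  show "L2_norm M f \<le> L2_norm M g"
    unfolding L2_norm_def using L2_integrable[OF L] L2_integrable[OF assms(1)] ae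
    by (intro real_sqrt_le_mono integral_mono_AE) auto
qed

lemma norm_add_square_le: "(norm (a + b))\<^sup>2 \<le> 2 * (norm a)\<^sup>2 + 2 * (norm b)\<^sup>2"
  for a b :: "'b::real_normed_vector"
proof -
  have "(norm (a + b))\<^sup>2 \<le> (norm a + norm b)\<^sup>2" by (intro power_mono norm_triangle_ineq) auto
  also have "\<dots> \<le> 2 * (norm a)\<^sup>2 + 2 * (norm b)\<^sup>2"
    using zero_le_power2[of "norm a - norm b"] by (simp add: power2_eq_square algebra_simps)
  finally show ?thesis .
qed

lemma L2_add: "f \<in> L2 M \<Longrightarrow> g \<in> L2 M \<Longrightarrow> (\<lambda>x. f x + g x) \<in> L2 M"
proof -
  assume L: "f \<in> L2 M" "g \<in> L2 M"
  have "integrable M (\<lambda>x. (norm (f x + g x))\<^sup>2)"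
  proof (rule Bochner_Integration.integrable_bound)
    show "integrable M (\<lambda>x. 2 * (norm (f x))\<^sup>2 + 2 * (norm (g x))\<^sup>2)"
      using L by (intro Bochner_Integration.integrable_add integrable_mult_right L2_integrable) auto
    show "(\<lambda>x. (norm (f x + g x))\<^sup>2) \<in> borel_measurable M" using L by measurable
    show "AE x in M. norm ((norm (f x + g x))\<^sup>2) \<le> norm (2 * (norm (f x))\<^sup>2 + 2 * (norm (g x))\<^sup>2)"
      using norm_add_square_le by (intro AE_I2) auto
  qed
  then show ?thesis using L by (intro L2I borel_measurable_add) auto
qed

lemma L2_scale: "f \<in> L2 M \<Longrightarrow> (\<lambda>x. c * f x) \<in> L2 M"
  by (auto simp: L2_def norm_mult power_mult_distrib)

lemma L2_norm_scale: "L2_norm M (\<lambda>x. c * f x) = norm c * L2_norm M f"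
  by (simp add: L2_norm_def norm_mult power_mult_distrib real_sqrt_mult)

lemma L2_diff: "f \<in> L2 M \<Longrightarrow> g \<in> L2 M \<Longrightarrow> (\<lambda>x. f x - g x) \<in> L2 M"
  using L2_add[of f M "\<lambda>x. (-1) * g x"] L2_scale[of g M "-1"] by simp

lemma L2_zero: "(\<lambda>x. 0) \<in> L2 M"
  by (simp add: L2_def)

lemma L2_norm_zero: "L2_norm M (\<lambda>x. 0) = 0"
  by (simp add: L2_norm_def)

lemma L2_sum: "(\<And>i. i \<in> I \<Longrightarrow> f i \<in> L2 M) \<Longrightarrow> (\<lambda>x. \<Sum>i\<in>I. f i x) \<in> L2 M"
  by (induction I rule: infinite_finite_induct) (auto intro: L2_add L2_zero)

lemma L2_norm_uminus: "L2_norm M (\<lambda>x. - f x) = L2_norm M f"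
  by (simp add: L2_norm_def)

lemma L2_norm_commute: "L2_norm M (\<lambda>x. f x - g x) = L2_norm M (\<lambda>x. g x - f x)"
  by (simp add: L2_norm_def norm_minus_commute)

lemma L2_norm_eq_0_iff: "f \<in> L2 M \<Longrightarrow> L2_norm M f = 0 \<longleftrightarrow> (AE x in M. f x = 0)"
  unfolding L2_norm_def real_sqrt_eq_zero_cancel_iff
  by (subst integral_nonneg_eq_0_iff_AE[OF L2_integrable]) auto

lemma L2_Cauchy_Schwarz:
  assumes L: "f \<in> L2 M" "g \<in> L2 M"
  shows "integrable M (\<lambda>x. f x * g x)" "(LINT x|M. norm (f x * g x)) \<le> L2_norm M f * L2_norm M g"
    "norm (LINT x|M. f x * g x) \<le> L2_norm M f * L2_norm M g"
proof -
  define A B where "A = L2_norm M f" and "B = L2_norm M g"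
  have AB: "A \<ge> 0" "B \<ge> 0" by (simp_all add: A_def B_def)
  have am: "norm (a * b) \<le> (t * (norm a)\<^sup>2 + (norm b)\<^sup>2 / t) / 2" if "t > 0" for t :: real and a b :: complex
  proof -
    have "0 \<le> (t * norm a - norm b)\<^sup>2 / t" using that by simp
    also have "\<dots> = t * (norm a)\<^sup>2 + (norm b)\<^sup>2 / t - 2 * norm (a * b)"
      using that by (simp add: power2_diff norm_mult field_simps power2_eq_square)
    finally show ?thesis by simp
  qed
  have int: "integrable M (\<lambda>x. (t * (norm (f x))\<^sup>2 + (norm (g x))\<^sup>2 / t) / 2)" for t
    using L by (intro integrable_divide Bochner_Integration.integrable_add integrable_mult_right L2_integrable) auto
  show I: "integrable M (\<lambda>x. f x * g x)"
    by (rule Bochner_Integration.integrable_bound[OF int[of 1]]) (use L am[of 1] in \<open>auto intro!: AE_I2\<close>)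
  \<comment> \<open>The arithmetic-geometric inequality with the balancing weight t; the shift by e
    keeps t finite and positive when a norm vanishes, and e tends to 0 afterwards.\<close>
  have key: "(LINT x|M. norm (f x * g x)) \<le> (A + e) * (B + e)" if e: "e > 0" for e
  proof -
    define t where "t = (B + e) / (A + e)"
    have t: "t > 0" using e AB by (simp add: t_def)
    have "(LINT x|M. norm (f x * g x)) \<le> (LINT x|M. (t * (norm (f x))\<^sup>2 + (norm (g x))\<^sup>2 / t) / 2)"
      using am[OF t] by (intro integral_mono integrable_norm I int)
    also have "\<dots> = (t * A\<^sup>2 + B\<^sup>2 / t) / 2"
      unfolding A_def B_def L2_norm_square using L2_integrable[OF L(1)] L2_integrable[OF L(2)] by simp
    also have "\<dots> \<le> (t * (A + e)\<^sup>2 + (B + e)\<^sup>2 / t) / 2"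
      using t AB e by (intro divide_right_mono add_mono mult_left_mono power_mono) auto
    also have "\<dots> = (A + e) * (B + e)" using e AB unfolding t_def by (simp add: power2_eq_square)
    finally show ?thesis .
  qed
  have "((\<lambda>e. (A + e) * (B + e)) \<longlongrightarrow> (A + 0) * (B + 0)) (at_right 0)"
    by (intro tendsto_intros)
  then have "(LINT x|M. norm (f x * g x)) \<le> (A + 0) * (B + 0)"
    by (rule tendsto_lowerbound) (auto simp: eventually_at_right_less intro!: eventually_mono[OF eventually_at_right_less] key)
  then show *: "(LINT x|M. norm (f x * g x)) \<le> L2_norm M f * L2_norm M g" by (simp add: A_def B_def)
  show "norm (LINT x|M. f x * g x) \<le> L2_norm M f * L2_norm M g"
    using integral_norm_bound[of M "\<lambda>x. f x * g x"] * by linarith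
qed

lemma L2_norm_triangle:
  assumes L: "f \<in> L2 M" "g \<in> L2 M"
  shows "L2_norm M (\<lambda>x. f x + g x) \<le> L2_norm M f + L2_norm M g"
proof -
  have L': "(\<lambda>x. of_real (norm (f x))) \<in> L2 M" "(\<lambda>x. of_real (norm (g x))) \<in> L2 M"
    using L by (auto simp: L2_def)
  have "(L2_norm M (\<lambda>x. f x + g x))\<^sup>2 \<le> (LINT x|M. (norm (f x))\<^sup>2 + (norm (g x))\<^sup>2 + 2 * norm (f x * g x))"
    unfolding L2_norm_square
  proof (intro integral_mono)
    show "integrable M (\<lambda>x. (norm (f x))\<^sup>2 + (norm (g x))\<^sup>2 + 2 * norm (f x * g x))"
      using L by (intro Bochner_Integration.integrable_add integrable_mult_right integrable_norm
          L2_integrable L2_Cauchy_Schwarz(1)) auto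
    show "(norm (f x + g x))\<^sup>2 \<le> (norm (f x))\<^sup>2 + (norm (g x))\<^sup>2 + 2 * norm (f x * g x)" for x
      using power_mono[OF norm_triangle_ineq[of "f x" "g x"], of 2]
      by (simp add: power2_sum norm_mult)
  qed (intro L2_integrable L2_add L)
  also have "\<dots> = (L2_norm M f)\<^sup>2 + (L2_norm M g)\<^sup>2 + 2 * (LINT x|M. norm (f x * g x))"
    using L2_integrable[OF L(1)] L2_integrable[OF L(2)] L2_Cauchy_Schwarz(1)[OF L] 
    by (simp add: L2_norm_square)
  also have "\<dots> \<le> (L2_norm M f + L2_norm M g)\<^sup>2"
    using L2_Cauchy_Schwarz(2)[OF L] by (simp add: power2_sum)
  finally show ?thesis by (rule power2_le_imp_le) simp
qed

lemma L2_norm_triangle_diff: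
  "f \<in> L2 M \<Longrightarrow> g \<in> L2 M \<Longrightarrow> L2_norm M (\<lambda>x. f x - g x) \<le> L2_norm M f + L2_norm M g"
  using L2_norm_triangle[of f M "\<lambda>x. - 1 * g x"] L2_scale[of g M "-1"] L2_norm_uminus[of M g] by simp

lemma L2_norm_dist_triangle:
  assumes "f \<in> L2 M" "g \<in> L2 M" "h \<in> L2 M"
  shows "L2_norm M (\<lambda>x. f x - h x) \<le> L2_norm M (\<lambda>x. f x - g x) + L2_norm M (\<lambda>x. g x - h x)"
  using L2_norm_triangle[OF L2_diff[OF assms(1,2)] L2_diff[OF assms(2,3)]] by simp

lemma L2_norm_le_dist:
  assumes "f \<in> L2 M" "g \<in> L2 M"
  shows "L2_norm M f \<le> L2_norm M g + L2_norm M (\<lambda>x. f x - g x)"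
  using L2_norm_triangle[OF assms(2) L2_diff[OF assms]] by simp

lemma L2_norm_sum_le:
  assumes "\<And>i. i \<in> I \<Longrightarrow> f i \<in> L2 M"
  shows "L2_norm M (\<lambda>x. \<Sum>i\<in>I. f i x) \<le> (\<Sum>i\<in>I. L2_norm M (f i))"
  using assms
proof (induction I rule: infinite_finite_induct)
  case (insert i I)
  have "L2_norm M (\<lambda>x. \<Sum>i\<in>insert i I. f i x) = L2_norm M (\<lambda>x. f i x + (\<Sum>i\<in>I. f i x))"
    using insert.hyps by simp
  also have "\<dots> \<le> L2_norm M (f i) + L2_norm M (\<lambda>x. \<Sum>i\<in>I. f i x)"
    using insert.prems by (intro L2_norm_triangle L2_sum) auto
  finally show ?case using insert by auto
qed (auto simp: L2_norm_zero)

lemma L2_parallelogram: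
  assumes L: "f \<in> L2 M" "g \<in> L2 M"
  shows "(L2_norm M (\<lambda>x. f x - g x))\<^sup>2
    = 2 * (L2_norm M f)\<^sup>2 + 2 * (L2_norm M g)\<^sup>2 - 4 * (L2_norm M (\<lambda>x. (f x + g x) / 2))\<^sup>2"
proof -
  have "(norm (a - b))\<^sup>2 = 2 * (norm a)\<^sup>2 + 2 * (norm b)\<^sup>2 - 4 * (norm ((a + b) / 2))\<^sup>2" for a b :: complex
    unfolding cmod_power2 by (simp add: power2_eq_square field_simps)
  moreover have "integrable M (\<lambda>x. (norm ((f x + g x) / 2))\<^sup>2)"
    using L2_integrable[OF L2_scale[OF L2_add[OF L], of "1/2"]] by simp
  ultimately show ?thesis
    unfolding L2_norm_square using L2_integrable[OF L(1)] L2_integrable[OF L(2)] by simp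
qed

lemma L2_comp_measure_preserving:
  assumes T: "T \<in> M \<rightarrow>\<^sub>M M" and d: "distr M M T = M" and L: "f \<in> L2 M"
  shows "(\<lambda>x. f (T x)) \<in> L2 M" "L2_norm M (\<lambda>x. f (T x)) = L2_norm M f"
proof -
  have f: "f \<in> borel_measurable M" using L by simp
  have "integrable (distr M M T) (\<lambda>x. (norm (f x))\<^sup>2)" unfolding d by (rule L2_integrable[OF L])
  then have "integrable M (\<lambda>x. (norm (f (T x)))\<^sup>2)" by (rule integrable_distr[OF T])
  then show "(\<lambda>x. f (T x)) \<in> L2 M" using f T by (simp add: L2_def)
  have "(LINT x|distr M M T. (norm (f x))\<^sup>2) = (LINT x|M. (norm (f (T x)))\<^sup>2)"
    using f by (intro integral_distr T) auto
  then show "L2_norm M (\<lambda>x. f (T x)) = L2_norm M f" by (simp add: d L2_norm_def)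
qed

lemma L2_comp:
  assumes "invertible_measure_preserving M T" "f \<in> L2 M"
  shows "(\<lambda>x. f (T x)) \<in> L2 M" "L2_norm M (\<lambda>x. f (T x)) = L2_norm M f"
  using L2_comp_measure_preserving[of T M f] assms by (auto simp: invertible_measure_preserving_def)

lemma L2_mult_bounded:
  assumes "f \<in> L2 M" "g \<in> borel_measurable M" "AE x in M. norm (g x) \<le> C"
  shows "(\<lambda>x. f x * g x) \<in> L2 M" "L2_norm M (\<lambda>x. f x * g x) \<le> \<bar>C\<bar> * L2_norm M f"
proof -
  have ae: "AE x in M. norm (f x * g x) \<le> norm (of_real \<bar>C\<bar> * f x)"
    using assms(3)
  proof eventually_elim
    case (elim x)
    then have "norm (f x) * norm (g x) \<le> norm (f x) * \<bar>C\<bar>" by (intro mult_left_mono) auto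
    then show ?case by (simp add: norm_mult mult.commute)
  qed
  have m: "(\<lambda>x. f x * g x) \<in> borel_measurable M" using assms by measurable
  show "(\<lambda>x. f x * g x) \<in> L2 M" by (rule L2_mono(1)[OF L2_scale[OF assms(1)] m ae])
  show "L2_norm M (\<lambda>x. f x * g x) \<le> \<bar>C\<bar> * L2_norm M f"
    using L2_mono(2)[OF L2_scale[OF assms(1)] m ae] by (simp add: L2_norm_scale)
qed

lemma L2_cnj: "f \<in> L2 M \<Longrightarrow> (\<lambda>x. cnj (f x)) \<in> L2 M"
proof (rule L2I)
  assume f: "f \<in> L2 M"
  have "cnj \<in> borel_measurable borel" by (intro borel_measurable_continuous_onI continuous_intros)
  with L2_measurable[OF f] show "(\<lambda>x. cnj (f x)) \<in> borel_measurable M" by (rule measurable_compose)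
  show "integrable M (\<lambda>x. (norm (cnj (f x)))\<^sup>2)" using L2_integrable[OF f] by simp
qed

context prob_space
begin

lemma L2_const: "(\<lambda>x. c) \<in> L2 M"
  by (simp add: L2_def)

lemma L2_norm_const: "L2_norm M (\<lambda>x. c) = norm c"
  by (simp add: L2_norm_def prob_space)

lemma Linf_subset_L2: "Linf M \<subseteq> L2 M"
proof
  fix f assume "f \<in> Linf M"
  then obtain C where f: "f \<in> borel_measurable M" and C: "AE x in M. norm (f x) \<le> C"
    by (auto simp: Linf_def)
  have "(\<lambda>x. 1 * f x) \<in> L2 M" by (rule L2_mult_bounded[OF L2_const f C])
  then show "f \<in> L2 M" by simp
qed

lemma L2_integrable1: "f \<in> L2 M \<Longrightarrow> integrable M f"
  using L2_Cauchy_Schwarz(1)[of f M "\<lambda>x. 1"] L2_const by simp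

lemma L2_norm_integral_le: "f \<in> L2 M \<Longrightarrow> (LINT x|M. norm (f x)) \<le> L2_norm M f"
  using L2_Cauchy_Schwarz(2)[of f M "\<lambda>x. 1"] L2_const L2_norm_const[of 1] by simp

lemma L2_complete:
  fixes c :: "nat \<Rightarrow> 'a \<Rightarrow> complex"
  assumes L: "\<And>n. c n \<in> L2 M"
    and cauchy: "\<And>e. e > 0 \<Longrightarrow> \<exists>N. \<forall>m\<ge>N. \<forall>n\<ge>N. L2_norm M (\<lambda>x. c m x - c n x) < e"
  obtains w where "w \<in> L2 M" "(\<lambda>n. L2_norm M (\<lambda>x. c n x - w x)) \<longlonglongrightarrow> 0"
proof -
  have "\<exists>N. \<forall>m\<ge>N. \<forall>n\<ge>N. L2_norm M (\<lambda>x. c m x - c n x) < (1 / 2) ^ k" for k :: nat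
    by (rule cauchy) simp
  then obtain r0 where r0: "\<And>k m n. m \<ge> r0 k \<Longrightarrow> n \<ge> r0 k \<Longrightarrow> L2_norm M (\<lambda>x. c m x - c n x) < (1 / 2) ^ k"
    by metis
  \<comment> \<open>Partial sums make the indices monotone while they stay above the Cauchy
    thresholds \<open>r0\<close>. The increments along this subsequence are summable in the mean,
    hence almost everywhere.\<close>
  define r where "r = (\<lambda>k. \<Sum>j\<le>k. r0 j)"
  have r: "r k \<ge> r0 k" "r (Suc k) \<ge> r0 k" "r (Suc k) \<ge> r k" for k
    by (auto simp: r_def lessThan_Suc_atMost[symmetric])
  have r_mono: "k \<le> l \<Longrightarrow> r k \<le> r l" for k l by (rule lift_Suc_mono_le[of r]) (auto intro: r(3))
  define d where "d = (\<lambda>k x. c (r (Suc k)) x - c (r k) x)"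
  have dL: "d k \<in> L2 M" for k unfolding d_def by (intro L2_diff L)
  have d1: "(LINT x|M. norm (d k x)) \<le> (1 / 2) ^ k" for k
    using L2_norm_integral_le[OF dL[of k]] r0[OF r(2)[of k] r(1)[of k]] unfolding d_def by linarith
  have "(\<integral>\<^sup>+x. (\<Sum>k. ennreal (norm (d k x))) \<partial>M) = (\<Sum>k. \<integral>\<^sup>+x. ennreal (norm (d k x)) \<partial>M)"
    using dL by (intro nn_integral_suminf) auto
  also have "\<dots> \<le> (\<Sum>k. ennreal ((1 / 2) ^ k))"
  proof (intro suminf_le allI)
    fix k
    have "(\<integral>\<^sup>+x. ennreal (norm (d k x)) \<partial>M) = ennreal (LINT x|M. norm (d k x))"
      by (intro nn_integral_eq_integral integrable_norm L2_integrable1 dL) auto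
    then show "(\<integral>\<^sup>+x. ennreal (norm (d k x)) \<partial>M) \<le> ennreal ((1 / 2) ^ k)"
      using d1 by (simp add: ennreal_leI)
  qed auto
  also have "\<dots> < \<infinity>"
    by (subst suminf_ennreal_eq[OF _ geometric_sums]) auto
  finally have "AE x in M. (\<Sum>k. ennreal (norm (d k x))) \<noteq> \<infinity>"
    using dL by (intro nn_integral_PInf_AE) auto
  then have conv: "AE x in M. convergent (\<lambda>k. c (r k) x)"
  proof eventually_elim
    case (elim x)
    have "summable (\<lambda>k. norm (d k x))" by (rule summable_suminf_not_top) (use elim in auto)
    then have "summable (\<lambda>k. d k x)" by (rule summable_norm_cancel)
    then have "convergent (\<lambda>n. \<Sum>k<n. d k x)" by (simp add: summable_iff_convergent)
    moreover have "(\<Sum>k<n. d k x) = c (r n) x - c (r 0) x" for n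
      unfolding d_def by (rule sum_lessThan_telescope)
    ultimately have "convergent (\<lambda>n. (c (r n) x - c (r 0) x) + c (r 0) x)"
      by (intro convergent_add convergent_const) simp
    then show ?case by simp
  qed
  define w where "w = (\<lambda>x. lim (\<lambda>k. c (r k) x))"
  have wm: "w \<in> borel_measurable M" unfolding w_def using L by measurable
  have bound: "(\<integral>\<^sup>+x. ennreal ((norm (c n x - w x))\<^sup>2) \<partial>M) \<le> ennreal (((1 / 2) ^ k)\<^sup>2)"
    if n: "n \<ge> r k" for n k
  proof -
    have "(\<integral>\<^sup>+x. ennreal ((norm (c n x - w x))\<^sup>2) \<partial>M)
        = (\<integral>\<^sup>+x. liminf (\<lambda>l. ennreal ((norm (c n x - c (r l) x))\<^sup>2)) \<partial>M)"
    proof (rule nn_integral_cong_AE)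
      show "AE x in M. ennreal ((norm (c n x - w x))\<^sup>2) = liminf (\<lambda>l. ennreal ((norm (c n x - c (r l) x))\<^sup>2))"
        using conv
      proof eventually_elim
        case (elim x)
        then have "(\<lambda>k. c (r k) x) \<longlonglongrightarrow> w x" unfolding w_def by (simp add: convergent_LIMSEQ_iff)
        then have "(\<lambda>l. ennreal ((norm (c n x - c (r l) x))\<^sup>2)) \<longlonglongrightarrow> ennreal ((norm (c n x - w x))\<^sup>2)"
          by (intro tendsto_ennrealI tendsto_intros)
        then show ?case by (intro lim_imp_Liminf[symmetric]) auto
      qed
    qed
    also have "\<dots> \<le> liminf (\<lambda>l. \<integral>\<^sup>+x. ennreal ((norm (c n x - c (r l) x))\<^sup>2) \<partial>M)"
      using L by (intro nn_integral_liminf) (auto intro!: measurable_compose[OF _ measurable_ennreal] borel_measurable_power borel_measurable_norm borel_measurable_diff)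
    also have "\<dots> \<le> liminf (\<lambda>l::nat. ennreal (((1 / 2) ^ k)\<^sup>2))"
    proof (rule Liminf_mono)
      show "\<forall>\<^sub>F l in sequentially. (\<integral>\<^sup>+x. ennreal ((norm (c n x - c (r l) x))\<^sup>2) \<partial>M) \<le> ennreal (((1 / 2) ^ k)\<^sup>2)"
        using eventually_ge_at_top[of k]
      proof eventually_elim
        case (elim l)
        have "(\<integral>\<^sup>+x. ennreal ((norm (c n x - c (r l) x))\<^sup>2) \<partial>M) = ennreal ((L2_norm M (\<lambda>x. c n x - c (r l) x))\<^sup>2)"
          unfolding L2_norm_square by (intro nn_integral_eq_integral L2_integrable L2_diff L) auto
        also have "L2_norm M (\<lambda>x. c n x - c (r l) x) \<le> (1 / 2) ^ k"
          using n r(1)[of k] r_mono[OF elim] by (intro less_imp_le[OF r0]) auto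
        then have "ennreal ((L2_norm M (\<lambda>x. c n x - c (r l) x))\<^sup>2) \<le> ennreal (((1 / 2) ^ k)\<^sup>2)"
          by (intro ennreal_leI power_mono) auto
        finally show ?case .
      qed
    qed
    also have "\<dots> = ennreal (((1 / 2) ^ k)\<^sup>2)" by (simp add: Liminf_const)
    finally show ?thesis .
  qed
  have intg: "integrable M (\<lambda>x. (norm (c n x - w x))\<^sup>2)" if "n \<ge> r k" for n k
  proof (rule integrableI_bounded)
    show "(\<integral>\<^sup>+x. ennreal (norm ((norm (c n x - w x))\<^sup>2)) \<partial>M) < \<infinity>"
      using bound[OF that] by (simp add: order_le_less_trans)
  qed (use L wm in measurable)
  have dwL: "(\<lambda>x. c n x - w x) \<in> L2 M" if "n \<ge> r k" for n k
    using intg[OF that] L[of n] wm by (intro L2I borel_measurable_diff) auto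
  have wL: "w \<in> L2 M"
    using L2_diff[OF L[of "r 0"] dwL[of 0 "r 0"]] by simp
  have small: "L2_norm M (\<lambda>x. c n x - w x) \<le> (1 / 2) ^ k" if n: "n \<ge> r k" for n k
  proof -
    have "ennreal ((L2_norm M (\<lambda>x. c n x - w x))\<^sup>2) = (\<integral>\<^sup>+x. ennreal ((norm (c n x - w x))\<^sup>2) \<partial>M)"
      unfolding L2_norm_square by (intro nn_integral_eq_integral[symmetric] intg[OF n]) auto
    then have "(L2_norm M (\<lambda>x. c n x - w x))\<^sup>2 \<le> ((1 / 2) ^ k)\<^sup>2"
      using bound[OF n] by (metis ennreal_le_iff zero_le_power2)
    then show ?thesis by (rule power2_le_imp_le) simp
  qed
  have "(\<lambda>n. L2_norm M (\<lambda>x. c n x - w x)) \<longlonglongrightarrow> 0"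
  proof (rule LIMSEQ_I)
    fix e :: real assume "e > 0"
    then obtain k where k: "(1 / 2) ^ k < e" using real_arch_pow_inv[of e "1/2"] by auto
    show "\<exists>N. \<forall>n\<ge>N. norm (L2_norm M (\<lambda>x. c n x - w x) - 0) < e"
      using small[of k] k by (intro exI[of _ "r k"]) (auto intro: order_le_less_trans)
  qed
  then show thesis using that wL by blast
qed

text \<open>By the parallelogram identity a norm-minimising sequence in a midpoint-convex set is
  Cauchy. A contraction that preserves the set maps it to another minimising sequence, at vanishing
  distance from the first, so the limit is fixed. As \<open>K\<close> need not be closed, the
  sequence is returned together with its limit.\<close>

lemma L2_minimal_norm:
  fixes K :: "('a \<Rightarrow> complex) set" and \<U> :: "(('a \<Rightarrow> complex) \<Rightarrow> 'a \<Rightarrow> complex) set"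
  assumes K: "K \<noteq> {}" "K \<subseteq> L2 M"
    and mid: "\<And>f g. f \<in> K \<Longrightarrow> g \<in> K \<Longrightarrow> (\<lambda>x. (f x + g x) / 2) \<in> K"
    and inv: "\<And>U f. U \<in> \<U> \<Longrightarrow> f \<in> K \<Longrightarrow> U f \<in> K"
    and contr: "\<And>U f. U \<in> \<U> \<Longrightarrow> f \<in> L2 M \<Longrightarrow> U f \<in> L2 M \<and> L2_norm M (U f) \<le> L2_norm M f"
    and lin: "\<And>U f g. U \<in> \<U> \<Longrightarrow> U (\<lambda>x. f x - g x) = (\<lambda>x. U f x - U g x)"
  obtains c w where "\<And>n. c n \<in> K" "w \<in> L2 M" "(\<lambda>n. L2_norm M (\<lambda>x. c n x - w x)) \<longlonglongrightarrow> 0"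
    "\<And>U. U \<in> \<U> \<Longrightarrow> AE x in M. U w x = w x"
proof -
  define \<delta> where "\<delta> = Inf ((\<lambda>f. (L2_norm M f)\<^sup>2) ` K)"
  have bdd: "bdd_below ((\<lambda>f. (L2_norm M f)\<^sup>2) ` K)" by (rule bdd_belowI2[of _ 0]) simp
  have lower: "\<delta> \<le> (L2_norm M f)\<^sup>2" if "f \<in> K" for f
    unfolding \<delta>_def using that bdd by (intro cInf_lower) auto
  have "\<exists>f\<in>K. (L2_norm M f)\<^sup>2 < \<delta> + 1 / (real n + 1)" for n :: nat
    using cInf_lessD[of "(\<lambda>f. (L2_norm M f)\<^sup>2) ` K" "\<delta> + 1 / (real n + 1)"] K(1)
    unfolding \<delta>_def by auto
  then obtain c where c: "\<And>n. c n \<in> K" "\<And>n::nat. (L2_norm M (c n))\<^sup>2 < \<delta> + 1 / (real n + 1)"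
    by metis
  have cL: "c n \<in> L2 M" for n using c(1) K(2) by blast
  have dist: "(L2_norm M (\<lambda>x. f x - g x))\<^sup>2 \<le> 2 * a + 2 * b"
    if "f \<in> K" "g \<in> K" "(L2_norm M f)\<^sup>2 \<le> \<delta> + a" "(L2_norm M g)\<^sup>2 \<le> \<delta> + b" for f g a b
  proof -
    have "f \<in> L2 M" "g \<in> L2 M" using that K(2) by auto
    from L2_parallelogram[OF this] show ?thesis using lower[OF mid[OF that(1,2)]] that(3,4) by linarith
  qed
  have "\<exists>N. \<forall>m\<ge>N. \<forall>n\<ge>N. L2_norm M (\<lambda>x. c m x - c n x) < e" if e: "e > 0" for e
  proof -
    obtain N :: nat where N: "real N > 4 / e\<^sup>2" using reals_Archimedean2 by blast
    have "L2_norm M (\<lambda>x. c m x - c n x) < e" if mn: "m \<ge> N" "n \<ge> N" for m n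
    proof -
      have k: "1 / (real k + 1) \<le> 1 / (real N + 1)" if "k \<ge> N" for k using that by (intro divide_left_mono) auto
      have "(L2_norm M (\<lambda>x. c m x - c n x))\<^sup>2 \<le> 2 * (1 / (real N + 1)) + 2 * (1 / (real N + 1))"
        using c(2)[of m] c(2)[of n] k[OF mn(1)] k[OF mn(2)] by (intro dist c(1)) auto
      also have "\<dots> = 4 / (real N + 1)" by simp
      also have "\<dots> < e\<^sup>2"
      proof -
        have "4 < e\<^sup>2 * real N" using N e by (simp add: field_simps)
        then show ?thesis using e by (simp add: field_simps add_strict_increasing)
      qed
      finally show ?thesis using e by (intro power2_less_imp_less[of _ e]) auto
    qed
    then show ?thesis by blast
  qed
  from L2_complete[OF cL this] obtain w where
    w: "w \<in> L2 M" "(\<lambda>n. L2_norm M (\<lambda>x. c n x - w x)) \<longlonglongrightarrow> 0" by blast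
  have "AE x in M. U w x = w x" if U: "U \<in> \<U>" for U
  proof -
    have UL: "U f \<in> L2 M" if "f \<in> L2 M" for f using contr[OF U that] by simp
    have "L2_norm M (\<lambda>x. U w x - w x) \<le> 2 * L2_norm M (\<lambda>x. c n x - w x) + sqrt (4 / (real n + 1))" for n
    proof -
      have "(L2_norm M (U (c n)))\<^sup>2 \<le> (L2_norm M (c n))\<^sup>2"
        using contr[OF U cL[of n]] by (intro power_mono) auto
      then have "(L2_norm M (\<lambda>x. U (c n) x - c n x))\<^sup>2 \<le> 2 * (1 / (real n + 1)) + 2 * (1 / (real n + 1))"
        using less_imp_le[OF c(2)[of n]] by (intro dist c(1) inv[OF U]) linarith+
      then have 1: "L2_norm M (\<lambda>x. U (c n) x - c n x) \<le> sqrt (4 / (real n + 1))"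
        by (intro real_le_rsqrt) simp
      have "L2_norm M (\<lambda>x. U w x - U (c n) x) = L2_norm M (U (\<lambda>x. w x - c n x))"
        by (simp add: lin[OF U])
      also have "\<dots> \<le> L2_norm M (\<lambda>x. w x - c n x)"
        using contr[OF U L2_diff[OF w(1) cL[of n]]] by simp
      also have "\<dots> = L2_norm M (\<lambda>x. c n x - w x)" by (rule L2_norm_commute)
      finally have 2: "L2_norm M (\<lambda>x. U w x - U (c n) x) \<le> L2_norm M (\<lambda>x. c n x - w x)" .
      have "L2_norm M (\<lambda>x. U w x - w x) \<le> L2_norm M (\<lambda>x. U w x - U (c n) x) + L2_norm M (\<lambda>x. U (c n) x - w x)"
        by (intro L2_norm_dist_triangle UL w cL)
      moreover have "L2_norm M (\<lambda>x. U (c n) x - w x) \<le> L2_norm M (\<lambda>x. U (c n) x - c n x) + L2_norm M (\<lambda>x. c n x - w x)"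
        by (intro L2_norm_dist_triangle UL w cL)
      ultimately show ?thesis using 1 2 by simp
    qed
    moreover have "(\<lambda>n. 2 * L2_norm M (\<lambda>x. c n x - w x) + sqrt (4 / (real n + 1))) \<longlonglongrightarrow> 2 * 0 + sqrt 0"
      by (intro tendsto_intros w) real_asymp
    ultimately have "L2_norm M (\<lambda>x. U w x - w x) \<le> 2 * 0 + sqrt 0"
      by (intro LIMSEQ_le_const) auto
    then have "L2_norm M (\<lambda>x. U w x - w x) = 0" using L2_norm_nonneg[of M "\<lambda>x. U w x - w x"] by (simp del: L2_norm_nonneg)
    then show ?thesis using L2_norm_eq_0_iff[OF L2_diff[OF UL[OF w(1)] w(1)]] by simp
  qed
  then show thesis using that c(1) w by blast
qed

end

section \<open>Averages along a twisted multiplicative action\<close>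

lemma not_summable_on_nonneg_large:
  fixes f :: "'b \<Rightarrow> real"
  assumes "\<not> f summable_on A" "\<And>x. x \<in> A \<Longrightarrow> f x \<ge> 0"
  obtains F where "finite F" "F \<subseteq> A" "sum f F \<ge> C"
proof -
  have "\<exists>F. finite F \<and> F \<subseteq> A \<and> sum f F \<ge> C"
  proof (rule ccontr)
    assume no: "\<not> ?thesis"
    have "sum f F \<le> C" if "F \<subseteq> A" "finite F" for F
    proof (rule ccontr)
      assume "\<not> sum f F \<le> C"
      then have "sum f F \<ge> C" by simp
      with no that show False by blast
    qed
    then have "bdd_above (sum f ` {F. F \<subseteq> A \<and> finite F})"
      by (intro bdd_aboveI2[of _ _ C]) simp
    then have "f summable_on A" by (intro nonneg_bdd_above_summable_on assms(2))
    with assms(1) show False by simp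
  qed
  then show ?thesis using that by blast
qed

lemma nat_floor_divide: "nat \<lfloor>y / real p\<rfloor> = nat \<lfloor>y\<rfloor> div p" if "p \<ge> 1" "y \<ge> 0"
proof -
  have "\<lfloor>y / real_of_int (int p)\<rfloor> = \<lfloor>y\<rfloor> div int p" by (rule floor_divide_real_eq_div) simp
  then show ?thesis using that by (simp add: nat_div_distrib)
qed

text \<open>Descend from \<open>t\<close> towards \<open>t / q\<close> in steps of ratio \<open>r\<close>; the Lipschitz bound covers the last,
  incomplete step.\<close>

lemma ratio_chain:
  fixes d :: "real \<Rightarrow> real \<Rightarrow> real"
  assumes refl: "\<And>s. d s s = 0"
    and tri: "\<And>s t u. s > 0 \<Longrightarrow> t > 0 \<Longrightarrow> u > 0 \<Longrightarrow> d s u \<le> d s t + d t u"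
    and lip: "\<And>s t. 0 < s \<Longrightarrow> s \<le> t \<Longrightarrow> d t s \<le> (2 * (t - s) + 1) / t"
    and step: "\<And>s. t / q \<le> s \<Longrightarrow> s \<le> t \<Longrightarrow> d s (s / r) \<le> \<xi>"
    and t: "t > 0" and q: "q \<ge> 1" and r: "r > 1" and \<xi>: "\<xi> \<ge> 0"
  shows "d t (t / q) \<le> ln q / ln r * \<xi> + 2 * ln r + q / t"
proof -
  define i0 where "i0 = nat \<lfloor>ln q / ln r\<rfloor>"
  have lr: "ln r > 0" using r by simp
  have lq: "ln q / ln r \<ge> 0" using lr q by simp
  have i0: "real i0 \<le> ln q / ln r" "ln q / ln r < real i0 + 1" unfolding i0_def using lq by linarith+
  have pow: "r ^ i = exp (real i * ln r)" for i using r by (simp add: exp_of_nat_mult)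
  have le: "r ^ i \<le> q" if "i \<le> i0" for i
  proof -
    have "real i * ln r \<le> real i0 * ln r" using that lr by (intro mult_right_mono) auto
    also have "\<dots> \<le> ln q" using i0(1) lr by (simp add: le_divide_eq)
    finally have "real i * ln r \<le> ln q" .
    then have "exp (real i * ln r) \<le> exp (ln q)" by simp
    then show ?thesis unfolding pow using q by simp
  qed
  have "d t (t / r ^ i) \<le> real i * \<xi>" if "i \<le> i0" for i
    using that
  proof (induction i)
    case (Suc i)
    have "t / q \<le> t / r ^ i" using le[of i] Suc.prems r t q by (intro divide_left_mono) auto
    moreover have "t / r ^ i \<le> t" using r t by (simp add: divide_le_eq one_le_power)
    ultimately have "d (t / r ^ i) (t / r ^ i / r) \<le> \<xi>" by (rule step)
    moreover have "d t (t / r ^ Suc i) \<le> d t (t / r ^ i) + d (t / r ^ i) (t / r ^ Suc i)"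
      using t r by (intro tri) auto
    ultimately show ?case using Suc by (simp add: algebra_simps)
  qed (simp add: refl)
  then have "d t (t / r ^ i0) \<le> real i0 * \<xi>" by simp
  also have "\<dots> \<le> ln q / ln r * \<xi>" by (rule mult_right_mono[OF i0(1) \<xi>])
  finally have 1: "d t (t / r ^ i0) \<le> ln q / ln r * \<xi>" .
  define t1 where "t1 = t / r ^ i0"
  have t1: "t1 > 0" "t / q \<le> t1" unfolding t1_def using t r q le[of i0] by (auto intro!: divide_left_mono)
  have "exp (ln q) \<le> exp (real (Suc i0) * ln r)"
    using i0(2) lr by (simp add: field_simps)
  then have "q \<le> r ^ Suc i0" unfolding pow using q by simp
  then have "t1 / r \<le> t / q" unfolding t1_def using t q r by (simp add: field_simps)
  have "d t1 (t / q) \<le> (2 * (t1 - t / q) + 1) / t1" using t1 t q by (intro lip) auto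
  also have "\<dots> \<le> (2 * (t1 - t1 / r) + 1) / t1"
    using t1 \<open>t1 / r \<le> t / q\<close> by (intro divide_right_mono) auto
  also have "\<dots> = 2 * (1 - 1 / r) + 1 / t1" using t1 r by (simp add: field_simps)
  also have "1 - 1 / r \<le> ln r" using ln_le_minus_one[of "1 / r"] r by (simp add: ln_div)
  also have "1 / t1 \<le> q / t" using t1 t q by (simp add: field_simps)
  finally have 2: "d t1 (t / q) \<le> 2 * ln r + q / t" by simp
  have "d t (t / q) \<le> d t t1 + d t1 (t / q)" using t t1 q by (intro tri) auto
  then show ?thesis using 1 2 unfolding t1_def by linarith
qed

text \<open>Covers the constant twist 1 as well as Dirichlet characters; the latter vanish at the
  finitely many primes dividing the modulus, whence the condition \<theta> p \<noteq> 0 in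
  \<open>twist_prime\<close>.\<close>

locale twisted_action = prob_space M for M :: "'a::metric_space measure" +
  fixes S :: "nat \<Rightarrow> 'a \<Rightarrow> 'a" and \<theta> :: "nat \<Rightarrow> complex"
  assumes action: "multiplicative_action M S"
    and twist_mult: "\<And>m n. \<theta> (m * n) = \<theta> m * \<theta> n"
    and twist_1: "\<theta> 1 = 1"
    and twist_prime: "\<And>p. prime p \<Longrightarrow> \<theta> p \<noteq> 0 \<Longrightarrow> norm (\<theta> p) = 1"
    and twist_le: "\<And>n. norm (\<theta> n) \<le> 1"
    and finite_zeros: "finite {p. prime p \<and> \<theta> p = 0}"
    and finite_colours: "finite ((\<lambda>p. (restrict (S p) (space M), \<theta> p)) ` {p. prime p})"
begin

definition V :: "nat \<Rightarrow> ('a \<Rightarrow> complex) \<Rightarrow> 'a \<Rightarrow> complex" where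
  "V n f x = \<theta> n * f (S n x)"

text \<open>Exactly the data that determine \<open>V p\<close> on the space
  (\<open>V_colour\<close>).\<close>

definition colour :: "nat \<Rightarrow> ('a \<Rightarrow> 'a) \<times> complex" where
  "colour p = (restrict (S p) (space M), \<theta> p)"

text \<open>The scale is real, and the normalisation is by y itself, because averages are compared
  at the scales y / p.\<close>

definition avg :: "('a \<Rightarrow> complex) \<Rightarrow> real \<Rightarrow> 'a \<Rightarrow> complex" where
  "avg f y x = of_real (1 / y) * (\<Sum>n=1..nat \<lfloor>y\<rfloor>. V n f x)"

lemma S_imp: "n \<ge> 1 \<Longrightarrow> invertible_measure_preserving M (S n)"
  using action by (simp add: multiplicative_action_def)

lemma S_mult: "m \<ge> 1 \<Longrightarrow> n \<ge> 1 \<Longrightarrow> x \<in> space M \<Longrightarrow> S (n * m) x = S n (S m x)"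
  using action by (simp add: multiplicative_action_def)

lemma S_space: "n \<ge> 1 \<Longrightarrow> x \<in> space M \<Longrightarrow> S n x \<in> space M"
  using S_imp[of n] by (auto simp: invertible_measure_preserving_def bij_betw_def)

lemma V_L2: "n \<ge> 1 \<Longrightarrow> f \<in> L2 M \<Longrightarrow> V n f \<in> L2 M"
  unfolding V_def using L2_scale[OF L2_comp(1)[OF S_imp]] by blast

lemma V_norm: "n \<ge> 1 \<Longrightarrow> f \<in> L2 M \<Longrightarrow> L2_norm M (V n f) = norm (\<theta> n) * L2_norm M f"
  unfolding V_def by (simp add: L2_norm_scale L2_comp(2)[OF S_imp])

lemma V_norm_le: "n \<ge> 1 \<Longrightarrow> f \<in> L2 M \<Longrightarrow> L2_norm M (V n f) \<le> L2_norm M f"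
  using mult_right_mono[OF twist_le[of n], of "L2_norm M f"] by (simp add: V_norm)

lemma V_diff: "V n (\<lambda>x. f x - g x) = (\<lambda>x. V n f x - V n g x)"
  by (simp add: V_def fun_eq_iff algebra_simps)

lemma V_V: "m \<ge> 1 \<Longrightarrow> n \<ge> 1 \<Longrightarrow> x \<in> space M \<Longrightarrow> V m (V n f) x = V (m * n) f x"
  using S_mult[of m n x] by (simp add: V_def twist_mult mult.commute mult.left_commute)

lemma V_colour: "colour p = colour p' \<Longrightarrow> x \<in> space M \<Longrightarrow> V p f x = V p' f x"
  unfolding colour_def V_def by (metis prod.inject restrict_apply)

lemma avg_L2: "f \<in> L2 M \<Longrightarrow> avg f y \<in> L2 M"
  unfolding avg_def by (intro L2_scale L2_sum V_L2) auto

lemma L2_norm_sum_V_le: "f \<in> L2 M \<Longrightarrow> (\<And>n. n \<in> I \<Longrightarrow> n \<ge> 1) \<Longrightarrow>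
    L2_norm M (\<lambda>x. \<Sum>n\<in>I. V n f x) \<le> real (card I) * L2_norm M f"
proof -
  assume f: "f \<in> L2 M" and I: "\<And>n. n \<in> I \<Longrightarrow> n \<ge> 1"
  have "L2_norm M (\<lambda>x. \<Sum>n\<in>I. V n f x) \<le> (\<Sum>n\<in>I. L2_norm M (V n f))"
    using f I by (intro L2_norm_sum_le V_L2) auto
  also have "\<dots> \<le> (\<Sum>n\<in>I. L2_norm M f)" using f I by (intro sum_mono V_norm_le) auto
  finally show ?thesis by simp
qed

lemma avg_norm_le: "f \<in> L2 M \<Longrightarrow> y > 0 \<Longrightarrow> L2_norm M (avg f y) \<le> L2_norm M f"
proof -
  assume f: "f \<in> L2 M" and y: "y > 0"
  have "L2_norm M (avg f y) = 1 / y * L2_norm M (\<lambda>x. \<Sum>n=1..nat \<lfloor>y\<rfloor>. V n f x)"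
    unfolding avg_def[abs_def] L2_norm_scale norm_of_real using y by simp
  also have "\<dots> \<le> 1 / y * (real (nat \<lfloor>y\<rfloor>) * L2_norm M f)"
    using L2_norm_sum_V_le[OF f, of "{1..nat \<lfloor>y\<rfloor>}"] y by (intro mult_left_mono) auto
  also have "\<dots> \<le> 1 / y * (y * L2_norm M f)"
    using y by (intro mult_left_mono mult_right_mono) auto
  finally show ?thesis using y by simp
qed

lemma avg_dilate:
  assumes p: "p \<ge> 1" and y: "y > 0" and x: "x \<in> space M"
  shows "V p (avg f (y / real p)) x = of_real (real p / y) * (\<Sum>n\<in>{n\<in>{1..nat \<lfloor>y\<rfloor>}. p dvd n}. V n f x)"
proof -
  have "V p (avg f (y / real p)) x = of_real (real p / y) * (\<Sum>n=1..nat \<lfloor>y / real p\<rfloor>. V p (V n f) x)"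
    unfolding V_def avg_def using p y by (simp add: sum_distrib_left mult_ac)
  also have "(\<Sum>n=1..nat \<lfloor>y / real p\<rfloor>. V p (V n f) x) = (\<Sum>n=1..nat \<lfloor>y\<rfloor> div p. V (p * n) f x)"
    using p y x by (intro sum.cong V_V) (auto simp: nat_floor_divide)
  also have "\<dots> = (\<Sum>n\<in>{n\<in>{1..nat \<lfloor>y\<rfloor>}. p dvd n}. V n f x)"
    unfolding multiples_eq_image[OF p] using p by (subst sum.reindex) (auto intro!: inj_onI)
  finally show ?thesis .
qed

text \<open>The dual inequality is applied at each point x to the sequence \<open>V n f x\<close>
  and integrated. By \<open>avg_dilate\<close> the sum over the multiples of p is the average at y /
  p moved by \<open>V p\<close>.\<close>

lemma avg_turan_kubilius:
  assumes f: "f \<in> L2 M" and P: "finite P" "\<And>p. p \<in> P \<Longrightarrow> prime p" and y: "y \<ge> real (\<Sum>P)" "y > 0"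
  shows "(\<Sum>p\<in>P. (L2_norm M (\<lambda>x. V p (avg f (y / real p)) x - avg f y x))\<^sup>2 / real p) \<le> 2 * (L2_norm M f)\<^sup>2"
proof -
  define N where "N = nat \<lfloor>y\<rfloor>"
  have N: "real N \<le> y" using y by (simp add: N_def)
  have p1: "p \<ge> 1" if "p \<in> P" for p using P(2)[OF that] prime_gt_0_nat[of p] by simp
  have dL: "(\<lambda>x. V p (avg f (y / real p)) x - avg f y x) \<in> L2 M" if "p \<in> P" for p
    using f p1[OF that] by (intro L2_diff V_L2 avg_L2) auto
  have "(\<Sum>p\<in>P. (L2_norm M (\<lambda>x. V p (avg f (y / real p)) x - avg f y x))\<^sup>2 / real p)
      = (LINT x|M. (\<Sum>p\<in>P. (norm (V p (avg f (y / real p)) x - avg f y x))\<^sup>2 / real p))"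
    unfolding L2_norm_square using L2_integrable[OF dL] by (subst Bochner_Integration.integral_sum) auto
  also have "\<dots> \<le> (LINT x|M. 2 / y * (\<Sum>n=1..N. (norm (V n f x))\<^sup>2))"
  proof (rule integral_mono)
    show "integrable M (\<lambda>x. \<Sum>p\<in>P. (norm (V p (avg f (y / real p)) x - avg f y x))\<^sup>2 / real p)"
      using L2_integrable[OF dL] by (intro Bochner_Integration.integrable_sum integrable_divide) auto
    show "integrable M (\<lambda>x. 2 / y * (\<Sum>n=1..N. (norm (V n f x))\<^sup>2))"
      using L2_integrable[OF V_L2[OF _ f]]
      by (intro integrable_mult_right Bochner_Integration.integrable_sum) auto
    fix x assume x: "x \<in> space M"
    have "(\<Sum>p\<in>P. (norm (V p (avg f (y / real p)) x - avg f y x))\<^sup>2 / real p)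
      = (\<Sum>p\<in>P. (norm (of_real (real p / y) * (\<Sum>n\<in>{n\<in>{1..N}. p dvd n}. V n f x)
            - of_real (1 / y) * (\<Sum>n=1..N. V n f x)))\<^sup>2 / real p)"
      using y by (intro sum.cong refl) (simp only: avg_dilate[OF p1 y(2) x] avg_def N_def)
    also have "\<dots> \<le> 2 / y * (\<Sum>n=1..N. (norm (V n f x))\<^sup>2)"
      by (rule dual_turan_kubilius[OF P y N])
    finally show "(\<Sum>p\<in>P. (norm (V p (avg f (y / real p)) x - avg f y x))\<^sup>2 / real p)
        \<le> 2 / y * (\<Sum>n=1..N. (norm (V n f x))\<^sup>2)" .
  qed
  also have "\<dots> = 2 / y * (\<Sum>n=1..N. (L2_norm M (V n f))\<^sup>2)"
    unfolding L2_norm_square using L2_integrable[OF V_L2[OF _ f]]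
    by (subst integral_mult_right_zero, subst Bochner_Integration.integral_sum) auto
  also have "\<dots> \<le> 2 / y * (\<Sum>n=1..N. (L2_norm M f)\<^sup>2)"
    using y f by (intro mult_left_mono sum_mono power_mono V_norm_le) auto
  also have "\<dots> \<le> 2 / y * (y * (L2_norm M f)\<^sup>2)"
    using y N by (intro mult_left_mono) (auto intro!: mult_right_mono)
  finally show ?thesis using y by simp
qed

text \<open>The change of normalisation contributes (y' - y) / y', and the new terms contribute (y'
  - y + 1) / y', the 1 coming from rounding.\<close>

lemma avg_lipschitz:
  assumes f: "f \<in> L2 M" "L2_norm M f \<le> 1" and y: "0 < y" "y \<le> y'"
  shows "L2_norm M (\<lambda>x. avg f y' x - avg f y x) \<le> (2 * (y' - y) + 1) / y'"
proof -
  define N N' where "N = nat \<lfloor>y\<rfloor>" and "N' = nat \<lfloor>y'\<rfloor>"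
  have NN: "N \<le> N'" unfolding N_def N'_def using y by (intro nat_mono floor_mono) auto
  have N: "real N \<le> y" "y < real N + 1" "real N' \<le> y'" "y' < real N' + 1"
    unfolding N_def N'_def using y by linarith+
  have un: "{1..N'} = {1..N} \<union> {N<..N'}" using NN by auto
  have "avg f y' x - avg f y x = of_real (1 / y' - 1 / y) * (\<Sum>n=1..N. V n f x) + of_real (1 / y') * (\<Sum>n\<in>{N<..N'}. V n f x)" for x
  proof -
    have "(\<Sum>n=1..N'. V n f x) = (\<Sum>n=1..N. V n f x) + (\<Sum>n\<in>{N<..N'}. V n f x)"
      unfolding un by (intro sum.union_disjoint) auto
    then show ?thesis unfolding avg_def N_def[symmetric] N'_def[symmetric]
      by (simp add: algebra_simps)
  qed
  then have "L2_norm M (\<lambda>x. avg f y' x - avg f y x)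
      = L2_norm M (\<lambda>x. of_real (1 / y' - 1 / y) * (\<Sum>n=1..N. V n f x) + of_real (1 / y') * (\<Sum>n\<in>{N<..N'}. V n f x))" by simp
  also have "\<dots> \<le> L2_norm M (\<lambda>x. of_real (1 / y' - 1 / y) * (\<Sum>n=1..N. V n f x)) + L2_norm M (\<lambda>x. of_real (1 / y') * (\<Sum>n\<in>{N<..N'}. V n f x))"
    using f by (intro L2_norm_triangle L2_scale L2_sum V_L2) auto
  also have "\<dots> = \<bar>1 / y' - 1 / y\<bar> * L2_norm M (\<lambda>x. \<Sum>n=1..N. V n f x) + 1 / y' * L2_norm M (\<lambda>x. \<Sum>n\<in>{N<..N'}. V n f x)"
    unfolding L2_norm_scale norm_of_real using y by simp
  also have "\<dots> \<le> \<bar>1 / y' - 1 / y\<bar> * (y * 1) + 1 / y' * ((y' - y + 1) * 1)"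
  proof (intro add_mono mult_left_mono)
    have "L2_norm M (\<lambda>x. \<Sum>n=1..N. V n f x) \<le> real (card {1..N}) * L2_norm M f"
      by (rule L2_norm_sum_V_le[OF f(1)]) auto
    also have "\<dots> \<le> y * 1" using N f y by (intro mult_mono) auto
    finally show "L2_norm M (\<lambda>x. \<Sum>n=1..N. V n f x) \<le> y * 1" .
    have "L2_norm M (\<lambda>x. \<Sum>n\<in>{N<..N'}. V n f x) \<le> real (card {N<..N'}) * L2_norm M f"
      by (rule L2_norm_sum_V_le[OF f(1)]) auto
    also have "\<dots> \<le> (y' - y + 1) * 1" using N f y NN by (intro mult_mono) auto
    finally show "L2_norm M (\<lambda>x. \<Sum>n\<in>{N<..N'}. V n f x) \<le> (y' - y + 1) * 1" .
  qed (use y in auto)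
  also have "\<dots> = (2 * (y' - y) + 1) / y'"
  proof -
    have a: "\<bar>1 / y' - 1 / y\<bar> = 1 / y - 1 / y'" using y by (simp add: field_simps)
    show ?thesis unfolding a using y by (simp add: field_simps)
  qed
  finally show ?thesis .
qed

end

lemma sum_UN_le:
  fixes f :: "'b \<Rightarrow> real"
  assumes "finite I" "\<And>i. i \<in> I \<Longrightarrow> finite (A i)" "\<And>x. f x \<ge> 0"
  shows "sum f (\<Union>i\<in>I. A i) \<le> (\<Sum>i\<in>I. sum f (A i))"
  using assms(1,2)
proof (induction I rule: finite_induct)
  case (insert i I)
  have "sum f (A i \<union> (\<Union>i\<in>I. A i)) \<le> sum f (A i) + sum f (\<Union>i\<in>I. A i)"
    using insert assms(3) by (subst sum.union_inter[symmetric]) (auto intro!: sum_nonneg)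
  then show ?case using insert by auto
qed simp

context twisted_action
begin

lemma V_isometry:
  assumes "prime p" "\<theta> p \<noteq> 0" "f \<in> L2 M" "g \<in> L2 M"
  shows "L2_norm M (\<lambda>x. V p f x - V p g x) = L2_norm M (\<lambda>x. f x - g x)"
  using V_norm[OF _ L2_diff[OF assms(3,4)], of p] assms twist_prime[of p] prime_ge_1_nat[of p]
  by (simp add: V_diff)

text \<open>For most primes \<open>p\<close> the dual Turan--Kubilius inequality gives \<open>V p (avg g (y / p)) \<approx> avg g y\<close>. Two
  primes \<open>p\<close>, \<open>p'\<close> of the same colour have \<open>V p = V p'\<close>, whence \<open>avg g s \<approx> avg g (s / r)\<close> for \<open>r = p' / p\<close>.
  If \<open>r\<close> is close to 1, iterating this links \<open>avg g t\<close> to \<open>avg g (t / q)\<close> for a prime \<open>q\<close> of the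
  colour of \<open>p0\<close>, and then \<open>V p0 (avg g t) = V q (avg g t) \<approx> V q (avg g (t / q)) \<approx> avg g t\<close>.\<close>

lemma asymptotic_invariance_unit:
  assumes g: "g \<in> L2 M" "L2_norm M g \<le> 1"
    and p0: "prime p0" "\<theta> p0 \<noteq> 0"
    and large: "\<not> (\<lambda>p. 1 / real p) summable_on {p. prime p \<and> colour p = colour p0}"
    and \<epsilon>: "0 < \<epsilon>" "\<epsilon> \<le> 1"
  shows "\<forall>\<^sub>F y in at_top. L2_norm M (\<lambda>x. V p0 (avg g y) x - avg g y x) \<le> \<epsilon>"
proof -
  define A where "A = avg g"
  define d where "d = (\<lambda>s t. L2_norm M (\<lambda>x. A s x - A t x))"
  define e where "e = (\<lambda>p z. L2_norm M (\<lambda>x. V p (A (z / real p)) x - A z x))"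
  have AL: "A y \<in> L2 M" for y unfolding A_def using g(1) by (rule avg_L2)
  have d_refl: "d s s = 0" for s by (simp add: d_def L2_norm_zero)
  have d_tri: "d s u \<le> d s t + d t u" for s t u unfolding d_def by (intro L2_norm_dist_triangle AL)
  have d_lip: "d t s \<le> (2 * (t - s) + 1) / t" if "0 < s" "s \<le> t" for s t
    unfolding d_def A_def using avg_lipschitz[OF g that] .
  have d_comm: "d s t = d t s" for s t unfolding d_def by (rule L2_norm_commute)
  have p1: "p \<ge> 1" if "prime p" for p :: nat using prime_gt_0_nat[OF that] by simp

  \<comment> \<open>The mass 32 / \<epsilon>^2 is chosen so that errors above \<epsilon> / 4 at all
    q in \<open>Q\<close> would violate the bound 2 of \<open>avg_turan_kubilius\<close>.\<close>
  have "1 / real p \<ge> 0" for p by simp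
  then obtain Q where Q: "finite Q" "Q \<subseteq> {p. prime p \<and> colour p = colour p0}"
    and Qsum: "(\<Sum>q\<in>Q. 1 / real q) \<ge> 32 / \<epsilon>\<^sup>2"
    by (rule not_summable_on_nonneg_large[OF large])
  have Qne: "Q \<noteq> {}"
  proof
    assume "Q = {}"
    then have "32 / \<epsilon>\<^sup>2 \<le> 0" using Qsum by simp
    then show False using \<epsilon> by (simp add: divide_le_0_iff)
  qed
  have Qp: "prime q" "colour q = colour p0" if "q \<in> Q" for q using Q(2) that by auto
  define B where "B = real (Max Q)"
  have QB: "real q \<le> B" if "q \<in> Q" for q unfolding B_def using Q(1) that by simp
  have B: "B \<ge> 1" 
  proof -
    obtain q where "q \<in> Q" using Qne by blast
    then show ?thesis using QB[of q] p1[OF Qp(1), of q] by simp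
  qed

  define k where "k = card (colour ` {p. prime p})"
  have finc: "finite (colour ` {p. prime p})" using finite_colours by (simp add: colour_def[abs_def])
  have k: "k \<ge> 1" unfolding k_def using finc p0 by (auto simp: Suc_le_eq card_gt_0_iff)
  \<comment> \<open>The pair will satisfy ln r <= 100 k \<eta>, so the incomplete last step of
    \<open>ratio_chain\<close> costs 2 ln r <= \<epsilon> / 8.\<close>
  define \<eta> where "\<eta> = \<epsilon> / (1600 * real k)"
  have \<eta>: "0 < \<eta>" "\<eta> \<le> 1" unfolding \<eta>_def using \<epsilon> k by (auto simp: divide_le_eq)
  define W where "W = ln B"
  have W: "W \<ge> 0" using B by (simp add: W_def)
  \<comment> \<open>Since ln r >= \<eta>, the chain from t to t / q has at most W / \<eta> steps; an
    error \<xi> in each adds up to at most \<epsilon> / 16.\<close>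
  define \<xi> where "\<xi> = \<epsilon> * \<eta> / (16 * (W + 1))"
  have \<xi>: "\<xi> > 0" unfolding \<xi>_def using \<epsilon> \<eta> W by simp
  have "\<epsilon> * \<eta> \<le> \<epsilon> * 1" using \<epsilon> \<eta> by (intro mult_left_mono) auto
  also have "\<epsilon> * 1 \<le> \<epsilon> * (W + 1)" using \<epsilon> W by (intro mult_left_mono) auto
  finally have \<xi>\<epsilon>: "\<xi> \<le> \<epsilon> / 16" unfolding \<xi>_def using W by (simp add: field_simps)
  \<comment> \<open>\<kappa> is the error allowed to a good prime, \<delta> the logarithmic mesh of
    a finite net of scales. One step costs 6 \<delta> + 2 \<kappa>, which is below \<xi>.\<close>
  define \<kappa> \<delta> where "\<kappa> = \<xi> / 8" and "\<delta> = \<xi> / 16"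
  have \<kappa>: "\<kappa> > 0" and \<delta>: "\<delta> > 0" using \<xi> by (auto simp: \<kappa>_def \<delta>_def)
  \<comment> \<open>With m steps of length \<delta> the net descends from y at least to y /
    B.\<close>
  obtain m :: nat where "real m > W / \<delta>" using reals_Archimedean2 by blast
  then have m: "real m * \<delta> \<ge> W" using \<delta> by (simp add: divide_less_eq)
  define Z where "Z = {p. prime p \<and> \<theta> p = 0}"
  have finZ: "finite Z" using finite_zeros by (simp add: Z_def)
  \<comment> \<open>Budget for the primes with error above \<kappa> at one of the m + 1 scales, plus
    the zeros of \<theta>. It does not depend on y, although the exceptional set \<open>Bd\<close>
    below does, so \<open>Y\<close> is fixed before y.\<close>
  define K where "K = real (m + 1) * (2 / \<kappa>\<^sup>2) + (\<Sum>p\<in>Z. 1 / real p)"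
  obtain Y :: nat where Y: "\<And>(col :: nat \<Rightarrow> ('a \<Rightarrow> 'a) \<times> complex) Bd. finite (col ` {p. prime p}) \<Longrightarrow> card (col ` {p. prime p}) \<le> k \<Longrightarrow>
       (\<Sum>p | prime p \<and> p \<in> Bd \<and> p \<le> Y. 1 / real p) \<le> K \<Longrightarrow>
       \<exists>p p'. prime p \<and> prime p' \<and> p \<notin> Bd \<and> p' \<notin> Bd \<and> p \<le> Y \<and> p' \<le> Y \<and> col p = col p' \<and>
         \<eta> \<le> ln (real p') - ln (real p) \<and> ln (real p') - ln (real p) \<le> 100 * real k * \<eta>"
    using monochromatic_prime_pair[OF \<eta> k, of K] by blast
  define P where "P = {p. prime p \<and> p \<le> Y}"
  have P: "finite P" "\<And>p. p \<in> P \<Longrightarrow> prime p" by (auto simp: P_def)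

  \<comment> \<open>The three thresholds ensure, in turn: Turan-Kubilius at every scale of the net
    with rounding terms below \<delta>; Turan-Kubilius for \<open>Q\<close> at the scale t; and q /
    t <= \<epsilon> / 32.\<close>
  have "\<forall>\<^sub>F y in at_top. y \<ge> exp (real m * \<delta>) * (real (\<Sum>P) + real Y / \<delta> + 1)"
    by (rule eventually_ge_at_top)
  moreover have "\<forall>\<^sub>F y in at_top. y \<ge> real Y * (real (\<Sum>Q) + 1)" by (rule eventually_ge_at_top)
  moreover have "\<forall>\<^sub>F y in at_top. y \<ge> 32 * B * real Y / \<epsilon>" by (rule eventually_ge_at_top)
  moreover have "\<forall>\<^sub>F y in at_top. y > (0::real)" by (rule eventually_gt_at_top)
  ultimately show ?thesis
  proof eventually_elim
    case (elim y)
    define z where "z = (\<lambda>j::nat. y * exp (- real j * \<delta>))"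
    have z: "z j \<ge> real (\<Sum>P) + real Y / \<delta> + 1" "z j > 0" if "j \<le> m" for j
    proof -
      have "exp (real j * \<delta>) \<le> exp (real m * \<delta>)" using that \<delta> by simp
      then have "exp (real j * \<delta>) * (real (\<Sum>P) + real Y / \<delta> + 1) \<le> y"
        using elim(1) \<delta>
        by (intro order_trans[OF mult_right_mono elim(1)]) (auto intro!: add_nonneg_nonneg sum_nonneg)
      then show "z j \<ge> real (\<Sum>P) + real Y / \<delta> + 1" by (simp add: z_def exp_minus field_simps)
      show "z j > 0" using elim by (simp add: z_def)
    qed
    have zP: "z j \<ge> real (\<Sum>P)" "\<delta> * z j \<ge> real Y" if "j \<le> m" for j
    proof -
      have "0 \<le> real Y / \<delta>" "0 \<le> real (\<Sum>P)" using \<delta> by (auto simp del: of_nat_sum)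
      then have "z j \<ge> real (\<Sum>P)" "z j \<ge> real Y / \<delta>" using z(1)[OF that] by linarith+
      then show "z j \<ge> real (\<Sum>P)" "\<delta> * z j \<ge> real Y" using \<delta> by (auto simp: divide_le_eq mult.commute)
    qed
    define Bd where "Bd = {p\<in>P. \<exists>j\<le>m. e p (z j) > \<kappa>} \<union> Z"
    have inv0: "(\<Sum>p\<in>F. 1 / real p) \<ge> 0" for F :: "nat set" by (intro sum_nonneg) auto
    have "(\<Sum>p | prime p \<and> p \<in> Bd \<and> p \<le> Y. 1 / real p) \<le> (\<Sum>p\<in>(\<Union>j\<in>{..m}. {p\<in>P. e p (z j) > \<kappa>}) \<union> Z. 1 / real p)"
      using P(1) finZ by (intro sum_mono2) (auto simp: Bd_def P_def)
    also have "\<dots> \<le> (\<Sum>p\<in>(\<Union>j\<in>{..m}. {p\<in>P. e p (z j) > \<kappa>}). 1 / real p) + (\<Sum>p\<in>Z. 1 / real p)"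
      using P(1) finZ inv0 by (subst sum.union_inter[symmetric]) auto
    also have "(\<Sum>p\<in>(\<Union>j\<in>{..m}. {p\<in>P. e p (z j) > \<kappa>}). 1 / real p) \<le> (\<Sum>j\<in>{..m}. \<Sum>p\<in>{p\<in>P. e p (z j) > \<kappa>}. 1 / real p)"
      using P(1) by (intro sum_UN_le) auto
    also have "\<dots> \<le> (\<Sum>j\<in>{..m}. 2 / \<kappa>\<^sup>2)"
    proof (intro sum_mono)
      fix j assume j: "j \<in> {..m}"
      have "\<kappa>\<^sup>2 * (\<Sum>p\<in>{p\<in>P. e p (z j) > \<kappa>}. 1 / real p) \<le> (\<Sum>p\<in>{p\<in>P. e p (z j) > \<kappa>}. (e p (z j))\<^sup>2 / real p)"
        unfolding sum_distrib_left using \<kappa> by (intro sum_mono) (auto intro!: divide_right_mono power_mono)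
      also have "\<dots> \<le> (\<Sum>p\<in>P. (e p (z j))\<^sup>2 / real p)" using P(1) by (intro sum_mono2) auto
      also have "\<dots> \<le> 2 * (L2_norm M g)\<^sup>2"
        unfolding e_def A_def using zP(1)[of j] z(2)[of j] j by (intro avg_turan_kubilius g P) auto
      also have "\<dots> \<le> 2" using g(2) by (simp add: power_le_one)
      finally show "(\<Sum>p\<in>{p\<in>P. e p (z j) > \<kappa>}. 1 / real p) \<le> 2 / \<kappa>\<^sup>2"
        using \<kappa> by (simp add: field_simps)
    qed
    finally have "(\<Sum>p | prime p \<and> p \<in> Bd \<and> p \<le> Y. 1 / real p) \<le> K" by (simp add: K_def)
    from Y[OF finc _ this] obtain p p' where pp: "prime p" "prime p'" "p \<notin> Bd" "p' \<notin> Bd" "p \<le> Y" "p' \<le> Y"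
      "colour p = colour p'" "\<eta> \<le> ln (real p') - ln (real p)" "ln (real p') - ln (real p) \<le> 100 * real k * \<eta>"
      unfolding k_def by blast
    have pos: "real p > 0" "real p' > 0" using pp(1,2) prime_gt_0_nat by auto
    have nz: "\<theta> p \<noteq> 0" "\<theta> p' \<noteq> 0" using pp by (auto simp: Bd_def Z_def)
    have ep: "e p (z j) \<le> \<kappa>" "e p' (z j) \<le> \<kappa>" if "j \<le> m" for j
      using pp that by (auto simp: Bd_def P_def not_less)
    define r where "r = real p' / real p"
    have lnr: "ln r = ln (real p') - ln (real p)" unfolding r_def using pos by (subst ln_divide_pos) auto
    have r: "r > 1"
    proof -
      have "r > 0" using pos by (simp add: r_def)
      moreover have "ln r > 0" using lnr pp(8) \<eta> by simp
      ultimately show ?thesis by (simp add: ln_gt_zero_iff)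
    qed
    define t where "t = y / real p"
    have t: "t > 0" using elim pos by (simp add: t_def)
    have yB: "y / B \<ge> z m"
    proof -
      have "z m \<le> y * exp (- W)" unfolding z_def using m elim by simp
      then show ?thesis using B by (simp add: W_def exp_minus divide_inverse)
    qed
    have step: "d s (s / r) \<le> \<xi>" if s: "t / B \<le> s" "s \<le> t" for s
    proof -
      define v where "v = s * real p"
      have v: "z m \<le> v" "v \<le> y" "v > 0"
      proof -
        have "t / B * real p = y / B" unfolding t_def using pos B by simp
        moreover have "t / B * real p \<le> s * real p" using s(1) by (rule mult_right_mono) simp
        ultimately show "z m \<le> v" using yB unfolding v_def by linarith
        then show "v > 0" using z(2)[of m] by simp
        show "v \<le> y" using s(2) pos unfolding v_def t_def by (simp add: field_simps)
      qed
      \<comment> \<open>The net point just above v: v <= z j <= exp \<delta> * v. The primes p and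
        p' are known to be good only at net scales, so v is compared with z j by the Lipschitz
        bound.\<close>
      define j where "j = nat \<lfloor>ln (y / v) / \<delta>\<rfloor>"
      have l0: "ln (y / v) / \<delta> \<ge> 0" using v \<delta> by simp
      have j: "real j \<le> ln (y / v) / \<delta>" "ln (y / v) / \<delta> < real j + 1" unfolding j_def using l0 by linarith+
      have yv: "exp (ln (y / v)) = y / v" using v elim by simp
      have "exp (real j * \<delta>) \<le> exp (ln (y / v))" using j(1) \<delta> by (simp add: field_simps)
      then have vz: "v \<le> z j" unfolding yv z_def using v by (simp add: exp_minus field_simps)
      have "exp (ln (y / v)) \<le> exp ((real j + 1) * \<delta>)" using j(2) \<delta> by (simp add: field_simps)
      then have zv: "z j * exp (- \<delta>) \<le> v" unfolding yv z_def using v by (simp add: exp_minus exp_add field_simps)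
      have jm: "j \<le> m"
      proof -
        have "y * exp (- real m * \<delta>) \<le> v" using v(1) by (simp add: z_def)
        then have "y / v \<le> exp (real m * \<delta>)" using v by (simp add: exp_minus field_simps)
        then have "exp (real j * \<delta>) \<le> exp (real m * \<delta>)" using \<open>exp (real j * \<delta>) \<le> exp (ln (y / v))\<close> yv by linarith
        then show ?thesis using \<delta> by simp
      qed
      have zj: "z j > 0" by (rule z(2)[OF jm])
      have near: "d (z j / real a) (v / real a) \<le> 3 * \<delta>" if a: "real a > 0" "a \<le> Y" for a
      proof -
        have "d (z j / real a) (v / real a) \<le> (2 * (z j / real a - v / real a) + 1) / (z j / real a)"
          using v vz a by (intro d_lip) (auto intro: divide_right_mono)
        also have "\<dots> = 2 * (1 - v / z j) + real a / z j" using a zj by (simp add: field_simps)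
        also have "1 - v / z j \<le> \<delta>"
        proof -
          have "exp (- \<delta>) \<le> v / z j" using zv zj by (simp add: field_simps)
          moreover have "1 - \<delta> \<le> exp (- \<delta>)" using exp_ge_add_one_self[of "- \<delta>"] by simp
          ultimately show ?thesis by simp
        qed
        also have "real a / z j \<le> \<delta>"
        proof -
          have "real a \<le> \<delta> * z j" using zP(2)[OF jm] a(2) by linarith
          then show ?thesis using zj by (simp add: divide_le_eq)
        qed
        finally show ?thesis by simp
      qed
      have "d (z j / real p) (z j / real p') = L2_norm M (\<lambda>x. V p (A (z j / real p)) x - V p (A (z j / real p')) x)"
        unfolding d_def by (rule V_isometry[symmetric, OF pp(1) nz(1) AL AL])
      also have "\<dots> = L2_norm M (\<lambda>x. V p (A (z j / real p)) x - V p' (A (z j / real p')) x)"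
        by (rule L2_norm_cong) (simp add: V_colour[OF pp(7)])
      also have "\<dots> \<le> e p (z j) + L2_norm M (\<lambda>x. A (z j) x - V p' (A (z j / real p')) x)"
        unfolding e_def using p1 pp by (intro L2_norm_dist_triangle V_L2 AL) auto
      also have "L2_norm M (\<lambda>x. A (z j) x - V p' (A (z j / real p')) x) = e p' (z j)"
        unfolding e_def by (rule L2_norm_commute)
      finally have same: "d (z j / real p) (z j / real p') \<le> 2 * \<kappa>" using ep[OF jm] by simp
      have "d (v / real p) (v / real p') \<le> d (v / real p) (z j / real p) + d (z j / real p) (v / real p')" by (rule d_tri)
      moreover have "d (z j / real p) (v / real p') \<le> d (z j / real p) (z j / real p') + d (z j / real p') (v / real p')" by (rule d_tri)
      ultimately have "d (v / real p) (v / real p') \<le> 3 * \<delta> + 2 * \<kappa> + 3 * \<delta>"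
        using near[OF pos(1) pp(5)] near[OF pos(2) pp(6)] same d_comm[of "v / real p" "z j / real p"] by linarith
      also have "\<dots> \<le> \<xi>" using \<xi> by (simp add: \<delta>_def \<kappa>_def)
      finally show ?thesis unfolding v_def r_def using pos by (simp add: field_simps)
    qed
    have chain: "d t (t / real q) \<le> \<epsilon> / 4" if q: "q \<in> Q" for q
    proof -
      have q1: "real q \<ge> 1" using p1[OF Qp(1)[OF q]] by simp
      have "t / B \<le> t / real q" using QB[OF q] q1 t B by (intro divide_left_mono) auto
      then have "d t (t / real q) \<le> ln (real q) / ln r * \<xi> + 2 * ln r + real q / t"
        using q1 r t \<xi> d_lip d_tri d_refl step by (intro ratio_chain) auto
      also have "ln (real q) / ln r * \<xi> \<le> \<epsilon> / 16"
      proof -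
        have "ln (real q) / ln r \<le> W / \<eta>"
          unfolding W_def using QB[OF q] q1 B \<eta> pp(8) lnr by (intro frac_le) auto
        then have "ln (real q) / ln r * \<xi> \<le> W / \<eta> * \<xi>" using \<xi> by (intro mult_right_mono) auto
        also have "\<dots> = \<epsilon> / 16 * (W / (W + 1))" unfolding \<xi>_def using \<eta> W by (simp add: field_simps)
        also have "\<dots> \<le> \<epsilon> / 16 * 1" using \<epsilon> W by (intro mult_left_mono) auto
        finally show ?thesis by simp
      qed
      also have "2 * ln r \<le> \<epsilon> / 8" using pp(9) k unfolding lnr \<eta>_def by (simp add: field_simps)
      also have "real q / t \<le> \<epsilon> / 32"
      proof -
        have "32 * (real q * real p) \<le> 32 * (B * real Y)"
          using QB[OF q] pp(5) B by (intro mult_left_mono mult_mono) auto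
        also have "\<dots> \<le> \<epsilon> * y" using elim(3) \<epsilon> by (simp add: field_simps)
        finally show ?thesis unfolding t_def using elim(4) pos by (simp add: field_simps)
      qed
      finally show ?thesis using \<epsilon> by simp
    qed
    have tQ: "t \<ge> real (\<Sum>Q)"
    proof -
      have "real (\<Sum>Q) * real p \<le> (real (\<Sum>Q) + 1) * real Y"
        using pp(5) by (intro mult_mono) (auto simp del: of_nat_sum)
      then show ?thesis unfolding t_def using elim(2) pos by (simp add: field_simps del: of_nat_sum)
    qed
    have "\<exists>q\<in>Q. (e q t)\<^sup>2 \<le> (\<epsilon> / 4)\<^sup>2"
    proof (rule ccontr)
      assume "\<not> ?thesis"
      then have *: "(e q t)\<^sup>2 > (\<epsilon> / 4)\<^sup>2" if "q \<in> Q" for q using that by force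
      have "2 \<le> (\<epsilon> / 4)\<^sup>2 * (32 / \<epsilon>\<^sup>2)" using \<epsilon> by (simp add: power2_eq_square field_simps)
      also have "\<dots> \<le> (\<epsilon> / 4)\<^sup>2 * (\<Sum>q\<in>Q. 1 / real q)" using Qsum by (intro mult_left_mono) auto
      also have "\<dots> = (\<Sum>q\<in>Q. (\<epsilon> / 4)\<^sup>2 / real q)" by (simp add: sum_distrib_left)
      also have "\<dots> < (\<Sum>q\<in>Q. (e q t)\<^sup>2 / real q)"
        using Q(1) Qne *  prime_gt_0_nat[OF Qp(1)] by (intro sum_strict_mono divide_strict_right_mono) auto
      also have "\<dots> \<le> 2 * (L2_norm M g)\<^sup>2"
        unfolding e_def A_def using tQ t Qp(1) by (intro avg_turan_kubilius g Q(1)) auto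
      also have "\<dots> \<le> 2" using g(2) by (simp add: power_le_one)
      finally show False by simp
    qed
    then obtain q where q: "q \<in> Q" "e q t \<le> \<epsilon> / 4" using \<epsilon> by (auto dest: power2_le_imp_le)
    have q1: "q \<ge> 1" "p0 \<ge> 1" "p \<ge> 1" using p1 Qp(1)[OF q(1)] p0 pp by auto
    have cq: "colour q = colour p0" by (rule Qp(2)[OF q(1)])
    have "L2_norm M (\<lambda>x. V q (A t) x - A t x) \<le> L2_norm M (\<lambda>x. V q (A t) x - V q (A (t / real q)) x) + e q t"
      unfolding e_def using q1 by (intro L2_norm_dist_triangle V_L2 AL) auto
    also have "L2_norm M (\<lambda>x. V q (A t) x - V q (A (t / real q)) x) \<le> d t (t / real q)"
      unfolding d_def using V_norm_le[OF q1(1) L2_diff[OF AL AL]] by (simp add: V_diff)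
    finally have "L2_norm M (\<lambda>x. V q (A t) x - A t x) \<le> \<epsilon> / 2" using chain[OF q(1)] q(2) by simp
    moreover have "L2_norm M (\<lambda>x. V q (A t) x - A t x) = L2_norm M (\<lambda>x. V p0 (A t) x - A t x)"
      by (rule L2_norm_cong) (simp add: V_colour[OF cq])
    ultimately have inv_t: "L2_norm M (\<lambda>x. V p0 (A t) x - A t x) \<le> \<epsilon> / 2" by simp
    \<comment> \<open>As z 0 = y, the prime p is also good at y. It carries the invariance from t =
      y / p back to y, because \<open>V p\<close> commutes with \<open>V p0\<close>.\<close>
    have "e p y \<le> \<kappa>" using ep(1)[of 0] by (simp add: z_def)
    then have ey: "L2_norm M (\<lambda>x. V p (A t) x - A y x) \<le> \<kappa>" by (simp add: e_def t_def)
    have "L2_norm M (\<lambda>x. V p0 (A y) x - A y x) \<le>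
        L2_norm M (\<lambda>x. V p0 (A y) x - V p0 (V p (A t)) x) + L2_norm M (\<lambda>x. V p0 (V p (A t)) x - A y x)"
      using q1 by (intro L2_norm_dist_triangle V_L2 AL) auto
    also have "L2_norm M (\<lambda>x. V p0 (V p (A t)) x - A y x) \<le>
        L2_norm M (\<lambda>x. V p0 (V p (A t)) x - V p (A t) x) + L2_norm M (\<lambda>x. V p (A t) x - A y x)"
      using q1 by (intro L2_norm_dist_triangle V_L2 AL) auto
    also have "L2_norm M (\<lambda>x. V p0 (A y) x - V p0 (V p (A t)) x) \<le> L2_norm M (\<lambda>x. A y x - V p (A t) x)"
      using V_norm_le[OF q1(2) L2_diff[OF AL V_L2[OF q1(3) AL]]] by (simp add: V_diff)
    also have "L2_norm M (\<lambda>x. A y x - V p (A t) x) = L2_norm M (\<lambda>x. V p (A t) x - A y x)"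
      by (rule L2_norm_commute)
    also have "L2_norm M (\<lambda>x. V p0 (V p (A t)) x - V p (A t) x) = L2_norm M (\<lambda>x. V p (V p0 (A t)) x - V p (A t) x)"
      by (rule L2_norm_cong) (use q1 in \<open>simp add: V_V mult.commute\<close>)
    also have "\<dots> \<le> L2_norm M (\<lambda>x. V p0 (A t) x - A t x)"
      using V_norm_le[OF q1(3) L2_diff[OF V_L2[OF q1(2) AL] AL]] by (simp add: V_diff)
    finally show ?case using inv_t ey \<xi>\<epsilon> \<epsilon> unfolding A_def \<kappa>_def by linarith
  qed
qed

lemma asymptotic_invariance:
  assumes g: "g \<in> L2 M" and p0: "prime p0" "\<theta> p0 \<noteq> 0"
    and large: "\<not> (\<lambda>p. 1 / real p) summable_on {p. prime p \<and> colour p = colour p0}"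
  shows "((\<lambda>y. L2_norm M (\<lambda>x. V p0 (avg g y) x - avg g y x)) \<longlongrightarrow> 0) at_top"
proof (rule tendstoI)
  fix e :: real assume e: "e > 0"
  define c where "c = L2_norm M g + 1"
  have c: "c > 0" using L2_norm_nonneg[of M g] unfolding c_def by linarith
  define g' where "g' = (\<lambda>x. of_real (1 / c) * g x)"
  have g': "g' \<in> L2 M" "L2_norm M g' \<le> 1"
  proof -
    show "g' \<in> L2 M" unfolding g'_def using g by (rule L2_scale)
    have "L2_norm M g' = L2_norm M g / c" unfolding g'_def L2_norm_scale norm_of_real using c by simp
    then show "L2_norm M g' \<le> 1" using c by (simp add: c_def)
  qed
  have eq: "avg g y = (\<lambda>x. of_real c * avg g' y x)" for y
    unfolding avg_def g'_def V_def using c by (simp add: fun_eq_iff sum_distrib_left mult_ac)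
  have V_eq: "V p0 (\<lambda>x. of_real c * f x) = (\<lambda>x. of_real c * V p0 f x)" for f
    by (simp add: V_def fun_eq_iff)
  have "0 < min 1 (e / (2 * c))" "min 1 (e / (2 * c)) \<le> 1" using e c by auto
  from asymptotic_invariance_unit[OF g' p0 large this]
  show "\<forall>\<^sub>F y in at_top. dist (L2_norm M (\<lambda>x. V p0 (avg g y) x - avg g y x)) 0 < e"
  proof eventually_elim
    case (elim y)
    have "L2_norm M (\<lambda>x. V p0 (avg g y) x - avg g y x) = c * L2_norm M (\<lambda>x. V p0 (avg g' y) x - avg g' y x)"
      unfolding eq V_eq right_diff_distrib[symmetric] L2_norm_scale using c by simp
    also have "\<dots> \<le> c * (e / (2 * c))" using elim c by (intro mult_left_mono) auto
    also have "\<dots> < e" using c e by simp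
    finally show ?case by simp
  qed
qed

end

section \<open>Typical primes and vanishing averages\<close>

lemma summable_on_Un_real:
  fixes f :: "'b \<Rightarrow> real"
  assumes "f summable_on A" "f summable_on B"
  shows "f summable_on (A \<union> B)"
proof -
  have "f summable_on (A \<union> (B - A))"
    by (intro summable_on_Un_disjoint assms(1) summable_on_subset_banach[OF assms(2)]) auto
  then show ?thesis by simp
qed

lemma summable_on_UN_finite:
  fixes f :: "'b \<Rightarrow> real"
  assumes "finite I" "\<And>i. i \<in> I \<Longrightarrow> f summable_on A i"
  shows "f summable_on (\<Union>i\<in>I. A i)"
  using assms by (induction I rule: finite_induct) (auto intro: summable_on_Un_real)

context twisted_action
begin

text \<open>The primes to which \<open>asymptotic_invariance\<close> applies. As there are only
  finitely many colours and finitely many zeros of \<theta>, the remaining primes have a convergent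
  sum of reciprocals.\<close>

definition typical :: "nat set" where
  "typical = {p. prime p \<and> \<theta> p \<noteq> 0 \<and> \<not> (\<lambda>r. 1 / real r) summable_on {r. prime r \<and> colour r = colour p}}"

lemma summable_atypical: "(\<lambda>p. 1 / real p) summable_on ({p. prime p} - typical)"
proof -
  define C where "C = {c \<in> colour ` {p. prime p}. (\<lambda>r. 1 / real r) summable_on {r. prime r \<and> colour r = c}}"
  have finC: "finite C" using finite_colours unfolding C_def by (simp add: colour_def[abs_def])
  have "(\<lambda>p. 1 / real p) summable_on (\<Union>c\<in>C. {r. prime r \<and> colour r = c})"
    using finC by (intro summable_on_UN_finite) (auto simp: C_def)
  then have "(\<lambda>p. 1 / real p) summable_on ((\<Union>c\<in>C. {r. prime r \<and> colour r = c}) \<union> {p. prime p \<and> \<theta> p = 0})"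
    by (rule summable_on_Un_real[OF _ summable_on_finite[OF finite_zeros]])
  then show ?thesis
    by (rule summable_on_subset_banach) (auto simp: typical_def C_def)
qed

text \<open>By asymptotic invariance all elements of the hull have asymptotically the same averages as \<open>G\<close>, while a
  minimising sequence in the hull converges to an invariant function.\<close>

inductive_set orbit_hull :: "('a \<Rightarrow> complex) \<Rightarrow> ('a \<Rightarrow> complex) set" for G where
  base: "G \<in> orbit_hull G"
| step: "f \<in> orbit_hull G \<Longrightarrow> p \<in> typical \<Longrightarrow> V p f \<in> orbit_hull G"
| mid: "f \<in> orbit_hull G \<Longrightarrow> g \<in> orbit_hull G \<Longrightarrow> (\<lambda>x. (f x + g x) / 2) \<in> orbit_hull G"

lemma typical_ge_1: "p \<in> typical \<Longrightarrow> p \<ge> 1"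
  using prime_gt_0_nat[of p] by (auto simp: typical_def)

lemma L2_mid: "f \<in> L2 N \<Longrightarrow> g \<in> L2 N \<Longrightarrow> (\<lambda>x. (f x + g x) / 2) \<in> L2 N"
  using L2_scale[OF L2_add, of f N g "1/2"] by simp

lemma hull_L2: "f \<in> orbit_hull G \<Longrightarrow> G \<in> L2 M \<Longrightarrow> f \<in> L2 M"
  by (induction rule: orbit_hull.induct) (auto intro: V_L2 L2_mid typical_ge_1)

lemma integral_V:
  assumes "f \<in> L2 M" "n \<ge> 1"
  shows "(LINT x|M. V n f x) = \<theta> n * (LINT x|M. f x)"
proof -
  have T: "S n \<in> M \<rightarrow>\<^sub>M M" "distr M M (S n) = M"
    using S_imp[OF assms(2)] by (auto simp: invertible_measure_preserving_def)
  have "(LINT x|distr M M (S n). f x) = (LINT x|M. f (S n x))"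
    using assms(1) by (intro integral_distr T) auto
  then show ?thesis by (simp add: V_def T)
qed

lemma hull_integral_zero: "f \<in> orbit_hull G \<Longrightarrow> G \<in> L2 M \<Longrightarrow> (LINT x|M. G x) = 0 \<Longrightarrow> (LINT x|M. f x) = 0"
proof (induction rule: orbit_hull.induct)
  case (mid f g)
  then show ?case
    using L2_integrable1[OF hull_L2[OF mid(1)]] L2_integrable1[OF hull_L2[OF mid(2)]] by simp
next
  case (step f p)
  then show ?case using integral_V[OF hull_L2[OF step(1) step.prems(1)] typical_ge_1[OF step(2)]] by simp
qed

lemma avg_V:
  assumes "p \<ge> 1" "x \<in> space M"
  shows "avg (V p f) y x = V p (avg f y) x"
proof -
  have "(\<Sum>n=1..nat \<lfloor>y\<rfloor>. V n (V p f) x) = (\<Sum>n=1..nat \<lfloor>y\<rfloor>. V p (V n f) x)"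
    using assms by (intro sum.cong) (auto simp: V_V mult.commute)
  then show ?thesis by (simp add: avg_def V_def[of p "avg f y"] V_def[of p "V _ f"] sum_distrib_left mult_ac
      flip: sum_divide_distrib)
qed

lemma hull_avg:
  assumes "f \<in> orbit_hull G" "G \<in> L2 M"
  shows "((\<lambda>y. L2_norm M (\<lambda>x. avg f y x - avg G y x)) \<longlongrightarrow> 0) at_top"
  using assms
proof (induction rule: orbit_hull.induct)
  case (step f p)
  have f: "f \<in> L2 M" using step hull_L2 by blast
  have p: "prime p" "\<theta> p \<noteq> 0" "\<not> (\<lambda>r. 1 / real r) summable_on {r. prime r \<and> colour r = colour p}"
    using step by (auto simp: typical_def)
  have "((\<lambda>y. L2_norm M (\<lambda>x. V p (avg f y) x - avg f y x) + L2_norm M (\<lambda>x. avg f y x - avg G y x)) \<longlongrightarrow> 0 + 0) at_top"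
    by (intro tendsto_add asymptotic_invariance f p step.IH step.prems)
  then have lim: "((\<lambda>y. L2_norm M (\<lambda>x. V p (avg f y) x - avg f y x) + L2_norm M (\<lambda>x. avg f y x - avg G y x)) \<longlongrightarrow> 0) at_top"
    by simp
  show ?case
  proof (rule tendsto_sandwich[OF _ _ tendsto_const lim])
    show "\<forall>\<^sub>F y in at_top. L2_norm M (\<lambda>x. avg (V p f) y x - avg G y x)
        \<le> L2_norm M (\<lambda>x. V p (avg f y) x - avg f y x) + L2_norm M (\<lambda>x. avg f y x - avg G y x)"
    proof (intro always_eventually allI)
      fix y
      have "L2_norm M (\<lambda>x. avg (V p f) y x - avg G y x) = L2_norm M (\<lambda>x. V p (avg f y) x - avg G y x)"
        by (rule L2_norm_cong) (simp only: avg_V[OF typical_ge_1[OF step.hyps(2)]])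
      also have "\<dots> \<le> L2_norm M (\<lambda>x. V p (avg f y) x - avg f y x) + L2_norm M (\<lambda>x. avg f y x - avg G y x)"
        using f step.prems typical_ge_1[OF step.hyps(2)] by (intro L2_norm_dist_triangle V_L2 avg_L2)
      finally show "L2_norm M (\<lambda>x. avg (V p f) y x - avg G y x)
        \<le> L2_norm M (\<lambda>x. V p (avg f y) x - avg f y x) + L2_norm M (\<lambda>x. avg f y x - avg G y x)" .
    qed
  qed (simp add: always_eventually)
next
  case (mid f g)
  have L: "f \<in> L2 M" "g \<in> L2 M" using mid hull_L2 by blast+
  have "((\<lambda>y. 1/2 * L2_norm M (\<lambda>x. avg f y x - avg G y x) + 1/2 * L2_norm M (\<lambda>x. avg g y x - avg G y x)) \<longlongrightarrow> 1/2 * 0 + 1/2 * 0) at_top"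
    by (intro tendsto_intros mid.IH mid.prems)
  then have lim: "((\<lambda>y. 1/2 * L2_norm M (\<lambda>x. avg f y x - avg G y x) + 1/2 * L2_norm M (\<lambda>x. avg g y x - avg G y x)) \<longlongrightarrow> 0) at_top"
    by simp
  show ?case
  proof (rule tendsto_sandwich[OF _ _ tendsto_const lim])
    show "\<forall>\<^sub>F y in at_top. L2_norm M (\<lambda>x. avg (\<lambda>x. (f x + g x) / 2) y x - avg G y x)
        \<le> 1/2 * L2_norm M (\<lambda>x. avg f y x - avg G y x) + 1/2 * L2_norm M (\<lambda>x. avg g y x - avg G y x)"
    proof (intro always_eventually allI)
      fix y
      have "avg (\<lambda>x. (f x + g x) / 2) y x = (1/2) * avg f y x + (1/2) * avg g y x" for x
        unfolding avg_def V_def by (simp add: sum.distrib sum_divide_distrib add_divide_distrib algebra_simps)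
      then have "(\<lambda>x. avg (\<lambda>x. (f x + g x) / 2) y x - avg G y x)
          = (\<lambda>x. (1/2) * (avg f y x - avg G y x) + (1/2) * (avg g y x - avg G y x))"
        by (simp add: algebra_simps)
      then have "L2_norm M (\<lambda>x. avg (\<lambda>x. (f x + g x) / 2) y x - avg G y x)
          \<le> L2_norm M (\<lambda>x. (1/2) * (avg f y x - avg G y x)) + L2_norm M (\<lambda>x. (1/2) * (avg g y x - avg G y x))"
        using L mid.prems by (simp only:) (intro L2_norm_triangle L2_scale L2_diff avg_L2)
      then show "L2_norm M (\<lambda>x. avg (\<lambda>x. (f x + g x) / 2) y x - avg G y x)
        \<le> 1/2 * L2_norm M (\<lambda>x. avg f y x - avg G y x) + 1/2 * L2_norm M (\<lambda>x. avg g y x - avg G y x)"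
        by (simp only: L2_norm_scale) simp
    qed
  qed (simp add: always_eventually)
qed (simp add: L2_norm_zero)

text \<open>The limit w of the minimising sequence inherits mean 0 and invariance, so it vanishes
  and the elements \<open>c n\<close> of the hull become small in norm. The averages of G are
  asymptotically those of \<open>c n\<close>, whose norms are at most that of
  \<open>c n\<close>.\<close>

lemma avg_tendsto_zero:
  assumes G: "G \<in> L2 M" "(LINT x|M. G x) = 0"
    and no_inv: "\<And>w. w \<in> L2 M \<Longrightarrow> (LINT x|M. w x) = 0 \<Longrightarrow> (\<And>p. p \<in> typical \<Longrightarrow> AE x in M. V p w x = w x) \<Longrightarrow>
        AE x in M. w x = 0"
  shows "((\<lambda>y. L2_norm M (avg G y)) \<longlongrightarrow> 0) at_top"
proof -
  obtain c w where c: "\<And>n. c n \<in> orbit_hull G" and w: "w \<in> L2 M" "(\<lambda>n. L2_norm M (\<lambda>x. c n x - w x)) \<longlonglongrightarrow> 0"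
    and inv: "\<And>U. U \<in> V ` typical \<Longrightarrow> AE x in M. U w x = w x"
  proof (rule L2_minimal_norm[of "orbit_hull G" "V ` typical"])
    show "U f \<in> orbit_hull G" if "U \<in> V ` typical" "f \<in> orbit_hull G" for U f using that by (auto intro: orbit_hull.step)
    show "U f \<in> L2 M \<and> L2_norm M (U f) \<le> L2_norm M f" if "U \<in> V ` typical" "f \<in> L2 M" for U f
      using that by (auto intro: V_L2 V_norm_le typical_ge_1)
    show "U (\<lambda>x. f x - g x) = (\<lambda>x. U f x - U g x)" if "U \<in> V ` typical" for U f g
      using that V_diff by auto
    show "orbit_hull G \<noteq> {}" using orbit_hull.base by blast
    show "orbit_hull G \<subseteq> L2 M" using hull_L2 G by blast
  qed (auto intro: orbit_hull.mid)
  have cL: "c n \<in> L2 M" for n using hull_L2[OF c G(1)] .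
  have "norm (LINT x|M. w x) \<le> L2_norm M (\<lambda>x. c n x - w x)" for n
  proof -
    have "(LINT x|M. c n x - w x) = - (LINT x|M. w x)"
      using L2_integrable1[OF cL[of n]] L2_integrable1[OF w(1)] hull_integral_zero[OF c G] by simp
    then have "norm (LINT x|M. w x) = norm (LINT x|M. c n x - w x)" by simp
    also have "\<dots> \<le> (LINT x|M. norm (c n x - w x))" by (rule integral_norm_bound)
    also have "\<dots> \<le> L2_norm M (\<lambda>x. c n x - w x)" by (intro L2_norm_integral_le L2_diff cL w)
    finally show ?thesis .
  qed
  then have "norm (LINT x|M. w x) \<le> 0" by (intro LIMSEQ_le_const[OF w(2)]) auto
  then have w0: "AE x in M. w x = 0" using inv by (intro no_inv w) auto
  have "L2_norm M (c n) = L2_norm M (\<lambda>x. c n x - w x)" for n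
    using cL[of n] w(1) by (intro L2_norm_cong_AE L2_measurable borel_measurable_diff) (use w0 in auto)
  then have lim: "(\<lambda>n. L2_norm M (c n)) \<longlonglongrightarrow> 0" using w(2) by simp
  show ?thesis
  proof (rule tendstoI)
    fix e :: real assume e: "e > 0"
    then obtain n where n: "L2_norm M (c n) < e / 2"
      using order_tendstoD(2)[OF lim, of "e / 2"] by (auto simp: eventually_sequentially)
    have "\<forall>\<^sub>F y in at_top. L2_norm M (\<lambda>x. avg (c n) y x - avg G y x) < e / 2"
      using order_tendstoD(2)[OF hull_avg[OF c G(1)], of "e / 2" n] e by simp
    moreover have "\<forall>\<^sub>F y in at_top. y > (0::real)" by (rule eventually_gt_at_top)
    ultimately show "\<forall>\<^sub>F y in at_top. dist (L2_norm M (avg G y)) 0 < e"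
    proof eventually_elim
      case (elim y)
      have "L2_norm M (avg G y) \<le> L2_norm M (avg (c n) y) + L2_norm M (\<lambda>x. avg G y x - avg (c n) y x)"
        by (intro L2_norm_le_dist avg_L2 cL G)
      also have "L2_norm M (\<lambda>x. avg G y x - avg (c n) y x) < e / 2"
        using elim by (subst L2_norm_commute)
      also have "L2_norm M (avg (c n) y) \<le> e / 2"
        using avg_norm_le[OF cL elim(2), of n] n by simp
      finally show ?case by simp
    qed
  qed
qed

end

section \<open>Dirichlet characters\<close>

text \<open>The additive character e(k/q); integer arguments allow the negative frequencies of
  Fourier inversion.\<close>

definition ez :: "nat \<Rightarrow> int \<Rightarrow> complex" where
  "ez q k = cis (2 * pi * (real_of_int k / real q))"

lemma ez_0 [simp]: "ez q 0 = 1" by (simp add: ez_def)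

lemma ez_add: "ez q (a + b) = ez q a * ez q b"
  by (simp add: ez_def cis_mult add_divide_distrib distrib_left)

lemma ez_power: "ez q (int n * a) = ez q a ^ n"
  unfolding ez_def Complex.DeMoivre by (intro arg_cong[where f = cis]) simp

lemma norm_ez [simp]: "norm (ez q a) = 1"
  by (simp add: ez_def)

lemma ez_eq_1_iff: "q > 0 \<Longrightarrow> ez q k = 1 \<longleftrightarrow> int q dvd k"
proof -
  assume q: "q > 0"
  have "ez q k = 1 \<longleftrightarrow> exp (\<i> * of_real (2 * pi * (real_of_int k / real q))) = 1"
    by (simp add: ez_def cis_conv_exp)
  also have "\<dots> \<longleftrightarrow> (\<exists>n::int. 2 * pi * (real_of_int k / real q) = of_int (2 * n) * pi)"
    by (subst exp_eq_1) simp
  also have "\<dots> \<longleftrightarrow> (\<exists>n::int. real_of_int k = real_of_int (n * int q))"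
    using q by (simp add: field_simps)
  also have "\<dots> \<longleftrightarrow> int q dvd k" unfolding of_int_eq_iff by (auto simp: dvd_def mult.commute)
  finally show ?thesis .
qed

lemma ez_cong: "q > 0 \<Longrightarrow> [a = b] (mod int q) \<Longrightarrow> ez q a = ez q b"
proof -
  assume q: "q > 0" and "[a = b] (mod int q)"
  then have "ez q (a - b) = 1" by (simp add: ez_eq_1_iff cong_iff_dvd_diff)
  then show ?thesis using ez_add[of q "a - b" b] by simp
qed

lemma sum_ez: "q > 0 \<Longrightarrow> (\<Sum>a<q. ez q (int a * k)) = (if int q dvd k then of_nat q else 0)"
proof (cases "int q dvd k")
  case True
  assume "q > 0"
  then have "ez q k = 1" using True by (simp add: ez_eq_1_iff)
  then show ?thesis using True by (simp add: ez_power)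
next
  case False
  assume q: "q > 0"
  then have "ez q k \<noteq> 1" using False by (simp add: ez_eq_1_iff)
  then have "(\<Sum>a<q. ez q k ^ a) = (ez q k ^ q - 1) / (ez q k - 1)" by (rule geometric_sum)
  also have "ez q k ^ q = 1" using q by (simp add: ez_power[symmetric] ez_eq_1_iff)
  finally show ?thesis using False by (simp add: ez_power)
qed

lemma periodic_mod:
  fixes f :: "nat \<Rightarrow> 'b"
  assumes "\<And>n. f (n + q) = f n"
  shows "f (n mod q) = f n"
proof -
  have "f (m + k * q) = f m" for m k
  proof (induction k)
    case (Suc k)
    then show ?case using assms[of "m + k * q"] by (simp add: algebra_simps)
  qed simp
  from this[of "n mod q" "n div q"] show ?thesis by simp
qed

lemma periodic_cong:
  fixes f :: "nat \<Rightarrow> 'b"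
  assumes "\<And>n. f (n + q) = f n" "[m = n] (mod q)"
  shows "f m = f n"
  using periodic_mod[of f q m, OF assms(1)] periodic_mod[of f q n, OF assms(1)] assms(2)
  by (simp add: cong_def)

lemma dirichlet_characterD:
  assumes "dirichlet_character q chi"
  shows "q \<ge> 1" "chi (m * n) = chi m * chi n" "chi (n + q) = chi n" "chi n \<noteq> 0 \<longleftrightarrow> coprime n q"
  using assms by (auto simp: dirichlet_character_def)


lemma dirichlet_character_1: "dirichlet_character q chi \<Longrightarrow> chi 1 = 1"
  using dirichlet_characterD(2)[of q chi 1 1] dirichlet_characterD(4)[of q chi 1] by simp

lemma dirichlet_character_cong:
  "dirichlet_character q chi \<Longrightarrow> [m = n] (mod q) \<Longrightarrow> chi m = chi n"
  by (rule periodic_cong[of chi]) (rule dirichlet_characterD(3))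

lemma dirichlet_character_power: "dirichlet_character q chi \<Longrightarrow> chi (n ^ k) = chi n ^ k"
  by (induction k) (auto simp: dirichlet_characterD(2) dirichlet_character_1[simplified])

lemma dirichlet_character_norm:
  assumes "dirichlet_character q chi" "coprime n q"
  shows "norm (chi n) = 1"
proof -
  have q: "q \<ge> 1" using assms(1) by (rule dirichlet_characterD)
  have "chi (n ^ totient q) = chi 1"
    by (rule dirichlet_character_cong[OF assms(1) euler_theorem[OF assms(2)]])
  then have "chi n ^ totient q = 1"
    using assms(1) dirichlet_character_1[OF assms(1)] by (simp add: dirichlet_character_power)
  then show ?thesis using q power_eq_1_iff[of "chi n" "totient q"] by simp
qed

lemma dirichlet_character_norm_le:
  assumes "dirichlet_character q chi"
  shows "norm (chi n) \<le> 1"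
  using dirichlet_character_norm[OF assms, of n] dirichlet_characterD(4)[OF assms, of n] by (cases "chi n = 0") auto

lemma dirichlet_character_finite_range:
  assumes "dirichlet_character q chi"
  shows "finite (range chi)"
proof (rule finite_subset)
  show "range chi \<subseteq> chi ` {..<q}"
  proof
    fix z assume "z \<in> range chi"
    then obtain n where "z = chi n" by blast
    also have "chi n = chi (n mod q)" using assms by (intro dirichlet_character_cong) (auto simp: cong_def)
    finally show "z \<in> chi ` {..<q}" using dirichlet_characterD(1)[OF assms] by auto
  qed
qed simp

lemma dirichlet_character_cnj: "dirichlet_character q chi \<Longrightarrow> dirichlet_character q (\<lambda>n. cnj (chi n))"
  by (simp add: dirichlet_character_def)

lemma primitive_character_cnj:
  assumes "primitive_character q chi"
  shows "primitive_character q (\<lambda>n. cnj (chi n))"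
  unfolding primitive_character_def
proof (intro conjI notI)
  show "dirichlet_character q (\<lambda>n. cnj (chi n))"
    using assms by (auto simp: primitive_character_def intro: dirichlet_character_cnj)
  assume "\<exists>d \<psi>. d dvd q \<and> d < q \<and> dirichlet_character d \<psi> \<and> (\<forall>n. coprime n q \<longrightarrow> cnj (chi n) = \<psi> n)"
  then obtain d \<psi> where d: "d dvd q" "d < q" "dirichlet_character d \<psi>" "\<And>n. coprime n q \<Longrightarrow> cnj (chi n) = \<psi> n" by blast
  have "chi n = cnj (\<psi> n)" if "coprime n q" for n using d(4)[OF that, symmetric] by simp
  then show False using assms d dirichlet_character_cnj[OF d(3)] unfolding primitive_character_def by blast
qed

lemma dirichlet_character_induced:
  assumes "dirichlet_character q chi"
  obtains d \<psi> where "d dvd q" "primitive_character d \<psi>" "\<And>n. coprime n q \<Longrightarrow> chi n = \<psi> n"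
proof -
  have "\<exists>d \<psi>. d dvd q \<and> primitive_character d \<psi> \<and> (\<forall>n. coprime n q \<longrightarrow> chi n = \<psi> n)"
    using assms
  proof (induction q arbitrary: chi rule: less_induct)
    case (less q)
    show ?case
    proof (cases "primitive_character q chi")
      case False
      then obtain d \<psi> where d: "d dvd q" "d < q" "dirichlet_character d \<psi>" "\<And>n. coprime n q \<Longrightarrow> chi n = \<psi> n"
        using less.prems unfolding primitive_character_def by blast
      from less.IH[OF d(2,3)] obtain d' \<psi>' where d': "d' dvd d" "primitive_character d' \<psi>'"
        "\<And>n. coprime n d \<Longrightarrow> \<psi> n = \<psi>' n" by blast
      have "coprime n d" if "coprime n q" for n
        using that d(1) by (meson coprime_divisors dvd_refl)
      then show ?thesis using d d' by (intro exI[of _ d'] exI[of _ \<psi>']) (auto intro: dvd_trans)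
    qed (intro exI[of _ q] exI[of _ chi], simp)
  qed
  then show ?thesis using that by blast
qed

lemma dirichlet_character_mod_1: "dirichlet_character 1 chi \<Longrightarrow> chi n = 1"
  using dirichlet_character_cong[of 1 chi n 1] dirichlet_character_1[of 1 chi] by (simp add: cong_def)

text \<open>If the character were 1 on all units, it would be induced from modulus 1. So some unit
  has a value other than 1, and multiplication by it permutes the residues.\<close>

lemma primitive_character_sum_zero:
  assumes "primitive_character q chi" "q > 1"
  shows "(\<Sum>n<q. chi n) = 0"
proof -
  have chi: "dirichlet_character q chi" using assms(1) by (simp add: primitive_character_def)
  have "\<exists>g. coprime g q \<and> chi g \<noteq> 1"
  proof (rule ccontr)
    assume "\<not> ?thesis"
    then have "\<forall>n. coprime n q \<longrightarrow> chi n = 1" by blast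
    moreover have "dirichlet_character 1 (\<lambda>n. 1)" by (simp add: dirichlet_character_def)
    ultimately show False using assms unfolding primitive_character_def by (metis one_dvd)
  qed
  then obtain g where g: "coprime g q" "chi g \<noteq> 1" by blast
  have "bij_betw (\<lambda>n. g * n mod q) {..<q} {..<q}"
  proof -
    have inj: "inj_on (\<lambda>n. g * n mod q) {..<q}"
    proof (rule inj_onI)
      fix m n assume mn: "m \<in> {..<q}" "n \<in> {..<q}" "g * m mod q = g * n mod q"
      then have "[g * m = g * n] (mod q)" by (simp add: cong_def)
      then have "[m = n] (mod q)" using g(1) by (simp add: cong_mult_lcancel_nat)
      then show "m = n" using mn by (simp add: cong_def)
    qed
    have "(\<lambda>n. g * n mod q) ` {..<q} = {..<q}" using assms by (intro endo_inj_surj inj) auto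
    with inj show ?thesis by (simp add: bij_betw_def)
  qed
  then have "(\<Sum>n<q. chi n) = (\<Sum>n<q. chi (g * n mod q))" by (rule sum.reindex_bij_betw[symmetric])
  also have "\<dots> = (\<Sum>n<q. chi g * chi n)"
  proof (rule sum.cong[OF refl])
    fix n
    have "chi (g * n mod q) = chi (g * n)" using chi by (intro dirichlet_character_cong[of q]) (auto simp: cong_def)
    then show "chi (g * n mod q) = chi g * chi n" using dirichlet_characterD(2)[OF chi] by simp
  qed
  also have "\<dots> = chi g * (\<Sum>n<q. chi n)" by (simp add: sum_distrib_left)
  finally have "(1 - chi g) * (\<Sum>n<q. chi n) = 0" by (simp add: algebra_simps)
  then show ?thesis using g(2) by simp
qed

lemma periodic_fourier_induct:
  fixes h :: "nat \<Rightarrow> complex"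
  assumes q: "q \<ge> 1" and per: "\<And>n. h (n + q) = h n" and zero: "(\<Sum>n<q. h n) = 0"
    and P0: "P (\<lambda>n. 0)" and P_add: "\<And>f g. P f \<Longrightarrow> P g \<Longrightarrow> P (\<lambda>n. f n + g n)"
    and P_exp: "\<And>a c. 0 < a \<Longrightarrow> a < q \<Longrightarrow> P (\<lambda>n. c * ez q (int a * int n))"
  shows "P h"
proof -
  define c where "c = (\<lambda>a. 1 / of_nat q * (\<Sum>k<q. h k * ez q (- (int a * int k))))"
  have h_eq: "h = (\<lambda>n. \<Sum>a<q. c a * ez q (int a * int n))"
  proof
    fix n
    have "(\<Sum>a<q. c a * ez q (int a * int n))
        = 1 / of_nat q * (\<Sum>a<q. \<Sum>k<q. h k * ez q (int a * (int n - int k)))"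
      unfolding c_def sum_distrib_left sum_distrib_right
      by (intro sum.cong refl) (simp add: ez_add[symmetric] algebra_simps)
    also have "(\<Sum>a<q. \<Sum>k<q. h k * ez q (int a * (int n - int k)))
        = (\<Sum>k<q. \<Sum>a<q. h k * ez q (int a * (int n - int k)))" by (rule sum.swap)
    also have "\<dots> = (\<Sum>k<q. h k * (if int q dvd int n - int k then of_nat q else 0))"
      unfolding sum_distrib_left[symmetric] using q by (intro sum.cong refl) (subst sum_ez, auto)
    also have "\<dots> = (\<Sum>k<q. if k = n mod q then h k * of_nat q else 0)"
    proof (intro sum.cong refl)
      fix k assume k: "k \<in> {..<q}"
      have "int q dvd int n - int k \<longleftrightarrow> [n = k] (mod q)"
        by (simp add: cong_iff_dvd_diff flip: cong_int_iff)
      also have "\<dots> \<longleftrightarrow> k = n mod q" using k by (auto simp: cong_def)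
      finally show "h k * (if int q dvd int n - int k then of_nat q else 0) = (if k = n mod q then h k * of_nat q else 0)"
        by simp
    qed
    also have "\<dots> = h (n mod q) * of_nat q" using q by simp
    finally show "h n = (\<Sum>a<q. c a * ez q (int a * int n))"
      using q periodic_mod[of h q n, OF per] by simp
  qed
  have c0: "c 0 = 0" using zero by (simp add: c_def)
  have "P (\<lambda>n. \<Sum>a\<in>A. c a * ez q (int a * int n))" if "finite A" "A \<subseteq> {..<q}" for A
    using that
  proof (induction A rule: finite_induct)
    case (insert a A)
    have "P (\<lambda>n. c a * ez q (int a * int n))"
      using c0 P0 P_exp[of a "c a"] insert.prems by (cases "a = 0") auto
    from P_add[OF this insert.IH] show ?case using insert by simp
  qed (simp add: P0)
  then show ?thesis by (subst h_eq) simp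
qed

section \<open>Fourier analysis on the units modulo q, with functions extended by zero\<close>

definition coprime_periodic :: "nat \<Rightarrow> (nat \<Rightarrow> complex) \<Rightarrow> bool" where
  "coprime_periodic q f \<longleftrightarrow> (\<forall>n. f (n + q) = f n) \<and> (\<forall>n. \<not> coprime n q \<longrightarrow> f n = 0)"

text \<open>Evaluation at n = 1 identifies the eigenvalue of translation by g as f g / f 1, which
  makes f / f 1 completely multiplicative; if f 1 = 0, the same evaluation kills f on all
  units.\<close>

lemma eigenfunction_dirichlet_character:
  assumes q: "q \<ge> 1" and f: "coprime_periodic q f"
    and eigen: "\<And>g. coprime g q \<Longrightarrow> \<exists>c. \<forall>n. f (g * n) = c * f n"
  obtains c chi where "dirichlet_character q chi" "f = (\<lambda>n. c * chi n)" | "f = (\<lambda>n. 0)"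
proof (cases "f 1 = 0")
  case True
  have "f n = 0" for n
  proof (cases "coprime n q")
    case True
    then obtain c where "\<And>m. f (n * m) = c * f m" using eigen by blast
    from this[of 1] show ?thesis using \<open>f 1 = 0\<close> by simp
  qed (use f in \<open>auto simp: coprime_periodic_def\<close>)
  then show ?thesis using that(2) by blast
next
  case False
  have per: "f (n + q) = f n" for n using f by (simp add: coprime_periodic_def)
  have mult: "f (m * n) * f 1 = f m * f n" for m n
  proof (cases "coprime m q")
    case True
    then obtain c where c: "\<And>k. f (m * k) = c * f k" using eigen by blast
    show ?thesis using c[of n] c[of 1] by simp
  qed (use f in \<open>auto simp: coprime_periodic_def\<close>)
  have nz: "f n \<noteq> 0 \<longleftrightarrow> coprime n q" for n
  proof
    assume n: "coprime n q"
    then obtain m where "[n * m = 1] (mod q)" using cong_solve_coprime_nat[OF n] by auto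
    then have "f (n * m) = f 1" by (rule periodic_cong[of f q, OF per])
    then show "f n \<noteq> 0" using mult[of n m] False by auto
  qed (use f in \<open>auto simp: coprime_periodic_def\<close>)
  have "dirichlet_character q (\<lambda>n. f n / f 1)"
    unfolding dirichlet_character_def
  proof (intro conjI allI)
    fix m n
    show "f (m * n) / f 1 = f m / f 1 * (f n / f 1)"
      using mult[of m n] False by (simp add: divide_simps)
    show "f (n + q) / f 1 = f n / f 1" by (simp only: per)
    show "(f n / f 1 \<noteq> 0) = coprime n q" using nz[of n] False by simp
  qed (rule q)
  moreover have "f = (\<lambda>n. f 1 * (f n / f 1))" using False by (simp only: fun_eq_iff) simp
  ultimately show ?thesis by (rule that(1))
qed

text \<open>The idea is joint diagonalisation of the translations by units: their simultaneous eigenfunctions are the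
  multiples of Dirichlet characters.\<close>

lemma coprime_periodic_induct:
  assumes q: "q \<ge> 1" and f: "coprime_periodic q f"
    and P0: "P (\<lambda>n. 0)" and P_add: "\<And>f g. P f \<Longrightarrow> P g \<Longrightarrow> P (\<lambda>n. f n + g n)"
    and P_char: "\<And>c chi. dirichlet_character q chi \<Longrightarrow> P (\<lambda>n. c * chi n)"
  shows "P f"
proof -
  define eig where "eig = (\<lambda>(f :: nat \<Rightarrow> complex) g. \<exists>c. \<forall>n. f (g * n) = c * f n)"
  have P_sum: "P (\<lambda>n. \<Sum>l\<in>A. F l n)" if "finite A" "\<And>l. l \<in> A \<Longrightarrow> P (F l)" for A :: "nat set" and F
    using that
  proof (induction A rule: finite_induct)
    case (insert a A)
    have "P (\<lambda>n. F a n + (\<Sum>l\<in>A. F l n))" using insert.prems insert.IH by (intro P_add) auto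
    then show ?case using insert.hyps by simp
  qed (simp add: P0)
  define m where "m = totient q"
  have m: "m \<ge> 1" using q by (simp add: m_def Suc_le_eq)
  \<comment> \<open>Induction on a set \<open>E\<close> of units whose translations are already
    diagonalised. A new unit g splits f into its eigencomponents, which remain eigenfunctions for
    the old units because translations commute.\<close>
  have main: "(\<And>f. coprime_periodic q f \<Longrightarrow> (\<And>g. g \<in> E \<Longrightarrow> eig f g) \<Longrightarrow> P f) \<Longrightarrow> coprime_periodic q f \<Longrightarrow> P f"
    if "finite E" "\<And>g. g \<in> E \<Longrightarrow> coprime g q" for E f
    using that
  proof (induction E arbitrary: f rule: finite_induct)
    case (insert g E)
    have g: "coprime g q" using insert.prems by simp
    show ?case
    proof (rule insert.IH)
      fix f assume f: "coprime_periodic q f" and eigE: "\<And>g. g \<in> E \<Longrightarrow> eig f g"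
      have per: "f (n + q) = f n" for n using f by (simp add: coprime_periodic_def)
      \<comment> \<open>The component of f for the eigenvalue e(l/m) of translation by g. By Euler's
        theorem the m-th power of this translation is the identity, so no other eigenvalues
        occur.\<close>
      define F where "F = (\<lambda>l n. 1 / of_nat m * (\<Sum>j<m. ez m (- (int l * int j)) * f (g ^ j * n)))"
      have FP: "P (F l)" if "l < m" for l
      proof (rule insert.prems(1))
        show "coprime_periodic q (F l)"
          unfolding coprime_periodic_def
        proof (intro conjI allI impI)
          fix n
          have "f (g ^ j * (n + q)) = f (g ^ j * n)" for j
            by (rule periodic_cong[of f q, OF per]) (simp add: cong_def algebra_simps)
          then show "F l (n + q) = F l n" by (simp add: F_def)
          assume "\<not> coprime n q"
          then have "f (g ^ j * n) = 0" for j using f by (simp add: coprime_periodic_def)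
          then show "F l n = 0" by (simp add: F_def)
        qed
        fix e assume e: "e \<in> insert g E"
        show "eig (F l) e"
        proof (cases "e = g")
          case False
          then obtain c where c: "\<And>n. f (e * n) = c * f n" using e eigE[of e] by (auto simp: eig_def)
          have "F l (e * n) = c * F l n" for n
          proof -
            have "f (g ^ j * (e * n)) = c * f (g ^ j * n)" for j
              using c[of "g ^ j * n"] by (simp add: mult_ac)
            then show ?thesis by (simp add: F_def sum_distrib_left mult_ac)
          qed
          then show ?thesis unfolding eig_def by blast
        next
          case True
          have "F l (g * n) = ez m (int l) * F l n" for n
          proof -
            define u where "u = (\<lambda>j. ez m (- (int l * int j)) * f (g ^ j * n))"
            have um: "u m = u 0"
            proof -
              have "[g ^ m * n = 1 * n] (mod q)"
                unfolding m_def using g by (intro cong_mult euler_theorem) auto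
              then have "f (g ^ m * n) = f n" using periodic_cong[of f q, OF per] by simp
              moreover have "ez m (- (int l * int m)) = 1" using m by (simp add: ez_eq_1_iff)
              ultimately show ?thesis by (simp add: u_def)
            qed
            have "(\<Sum>j<m. ez m (- (int l * int j)) * f (g ^ j * (g * n))) = (\<Sum>j<m. ez m (int l) * u (Suc j))"
            proof (rule sum.cong[OF refl])
              fix j
              have "g ^ j * (g * n) = g ^ Suc j * n" by simp
              moreover have "ez m (- (int l * int j)) = ez m (int l) * ez m (- (int l * int (Suc j)))"
                unfolding ez_add[symmetric] by (simp add: algebra_simps)
              ultimately show "ez m (- (int l * int j)) * f (g ^ j * (g * n)) = ez m (int l) * u (Suc j)"
                unfolding u_def by (simp only: mult.assoc)
            qed
            also have "\<dots> = ez m (int l) * (\<Sum>j<m. u (Suc j))" by (simp add: sum_distrib_left)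
            also have "(\<Sum>j<m. u (Suc j)) = (\<Sum>j<m. u j)"
              using sum.lessThan_Suc_shift[of u m] um by simp
            finally show ?thesis by (simp add: F_def u_def)
          qed
          then show ?thesis unfolding eig_def True by blast
        qed
      qed
      have "f = (\<lambda>n. \<Sum>l<m. F l n)"
      proof
        fix n
        have "(\<Sum>l<m. F l n) = 1 / of_nat m * (\<Sum>l<m. \<Sum>j<m. ez m (int l * (- int j)) * f (g ^ j * n))"
          unfolding F_def by (simp add: sum_distrib_left)
        also have "(\<Sum>l<m. \<Sum>j<m. ez m (int l * (- int j)) * f (g ^ j * n))
            = (\<Sum>j<m. (\<Sum>l<m. ez m (int l * (- int j))) * f (g ^ j * n))"
          by (subst sum.swap) (simp add: sum_distrib_right)
        also have "\<dots> = (\<Sum>j<m. if j = 0 then of_nat m * f n else 0)"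
        proof (intro sum.cong refl)
          fix j assume "j \<in> {..<m}"
          then have "int m dvd - int j \<longleftrightarrow> j = 0" by (auto dest: nat_dvd_not_less)
          then show "(\<Sum>l<m. ez m (int l * (- int j))) * f (g ^ j * n) = (if j = 0 then of_nat m * f n else 0)"
            using m sum_ez[of m "- int j"] by auto
        qed
        also have "\<dots> = of_nat m * f n" using m by (simp add: sum.delta)
        finally show "f n = (\<Sum>l<m. F l n)" using m by simp
      qed
      then show "P f" using P_sum[of "{..<m}" F] FP by simp
    qed (use insert.prems in blast)+
  next
    case empty
    show ?case by (rule empty.prems(1)[OF empty.prems(2)]) simp
  qed
  show ?thesis
  proof (rule main[of "{g\<in>{..<q}. coprime g q}"])
    fix f assume f: "coprime_periodic q f" and eigE: "\<And>g. g \<in> {g\<in>{..<q}. coprime g q} \<Longrightarrow> eig f g"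
    have per: "f (n + q) = f n" for n using f by (simp add: coprime_periodic_def)
    have "\<exists>c. \<forall>n. f (g * n) = c * f n" if g: "coprime g q" for g
    proof -
      have "coprime (g mod q) q" using g by (simp add: coprime_iff_gcd_eq_1 gcd.commute flip: gcd_red_nat)
      then have "eig f (g mod q)" using q by (intro eigE) auto
      then obtain c where c: "\<And>n. f (g mod q * n) = c * f n" by (auto simp: eig_def)
      have "f (g * n) = f (g mod q * n)" for n
        by (rule periodic_cong[of f q, OF per]) (simp add: cong_def mod_mult_left_eq)
      then show ?thesis using c by auto
    qed
    then show "P f"
    proof (rule eigenfunction_dirichlet_character[OF q f])
      fix c chi assume "dirichlet_character q chi" "f = (\<lambda>n. c * chi n)"
      then show "P f" using P_char[of chi c] by simp
    next
      assume "f = (\<lambda>n. 0)"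
      then show "P f" using P0 by simp
    qed
  qed (use f in auto)
qed

text \<open>The residues are split by d = gcd(n, q). On the class of d the integer n = d m has m
  coprime to q / d, so the expansion on the units modulo q / d applies to m = n div d.\<close>

lemma periodic_character_induct:
  assumes q: "q \<ge> 1" and per: "\<And>n. h (n + q) = h n"
    and P0: "P (\<lambda>n. 0)" and P_add: "\<And>f g. P f \<Longrightarrow> P g \<Longrightarrow> P (\<lambda>n. f n + g n)"
    and P_char: "\<And>c d chi. d dvd q \<Longrightarrow> dirichlet_character (q div d) chi \<Longrightarrow>
        P (\<lambda>n. if d dvd n then c * chi (n div d) else 0)"
  shows "P (h :: nat \<Rightarrow> complex)"
proof -
  define H where "H = (\<lambda>d n. if gcd n q = d then h n else 0)"
  have "P (H d)" if d: "d dvd q" for d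
  proof -
    define f where "f = (\<lambda>m. if coprime m (q div d) then h (d * m) else 0)"
    from d obtain k where k: "q = d * k" by blast
    with q have "d > 0" "k > 0" by (auto intro!: Nat.gr0I)
    then have dq: "d \<ge> 1" "q div d \<ge> 1" "d * (q div d) = q" using k by auto
    have "f (n + q div d) = f n" for n
    proof -
      have "h (d * (n + q div d)) = h (d * n)" using per[of "d * n"] dq(3) by (simp add: distrib_left)
      moreover have "coprime (n + q div d) (q div d) \<longleftrightarrow> coprime n (q div d)"
        by (simp add: coprime_iff_gcd_eq_1)
      ultimately show ?thesis unfolding f_def by simp
    qed
    then have "coprime_periodic (q div d) f"
      unfolding coprime_periodic_def by (simp add: f_def)
    then have "P (\<lambda>n. if d dvd n then f (n div d) else 0)"
    proof (rule coprime_periodic_induct[OF dq(2), where P = "\<lambda>f. P (\<lambda>n. if d dvd n then f (n div d) else 0)"])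
      show "P (\<lambda>n. if d dvd n then f (n div d) + g (n div d) else 0)"
        if "P (\<lambda>n. if d dvd n then f (n div d) else 0)" "P (\<lambda>n. if d dvd n then g (n div d) else 0)" for f g
      proof -
        have "(\<lambda>n. if d dvd n then f (n div d) + g (n div d) else 0) =
          (\<lambda>n. (if d dvd n then f (n div d) else 0) + (if d dvd n then g (n div d) else 0))" by auto
        then show ?thesis using P_add[OF that] by simp
      qed
    qed (use P0 P_char d in auto)
    also have "(\<lambda>n. if d dvd n then f (n div d) else 0) = H d"
    proof
      fix n
      show "(if d dvd n then f (n div d) else 0) = H d n"
      proof (cases "d dvd n")
        case True
        then obtain m where m: "n = d * m" by blast
        have "gcd n q = d * gcd m (q div d)" using dq(3) gcd_mult_distrib_nat[of d m "q div d"] by (simp add: m)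
        then have "gcd n q = d \<longleftrightarrow> coprime m (q div d)" using dq(1) by (auto simp: coprime_iff_gcd_eq_1)
        then show ?thesis using m dq(1) by (simp add: f_def H_def)
      next
        case False
        then have "gcd n q \<noteq> d" by (metis gcd_dvd1)
        then show ?thesis using False by (simp add: H_def)
      qed
    qed
    finally show ?thesis .
  qed
  note PH = this
  have sum: "P (\<lambda>n. \<Sum>d\<in>D. H d n)" if "finite D" "D \<subseteq> {d. d dvd q}" for D
    using that
  proof (induction D rule: finite_induct)
    case (insert d D)
    have "P (\<lambda>n. H d n + (\<Sum>d\<in>D. H d n))" using insert.prems insert.IH PH
      by (intro P_add) auto
    then show ?case using insert.hyps by simp
  qed (simp add: P0)
  have fin: "finite {d. d dvd q}" using q by (intro finite_divisors_nat) simp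
  have "h = (\<lambda>n. \<Sum>d\<in>{d. d dvd q}. H d n)"
    unfolding H_def by (intro ext) (simp add: fin sum.delta')
  then show ?thesis using sum[OF fin] by simp
qed

section \<open>Ergodic transformations\<close>

text \<open>Each comparison of f with a rational level is decided almost everywhere. As there are
  countably many levels, all are decided at once, and any point that obeys the decisions supplies
  the constant.\<close>

lemma (in prob_space) AE_const_if_level_sets_trivial:
  fixes f :: "'a \<Rightarrow> real"
  assumes f: "f \<in> borel_measurable M"
    and triv: "\<And>t. prob {x\<in>space M. f x > t} \<in> {0, 1}"
  obtains c where "AE x in M. f x = c"
proof -
  have "\<exists>b. AE x in M. (f x > t) = b" for t
  proof -
    have m: "{x\<in>space M. f x > t} \<in> sets M" using f by measurable
    show ?thesis
    proof (cases "prob {x\<in>space M. f x > t} = 1")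
      case True
      then have "AE x in M. x \<in> {x\<in>space M. f x > t}" using m by (subst (asm) prob_eq_1) auto
      then show ?thesis by (intro exI[of _ True]) (auto elim: eventually_mono)
    next
      case False
      then have "prob {x\<in>space M. f x > t} = 0" using triv[of t] by blast
      then have "AE x in M. x \<notin> {x\<in>space M. f x > t}" using m by (subst (asm) prob_eq_0) auto
      then show ?thesis by (intro exI[of _ False]) (use AE_space in \<open>auto elim!: eventually_elim2\<close>)
    qed
  qed
  then obtain b where "\<And>t. AE x in M. (f x > t) = b t" by metis
  then have ae: "AE x in M. \<forall>q::rat. (f x > of_rat q) = b (of_rat q)" by (subst AE_all_countable) blast
  have "\<exists>x0. \<forall>q::rat. (f x0 > of_rat q) = b (of_rat q)"
  proof (rule ccontr)
    assume no: "\<not> ?thesis"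
    from ae have "AE x in M. False"
      by (rule eventually_mono) (use no in blast)
    then show False by (simp add: AE_const)
  qed
  then obtain x0 where x0: "\<forall>q::rat. (f x0 > of_rat q) = b (of_rat q)" by blast
  from ae have "AE x in M. f x = f x0"
  proof eventually_elim
    case (elim x)
    then have eq: "f x > of_rat q \<longleftrightarrow> f x0 > of_rat q" for q :: rat using x0 by simp
    show ?case
    proof (rule ccontr)
      assume "f x \<noteq> f x0"
      then consider "f x < f x0" | "f x0 < f x" by linarith
      then show False
      proof cases
        case 1
        then obtain q :: rat where "f x < of_rat q" "of_rat q < f x0" using of_rat_dense by blast
        then show False using eq[of q] by simp
      next
        case 2
        then obtain q :: rat where "f x0 < of_rat q" "of_rat q < f x" using of_rat_dense by blast
        then show False using eq[of q] by simp
      qed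
    qed
  qed
  then show thesis using that by blast
qed

lemma (in prob_space) AE_const_if_level_sets_trivial_complex:
  fixes f :: "'a \<Rightarrow> complex"
  assumes f: "f \<in> borel_measurable M"
    and "\<And>t. prob {x\<in>space M. Re (f x) > t} \<in> {0, 1}" "\<And>t. prob {x\<in>space M. Im (f x) > t} \<in> {0, 1}"
  obtains c where "AE x in M. f x = c"
proof -
  obtain a where a: "AE x in M. Re (f x) = a"
    using AE_const_if_level_sets_trivial[of "\<lambda>x. Re (f x)"] assms by auto
  obtain b where b: "AE x in M. Im (f x) = b"
    using AE_const_if_level_sets_trivial[of "\<lambda>x. Im (f x)"] assms by auto
  from a b have "AE x in M. f x = Complex a b" by eventually_elim (simp add: complex_eq_iff)
  then show thesis using that by blast
qed

lemma AE_comp_measure_preserving: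
  assumes "T \<in> M \<rightarrow>\<^sub>M M" "distr M M T = M" "AE x in M. P x"
  shows "AE x in M. P (T x)"
proof (rule AE_distrD[OF assms(1)])
  show "AE x in distr M M T. P x" unfolding assms(2) by (rule assms(3))
qed

lemma measure_preserving_funpow:
  assumes T: "T \<in> M \<rightarrow>\<^sub>M M" "distr M M T = M"
  shows "(T ^^ n) \<in> M \<rightarrow>\<^sub>M M" "distr M M (T ^^ n) = M"
proof -
  have "(T ^^ n) \<in> M \<rightarrow>\<^sub>M M \<and> distr M M (T ^^ n) = M"
  proof (induction n)
    case (Suc n)
    have "distr M M (T \<circ> (T ^^ n)) = distr (distr M M (T ^^ n)) M T"
      using T Suc by (subst distr_distr) auto
    then have "distr M M (T \<circ> (T ^^ n)) = M" using Suc T by simp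
    moreover have "T \<circ> (T ^^ n) \<in> M \<rightarrow>\<^sub>M M" using Suc T by (intro measurable_comp) auto
    ultimately show ?case by (simp only: funpow.simps)
  qed (auto simp: distr_id id_def distr_cong)
  then show "(T ^^ n) \<in> M \<rightarrow>\<^sub>M M" "distr M M (T ^^ n) = M" by auto
qed

locale ergodic_system = prob_space M for M :: "'a::metric_space measure" +
  fixes T :: "'a \<Rightarrow> 'a"
  assumes imp: "invertible_measure_preserving M T" and ergodic: "ergodic M T"
begin

lemma T_meas [measurable]: "T \<in> M \<rightarrow>\<^sub>M M" and T_distr: "distr M M T = M"
  using imp by (auto simp: invertible_measure_preserving_def)

lemmas Tn_meas [measurable] = measure_preserving_funpow(1)[OF T_meas T_distr]
lemmas Tn_distr = measure_preserving_funpow(2)[OF T_meas T_distr]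

lemma T_space: "x \<in> space M \<Longrightarrow> T x \<in> space M"
  using T_meas by (rule measurable_space)

text \<open>Ergodicity is stated for strictly invariant sets. An almost invariant A is replaced by
  the set of points visiting A infinitely often, which is strictly invariant and agrees with A
  almost everywhere.\<close>

lemma invariant_set_trivial:
  assumes A: "A \<in> sets M" and inv: "AE x in M. T x \<in> A \<longleftrightarrow> x \<in> A"
  shows "prob A \<in> {0, 1}"
proof -
  define B where "B = {x\<in>space M. \<forall>n. \<exists>m\<ge>n. (T ^^ m) x \<in> A}"
  have B: "B \<in> sets M" unfolding B_def using A by measurable
  have "T -` B \<inter> space M = B"
  proof -
    have "(\<forall>n. \<exists>m\<ge>n. (T ^^ m) (T x) \<in> A) \<longleftrightarrow> (\<forall>n. \<exists>m\<ge>n. (T ^^ m) x \<in> A)" for x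
    proof -
      have eq: "(T ^^ m) (T x) = (T ^^ Suc m) x" for m by (simp add: funpow_swap1)
      show ?thesis
        unfolding eq
      proof (intro iffI allI)
        fix n
        { assume *: "\<forall>n. \<exists>m\<ge>n. (T ^^ Suc m) x \<in> A"
          then obtain m where "m \<ge> n" "(T ^^ Suc m) x \<in> A" by blast
          then show "\<exists>m\<ge>n. (T ^^ m) x \<in> A" by (intro exI[of _ "Suc m"]) auto }
        { assume *: "\<forall>n. \<exists>m\<ge>n. (T ^^ m) x \<in> A"
          then obtain m where "m \<ge> Suc n" "(T ^^ m) x \<in> A" by blast
          then show "\<exists>m\<ge>n. (T ^^ Suc m) x \<in> A" by (intro exI[of _ "m - 1"]) (auto simp: Suc_le_eq) }
      qed
    qed
    then show ?thesis using T_space by (auto simp: B_def)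
  qed
  then have "prob B \<in> {0, 1}" using ergodic B by (simp add: ergodic_def)
  moreover have "AE x in M. x \<in> B \<longleftrightarrow> x \<in> A"
  proof -
    have "AE x in M. \<forall>n. (T ^^ Suc n) x \<in> A \<longleftrightarrow> (T ^^ n) x \<in> A"
      unfolding AE_all_countable using AE_comp_measure_preserving[OF Tn_meas Tn_distr inv] by simp
    then show ?thesis using AE_space
    proof eventually_elim
      case (elim x)
      have "(T ^^ n) x \<in> A \<longleftrightarrow> x \<in> A" for n by (induction n) (use elim in auto)
      then show ?case using elim by (auto simp: B_def)
    qed
  qed
  then have "prob B = prob A" using A B by (intro finite_measure_eq_AE) auto
  ultimately show ?thesis by simp
qed

lemma invariant_function_const:
  fixes f :: "'a \<Rightarrow> complex"
  assumes f: "f \<in> borel_measurable M" and inv: "AE x in M. f (T x) = f x"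
  obtains c where "AE x in M. f x = c"
proof (rule AE_const_if_level_sets_trivial_complex[OF f])
  note [measurable] = f
  fix t
  have "AE x in M. T x \<in> {x\<in>space M. Re (f x) > t} \<longleftrightarrow> x \<in> {x\<in>space M. Re (f x) > t}"
    using inv AE_space by eventually_elim (auto simp: T_space)
  then show "prob {x\<in>space M. Re (f x) > t} \<in> {0, 1}" by (intro invariant_set_trivial) measurable
  have "AE x in M. T x \<in> {x\<in>space M. Im (f x) > t} \<longleftrightarrow> x \<in> {x\<in>space M. Im (f x) > t}"
    using inv AE_space by eventually_elim (auto simp: T_space)
  then show "prob {x\<in>space M. Im (f x) > t} \<in> {0, 1}" by (intro invariant_set_trivial) measurable
qed (use that in blast)

lemma eigenfunction_norm_const:
  fixes f :: "'a \<Rightarrow> complex"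
  assumes f: "f \<in> borel_measurable M" and eig: "AE x in M. f (T x) = c * f x" and c: "norm c = 1"
  obtains d where "d \<ge> 0" "AE x in M. norm (f x) = d"
proof -
  have "AE x in M. complex_of_real (norm (f (T x))) = of_real (norm (f x))"
    using eig by eventually_elim (simp add: norm_mult c)
  then obtain d where d: "AE x in M. complex_of_real (norm (f x)) = d"
    using invariant_function_const[of "\<lambda>x. of_real (norm (f x))"] f by auto
  then have "AE x in M. norm (f x) = Re d" by eventually_elim auto
  moreover from this have "Re d \<ge> 0"
  proof -
    assume "AE x in M. norm (f x) = Re d"
    then have "AE x in M. Re d \<ge> 0" by eventually_elim (metis norm_ge_zero)
    then show ?thesis by (simp add: AE_const)
  qed
  ultimately show thesis using that by blast
qed

lemma eigenfunction_Linf: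
  fixes f :: "'a \<Rightarrow> complex"
  assumes f: "f \<in> borel_measurable M" and eig: "AE x in M. f (T x) = c * f x" and c: "norm c = 1"
  shows "f \<in> Linf M"
proof -
  obtain d where "AE x in M. norm (f x) = d" using eigenfunction_norm_const[OF assms] .
  then have "AE x in M. norm (f x) \<le> d" by eventually_elim simp
  then show ?thesis using f by (auto simp: Linf_def)
qed

lemma eigenfunction_funpow:
  fixes f :: "'a \<Rightarrow> complex"
  assumes "AE x in M. f (T x) = c * f x"
  shows "AE x in M. f ((T ^^ n) x) = c ^ n * f x"
proof (induction n)
  case (Suc n)
  from AE_comp_measure_preserving[OF Tn_meas Tn_distr assms, of n] Suc show ?case
    by eventually_elim simp
qed simp

text \<open>The n-th power of an eigenfunction serves: its modulus is constant by ergodicity, so the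
  power is bounded and does not vanish.\<close>

lemma eigenvalue_power:
  assumes "L2_eigenvalue M T c" and c: "norm c = 1"
  shows "L2_eigenvalue M T (c ^ n)"
proof -
  obtain f where f: "f \<in> L2 M" "\<not> (AE x in M. f x = 0)" "AE x in M. f (T x) = c * f x"
    using assms(1) by (auto simp: L2_eigenvalue_def)
  have fm: "f \<in> borel_measurable M" using f by simp
  obtain d where d: "AE x in M. norm (f x) = d" using eigenfunction_norm_const[OF fm f(3) c] .
  have d0: "d \<noteq> 0" using f(2) d by auto
  have eig: "AE x in M. f (T x) ^ n = c ^ n * f x ^ n"
    using f(3) by eventually_elim (simp add: power_mult_distrib)
  have "(\<lambda>x. f x ^ n) \<in> Linf M"
    by (rule eigenfunction_Linf[OF _ eig]) (use fm c in \<open>auto simp: norm_power\<close>)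
  then have "(\<lambda>x. f x ^ n) \<in> L2 M" using Linf_subset_L2 by blast
  moreover have "\<not> (AE x in M. f x ^ n = 0)"
  proof
    assume "AE x in M. f x ^ n = 0"
    with d have "AE x in M. False" by eventually_elim (use d0 in auto)
    then show False using AE_False not_empty by (simp add: AE_const)
  qed
  ultimately show ?thesis using eig unfolding L2_eigenvalue_def by (intro bexI[of _ "\<lambda>x. f x ^ n"] conjI)
qed

end

section \<open>Orthogonality along an additive and a multiplicative action\<close>

text \<open>If the sum converged, all primes could be declared exceptional within the budget, and
  \<open>monochromatic_prime_pair\<close> would produce a pair outside the set of all
  numbers.\<close>

lemma primes_reciprocals_not_summable: "\<not> (\<lambda>p. 1 / real p) summable_on {p. prime p}"
proof
  assume sm: "(\<lambda>p. 1 / real p) summable_on {p::nat. prime p}"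
  define s where "s = infsum (\<lambda>p. 1 / real p) {p::nat. prime p}"
  show False
  proof (rule monochromatic_prime_pair[of 1 1 s, where ?'c = unit])
    fix Y :: nat
    assume Y: "\<And>(col :: nat \<Rightarrow> unit) Bd. finite (col ` {p. prime p}) \<Longrightarrow> card (col ` {p. prime p}) \<le> 1 \<Longrightarrow>
       (\<Sum>p | prime p \<and> p \<in> Bd \<and> p \<le> Y. 1 / real p) \<le> s \<Longrightarrow>
       \<exists>p p'. prime p \<and> prime p' \<and> p \<notin> Bd \<and> p' \<notin> Bd \<and> p \<le> Y \<and> p' \<le> Y \<and> col p = col p' \<and>
         1 \<le> ln (real p') - ln (real p) \<and> ln (real p') - ln (real p) \<le> 100 * real 1 * 1"
    have "(\<Sum>p | prime p \<and> p \<in> UNIV \<and> p \<le> Y. 1 / real p) \<le> s"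
      unfolding s_def using sm by (rule finite_sum_le_infsum) auto
    moreover have "card ((\<lambda>_. ()) ` {p::nat. prime p}) \<le> card (UNIV :: unit set)" by (rule card_mono) simp_all
    ultimately show False using Y[of "\<lambda>_. ()" UNIV] by simp
  qed simp_all
qed

lemma (in twisted_action) typical_nonempty: "typical \<noteq> {}"
  using summable_atypical primes_reciprocals_not_summable by auto

locale joint_system = ergodic_system M T + twisted_action M S "\<lambda>_. 1"
  for M :: "'a::metric_space measure" and T :: "'a \<Rightarrow> 'a" and S :: "nat \<Rightarrow> 'a \<Rightarrow> 'a"
begin

definition B :: "('a \<Rightarrow> complex) \<Rightarrow> ('a \<Rightarrow> complex) \<Rightarrow> nat \<Rightarrow> 'a \<Rightarrow> complex" where
  "B f G N x = (\<Sum>n=1..N. f ((T ^^ n) x) * G (S n x)) / of_nat N"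

lemma Tn_L2: "f \<in> L2 M \<Longrightarrow> (\<lambda>x. f ((T ^^ n) x)) \<in> L2 M"
  and Tn_norm: "f \<in> L2 M \<Longrightarrow> L2_norm M (\<lambda>x. f ((T ^^ n) x)) = L2_norm M f"
  using L2_comp_measure_preserving[OF Tn_meas Tn_distr] by auto

lemma S_AE: "n \<ge> 1 \<Longrightarrow> AE x in M. P x \<Longrightarrow> AE x in M. P (S n x)"
  using AE_comp_measure_preserving[of "S n" M P] S_imp[of n] by (auto simp: invertible_measure_preserving_def)

lemma S_meas: "n \<ge> 1 \<Longrightarrow> S n \<in> M \<rightarrow>\<^sub>M M"
  using S_imp[of n] by (auto simp: invertible_measure_preserving_def)

lemma term_L2:
  assumes f: "f \<in> L2 M" and G: "G \<in> borel_measurable M" "AE x in M. norm (G x) \<le> C" and n: "n \<ge> 1"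
  shows "(\<lambda>x. f ((T ^^ k) x) * G (S n x)) \<in> L2 M"
    and "L2_norm M (\<lambda>x. f ((T ^^ k) x) * G (S n x)) \<le> \<bar>C\<bar> * L2_norm M f"
proof -
  have m: "(\<lambda>x. G (S n x)) \<in> borel_measurable M" using measurable_compose[OF S_meas[OF n] G(1)] .
  show "(\<lambda>x. f ((T ^^ k) x) * G (S n x)) \<in> L2 M"
    by (rule L2_mult_bounded(1)[OF Tn_L2[OF f] m S_AE[OF n G(2)]])
  show "L2_norm M (\<lambda>x. f ((T ^^ k) x) * G (S n x)) \<le> \<bar>C\<bar> * L2_norm M f"
    using L2_mult_bounded(2)[OF Tn_L2[OF f] m S_AE[OF n G(2)]] by (simp add: Tn_norm f)
qed

lemma B_L2:
  assumes "f \<in> L2 M" "G \<in> borel_measurable M" "AE x in M. norm (G x) \<le> C"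
  shows "B f G N \<in> L2 M"
proof -
  have "(\<lambda>x. (1 / of_nat N) * (\<Sum>n=1..N. f ((T ^^ n) x) * G (S n x))) \<in> L2 M"
    using assms by (intro L2_scale L2_sum term_L2) auto
  then show ?thesis by (simp add: B_def[abs_def])
qed

lemma B_norm_le:
  assumes "f \<in> L2 M" "G \<in> borel_measurable M" "AE x in M. norm (G x) \<le> C"
  shows "L2_norm M (B f G N) \<le> \<bar>C\<bar> * L2_norm M f"
proof (cases "N = 0")
  case False
  have "B f G N = (\<lambda>x. (1 / of_nat N) * (\<Sum>n=1..N. f ((T ^^ n) x) * G (S n x)))"
    by (simp add: B_def[abs_def])
  then have "L2_norm M (B f G N) = 1 / real N * L2_norm M (\<lambda>x. \<Sum>n=1..N. f ((T ^^ n) x) * G (S n x))"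
    by (simp only: L2_norm_scale) (simp add: norm_divide)
  also have "\<dots> \<le> 1 / real N * (\<Sum>n=1..N. L2_norm M (\<lambda>x. f ((T ^^ n) x) * G (S n x)))"
    using assms by (intro mult_left_mono L2_norm_sum_le term_L2) auto
  also have "\<dots> \<le> 1 / real N * (\<Sum>n=1..N. \<bar>C\<bar> * L2_norm M f)"
    using assms by (intro mult_left_mono sum_mono term_L2) auto
  also have "\<dots> = \<bar>C\<bar> * L2_norm M f" using False by simp
  finally show ?thesis .
next
  case True
  then have "B f G N = (\<lambda>x. 0)" by (simp add: B_def[abs_def])
  then show ?thesis by (simp add: L2_norm_zero)
qed

lemma Tn_integral: "h \<in> borel_measurable M \<Longrightarrow> (LINT x|M. h ((T ^^ k) x)) = (LINT x|M. h x)"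
  for h :: "'a \<Rightarrow> complex"
  using integral_distr[OF Tn_meas[of k], of h] by (simp add: Tn_distr)

text \<open>A property of coboundaries of T^d. It is the form in which orthogonality to the
  T^d-invariant functions enters Katai's criterion, with a bound uniform in the length of the
  sum.\<close>

definition bounded_sums :: "nat \<Rightarrow> ('a \<Rightarrow> complex) \<Rightarrow> bool" where
  "bounded_sums d f \<longleftrightarrow> (\<exists>C. \<forall>K. L2_norm M (\<lambda>x. \<Sum>m=1..K. f ((T ^^ (d * m)) x)) \<le> C)"

text \<open>Invariance of the measure under the p' m-th iterate turns the correlation of the
  iterates p m and p' m into that of f with its iterate d m. The sum over m then falls on one
  factor, and Cauchy-Schwarz applies.\<close>

lemma sum_correlation_le:
  assumes f: "f \<in> L2 M" and C: "\<And>K. L2_norm M (\<lambda>x. \<Sum>m=1..K. f ((T ^^ (d * m)) x)) \<le> C"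
    and p: "p = p' + d"
  shows "norm (\<Sum>m=1..K. LINT x|M. f ((T ^^ (p * m)) x) * cnj (f ((T ^^ (p' * m)) x))) \<le> C * L2_norm M f"
proof -
  have fm: "f \<in> borel_measurable M" using f by simp
  have cf: "(\<lambda>x. cnj (f x)) \<in> L2 M" using f by (rule L2_cnj)
  have "(LINT x|M. f ((T ^^ (p * m)) x) * cnj (f ((T ^^ (p' * m)) x)))
      = (LINT x|M. f ((T ^^ (d * m)) x) * cnj (f x))" for m
  proof -
    have "(T ^^ (p * m)) x = (T ^^ (d * m)) ((T ^^ (p' * m)) x)" for x
      unfolding p by (simp add: add_mult_distrib add.commute funpow_add)
    moreover have "(\<lambda>x. f ((T ^^ (d * m)) x) * cnj (f x)) \<in> borel_measurable M"
      by (intro borel_measurable_times measurable_compose[OF Tn_meas fm] L2_measurable[OF cf])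
    ultimately show ?thesis
      using Tn_integral[of "\<lambda>x. f ((T ^^ (d * m)) x) * cnj (f x)" "p' * m"] by simp
  qed
  then have "(\<Sum>m=1..K. LINT x|M. f ((T ^^ (p * m)) x) * cnj (f ((T ^^ (p' * m)) x)))
      = (\<Sum>m=1..K. LINT x|M. f ((T ^^ (d * m)) x) * cnj (f x))" by simp
  also have "\<dots> = (LINT x|M. (\<Sum>m=1..K. f ((T ^^ (d * m)) x)) * cnj (f x))"
    using L2_Cauchy_Schwarz(1)[OF Tn_L2[OF f] cf]
    by (subst Bochner_Integration.integral_sum[symmetric]) (auto simp: sum_distrib_right)
  also have "norm \<dots> \<le> L2_norm M (\<lambda>x. \<Sum>m=1..K. f ((T ^^ (d * m)) x)) * L2_norm M (\<lambda>x. cnj (f x))"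
    by (intro L2_Cauchy_Schwarz(3) L2_sum Tn_L2 f cf)
  also have "L2_norm M (\<lambda>x. cnj (f x)) = L2_norm M f" by (simp add: L2_norm_def)
  also have "L2_norm M (\<lambda>x. \<Sum>m=1..K. f ((T ^^ (d * m)) x)) * L2_norm M f \<le> C * L2_norm M f"
    by (intro mult_right_mono C) auto
  finally show ?thesis .
qed

text \<open>A form of Katai's orthogonality criterion. On a colour class the factor \<open>G (S (p * m) x)\<close> depends on \<open>m\<close>
  only, so that after the dual Turan--Kubilius inequality it can be bounded pointwise and discarded.\<close>

lemma katai:
  assumes f: "f \<in> L2 M" and G: "G \<in> borel_measurable M" "AE x in M. norm (G x) \<le> C" and C: "C \<ge> 0"
    and P: "finite P" "P \<noteq> {}" "\<And>p. p \<in> P \<Longrightarrow> prime p" "\<And>p. p \<in> P \<Longrightarrow> colour p = colour p0" and p0: "p0 \<ge> 1"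
    and bs: "\<And>d. 1 \<le> d \<Longrightarrow> d \<le> Max P \<Longrightarrow> bounded_sums d f"
  shows "\<forall>\<^sub>F N in sequentially. L2_norm M (B f G N) \<le> 3 * C * (L2_norm M f + 1) / sqrt (\<Sum>p\<in>P. 1 / real p)"
proof -
  define L where "L = (\<Sum>p\<in>P. 1 / real p)"
  define a where "a = L2_norm M f"
  have a: "a \<ge> 0" by (simp add: a_def)
  have p1: "p \<ge> 1" if "p \<in> P" for p using P(3)[OF that] prime_gt_0_nat[of p] by simp
  have L: "L > 0" unfolding L_def using P(1,2) p1 by (intro sum_pos) force+
  obtain E where E: "\<And>d K. 1 \<le> d \<Longrightarrow> d \<le> Max P \<Longrightarrow> L2_norm M (\<lambda>x. \<Sum>m=1..K. f ((T ^^ (d * m)) x)) \<le> E d"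
    using bs unfolding bounded_sums_def by metis
  \<comment> \<open>Only finitely many differences of primes in \<open>P\<close> occur, so one
    constant serves for all of them.\<close>
  define E0 where "E0 = (\<Sum>d=1..Max P. \<bar>E d\<bar>)"
  have E0: "L2_norm M (\<lambda>x. \<Sum>m=1..K. f ((T ^^ (d * m)) x)) \<le> E0" if "1 \<le> d" "d \<le> Max P" for d K
  proof -
    have "\<bar>E d\<bar> \<le> E0" unfolding E0_def using that by (intro member_le_sum) auto
    then show ?thesis using E[OF that, of K] by linarith
  qed
  define cor where "cor = (\<lambda>p r m. LINT x|M. f ((T ^^ (p * m)) x) * cnj (f ((T ^^ (r * m)) x)))"
  have cor_ne: "norm (\<Sum>m=1..K. cor p r m) \<le> E0 * a" if pr: "p \<in> P" "r \<in> P" "p \<noteq> r" for p r K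
  proof -
    have *: "norm (\<Sum>m=1..K. cor p r m) \<le> E0 * a" if "p \<in> P" "r \<in> P" "r < p" for p r
    proof -
      have "p \<le> Max P" using that P(1) by simp
      then show ?thesis unfolding cor_def a_def using that
        by (intro sum_correlation_le[where d = "p - r"] f E0) auto
    qed
    show ?thesis
    proof (cases "r < p")
      case True
      then show ?thesis using *[of p r] pr by simp
    next
      case False
      have "cor p r m = cnj (cor r p m)" for m
        unfolding cor_def by (subst Bochner_Integration.integral_cnj[symmetric]) (simp add: mult.commute)
      then have "norm (\<Sum>m=1..K. cor p r m) = norm (\<Sum>m=1..K. cor r p m)"
        by (simp flip: cnj_sum)
      then show ?thesis using *[of r p] False pr by simp
    qed
  qed
  have cor_eq: "norm (\<Sum>m=1..K. cor p p m) \<le> real K * a\<^sup>2" for p K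
  proof -
    have "norm (cor p p m) \<le> a\<^sup>2" for m
    proof -
      have "norm (cor p p m) \<le> L2_norm M (\<lambda>x. f ((T ^^ (p * m)) x)) * L2_norm M (\<lambda>x. cnj (f ((T ^^ (p * m)) x)))"
        unfolding cor_def using Tn_L2[OF f, of "p * m"] by (intro L2_Cauchy_Schwarz(3) L2_cnj)
      also have "L2_norm M (\<lambda>x. cnj (f ((T ^^ (p * m)) x))) = L2_norm M (\<lambda>x. f ((T ^^ (p * m)) x))"
        by (simp add: L2_norm_def)
      finally show ?thesis using f by (simp add: Tn_norm a_def power2_eq_square)
    qed
    then have "norm (\<Sum>m=1..K. cor p p m) \<le> (\<Sum>m=1..K. a\<^sup>2)" by (intro order_trans[OF norm_sum] sum_mono)
    then show ?thesis by simp
  qed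
  \<comment> \<open>Beyond this threshold all off-diagonal correlations together are at most N L,
    the order of the diagonal.\<close>
  have "\<forall>\<^sub>F N in sequentially. real N \<ge> (real (card P))\<^sup>2 * (E0 * a) / L"
    by (rule eventually_compose_filterlim[OF eventually_ge_at_top filterlim_real_sequentially])
  moreover have "\<forall>\<^sub>F N in sequentially. real N \<ge> real (\<Sum>P)"
    by (rule eventually_compose_filterlim[OF eventually_ge_at_top filterlim_real_sequentially])
  moreover have "\<forall>\<^sub>F N in sequentially. real N > 0"
    by (rule eventually_compose_filterlim[OF eventually_gt_at_top filterlim_real_sequentially])
  ultimately show ?thesis
  proof eventually_elim
    case (elim N)
    define b where "b = (\<lambda>n x. f ((T ^^ n) x) * G (S n x))"
    have bL: "b n \<in> L2 M" "L2_norm M (b n) \<le> C * a" if "n \<ge> 1" for n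
      using term_L2[OF f G that, of n] C by (auto simp: b_def a_def)
    define X where "X = (\<lambda>p x. of_real (real p / real N) * (\<Sum>n\<in>{n\<in>{1..N}. p dvd n}. b n x))"
    have XL: "X p \<in> L2 M" for p unfolding X_def using bL by (intro L2_scale L2_sum) auto
    have BL: "B f G N \<in> L2 M" using f G by (rule B_L2)
    have dL: "(\<lambda>x. X p x - B f G N x) \<in> L2 M" for p by (intro L2_diff XL BL)
    have B_eq: "B f G N x = of_real (1 / real N) * (\<Sum>n=1..N. b n x)" for x by (simp add: B_def b_def)
    have "(\<Sum>p\<in>P. (L2_norm M (\<lambda>x. X p x - B f G N x))\<^sup>2 / real p)
        = (LINT x|M. (\<Sum>p\<in>P. (norm (X p x - B f G N x))\<^sup>2 / real p))"
      unfolding L2_norm_square using L2_integrable[OF dL] by (subst Bochner_Integration.integral_sum) auto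
    also have "\<dots> \<le> (LINT x|M. 2 / real N * (\<Sum>n=1..N. (norm (b n x))\<^sup>2))"
    proof (rule integral_mono)
      show "integrable M (\<lambda>x. \<Sum>p\<in>P. (norm (X p x - B f G N x))\<^sup>2 / real p)"
        using L2_integrable[OF dL] by (intro Bochner_Integration.integrable_sum integrable_divide) auto
      show "integrable M (\<lambda>x. 2 / real N * (\<Sum>n=1..N. (norm (b n x))\<^sup>2))"
        using L2_integrable[OF bL(1)] by (intro integrable_mult_right Bochner_Integration.integrable_sum) auto
      show "(\<Sum>p\<in>P. (norm (X p x - B f G N x))\<^sup>2 / real p) \<le> 2 / real N * (\<Sum>n=1..N. (norm (b n x))\<^sup>2)" for x
        unfolding X_def B_eq using elim P by (intro dual_turan_kubilius) auto
    qed
    also have "\<dots> = 2 / real N * (\<Sum>n=1..N. (L2_norm M (b n))\<^sup>2)"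
      unfolding L2_norm_square using L2_integrable[OF bL(1)]
      by (subst integral_mult_right_zero, subst Bochner_Integration.integral_sum) auto
    also have "\<dots> \<le> 2 / real N * (\<Sum>n=1..N. (C * a)\<^sup>2)"
      using bL by (intro mult_left_mono sum_mono power_mono) auto
    also have "\<dots> = 2 * (C * a)\<^sup>2" using elim by simp
    finally have tk: "(\<Sum>p\<in>P. (L2_norm M (\<lambda>x. X p x - B f G N x))\<^sup>2 / real p) \<le> 2 * (C * a)\<^sup>2" .

    have "(\<Sum>p\<in>P. 1 / real p * L2_norm M (\<lambda>x. X p x - B f G N x))\<^sup>2
        = (\<Sum>p\<in>P. (1 / sqrt (real p)) * (L2_norm M (\<lambda>x. X p x - B f G N x) / sqrt (real p)))\<^sup>2"
      by (intro arg_cong[where f = "\<lambda>x. x\<^sup>2"] sum.cong refl) simp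
    also have "\<dots> \<le> (\<Sum>p\<in>P. (1 / sqrt (real p))\<^sup>2) * (\<Sum>p\<in>P. (L2_norm M (\<lambda>x. X p x - B f G N x) / sqrt (real p))\<^sup>2)"
      by (rule Cauchy_Schwarz_ineq_sum)
    also have "\<dots> = L * (\<Sum>p\<in>P. (L2_norm M (\<lambda>x. X p x - B f G N x))\<^sup>2 / real p)"
      by (simp add: L_def power_divide)
    also have "\<dots> \<le> L * (2 * (C * a)\<^sup>2)" using tk L by (intro mult_left_mono) auto
    finally have cs: "(\<Sum>p\<in>P. 1 / real p * L2_norm M (\<lambda>x. X p x - B f G N x)) \<le> sqrt (L * (2 * (C * a)\<^sup>2))"
      by (rule real_le_rsqrt)

    \<comment> \<open>The Turan-Kubilius approximations averaged with weights 1 / p, which recovers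
      L times the joint average up to the error bounded in \<open>cs\<close>.\<close>
    define Z where "Z = (\<lambda>x. \<Sum>p\<in>P. of_real (1 / real p) * X p x)"
    have ZL: "Z \<in> L2 M" unfolding Z_def by (intro L2_sum L2_scale XL)
    have "Z x - (\<Sum>p\<in>P. of_real (1 / real p) * (X p x - B f G N x)) = of_real L * B f G N x" for x
    proof -
      have "(\<Sum>p\<in>P. of_real (1 / real p) * (X p x - B f G N x))
          = (\<Sum>p\<in>P. of_real (1 / real p) * X p x) - (\<Sum>p\<in>P. of_real (1 / real p)) * B f G N x"
        by (simp only: right_diff_distrib sum_subtractf sum_distrib_right)
      moreover have "(\<Sum>p\<in>P. complex_of_real (1 / real p)) = of_real L" by (simp only: L_def of_real_sum)
      ultimately show ?thesis unfolding Z_def by simp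
    qed
    then have "(\<lambda>x. of_real L * B f G N x) = (\<lambda>x. Z x - (\<Sum>p\<in>P. of_real (1 / real p) * (X p x - B f G N x)))"
      by (intro ext) (rule sym)
    then have "L2_norm M (\<lambda>x. of_real L * B f G N x)
        = L2_norm M (\<lambda>x. Z x - (\<Sum>p\<in>P. of_real (1 / real p) * (X p x - B f G N x)))"
      by (rule arg_cong)
    also have "\<dots> \<le> L2_norm M Z + L2_norm M (\<lambda>x. \<Sum>p\<in>P. of_real (1 / real p) * (X p x - B f G N x))"
      by (intro L2_norm_triangle_diff ZL L2_sum L2_scale dL)
    also have "L2_norm M (\<lambda>x. \<Sum>p\<in>P. of_real (1 / real p) * (X p x - B f G N x))
        \<le> (\<Sum>p\<in>P. L2_norm M (\<lambda>x. of_real (1 / real p) * (X p x - B f G N x)))"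
      by (intro L2_norm_sum_le L2_scale dL)
    also have "\<dots> = (\<Sum>p\<in>P. 1 / real p * L2_norm M (\<lambda>x. X p x - B f G N x))"
      unfolding L2_norm_scale norm_of_real by simp
    finally have main1: "L * L2_norm M (B f G N) \<le> L2_norm M Z + sqrt (L * (2 * (C * a)\<^sup>2))"
      unfolding L2_norm_scale norm_of_real using cs L by simp

    \<comment> \<open>The sum over p with the common factor G' (S m x) removed. Once this factor is
      bounded by C, Cauchy-Schwarz in m leads to the squared norms of \<Phi> m, which expand into
      correlations. The cutoff m <= N div p records p m <= N.\<close>
    define \<Phi> where "\<Phi> = (\<lambda>m x. \<Sum>p\<in>{p\<in>P. m \<le> N div p}. f ((T ^^ (p * m)) x))"
    have \<Phi>L: "\<Phi> m \<in> L2 M" for m unfolding \<Phi>_def by (intro L2_sum Tn_L2 f)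
    define G' where "G' = (\<lambda>x. G (S p0 x))"
    have G'm: "G' \<in> borel_measurable M" unfolding G'_def using measurable_compose[OF S_meas[OF p0] G(1)] .
    have G'b: "AE x in M. norm (G' x) \<le> C" unfolding G'_def by (rule S_AE[OF p0 G(2)])
    have Z_eq: "Z x = of_real (1 / real N) * (\<Sum>m=1..N. \<Phi> m x * G' (S m x))" if x: "x \<in> space M" for x
    proof -
      have "of_real (1 / real p) * X p x = of_real (1 / real N) * (\<Sum>m=1..N. if m \<le> N div p then f ((T ^^ (p * m)) x) * G' (S m x) else 0)"
        if p: "p \<in> P" for p
      proof -
        have "(\<Sum>n\<in>{n\<in>{1..N}. p dvd n}. b n x) = (\<Sum>m=1..N div p. b (p * m) x)"
          unfolding multiples_eq_image[OF p1[OF p]] using p1[OF p] by (subst sum.reindex) (auto intro!: inj_onI)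
        also have "\<dots> = (\<Sum>m=1..N div p. f ((T ^^ (p * m)) x) * G' (S m x))"
        proof (rule sum.cong[OF refl])
          fix m assume m: "m \<in> {1..N div p}"
          have "S (p * m) x = S p (S m x)" using S_mult[of m p x] m p1[OF p] x by simp
          also have "\<dots> = S p0 (S m x)"
            using P(4)[OF p] S_space[of m x] m x unfolding colour_def by (metis atLeastAtMost_iff prod.inject restrict_apply)
          finally show "b (p * m) x = f ((T ^^ (p * m)) x) * G' (S m x)" by (simp add: b_def G'_def)
        qed
        also have "\<dots> = (\<Sum>m\<in>{m\<in>{1..N}. m \<le> N div p}. f ((T ^^ (p * m)) x) * G' (S m x))"
        proof (rule sum.cong)
          have "N div p \<le> N" by simp
          then have "m \<in> {1..N div p} \<longleftrightarrow> m \<in> {m\<in>{1..N}. m \<le> N div p}" for m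
            by (simp only: atLeastAtMost_iff mem_Collect_eq) linarith
          then show "{1..N div p} = {m\<in>{1..N}. m \<le> N div p}" by blast
        qed simp
        also have "\<dots> = (\<Sum>m=1..N. if m \<le> N div p then f ((T ^^ (p * m)) x) * G' (S m x) else 0)"
          by (rule sum.inter_filter) simp
        finally show ?thesis unfolding X_def using p1[OF p] by simp
      qed
      then have "Z x = of_real (1 / real N) * (\<Sum>p\<in>P. \<Sum>m=1..N. if m \<le> N div p then f ((T ^^ (p * m)) x) * G' (S m x) else 0)"
        unfolding Z_def sum_distrib_left by simp
      also have "(\<Sum>p\<in>P. \<Sum>m=1..N. if m \<le> N div p then f ((T ^^ (p * m)) x) * G' (S m x) else 0)
          = (\<Sum>m=1..N. \<Sum>p\<in>P. if m \<le> N div p then f ((T ^^ (p * m)) x) * G' (S m x) else 0)" by (rule sum.swap)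
      also have "\<dots> = (\<Sum>m=1..N. \<Phi> m x * G' (S m x))"
      proof (rule sum.cong[OF refl])
        fix m
        have "\<Phi> m x = (\<Sum>p\<in>P. if m \<le> N div p then f ((T ^^ (p * m)) x) else 0)"
          unfolding \<Phi>_def using P(1) by (rule sum.inter_filter)
        then show "(\<Sum>p\<in>P. if m \<le> N div p then f ((T ^^ (p * m)) x) * G' (S m x) else 0) = \<Phi> m x * G' (S m x)"
          by (simp only: sum_distrib_right) (rule sum.cong[OF refl], simp)
      qed
      finally show ?thesis .
    qed
    have GS: "(\<lambda>x. G' (S m x)) \<in> borel_measurable M" "AE x in M. norm (G' (S m x)) \<le> C" if "m \<ge> 1" for m
      using measurable_compose[OF S_meas[OF that] G'm] S_AE[OF that G'b] by auto
    have \<Phi>G: "(\<lambda>x. \<Phi> m x * G' (S m x)) \<in> L2 M" "L2_norm M (\<lambda>x. \<Phi> m x * G' (S m x)) \<le> C * L2_norm M (\<Phi> m)" if "m \<ge> 1" for m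
      using L2_mult_bounded[OF \<Phi>L GS[OF that]] C by auto
    have "L2_norm M Z = L2_norm M (\<lambda>x. of_real (1 / real N) * (\<Sum>m=1..N. \<Phi> m x * G' (S m x)))"
      by (rule L2_norm_cong) (rule Z_eq)
    also have "\<dots> = 1 / real N * L2_norm M (\<lambda>x. \<Sum>m=1..N. \<Phi> m x * G' (S m x))"
      unfolding L2_norm_scale norm_of_real by simp
    also have "\<dots> \<le> 1 / real N * (\<Sum>m=1..N. L2_norm M (\<lambda>x. \<Phi> m x * G' (S m x)))"
      by (intro mult_left_mono L2_norm_sum_le \<Phi>G) auto
    also have "\<dots> \<le> 1 / real N * (\<Sum>m=1..N. C * L2_norm M (\<Phi> m))"
      by (intro mult_left_mono sum_mono \<Phi>G) auto
    also have "\<dots> = C / real N * (\<Sum>m=1..N. 1 * L2_norm M (\<Phi> m))" by (simp add: sum_distrib_left)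
    also have "\<dots> \<le> C / real N * sqrt (real N * (\<Sum>m=1..N. (L2_norm M (\<Phi> m))\<^sup>2))"
    proof (rule mult_left_mono)
      show "(\<Sum>m=1..N. 1 * L2_norm M (\<Phi> m)) \<le> sqrt (real N * (\<Sum>m=1..N. (L2_norm M (\<Phi> m))\<^sup>2))"
        using Cauchy_Schwarz_ineq_sum[of "\<lambda>_. 1" "\<lambda>m. L2_norm M (\<Phi> m)" "{1..N}"] by (intro real_le_rsqrt) simp
    qed (use C in simp)
    finally have Zle: "L2_norm M Z \<le> C / real N * sqrt (real N * (\<Sum>m=1..N. (L2_norm M (\<Phi> m))\<^sup>2))" .
    have "complex_of_real (\<Sum>m=1..N. (L2_norm M (\<Phi> m))\<^sup>2) = (\<Sum>p\<in>P. \<Sum>r\<in>P. \<Sum>m=1..min (N div p) (N div r). cor p r m)"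
    proof -
      have "complex_of_real ((L2_norm M (\<Phi> m))\<^sup>2) = (\<Sum>p\<in>P. \<Sum>r\<in>P. if m \<le> min (N div p) (N div r) then cor p r m else 0)" for m
      proof -
        have cf: "(\<lambda>x. cnj (f ((T ^^ k) x))) \<in> L2 M" for k using Tn_L2[OF f, of k] by (rule L2_cnj)
        have "complex_of_real ((L2_norm M (\<Phi> m))\<^sup>2) = (LINT x|M. complex_of_real ((norm (\<Phi> m x))\<^sup>2))"
          unfolding L2_norm_square by (rule integral_complex_of_real[symmetric])
        also have "\<dots> = (LINT x|M. (\<Sum>p\<in>{p\<in>P. m \<le> N div p}. \<Sum>r\<in>{p\<in>P. m \<le> N div p}.
            f ((T ^^ (p * m)) x) * cnj (f ((T ^^ (r * m)) x))))"
          unfolding complex_norm_square \<Phi>_def by (simp add: sum_product)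
        also have "\<dots> = (\<Sum>p\<in>{p\<in>P. m \<le> N div p}. \<Sum>r\<in>{p\<in>P. m \<le> N div p}. cor p r m)"
          unfolding cor_def using L2_Cauchy_Schwarz(1)[OF Tn_L2[OF f] cf]
          by (simp add: Bochner_Integration.integral_sum)
        also have "\<dots> = (\<Sum>p\<in>P. if m \<le> N div p then (\<Sum>r\<in>P. if m \<le> N div r then cor p r m else 0) else 0)"
          using P(1) by (simp add: sum.inter_filter)
        also have "\<dots> = (\<Sum>p\<in>P. \<Sum>r\<in>P. if m \<le> min (N div p) (N div r) then cor p r m else 0)"
          by (intro sum.cong refl) auto
        finally show ?thesis .
      qed
      then have "complex_of_real (\<Sum>m=1..N. (L2_norm M (\<Phi> m))\<^sup>2)
          = (\<Sum>m=1..N. \<Sum>p\<in>P. \<Sum>r\<in>P. if m \<le> min (N div p) (N div r) then cor p r m else 0)" by simp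
      also have "\<dots> = (\<Sum>p\<in>P. \<Sum>m=1..N. \<Sum>r\<in>P. if m \<le> min (N div p) (N div r) then cor p r m else 0)"
        by (rule sum.swap)
      also have "\<dots> = (\<Sum>p\<in>P. \<Sum>r\<in>P. \<Sum>m=1..N. if m \<le> min (N div p) (N div r) then cor p r m else 0)"
        by (intro sum.cong refl sum.swap)
      also have "\<dots> = (\<Sum>p\<in>P. \<Sum>r\<in>P. \<Sum>m=1..min (N div p) (N div r). cor p r m)"
      proof (rule sum.cong[OF refl], rule sum.cong[OF refl])
        fix p r
        have "min (N div p) (N div r) \<le> N" by (simp add: min.coboundedI1)
        then have "{m\<in>{1..N}. m \<le> min (N div p) (N div r)} = {1..min (N div p) (N div r)}" by auto
        then show "(\<Sum>m=1..N. if m \<le> min (N div p) (N div r) then cor p r m else 0) = (\<Sum>m=1..min (N div p) (N div r). cor p r m)"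
          by (subst sum.inter_filter[symmetric]) auto
      qed
      finally show ?thesis .
    qed
    then have "norm (complex_of_real (\<Sum>m=1..N. (L2_norm M (\<Phi> m))\<^sup>2))
        \<le> (\<Sum>p\<in>P. \<Sum>r\<in>P. norm (\<Sum>m=1..min (N div p) (N div r). cor p r m))"
      by (simp only:) (intro order_trans[OF norm_sum] sum_mono order_refl)
    also have "\<dots> \<le> (\<Sum>p\<in>P. \<Sum>r\<in>P. (if r = p then (real N / real p) * a\<^sup>2 else 0) + E0 * a)"
    proof (intro sum_mono)
      fix p r assume pr: "p \<in> P" "r \<in> P"
      have E00: "E0 * a \<ge> 0" using a by (simp add: E0_def sum_nonneg)
      show "norm (\<Sum>m=1..min (N div p) (N div r). cor p r m) \<le> (if r = p then (real N / real p) * a\<^sup>2 else 0) + E0 * a"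
      proof (cases "r = p")
        case True
        have "norm (\<Sum>m=1..N div p. cor p p m) \<le> real (N div p) * a\<^sup>2" by (rule cor_eq)
        also have "\<dots> \<le> (real N / real p) * a\<^sup>2" by (intro mult_right_mono of_nat_div_le_of_nat) auto
        finally show ?thesis using True E00 by simp
      next
        case False
        then show ?thesis using cor_ne[OF pr] by auto
      qed
    qed
    also have "\<dots> = (\<Sum>p\<in>P. (real N / real p) * a\<^sup>2) + real (card P) * real (card P) * (E0 * a)"
      using P(1) by (simp add: sum.distrib)
    also have "(\<Sum>p\<in>P. (real N / real p) * a\<^sup>2) = real N * L * a\<^sup>2"
      by (simp add: L_def sum_distrib_left sum_distrib_right)
    also have "real (card P) * real (card P) * (E0 * a) \<le> real N * L"
      using elim(1) L by (simp add: divide_le_eq power2_eq_square)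
    finally have "(\<Sum>m=1..N. (L2_norm M (\<Phi> m))\<^sup>2) \<le> real N * L * a\<^sup>2 + real N * L"
      by (simp add: sum_nonneg del: of_real_sum)
    also have "\<dots> = real N * L * (a\<^sup>2 + 1)" by (simp add: algebra_simps)
    also have "\<dots> \<le> real N * L * (a + 1)\<^sup>2" using a L by (intro mult_left_mono) (auto simp: power2_eq_square algebra_simps)
    finally have \<Phi>le: "(\<Sum>m=1..N. (L2_norm M (\<Phi> m))\<^sup>2) \<le> real N * L * (a + 1)\<^sup>2" .
    have "L2_norm M Z \<le> C / real N * sqrt (real N * (real N * L * (a + 1)\<^sup>2))"
      using C \<Phi>le by (intro order_trans[OF Zle] mult_left_mono real_sqrt_le_mono) auto
    also have "real N * (real N * L * (a + 1)\<^sup>2) = (real N * (a + 1))\<^sup>2 * L" by (simp add: power2_eq_square)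
    also have "sqrt ((real N * (a + 1))\<^sup>2 * L) = real N * (a + 1) * sqrt L"
      using a by (simp add: real_sqrt_mult)
    also have "C / real N * (real N * (a + 1) * sqrt L) = C * (a + 1) * sqrt L" using elim by simp
    finally have Z2: "L2_norm M Z \<le> C * (a + 1) * sqrt L" .
    have "sqrt (L * (2 * (C * a)\<^sup>2)) = sqrt 2 * (C * a) * sqrt L"
      using C a by (simp add: real_sqrt_mult)
    also have "\<dots> \<le> 2 * (C * (a + 1)) * sqrt L"
      using C a L sqrt_le_D[of 2 4] by (intro mult_right_mono mult_mono mult_left_mono) (auto intro: real_le_lsqrt)
    finally have "L * L2_norm M (B f G N) \<le> 3 * C * (a + 1) * sqrt L"
      using main1 Z2 by (simp add: algebra_simps)
    then have "sqrt L * (sqrt L * L2_norm M (B f G N)) \<le> sqrt L * (3 * C * (a + 1))"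
    proof -
      have "sqrt L * (sqrt L * L2_norm M (B f G N)) = L * L2_norm M (B f G N)"
        unfolding mult.assoc[symmetric] using L by simp
      moreover have "sqrt L * (3 * C * (a + 1)) = 3 * C * (a + 1) * sqrt L" by (rule mult.commute)
      ultimately show ?thesis using \<open>L * L2_norm M (B f G N) \<le> 3 * C * (a + 1) * sqrt L\<close> by linarith
    qed
    then have "sqrt L * L2_norm M (B f G N) \<le> 3 * C * (a + 1)"
      by (rule mult_left_le_imp_le) (use L in simp)
    then show ?case using L by (simp add: L_def[symmetric] a_def[symmetric] pos_le_divide_eq mult.commute)
  qed
qed

end

section \<open>The pretentious rational spectrum\<close>

lemma ennreal_infsum_less_top_iff:
  fixes f :: "'b \<Rightarrow> real"
  assumes "\<And>x. x \<in> A \<Longrightarrow> f x \<ge> 0"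
  shows "(\<Sum>\<^sub>\<infinity>x\<in>A. ennreal (f x)) < \<infinity> \<longleftrightarrow> f summable_on A"
proof
  have sup: "(\<Sum>\<^sub>\<infinity>x\<in>A. ennreal (f x)) = (SUP F\<in>{F. finite F \<and> F \<subseteq> A}. sum (\<lambda>x. ennreal (f x)) F)"
    by (rule nonneg_infsum_complete) simp
  have sum_eq: "sum (\<lambda>x. ennreal (f x)) F = ennreal (sum f F)" if "F \<subseteq> A" for F
    using that assms by (intro sum_ennreal) auto
  {
    assume fin: "(\<Sum>\<^sub>\<infinity>x\<in>A. ennreal (f x)) < \<infinity>"
    have "sum f F \<le> enn2real (\<Sum>\<^sub>\<infinity>x\<in>A. ennreal (f x))" if F: "F \<subseteq> A" "finite F" for F
    proof -
      have "ennreal (sum f F) \<le> (\<Sum>\<^sub>\<infinity>x\<in>A. ennreal (f x))"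
        unfolding sup sum_eq[OF F(1), symmetric] using F by (intro SUP_upper) auto
      moreover have "sum f F \<ge> 0" using F assms by (intro sum_nonneg) auto
      ultimately show ?thesis using fin by (metis enn2real_ennreal enn2real_mono infinity_ennreal_def)
    qed
    then have "bdd_above (sum f ` {F. F \<subseteq> A \<and> finite F})"
      by (intro bdd_aboveI2[of _ _ "enn2real (\<Sum>\<^sub>\<infinity>x\<in>A. ennreal (f x))"]) simp
    then show "f summable_on A" by (intro nonneg_bdd_above_summable_on assms)
  }
  assume sm: "f summable_on A"
  have "(\<Sum>\<^sub>\<infinity>x\<in>A. ennreal (f x)) \<le> ennreal (infsum f A)"
    unfolding sup
  proof (rule SUP_least)
    fix F assume "F \<in> {F. finite F \<and> F \<subseteq> A}"
    then show "sum (\<lambda>x. ennreal (f x)) F \<le> ennreal (infsum f A)"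
      using sm assms by (subst sum_eq) (auto intro!: ennreal_leI finite_sum_le_infsum)
  qed
  then show "(\<Sum>\<^sub>\<infinity>x\<in>A. ennreal (f x)) < \<infinity>" by (simp add: order_le_less_trans)
qed

lemma sqrt_ennreal_less_top_iff: "sqrt_ennreal x < \<infinity> \<longleftrightarrow> x < \<infinity>"
  by (auto simp: sqrt_ennreal_def less_top)

lemma summable_on_nonneg_comparison:
  fixes f g :: "'b \<Rightarrow> real"
  assumes "g summable_on A" "\<And>x. x \<in> A \<Longrightarrow> 0 \<le> f x" "\<And>x. x \<in> A \<Longrightarrow> f x \<le> g x"
  shows "f summable_on A"
  using assms(1,3,2) by (rule summable_on_comparison_test)

lemma summable_on_extend_zero:
  fixes f :: "'b \<Rightarrow> real"
  assumes "f summable_on B" "B \<subseteq> A" "\<And>x. x \<in> A - B \<Longrightarrow> f x = 0"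
  shows "f summable_on A"
  using assms summable_on_cong_neutral[of A B f f] by auto

text \<open>Finitely many nonzero values are bounded away from 0. Through this lemma finite
  generation turns a convergent series of distances into exact relations outside a sparse set of
  primes.\<close>

lemma summable_reciprocals_of_finite_values:
  fixes g :: "nat \<Rightarrow> real"
  assumes sm: "(\<lambda>p. g p / real p) summable_on A" and nn: "\<And>p. p \<in> A \<Longrightarrow> g p \<ge> 0" and fin: "finite (g ` A)"
  shows "(\<lambda>p. 1 / real p) summable_on {p\<in>A. g p \<noteq> 0}"
proof (cases "{p\<in>A. g p \<noteq> 0} = {}")
  case False
  define m where "m = Min (g ` {p\<in>A. g p \<noteq> 0})"
  have fin': "finite (g ` {p\<in>A. g p \<noteq> 0})" using fin by (rule finite_subset[rotated]) auto
  have "m \<in> g ` {p\<in>A. g p \<noteq> 0}" unfolding m_def using fin' False by (intro Min_in) auto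
  then have m0: "m > 0" using nn by force
  have m: "m \<le> g p" if "p \<in> A" "g p \<noteq> 0" for p unfolding m_def using that fin' by (intro Min_le) auto
  have "(\<lambda>p. 1 / m * (g p / real p)) summable_on {p\<in>A. g p \<noteq> 0}"
    by (intro summable_on_cmult_right summable_on_subset_banach[OF sm]) auto
  then show ?thesis
  proof (rule summable_on_nonneg_comparison)
    fix p assume "p \<in> {p\<in>A. g p \<noteq> 0}"
    then have "1 \<le> g p / m" using m[of p] m0 by simp
    then have "1 / real p \<le> g p / m / real p" by (intro divide_right_mono) auto
    then show "1 / real p \<le> 1 / m * (g p / real p)" by simp
  qed auto
next
  case True
  show ?thesis unfolding True by simp
qed

section \<open>Finitely generated multiplicative actions and their eigenfunctions\<close>

locale mult_system = prob_space M for M :: "'a::metric_space measure" +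
  fixes S :: "nat \<Rightarrow> 'a \<Rightarrow> 'a"
  assumes mult_action: "multiplicative_action M S" and fin_gen: "finitely_generated M S"
begin

lemma S_imp': "n \<ge> 1 \<Longrightarrow> invertible_measure_preserving M (S n)"
  using mult_action by (simp add: multiplicative_action_def)

lemma finite_pairs:
  assumes "finite (f ` {p. prime p})"
  shows "finite ((\<lambda>p. (restrict (S p) (space M), f p)) ` {p. prime p})"
proof (rule finite_subset)
  show "(\<lambda>p. (restrict (S p) (space M), f p)) ` {p. prime p}
      \<subseteq> {restrict (S p) (space M) |p. prime p} \<times> f ` {p. prime p}" by auto
  show "finite ({restrict (S p) (space M) |p. prime p} \<times> f ` {p. prime p})"
    using fin_gen assms by (simp add: finitely_generated_def)
qed

lemma finite_primes_not_coprime: "q \<ge> 1 \<Longrightarrow> finite {p. prime p \<and> \<not> coprime p (q::nat)}"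
proof (rule finite_subset)
  assume "q \<ge> 1"
  then show "finite {p. p dvd q}" by (intro finite_divisors_nat) simp
  show "{p. prime p \<and> \<not> coprime p q} \<subseteq> {p. p dvd q}" using prime_imp_coprime by blast
qed

lemma twisted_action_character:
  assumes "dirichlet_character q chi"
  shows "twisted_action M S chi"
proof
  show "chi 1 = 1" using assms by (rule dirichlet_character_1)
  show "finite ((\<lambda>p. (restrict (S p) (space M), chi p)) ` {p. prime p})"
    by (intro finite_pairs finite_subset[OF _ dirichlet_character_finite_range[OF assms]]) auto
  have "{p. prime p \<and> chi p = 0} = {p. prime p \<and> \<not> coprime p q}"
    using dirichlet_characterD(4)[OF assms] by auto
  then show "finite {p. prime p \<and> chi p = 0}"
    using finite_primes_not_coprime dirichlet_characterD(1)[OF assms] by simp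
qed (use assms mult_action dirichlet_characterD dirichlet_character_norm dirichlet_character_norm_le in auto)

lemma L2_norm_displacement_cong:
  assumes "restrict (S p) (space M) = restrict (S r) (space M)" "c = d"
  shows "L2_norm M (\<lambda>x. F (S p x) - c * F x) = L2_norm M (\<lambda>x. F (S r x) - d * F x)"
proof (rule L2_norm_cong)
  fix x assume "x \<in> space M"
  then have "S p x = S r x" using assms(1) by (metis restrict_apply)
  then show "F (S p x) - c * F x = F (S r x) - d * F x" using assms(2) by simp
qed

lemma finite_displacements:
  fixes f :: "nat \<Rightarrow> complex"
  assumes "finite (f ` {p. prime p})"
  shows "finite ((\<lambda>p. (L2_norm M (\<lambda>x. F (S p x) - f p * F x))\<^sup>2) ` {p. prime p})"
proof -
  define pr where "pr = (\<lambda>p. (restrict (S p) (space M), f p))"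
  define h where "h = (\<lambda>z. let r = (SOME r. prime r \<and> pr r = z) in (L2_norm M (\<lambda>x. F (S r x) - f r * F x))\<^sup>2)"
  have "(L2_norm M (\<lambda>x. F (S p x) - f p * F x))\<^sup>2 = h (pr p)" if "prime p" for p
  proof -
    define r where "r = (SOME r. prime r \<and> pr r = pr p)"
    have "prime r \<and> pr r = pr p" unfolding r_def by (rule someI[of _ p]) (use that in simp)
    then have "L2_norm M (\<lambda>x. F (S p x) - f p * F x) = L2_norm M (\<lambda>x. F (S r x) - f r * F x)"
      by (intro L2_norm_displacement_cong) (auto simp: pr_def)
    then show ?thesis by (simp add: h_def r_def[symmetric] Let_def)
  qed
  then have "(\<lambda>p. (L2_norm M (\<lambda>x. F (S p x) - f p * F x))\<^sup>2) ` {p. prime p} = h ` pr ` {p. prime p}"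
    by (force simp: image_image)
  then show ?thesis using finite_pairs[OF assms] by (simp add: pr_def)
qed

lemma modified_character_finite:
  assumes "dirichlet_character q chi"
  shows "finite (modified_character chi ` {p. prime p})"
  by (rule finite_subset[of _ "insert 1 (range chi)"])
     (use dirichlet_character_finite_range[OF assms] in \<open>auto simp: modified_character_prime\<close>)

text \<open>By \<open>finite_displacements\<close> a finite distance forces exact equations at all
  primes outside a set with convergent reciprocal sum. Conversely, a normalised function is
  displaced by at most 2, so an exceptional prime costs at most 4 / p. Passing from chi to its
  modified character affects only the finitely many primes dividing the modulus.\<close>

lemma action_dist_less_top_iff:
  assumes "dirichlet_character q chi"
  shows "action_dist M S (modified_character chi) < \<infinity> \<longleftrightarrow>
    (\<exists>F\<in>L2 M. \<not> (AE x in M. F x = 0) \<and>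
      (\<exists>E. (\<lambda>p. 1 / real p) summable_on E \<and> (\<forall>p. prime p \<longrightarrow> p \<notin> E \<longrightarrow> (AE x in M. F (S p x) = chi p * F x))))"
    (is "?L \<longleftrightarrow> ?R")
proof
  define f where "f = modified_character chi"
  define Z where "Z = {p. prime p \<and> \<not> coprime p q}"
  have finZ: "finite Z" unfolding Z_def using dirichlet_characterD(1)[OF assms] by (rule finite_primes_not_coprime)
  have f_eq: "f p = chi p" if "prime p" "p \<notin> Z" for p
    using that dirichlet_characterD(4)[OF assms, of p] by (simp add: f_def Z_def modified_character_prime)
  have f1: "norm (f p) = 1" if "prime p" for p
    using that dirichlet_character_norm[OF assms, of p] dirichlet_characterD(4)[OF assms, of p]
    by (simp add: f_def modified_character_prime)
  have dL: "(\<lambda>x. F (S p x) - f p * F x) \<in> L2 M" if "F \<in> L2 M" "prime p" for F p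
    using that prime_ge_1_nat[OF that(2)] by (intro L2_diff L2_scale L2_comp(1)[OF S_imp']) auto
  have dist_iff: "action_dist_at M S F f < \<infinity> \<longleftrightarrow>
      (\<lambda>p. (L2_norm M (\<lambda>x. F (S p x) - f p * F x))\<^sup>2 / real p) summable_on {p. prime p}" for F
  proof -
    have "(1 / 2 :: ennreal) = ennreal (1 / 2)"
      by (simp add: divide_ennreal flip: ennreal_1 ennreal_numeral)
    then have half: "(1 / 2 :: ennreal) < \<infinity>" by (simp only: infinity_ennreal_def ennreal_less_top)
    show ?thesis
      unfolding action_dist_at_def sqrt_ennreal_less_top_iff
      by (subst ennreal_infsum_less_top_iff[symmetric]) (use half in \<open>auto simp: ennreal_mult_less_top simp del: divide_eq_0_iff\<close>)
  qed
  {
    assume ?L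
    then obtain F where F: "F \<in> L2 M" "L2_norm M F = 1" "action_dist_at M S F f < \<infinity>"
      unfolding action_dist_def f_def by (auto simp: INF_less_iff)
    define g where "g = (\<lambda>p. (L2_norm M (\<lambda>x. F (S p x) - f p * F x))\<^sup>2)"
    have "(\<lambda>p. 1 / real p) summable_on {p\<in>{p. prime p}. g p \<noteq> 0}"
      using F(3) unfolding dist_iff g_def
      by (intro summable_reciprocals_of_finite_values finite_displacements)
         (auto simp: f_def modified_character_finite[OF assms])
    then have "(\<lambda>p. 1 / real p) summable_on ({p\<in>{p. prime p}. g p \<noteq> 0} \<union> Z)"
      by (rule summable_on_Un_real) (rule summable_on_finite[OF finZ])
    moreover have "AE x in M. F (S p x) = chi p * F x" if p: "prime p" "p \<notin> {p\<in>{p. prime p}. g p \<noteq> 0} \<union> Z" for p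
    proof -
      have "L2_norm M (\<lambda>x. F (S p x) - f p * F x) = 0" using p by (simp add: g_def)
      then have "AE x in M. F (S p x) - f p * F x = 0" using L2_norm_eq_0_iff[OF dL[OF F(1) p(1)]] by simp
      then show ?thesis using f_eq p by auto
    qed
    moreover have "\<not> (AE x in M. F x = 0)" using L2_norm_eq_0_iff[OF F(1)] F(2) by simp
    ultimately show ?R using F(1) by blast
  }
  assume ?R
  then obtain F E where F: "F \<in> L2 M" "\<not> (AE x in M. F x = 0)" and E: "(\<lambda>p. 1 / real p) summable_on E"
    and eig: "\<And>p. prime p \<Longrightarrow> p \<notin> E \<Longrightarrow> AE x in M. F (S p x) = chi p * F x" by blast
  define a where "a = L2_norm M F"
  have a: "a > 0" using F L2_norm_eq_0_iff[OF F(1)] L2_norm_nonneg[of M F] unfolding a_def by linarith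
  define H where "H = (\<lambda>x. of_real (1 / a) * F x)"
  have HL: "H \<in> L2 M" unfolding H_def by (rule L2_scale[OF F(1)])
  have H1: "L2_norm M H = 1" unfolding H_def L2_norm_scale norm_of_real using a by (simp add: a_def)
  define h where "h = (\<lambda>p. (L2_norm M (\<lambda>x. H (S p x) - f p * H x))\<^sup>2 / real p)"
  have h0: "h p = 0" if "prime p" "p \<notin> E \<union> Z" for p
  proof -
    have "AE x in M. H (S p x) - f p * H x = 0"
      using eig[OF that(1)] that f_eq[OF that(1)] unfolding H_def by auto
    then show ?thesis using L2_norm_eq_0_iff[OF dL[OF HL that(1)]] by (simp add: h_def)
  qed
  have h4: "h p \<le> 4 * (1 / real p)" if p: "prime p" for p
  proof -
    have p1: "p \<ge> 1" using prime_ge_1_nat[OF p] .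
    have "L2_norm M (\<lambda>x. H (S p x) - f p * H x) \<le> L2_norm M (\<lambda>x. H (S p x)) + L2_norm M (\<lambda>x. f p * H x)"
      by (intro L2_norm_triangle_diff L2_scale HL L2_comp(1)[OF S_imp'[OF p1]])
    also have "\<dots> = 2" using L2_comp(2)[OF S_imp'[OF p1] HL] H1 f1[OF p] by (simp add: L2_norm_scale)
    finally have "(L2_norm M (\<lambda>x. H (S p x) - f p * H x))\<^sup>2 \<le> 2\<^sup>2" by (intro power_mono) auto
    then have "h p \<le> 2\<^sup>2 / real p" unfolding h_def by (intro divide_right_mono) auto
    then show ?thesis by simp
  qed
  have "(\<lambda>p. 1 / real p) summable_on (E \<union> Z)"
    by (rule summable_on_Un_real[OF E summable_on_finite[OF finZ]])
  then have "(\<lambda>p. 4 * (1 / real p)) summable_on ((E \<union> Z) \<inter> {p. prime p})"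
    by (intro summable_on_cmult_right) (erule summable_on_subset_banach, auto)
  then have "h summable_on ((E \<union> Z) \<inter> {p. prime p})"
    by (rule summable_on_nonneg_comparison) (use h4 in \<open>auto simp: h_def\<close>)
  then have "h summable_on {p. prime p}" by (rule summable_on_extend_zero) (use h0 in auto)
  then have "action_dist_at M S H f < \<infinity>" unfolding dist_iff h_def .
  then show ?L unfolding action_dist_def f_def[symmetric] using HL H1 by (auto simp: INF_less_iff)
qed

text \<open>For g p unimodular and f p in the unit disc, 1 - Re (f p * cnj (g p)) is nonnegative and
  vanishes only if f p = g p; it takes finitely many values.\<close>

lemma pret_dist_summable:
  assumes "pret_dist f g < \<infinity>" "\<And>p. prime p \<Longrightarrow> norm (f p) \<le> 1" "\<And>p. prime p \<Longrightarrow> norm (g p) = 1"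
    "finite (f ` {p. prime p})" "finite (g ` {p. prime p})"
  shows "(\<lambda>p. 1 / real p) summable_on {p. prime p \<and> f p \<noteq> g p}"
proof -
  define h where "h = (\<lambda>p. 1 - Re (f p * cnj (g p)))"
  have le1: "norm (f p * cnj (g p)) \<le> 1" if "prime p" for p using assms(2,3)[OF that] by (simp add: norm_mult)
  have h0: "h p \<ge> 0" if "prime p" for p
    using complex_Re_le_cmod[of "f p * cnj (g p)"] le1[OF that] unfolding h_def by linarith
  have "(\<lambda>p. h p / real p) summable_on {p. prime p}"
    using assms(1) unfolding pret_dist_def sqrt_ennreal_less_top_iff h_def
    by (subst (asm) ennreal_infsum_less_top_iff) (use h0 h_def in auto)
  moreover have "finite (h ` {p. prime p})"
  proof (rule finite_subset)
    show "h ` {p. prime p} \<subseteq> (\<lambda>(a, b). 1 - Re (a * cnj b)) ` (f ` {p. prime p} \<times> g ` {p. prime p})"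
      unfolding h_def by force
  qed (use assms in auto)
  ultimately have "(\<lambda>p. 1 / real p) summable_on {p\<in>{p. prime p}. h p \<noteq> 0}"
    using h0 by (intro summable_reciprocals_of_finite_values) auto
  moreover have "{p. prime p \<and> f p \<noteq> g p} \<subseteq> {p\<in>{p. prime p}. h p \<noteq> 0}"
  proof clarsimp
    fix p assume p: "prime p" "f p \<noteq> g p" "h p = 0"
    define z where "z = f p * cnj (g p)"
    have "Re z = 1" "norm z \<le> 1" using p le1[OF p(1)] by (auto simp: h_def z_def)
    then have "(Re z)\<^sup>2 + (Im z)\<^sup>2 \<le> 1" by (simp add: cmod_def)
    then have "Im z = 0" using \<open>Re z = 1\<close> by simp
    then have "z = 1" using \<open>Re z = 1\<close> by (simp add: complex_eq_iff)
    moreover have "cnj (g p) * g p = 1" using assms(3)[OF p(1)]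
      by (metis complex_norm_square mult.commute of_real_1 power_one)
    ultimately have "f p = g p" unfolding z_def by (metis mult.assoc mult.left_neutral mult.right_neutral)
    then show False using p by simp
  qed
  ultimately show ?thesis by (rule summable_on_subset_banach)
qed

text \<open>The spectrum admits any character \<psi> at finite distance from the modified chi. Both
  take finitely many values at primes, so they agree there outside a sparse set, and the
  eigenfunction belonging to \<psi> serves for chi as well.\<close>

lemma modified_character_in_spectrum_iff:
  assumes chi: "dirichlet_character q chi"
  shows "modified_character chi \<in> pret_rational_spectrum M S \<longleftrightarrow>
    (\<exists>F\<in>L2 M. \<not> (AE x in M. F x = 0) \<and>
      (\<exists>E. (\<lambda>p. 1 / real p) summable_on E \<and> (\<forall>p. prime p \<longrightarrow> p \<notin> E \<longrightarrow> (AE x in M. F (S p x) = chi p * F x))))"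
    (is "?L \<longleftrightarrow> ?R")
proof
  have mod1: "norm (modified_character chi p) = 1" if "prime p" for p
    using that dirichlet_character_norm[OF chi, of p] dirichlet_characterD(4)[OF chi, of p]
    by (simp add: modified_character_prime)
  define Z where "Z = {p. prime p \<and> \<not> coprime p q}"
  have finZ: "finite Z" unfolding Z_def using dirichlet_characterD(1)[OF chi] by (rule finite_primes_not_coprime)
  have mod_eq: "modified_character chi p = chi p" if "prime p" "p \<notin> Z" for p
    using that dirichlet_characterD(4)[OF chi, of p] by (simp add: Z_def modified_character_prime)
  {
    assume ?L
    then obtain q' \<psi> where \<psi>: "dirichlet_character q' \<psi>" "action_dist M S (modified_character \<psi>) < \<infinity>"
      "pret_dist \<psi> (modified_character chi) < \<infinity>"
      by (auto simp: pret_rational_spectrum_def pretentious_class_def)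
    from \<psi>(2) obtain F E where F: "F \<in> L2 M" "\<not> (AE x in M. F x = 0)"
      and E: "(\<lambda>p. 1 / real p) summable_on E" "\<And>p. prime p \<Longrightarrow> p \<notin> E \<Longrightarrow> AE x in M. F (S p x) = \<psi> p * F x"
      unfolding action_dist_less_top_iff[OF \<psi>(1)] by blast
    define E' where "E' = {p. prime p \<and> \<psi> p \<noteq> modified_character chi p}"
    have "finite (\<psi> ` {p. prime p})"
      by (rule finite_subset[OF _ dirichlet_character_finite_range[OF \<psi>(1)]]) auto
    then have "(\<lambda>p. 1 / real p) summable_on E'"
      unfolding E'_def using \<psi> mod1 dirichlet_character_norm_le[OF \<psi>(1)] modified_character_finite[OF chi]
      by (intro pret_dist_summable) auto
    then have "(\<lambda>p. 1 / real p) summable_on (E \<union> E' \<union> Z)"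
      using E(1) summable_on_finite[OF finZ] by (intro summable_on_Un_real)
    moreover have "AE x in M. F (S p x) = chi p * F x" if "prime p" "p \<notin> E \<union> E' \<union> Z" for p
      using E(2)[OF that(1)] mod_eq[OF that(1)] that by (auto simp: E'_def)
    ultimately show ?R using F by blast
  }
  assume ?R
  then have "action_dist M S (modified_character chi) < \<infinity>" using action_dist_less_top_iff[OF chi] by simp
  moreover have "modified_character chi \<in> pretentious_class chi"
  proof -
    have "norm (modified_character chi n) = 1" if "n \<ge> 1" for n
    proof -
      have "norm (\<Prod>p\<in>#A. if chi p = 0 then 1 else chi p) = 1" if "\<And>p. p \<in># A \<Longrightarrow> prime p" for A
        using that
      proof (induction A)
        case (add p A)
        have "norm (if chi p = 0 then 1 else chi p) = 1"
          using mod1[of p] add.prems by (simp add: modified_character_prime)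
        then show ?case using add by (simp add: norm_mult)
      qed simp
      then show ?thesis unfolding modified_character_def by (metis in_prime_factors_imp_prime)
    qed
    then have "modified_character chi \<in> unimodular_cmult"
      by (auto simp: unimodular_cmult_def modified_character_mult)
    moreover have "pret_dist chi (modified_character chi) < \<infinity>"
    proof -
      define h where "h = (\<lambda>p. (1 - Re (chi p * cnj (modified_character chi p))) / real p)"
      have z: "h p = 0" if "prime p" "p \<notin> Z" for p
      proof -
        have "norm (chi p) = 1" using mod1[OF that(1)] mod_eq[OF that] by simp
        then have "chi p * cnj (chi p) = 1" by (simp add: complex_norm_square[symmetric])
        then show ?thesis unfolding h_def mod_eq[OF that] by (simp only:) simp
      qed
      have nn: "h p \<ge> 0" if "prime p" for p
        using complex_Re_le_cmod[of "chi p * cnj (modified_character chi p)"] dirichlet_character_norm_le[OF chi, of p] mod1[OF that]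
        unfolding h_def by (auto simp: norm_mult intro!: divide_nonneg_nonneg)
      have "h summable_on {p. prime p}"
        by (rule summable_on_extend_zero[OF summable_on_finite[OF finZ]]) (use z in \<open>auto simp: Z_def\<close>)
      then show ?thesis
        unfolding pret_dist_def sqrt_ennreal_less_top_iff
        by (subst ennreal_infsum_less_top_iff) (use nn in \<open>auto simp: h_def\<close>)
    qed
    ultimately show ?thesis by (simp add: pretentious_class_def)
  qed
  ultimately show ?L using chi unfolding pret_rational_spectrum_def by blast
qed

text \<open>For a level set of f, the series in the definition of pretentious ergodicity has nonzero
  terms only at primes of \<open>E\<close>, each at most 1 / p, so it converges.\<close>

lemma pretentiously_invariant_const:
  fixes f :: "'a \<Rightarrow> complex"
  assumes pe: "pretentiously_ergodic M S" and f: "f \<in> borel_measurable M"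
    and E: "(\<lambda>p. 1 / real p) summable_on E"
    and inv: "\<And>p. prime p \<Longrightarrow> p \<notin> E \<Longrightarrow> AE x in M. f (S p x) = f x"
  obtains c where "AE x in M. f x = c"
proof -
  have triv: "prob A \<in> {0, 1}"
    if A: "A \<in> sets M" and invA: "\<And>p. prime p \<Longrightarrow> p \<notin> E \<Longrightarrow> AE x in M. S p x \<in> A \<longleftrightarrow> x \<in> A" for A
  proof -
    define h where "h = (\<lambda>p. (L2_norm M (\<lambda>x. indicator A (S p x) - indicator A x))\<^sup>2 / real p)"
    have ind: "(\<lambda>x. indicator A x :: complex) \<in> borel_measurable M" using A by measurable
    have m: "(\<lambda>x. indicator A (S p x) - indicator A x :: complex) \<in> borel_measurable M" if "prime p" for p
      using S_imp'[OF prime_ge_1_nat[OF that]] ind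
      by (intro borel_measurable_diff measurable_compose[OF _ ind]) (auto simp: invertible_measure_preserving_def)
    have L: "L2_norm M (\<lambda>x. indicator A (S p x) - indicator A x) \<le> 1" if "prime p" for p
      using L2_mono(2)[OF L2_const[of 1] m[OF that]] L2_norm_const[of 1] by (auto simp: indicator_def)
    have h0: "h p = 0" if p: "prime p" "p \<notin> E" for p
    proof -
      have "L2_norm M (\<lambda>x. indicator A (S p x) - indicator A x) = L2_norm M (\<lambda>x. 0)"
        using invA[OF p] by (intro L2_norm_cong_AE m p) (auto elim!: eventually_mono simp: indicator_def)
      then show ?thesis by (simp add: h_def L2_norm_zero)
    qed
    have h1: "h p \<le> 1 / real p" if "prime p" for p
      unfolding h_def using L[OF that] by (intro divide_right_mono power_le_one) auto
    have "(\<lambda>p. 1 / real p) summable_on (E \<inter> {p. prime p})" using E by (rule summable_on_subset_banach) auto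
    then have "h summable_on (E \<inter> {p. prime p})"
      by (rule summable_on_nonneg_comparison) (use h1 in \<open>auto simp: h_def\<close>)
    then have "h summable_on {p. prime p}" by (rule summable_on_extend_zero) (use h0 in auto)
    then show ?thesis using pe A unfolding pretentiously_ergodic_def h_def by blast
  qed
  show thesis
  proof (rule AE_const_if_level_sets_trivial_complex[OF f])
    note [measurable] = f
    have sp: "S p x \<in> space M" if "prime p" "x \<in> space M" for p x
      using S_imp'[OF prime_ge_1_nat[OF that(1)]] that(2)
      by (auto simp: invertible_measure_preserving_def dest: measurable_space)
    fix t
    show "prob {x\<in>space M. Re (f x) > t} \<in> {0, 1}"
    proof (rule triv)
      fix p assume p: "prime p" "p \<notin> E"
      from inv[OF p] AE_space show "AE x in M. S p x \<in> {x\<in>space M. Re (f x) > t} \<longleftrightarrow> x \<in> {x\<in>space M. Re (f x) > t}"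
        by eventually_elim (auto simp: sp p)
    qed measurable
    show "prob {x\<in>space M. Im (f x) > t} \<in> {0, 1}"
    proof (rule triv)
      fix p assume p: "prime p" "p \<notin> E"
      from inv[OF p] AE_space show "AE x in M. S p x \<in> {x\<in>space M. Im (f x) > t} \<longleftrightarrow> x \<in> {x\<in>space M. Im (f x) > t}"
        by eventually_elim (auto simp: sp p)
    qed measurable
  qed (use that in blast)
qed

end

section \<open>Disjoint spectra imply joint ergodicity\<close>

locale full_system = ergodic_system M T + mult_system M S
  for M :: "'a::metric_space measure" and T :: "'a \<Rightarrow> 'a" and S :: "nat \<Rightarrow> 'a \<Rightarrow> 'a" +
  assumes pret_ergodic: "pretentiously_ergodic M S"

sublocale full_system \<subseteq> joint_system M T S
proof -
  have "dirichlet_character 1 (\<lambda>_. 1)" by (simp add: dirichlet_character_def)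
  then interpret twisted_action M S "\<lambda>_. 1" by (rule twisted_action_character)
  show "joint_system M T S" by unfold_locales
qed

context full_system
begin

definition W :: "(nat \<Rightarrow> complex) \<Rightarrow> ('a \<Rightarrow> complex) \<Rightarrow> nat \<Rightarrow> 'a \<Rightarrow> complex" where
  "W h G N x = (\<Sum>n=1..N. h n * G (S n x)) / of_nat N"

definition null :: "(nat \<Rightarrow> complex) \<Rightarrow> ('a \<Rightarrow> complex) \<Rightarrow> bool" where
  "null h G \<longleftrightarrow> (\<lambda>N. L2_norm M (W h G N)) \<longlonglongrightarrow> 0"

lemma W_L2: "G \<in> L2 M \<Longrightarrow> W h G N \<in> L2 M"
proof -
  assume G: "G \<in> L2 M"
  have "(\<lambda>x. (1 / of_nat N) * (\<Sum>n=1..N. h n * G (S n x))) \<in> L2 M"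
    by (intro L2_scale L2_sum L2_comp(1)[OF S_imp] G) auto
  then show ?thesis by (simp add: W_def[abs_def])
qed

lemma null_zero: "null (\<lambda>_. 0) G"
  by (simp add: null_def W_def[abs_def] L2_norm_zero)

lemma null_add:
  assumes G: "G \<in> L2 M" and "null f G" "null g G"
  shows "null (\<lambda>n. f n + g n) G"
  unfolding null_def
proof (rule tendsto_sandwich[OF _ _ tendsto_const])
  show "(\<lambda>N. L2_norm M (W f G N) + L2_norm M (W g G N)) \<longlonglongrightarrow> 0"
    using tendsto_add[OF assms(2,3)[unfolded null_def]] by simp
  have "W (\<lambda>n. f n + g n) G N = (\<lambda>x. W f G N x + W g G N x)" for N
    by (simp add: W_def[abs_def] add_divide_distrib sum.distrib distrib_right)
  then show "\<forall>\<^sub>F N in sequentially. L2_norm M (W (\<lambda>n. f n + g n) G N) \<le> L2_norm M (W f G N) + L2_norm M (W g G N)"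
    using L2_norm_triangle[OF W_L2[OF G] W_L2[OF G]] by (simp add: always_eventually)
qed (simp add: always_eventually)

text \<open>For n = d m the map S n is S m after S d. The dilated average is therefore a multiple of
  the average of length N div d, composed with the measure-preserving S d.\<close>

lemma null_dilate:
  assumes G: "G \<in> L2 M" and n: "null h G" and d: "d \<ge> 1"
  shows "null (\<lambda>n. if d dvd n then c * h (n div d) else 0) G"
  unfolding null_def
proof (rule tendsto_sandwich[OF _ _ tendsto_const])
  have "filterlim (\<lambda>N. N div d) sequentially sequentially"
    using d by (intro filterlim_at_top_div_const_nat) simp
  from filterlim_compose[OF n[unfolded null_def] this]
  have "(\<lambda>N. norm c * L2_norm M (W h G (N div d))) \<longlonglongrightarrow> norm c * 0" by (intro tendsto_intros)
  then show "(\<lambda>N. norm c * L2_norm M (W h G (N div d))) \<longlonglongrightarrow> 0" by simp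
  have "L2_norm M (W (\<lambda>n. if d dvd n then c * h (n div d) else 0) G N) \<le> norm c * L2_norm M (W h G (N div d))" for N
  proof -
    define a where "a = c * (of_nat (N div d) / of_nat N)"
    have "W (\<lambda>n. if d dvd n then c * h (n div d) else 0) G N x = a * W h G (N div d) (S d x)" if x: "x \<in> space M" for x
    proof -
      have "(\<Sum>n=1..N. (if d dvd n then c * h (n div d) else 0) * G (S n x))
          = (\<Sum>n\<in>{n\<in>{1..N}. d dvd n}. c * h (n div d) * G (S n x))"
        by (subst sum.inter_filter) (auto intro!: sum.cong)
      also have "\<dots> = (\<Sum>m=1..N div d. c * h m * G (S (d * m) x))"
        unfolding multiples_eq_image[OF d] using d by (subst sum.reindex) (auto intro!: inj_onI)
      also have "\<dots> = (\<Sum>m=1..N div d. c * (h m * G (S m (S d x))))"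
      proof (rule sum.cong[OF refl])
        fix m assume "m \<in> {1..N div d}"
        then have "S (d * m) x = S m (S d x)" using S_mult[of d m x] d x by (simp add: mult.commute)
        then show "c * h m * G (S (d * m) x) = c * (h m * G (S m (S d x)))" by simp
      qed
      also have "\<dots> = c * (\<Sum>m=1..N div d. h m * G (S m (S d x)))" by (simp add: sum_distrib_left)
      finally have *: "(\<Sum>n=1..N. (if d dvd n then c * h (n div d) else 0) * G (S n x))
          = c * (\<Sum>m=1..N div d. h m * G (S m (S d x)))" .
      show ?thesis unfolding W_def * a_def by (cases "N div d = 0") simp_all
    qed
    then have "L2_norm M (W (\<lambda>n. if d dvd n then c * h (n div d) else 0) G N) = L2_norm M (\<lambda>x. a * W h G (N div d) (S d x))"
      by (rule L2_norm_cong)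
    also have "\<dots> = norm a * L2_norm M (W h G (N div d))"
      unfolding L2_norm_scale using L2_comp(2)[OF S_imp[OF d] W_L2[OF G]] by simp
    also have "\<dots> \<le> norm c * L2_norm M (W h G (N div d))"
    proof (rule mult_right_mono)
      have "real (N div d) / real N \<le> 1" by (simp add: divide_le_eq)
      then have "norm c * (real (N div d) / real N) \<le> norm c * 1" by (intro mult_left_mono) auto
      then show "norm a \<le> norm c" by (simp add: a_def norm_mult norm_divide)
    qed simp
    finally show ?thesis .
  qed
  then show "\<forall>\<^sub>F N in sequentially. L2_norm M (W (\<lambda>n. if d dvd n then c * h (n div d) else 0) G N)
      \<le> norm c * L2_norm M (W h G (N div d))" by (simp add: always_eventually)
qed (simp add: always_eventually)

lemma null_scale: "G \<in> L2 M \<Longrightarrow> null h G \<Longrightarrow> null (\<lambda>n. c * h n) G"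
  using null_dilate[of G h 1 c] by simp

text \<open>All divisors d > 1 are included because the characters in the expansion of a function of
  period q are induced by primitive characters of moduli dividing q.\<close>

definition nonprincipal_free :: "nat \<Rightarrow> bool" where
  "nonprincipal_free q \<longleftrightarrow> (\<forall>d \<psi>. d dvd q \<longrightarrow> d > 1 \<longrightarrow> primitive_character d \<psi> \<longrightarrow>
     modified_character \<psi> \<notin> pret_rational_spectrum M S)"

text \<open>A function w fixed by the twisted action satisfies w (S p x) = cnj (\<psi> p) * w x at
  typical p, with \<psi> the primitive character inducing chi. For modulus 1 pretentious ergodicity
  makes w constant, hence 0 by its mean. For larger modulus a nonzero w would put the conjugate of
  \<psi>, again primitive, into the spectrum.\<close>

lemma null_character:
  assumes G: "G \<in> L2 M" "(LINT x|M. G x) = 0" and chi: "dirichlet_character q chi" and free: "nonprincipal_free q"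
  shows "null chi G"
proof -
  interpret tw: twisted_action M S chi by (rule twisted_action_character[OF chi])
  obtain d \<psi> where \<psi>: "d dvd q" "primitive_character d \<psi>" "\<And>n. coprime n q \<Longrightarrow> chi n = \<psi> n"
    by (rule dirichlet_character_induced[OF chi]) (rule that)
  have \<psi>D: "dirichlet_character d \<psi>" using \<psi>(2) by (simp add: primitive_character_def)
  have "((\<lambda>y. L2_norm M (tw.avg G y)) \<longlongrightarrow> 0) at_top"
  proof (rule tw.avg_tendsto_zero[OF G])
    fix w assume w: "w \<in> L2 M" "(LINT x|M. w x) = 0" and inv: "\<And>p. p \<in> tw.typical \<Longrightarrow> AE x in M. tw.V p w x = w x"
    have eig: "norm (\<psi> p) = 1" "AE x in M. w (S p x) = cnj (\<psi> p) * w x" if "p \<in> tw.typical" for p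
    proof -
      have cop: "coprime p q" using that dirichlet_characterD(4)[OF chi, of p] by (simp add: tw.typical_def)
      have 1: "chi p = \<psi> p" "norm (chi p) = 1" using \<psi>(3)[OF cop] dirichlet_character_norm[OF chi cop] by auto
      then show "norm (\<psi> p) = 1" by simp
      have c1: "cnj (\<psi> p) * \<psi> p = 1" using 1 by (metis complex_norm_square mult.commute of_real_1 power_one)
      from inv[OF that] show "AE x in M. w (S p x) = cnj (\<psi> p) * w x"
      proof eventually_elim
        case (elim x)
        then have "cnj (\<psi> p) * (\<psi> p * w (S p x)) = cnj (\<psi> p) * w x" using 1 by (simp add: tw.V_def)
        then show ?case unfolding mult.assoc[symmetric] c1 by simp
      qed
    qed
    define E where "E = {p. prime p} - tw.typical"
    have E: "(\<lambda>p. 1 / real p) summable_on E" unfolding E_def by (rule tw.summable_atypical)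
    show "AE x in M. w x = 0"
    proof (cases "d = 1")
      case True
      have "AE x in M. w (S p x) = w x" if "prime p" "p \<notin> E" for p
        using eig(2)[of p] that dirichlet_character_mod_1[of \<psi> p] \<psi>D True by (simp add: E_def)
      then obtain c where c: "AE x in M. w x = c"
        using pretentiously_invariant_const[OF pret_ergodic L2_measurable[OF w(1)] E] by blast
      have "(LINT x|M. w x) = (LINT x|M. c)" using c w(1) by (intro integral_cong_AE) auto
      then have "c = 0" using w(2) by (simp add: prob_space)
      then show ?thesis using c by simp
    next
      case False
      have d: "d > 1" using False dirichlet_characterD(1)[OF \<psi>D] by simp
      show ?thesis
      proof (rule ccontr)
        assume "\<not> ?thesis"
        moreover have "AE x in M. w (S p x) = cnj (\<psi> p) * w x" if "prime p" "p \<notin> E" for p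
          using eig(2)[of p] that by (simp add: E_def)
        ultimately have "modified_character (\<lambda>n. cnj (\<psi> n)) \<in> pret_rational_spectrum M S"
          unfolding modified_character_in_spectrum_iff[OF dirichlet_character_cnj[OF \<psi>D]] using w(1) E by blast
        then show False using free d \<psi>(1) primitive_character_cnj[OF \<psi>(2)] unfolding nonprincipal_free_def by blast
      qed
    qed
  qed
  from filterlim_compose[OF this filterlim_real_sequentially]
  have "(\<lambda>N. L2_norm M (tw.avg G (real N))) \<longlonglongrightarrow> 0" .
  moreover have "tw.avg G (real N) = W chi G N" for N
    by (simp add: tw.avg_def[abs_def] tw.V_def W_def[abs_def])
  ultimately show ?thesis by (simp add: null_def)
qed

lemma null_periodic:
  assumes G: "G \<in> L2 M" "(LINT x|M. G x) = 0" and q: "q \<ge> 1" and free: "nonprincipal_free q"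
    and per: "\<And>n. h (n + q) = h n"
  shows "null h G"
proof (rule periodic_character_induct[where h = h and q = q and P = "\<lambda>h. null h G", OF q per])
  fix c d chi assume d: "d dvd q" and chi: "dirichlet_character (q div d) chi"
  have "d \<ge> 1" using d q by (auto intro!: Suc_leI Nat.gr0I)
  moreover have "q div d dvd q" using d by (metis dvd_div_mult_self dvd_triv_left)
  then have "nonprincipal_free (q div d)" using free unfolding nonprincipal_free_def by (meson dvd_trans)
  ultimately show "null (\<lambda>n. if d dvd n then c * chi (n div d) else 0) G"
    by (intro null_dilate G null_character[OF G chi])
qed (auto intro: null_zero null_add G)

text \<open>The power q / d of the eigenvalue e(r/q) is e(r/d), a fraction with exact denominator d.
  A primitive character modulo d in the spectrum would make it, reduced modulo 1, a common element,
  nonzero because r mod d is coprime to d > 1.\<close>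

lemma spectra_disjoint_nonprincipal_free:
  assumes disj: "rational_spectrum M T \<inter> pret_rational_spectrum_fractions M S = {0}"
    and eig: "L2_eigenvalue M T (ez q (int r))" and q: "q \<ge> 1" and cop: "coprime r q"
  shows "nonprincipal_free q"
  unfolding nonprincipal_free_def
proof (intro allI impI notI)
  fix d \<psi> assume d: "d dvd q" "d > 1" and \<psi>: "primitive_character d \<psi>" "modified_character \<psi> \<in> pret_rational_spectrum M S"
  from d(1) obtain k where k: "q = d * k" by blast
  have k0: "k > 0" using k q by (cases k) auto
  define \<alpha> where "\<alpha> = real (r mod d) / real d"
  have "ez q (int r) ^ k = cis (2 * pi * \<alpha>)"
  proof -
    have "ez q (int r) ^ k = ez d (int r)"
      unfolding ez_power[symmetric] using k k0 by (simp add: ez_def)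
    also have "\<dots> = ez d (int (r mod d))" using d by (intro ez_cong) (auto simp: cong_def zmod_int)
    finally show ?thesis by (simp add: ez_def \<alpha>_def)
  qed
  then have "L2_eigenvalue M T (cis (2 * pi * \<alpha>))" using eigenvalue_power[OF eig, of k] by simp
  moreover have "\<alpha> \<in> {0..<1} \<inter> \<rat>" unfolding \<alpha>_def using d by auto
  ultimately have 1: "\<alpha> \<in> rational_spectrum M T" by (simp add: rational_spectrum_def)
  have cop_d: "coprime (r mod d) d"
  proof -
    have "coprime r d" using cop d(1) by (meson coprime_divisors dvd_refl)
    then show ?thesis by (simp add: coprime_iff_gcd_eq_1 gcd.commute flip: gcd_red_nat)
  qed
  have "\<alpha> = real_of_int (int (r mod d)) / real d \<and> d \<ge> 1 \<and> coprime (int (r mod d)) (int d) \<and>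
        (\<exists>chi. primitive_character d chi \<and> modified_character chi \<in> pret_rational_spectrum M S)"
    unfolding coprime_int_iff using \<psi> d cop_d by (auto simp: \<alpha>_def)
  then have 2: "\<alpha> \<in> pret_rational_spectrum_fractions M S" unfolding pret_rational_spectrum_fractions_def by blast
  have "\<alpha> = 0" using 1 2 disj by blast
  then have "r mod d = 0" using d by (simp add: \<alpha>_def)
  then show False using cop_d d by simp
qed

text \<open>The fraction j / D is first reduced to lowest terms r / q, because disjointness
  constrains only the divisors of the exact denominator.\<close>

lemma eigenvalue_null:
  assumes disj: "rational_spectrum M T \<inter> pret_rational_spectrum_fractions M S = {0}"
    and eig: "L2_eigenvalue M T (ez D (int j))" and D: "D \<ge> 1" and G: "G \<in> L2 M" "(LINT x|M. G x) = 0"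
  shows "null (\<lambda>n. ez D (int j * int n)) G"
proof -
  define g where "g = gcd j D"
  have g: "g > 0" using D by (simp add: g_def)
  obtain r q where rq: "j = g * r" "D = g * q" "coprime r q"
    using gcd_coprime_exists[of j D] g unfolding g_def by (metis less_numeral_extra(3) mult.commute)
  have q: "q \<ge> 1" using rq D by (cases q) auto
  have ez_eq: "ez D (int j * k) = ez q (int r * k)" for k
    using g by (simp add: ez_def rq)
  have "nonprincipal_free q"
    using ez_eq[of 1] eig by (intro spectra_disjoint_nonprincipal_free[OF disj _ q rq(3)]) simp
  then show ?thesis
    unfolding ez_eq
  proof (rule null_periodic[OF G q])
    fix n
    show "ez q (int r * int (n + q)) = ez q (int r * int n)"
      using q by (intro ez_cong) (auto simp: cong_iff_dvd_diff algebra_simps)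
  qed
qed

section \<open>Coboundaries and periodic parts for T\<close>

lemma sum_shift_difference:
  fixes u :: "nat \<Rightarrow> complex"
  shows "(\<Sum>m=1..K. u m - u (m + e)) = (\<Sum>i<e. u (Suc i) - u (K + Suc i))"
proof (induction e)
  case (Suc e)
  have "(\<Sum>m=1..K. u (m + e) - u (Suc (m + e))) = u (Suc e) - u (K + Suc e)"
    by (induction K) auto
  moreover have "(\<Sum>m=1..K. u m - u (m + Suc e)) = (\<Sum>m=1..K. u m - u (m + e)) + (\<Sum>m=1..K. u (m + e) - u (Suc (m + e)))"
    by (simp add: sum.distrib[symmetric])
  ultimately show ?case using Suc by simp
qed simp

text \<open>The iterate d e is a shift by e along T^d, so consecutive terms telescope and only e
  terms at either end survive, independently of the length K.\<close>

lemma bounded_sums_coboundary: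
  assumes h: "h \<in> L2 M"
  shows "bounded_sums d (\<lambda>x. h x - h ((T ^^ (d * e)) x))"
  unfolding bounded_sums_def
proof (intro exI allI)
  fix K
  define u where "u = (\<lambda>m x. h ((T ^^ (d * m)) x))"
  have uL: "u m \<in> L2 M" "L2_norm M (u m) = L2_norm M h" for m
    unfolding u_def using Tn_L2[OF h] Tn_norm[OF h] by auto
  have "h ((T ^^ (d * m)) x) - h ((T ^^ (d * e)) ((T ^^ (d * m)) x)) = u m x - u (m + e) x" for m x
    by (simp add: u_def distrib_left add.commute funpow_add)
  then have "(\<lambda>x. \<Sum>m=1..K. h ((T ^^ (d * m)) x) - h ((T ^^ (d * e)) ((T ^^ (d * m)) x)))
      = (\<lambda>x. \<Sum>i<e. u (Suc i) x - u (K + Suc i) x)"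
    using sum_shift_difference[of "\<lambda>m. u m _" e K] by simp
  then have "L2_norm M (\<lambda>x. \<Sum>m=1..K. h ((T ^^ (d * m)) x) - h ((T ^^ (d * e)) ((T ^^ (d * m)) x)))
      = L2_norm M (\<lambda>x. \<Sum>i<e. u (Suc i) x - u (K + Suc i) x)" by simp
  also have "\<dots> \<le> (\<Sum>i<e. L2_norm M (\<lambda>x. u (Suc i) x - u (K + Suc i) x))"
    by (intro L2_norm_sum_le L2_diff uL)
  also have "\<dots> \<le> (\<Sum>i<e. 2 * L2_norm M h)"
  proof (rule sum_mono)
    fix i
    show "L2_norm M (\<lambda>x. u (Suc i) x - u (K + Suc i) x) \<le> 2 * L2_norm M h"
      using L2_norm_triangle_diff[OF uL(1) uL(1), of "Suc i" "K + Suc i"] by (simp add: uL(2))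
  qed
  finally show "L2_norm M (\<lambda>x. \<Sum>m=1..K. h ((T ^^ (d * m)) x) - h ((T ^^ (d * e)) ((T ^^ (d * m)) x)))
      \<le> (\<Sum>i<e. 2 * L2_norm M h)" .
qed

lemma bounded_sums_add:
  assumes fg: "f \<in> L2 M" "g \<in> L2 M" and "bounded_sums d f" "bounded_sums d g"
  shows "bounded_sums d (\<lambda>x. f x + g x)"
proof -
  from assms obtain C1 C2 where
    C: "\<And>K. L2_norm M (\<lambda>x. \<Sum>m=1..K. f ((T ^^ (d * m)) x)) \<le> C1"
      "\<And>K. L2_norm M (\<lambda>x. \<Sum>m=1..K. g ((T ^^ (d * m)) x)) \<le> C2" by (auto simp: bounded_sums_def)
  have "L2_norm M (\<lambda>x. \<Sum>m=1..K. f ((T ^^ (d * m)) x) + g ((T ^^ (d * m)) x)) \<le> C1 + C2" for K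
  proof -
    have "L2_norm M (\<lambda>x. \<Sum>m=1..K. f ((T ^^ (d * m)) x) + g ((T ^^ (d * m)) x))
        \<le> L2_norm M (\<lambda>x. \<Sum>m=1..K. f ((T ^^ (d * m)) x)) + L2_norm M (\<lambda>x. \<Sum>m=1..K. g ((T ^^ (d * m)) x))"
      unfolding sum.distrib by (intro L2_norm_triangle L2_sum Tn_L2 fg)
    then show ?thesis using C[of K] by linarith
  qed
  then show ?thesis unfolding bounded_sums_def by blast
qed

lemma bounded_sums_scale:
  assumes "bounded_sums d f"
  shows "bounded_sums d (\<lambda>x. c * f x)"
proof -
  from assms obtain C where C: "\<And>K. L2_norm M (\<lambda>x. \<Sum>m=1..K. f ((T ^^ (d * m)) x)) \<le> C" by (auto simp: bounded_sums_def)
  have "L2_norm M (\<lambda>x. \<Sum>m=1..K. c * f ((T ^^ (d * m)) x)) \<le> norm c * C" for K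
    unfolding sum_distrib_left[symmetric] L2_norm_scale by (intro mult_left_mono C) auto
  then show ?thesis unfolding bounded_sums_def by blast
qed

text \<open>Each element differs from F by a combination of coboundaries of T^D, whose sums along
  T^d stay bounded for all d dividing D simultaneously (\<open>T_hull_props\<close>).\<close>

inductive_set T_hull :: "nat \<Rightarrow> ('a \<Rightarrow> complex) \<Rightarrow> ('a \<Rightarrow> complex) set" for D F where
  base: "F \<in> T_hull D F"
| step: "f \<in> T_hull D F \<Longrightarrow> (\<lambda>x. f ((T ^^ D) x)) \<in> T_hull D F"
| mid: "f \<in> T_hull D F \<Longrightarrow> g \<in> T_hull D F \<Longrightarrow> (\<lambda>x. (f x + g x) / 2) \<in> T_hull D F"

lemma T_hull_props:
  assumes "f \<in> T_hull D F" "F \<in> L2 M"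
  shows "f \<in> L2 M \<and> L2_norm M f \<le> L2_norm M F \<and> (LINT x|M. f x) = (LINT x|M. F x) \<and>
    (\<forall>d. d dvd D \<longrightarrow> bounded_sums d (\<lambda>x. F x - f x))"
  using assms
proof (induction rule: T_hull.induct)
  case base
  then show ?case by (auto simp: bounded_sums_def L2_norm_zero)
next
  case (step f)
  then have f: "f \<in> L2 M" "L2_norm M f \<le> L2_norm M F" "(LINT x|M. f x) = (LINT x|M. F x)"
    "\<And>d. d dvd D \<Longrightarrow> bounded_sums d (\<lambda>x. F x - f x)" by auto
  have "bounded_sums d (\<lambda>x. F x - f ((T ^^ D) x))" if "d dvd D" for d
  proof -
    from that obtain e where e: "D = d * e" by blast
    have "bounded_sums d (\<lambda>x. (F x - f x) + (f x - f ((T ^^ D) x)))"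
      unfolding e by (intro bounded_sums_add L2_diff Tn_L2 bounded_sums_coboundary f step.prems) (simp add: e)
    then show ?thesis by simp
  qed
  then show ?case using f Tn_L2[OF f(1)] Tn_norm[OF f(1)] Tn_integral[OF L2_measurable[OF f(1)]] by simp
next
  case (mid f g)
  then have fg: "f \<in> L2 M" "g \<in> L2 M" "L2_norm M f \<le> L2_norm M F" "L2_norm M g \<le> L2_norm M F"
    "(LINT x|M. f x) = (LINT x|M. F x)" "(LINT x|M. g x) = (LINT x|M. F x)"
    "\<And>d. d dvd D \<Longrightarrow> bounded_sums d (\<lambda>x. F x - f x)" "\<And>d. d dvd D \<Longrightarrow> bounded_sums d (\<lambda>x. F x - g x)" by auto
  have "L2_norm M (\<lambda>x. 1/2 * (f x + g x)) \<le> 1/2 * (L2_norm M f + L2_norm M g)"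
    unfolding L2_norm_scale using L2_norm_triangle[OF fg(1,2)] by simp
  then have "L2_norm M (\<lambda>x. (f x + g x) / 2) \<le> L2_norm M F" using fg by simp
  moreover have "bounded_sums d (\<lambda>x. F x - (f x + g x) / 2)" if "d dvd D" for d
  proof -
    have "bounded_sums d (\<lambda>x. 1/2 * (F x - f x) + 1/2 * (F x - g x))"
      by (intro bounded_sums_add bounded_sums_scale L2_scale L2_diff fg mid.prems that)
    moreover have "(\<lambda>x. 1/2 * (F x - f x) + 1/2 * (F x - g x)) = (\<lambda>x. F x - (f x + g x) / 2)"
      by (simp add: fun_eq_iff field_simps)
    ultimately show ?thesis by simp
  qed
  moreover have "(LINT x|M. (f x + g x) / 2) = (LINT x|M. F x)"
    using L2_integrable1[OF fg(1)] L2_integrable1[OF fg(2)] fg by simp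
  ultimately show ?case using L2_mid[OF fg(1,2)] by simp
qed

text \<open>Katai's criterion handles F - c, the trivial norm bound handles c - w, and w is left to
  its spectral decomposition.\<close>

lemma T_decomposition:
  assumes F: "F \<in> L2 M" and e: "e > 0"
  obtains c w where "c \<in> T_hull D F" "w \<in> L2 M" "L2_norm M (\<lambda>x. c x - w x) < e" "AE x in M. w ((T ^^ D) x) = w x"
proof -
  define U where "U = (\<lambda>f :: 'a \<Rightarrow> complex. \<lambda>x. f ((T ^^ D) x))"
  obtain c w where c: "\<And>n. c n \<in> T_hull D F" and w: "w \<in> L2 M" "(\<lambda>n. L2_norm M (\<lambda>x. c n x - w x)) \<longlonglongrightarrow> 0"
    and inv: "\<And>U'. U' \<in> {U} \<Longrightarrow> AE x in M. U' w x = w x"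
  proof (rule L2_minimal_norm[of "T_hull D F" "{U}"])
    show "T_hull D F \<noteq> {}" using T_hull.base by blast
    show "T_hull D F \<subseteq> L2 M" using T_hull_props[OF _ F] by blast
    show "(\<lambda>x. (f x + g x) / 2) \<in> T_hull D F" if "f \<in> T_hull D F" "g \<in> T_hull D F" for f g
      using that by (rule T_hull.mid)
    show "U' f \<in> T_hull D F" if "U' \<in> {U}" "f \<in> T_hull D F" for U' f
      using that T_hull.step unfolding U_def by auto
    show "U' f \<in> L2 M \<and> L2_norm M (U' f) \<le> L2_norm M f" if "U' \<in> {U}" "f \<in> L2 M" for U' f
      using that Tn_L2 Tn_norm unfolding U_def by simp
    show "U' (\<lambda>x. f x - g x) = (\<lambda>x. U' f x - U' g x)" if "U' \<in> {U}" for U' f g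
      using that by (simp add: U_def)
  qed blast
  obtain n where "L2_norm M (\<lambda>x. c n x - w x) < e"
    using order_tendstoD(2)[OF w(2) e] by (auto simp: eventually_sequentially)
  then show thesis using that[of "c n" w] c w inv[of U] by (simp add: U_def)
qed

text \<open>Along an eigenfunction the joint average is v times an exponentially weighted average of
  G (S n x), and the modulus of v is constant by ergodicity. If v vanishes, there is no eigenvalue
  to appeal to, hence the case distinction.\<close>

lemma eigenfunction_average_null:
  assumes disj: "rational_spectrum M T \<inter> pret_rational_spectrum_fractions M S = {0}"
    and D: "D \<ge> 1" and v: "v \<in> L2 M" "AE x in M. v (T x) = ez D (int j) * v x"
    and G: "G \<in> L2 M" "(LINT x|M. G x) = 0"
  shows "(\<lambda>N. L2_norm M (B v G N)) \<longlonglongrightarrow> 0"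
proof -
  have vm: "v \<in> borel_measurable M" using v(1) by simp
  obtain d where d: "d \<ge> 0" "AE x in M. norm (v x) = d"
    using eigenfunction_norm_const[OF vm v(2)] by auto
  have B_eq: "AE x in M. B v G N x = W (\<lambda>n. ez D (int j * int n)) G N x * v x" for N
  proof -
    have "AE x in M. \<forall>n. v ((T ^^ n) x) = ez D (int j) ^ n * v x"
      unfolding AE_all_countable using eigenfunction_funpow[OF v(2)] by simp
    then show ?thesis
    proof eventually_elim
      case (elim x)
      have "(\<Sum>n=1..N. v ((T ^^ n) x) * G (S n x)) = (\<Sum>n=1..N. ez D (int j * int n) * G (S n x) * v x)"
        using elim by (intro sum.cong refl) (simp add: ez_power mult.commute[of "int j"] mult_ac)
      then show ?case unfolding B_def W_def by (simp add: sum_distrib_right)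
    qed
  qed
  show ?thesis
  proof (cases "d = 0")
    case True
    have "L2_norm M (B v G N) = 0" for N
    proof -
      have "AE x in M. B v G N x = 0"
        using B_eq[of N] d(2) by eventually_elim (use True in auto)
      then have ae: "AE x in M. (\<lambda>_. 0) x = B v G N x" by eventually_elim simp
      have "B v G N \<in> borel_measurable M"
        unfolding B_def[abs_def] using S_meas L2_measurable[OF G(1)] vm
        by (intro borel_measurable_divide borel_measurable_sum borel_measurable_times borel_measurable_const
            measurable_compose[OF Tn_meas vm] measurable_compose[OF S_meas L2_measurable[OF G(1)]]) auto
      then have "L2_norm M (B v G N) = L2_norm M (\<lambda>_. 0)"
        using ae by (intro L2_norm_cong_AE[symmetric]) auto
      then show ?thesis by (simp add: L2_norm_zero)
    qed
    then show ?thesis by simp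
  next
    case False
    have "\<not> (AE x in M. v x = 0)"
    proof
      assume "AE x in M. v x = 0"
      with d(2) have "AE x in M. False" by eventually_elim (use False in auto)
      then show False by (simp add: AE_const)
    qed
    then have "L2_eigenvalue M T (ez D (int j))" using v unfolding L2_eigenvalue_def by blast
    then have n: "null (\<lambda>n. ez D (int j * int n)) G" by (intro eigenvalue_null disj D G)
    have "AE x in M. norm (v x) \<le> d" using d(2) by eventually_elim simp
    then have "L2_norm M (\<lambda>x. W (\<lambda>n. ez D (int j * int n)) G N x * v x) \<le> \<bar>d\<bar> * L2_norm M (W (\<lambda>n. ez D (int j * int n)) G N)" for N
      by (intro L2_mult_bounded(2) W_L2 G vm)
    moreover have "L2_norm M (B v G N) = L2_norm M (\<lambda>x. W (\<lambda>n. ez D (int j * int n)) G N x * v x)" for N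
    proof (rule L2_norm_cong_AE[OF _ _ B_eq])
      show "B v G N \<in> borel_measurable M"
        unfolding B_def[abs_def]
        by (intro borel_measurable_divide borel_measurable_sum borel_measurable_times borel_measurable_const
            measurable_compose[OF Tn_meas vm] measurable_compose[OF S_meas L2_measurable[OF G(1)]]) auto
      show "(\<lambda>x. W (\<lambda>n. ez D (int j * int n)) G N x * v x) \<in> borel_measurable M"
        using L2_measurable[OF W_L2[OF G(1)]] vm by (intro borel_measurable_times)
    qed
    ultimately have le: "L2_norm M (B v G N) \<le> d * L2_norm M (W (\<lambda>n. ez D (int j * int n)) G N)" for N
      using d(1) by simp
    have lim: "(\<lambda>N. d * L2_norm M (W (\<lambda>n. ez D (int j * int n)) G N)) \<longlonglongrightarrow> 0"
      using tendsto_mult_left[OF n[unfolded null_def], of d] by simp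
    show ?thesis
      by (rule tendsto_sandwich[OF _ _ tendsto_const lim]) (auto simp: le always_eventually)
  qed
qed

text \<open>A \<open>T ^^ D\<close>-invariant function is the sum of its \<open>D\<close> spectral components
  \<open>1 / D * (\<Sum>l<D. ez D (- j l) * w ((T ^^ l) x))\<close>.\<close>

lemma periodic_average_null:
  assumes disj: "rational_spectrum M T \<inter> pret_rational_spectrum_fractions M S = {0}"
    and D: "D \<ge> 1" and w: "w \<in> L2 M" "AE x in M. w ((T ^^ D) x) = w x"
    and G: "G \<in> L2 M" "(LINT x|M. G x) = 0"
    and Gb: "AE x in M. norm (G x) \<le> C"
  shows "(\<lambda>N. L2_norm M (B w G N)) \<longlonglongrightarrow> 0"
proof -
  define v where "v = (\<lambda>j x. 1 / of_nat D * (\<Sum>l<D. ez D (- (int j * int l)) * w ((T ^^ l) x)))"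
  have vL: "v j \<in> L2 M" for j unfolding v_def by (intro L2_scale L2_sum Tn_L2 w)
  have eig: "AE x in M. v j (T x) = ez D (int j) * v j x" for j
    using w(2)
  proof eventually_elim
    case (elim x)
    define u where "u = (\<lambda>l. ez D (- (int j * int l)) * w ((T ^^ l) x))"
    have "u D = u 0" using elim D by (simp add: u_def ez_eq_1_iff)
    then have shift: "(\<Sum>l<D. u (Suc l)) = (\<Sum>l<D. u l)" using sum.lessThan_Suc_shift[of u D] by simp
    have "(\<Sum>l<D. ez D (- (int j * int l)) * w ((T ^^ l) (T x))) = (\<Sum>l<D. ez D (int j) * u (Suc l))"
    proof (rule sum.cong[OF refl])
      fix l
      have "ez D (- (int j * int l)) = ez D (int j) * ez D (- (int j * int (Suc l)))"
        unfolding ez_add[symmetric] by (simp add: algebra_simps)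
      moreover have "(T ^^ l) (T x) = (T ^^ Suc l) x" by (simp add: funpow_swap1)
      ultimately show "ez D (- (int j * int l)) * w ((T ^^ l) (T x)) = ez D (int j) * u (Suc l)"
        unfolding u_def by (simp only: mult.assoc)
    qed
    also have "\<dots> = ez D (int j) * (\<Sum>l<D. u l)" unfolding sum_distrib_left[symmetric] shift ..
    finally show ?case by (simp add: v_def u_def)
  qed
  have w_eq: "w x = (\<Sum>j<D. v j x)" for x
  proof -
    have "(\<Sum>j<D. v j x) = 1 / of_nat D * (\<Sum>j<D. \<Sum>l<D. ez D (int j * (- int l)) * w ((T ^^ l) x))"
      unfolding v_def by (simp add: sum_distrib_left)
    also have "(\<Sum>j<D. \<Sum>l<D. ez D (int j * (- int l)) * w ((T ^^ l) x))
        = (\<Sum>l<D. (\<Sum>j<D. ez D (int j * (- int l))) * w ((T ^^ l) x))"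
      by (subst sum.swap) (simp add: sum_distrib_right)
    also have "\<dots> = (\<Sum>l<D. if l = 0 then of_nat D * w x else 0)"
    proof (rule sum.cong[OF refl])
      fix l assume "l \<in> {..<D}"
      then have "int D dvd - int l \<longleftrightarrow> l = 0" by (auto dest: nat_dvd_not_less)
      then show "(\<Sum>j<D. ez D (int j * (- int l))) * w ((T ^^ l) x) = (if l = 0 then of_nat D * w x else 0)"
        using D sum_ez[of D "- int l"] by auto
    qed
    also have "\<dots> = of_nat D * w x" using D by (simp add: sum.delta)
    finally show ?thesis using D by simp
  qed
  have B_eq: "B w G N = (\<lambda>x. \<Sum>j<D. B (v j) G N x)" for N
  proof
    fix x
    have "(\<Sum>n=1..N. w ((T ^^ n) x) * G (S n x)) = (\<Sum>j<D. \<Sum>n=1..N. v j ((T ^^ n) x) * G (S n x))"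
      unfolding w_eq sum_distrib_right by (rule sum.swap)
    then show "B w G N x = (\<Sum>j<D. B (v j) G N x)" unfolding B_def by (simp add: sum_divide_distrib)
  qed
  have "(\<lambda>N. \<Sum>j<D. L2_norm M (B (v j) G N)) \<longlonglongrightarrow> (\<Sum>j<D. 0)"
    by (intro tendsto_sum eigenfunction_average_null[OF disj D vL eig G])
  then have lim: "(\<lambda>N. \<Sum>j<D. L2_norm M (B (v j) G N)) \<longlonglongrightarrow> 0" by simp
  have "L2_norm M (B w G N) \<le> (\<Sum>j<D. L2_norm M (B (v j) G N))" for N
    unfolding B_eq by (intro L2_norm_sum_le B_L2[OF vL _ Gb]) (use G in auto)
  then show ?thesis
    by (intro tendsto_sandwich[OF _ _ tendsto_const lim]) (auto simp: always_eventually)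
qed

lemma B_split: "B F G N = (\<lambda>x. B (\<lambda>x. F x - c x) G N x + (B (\<lambda>x. c x - w x) G N x + B w G N x))"
proof
  fix x
  have "(\<Sum>n=1..N. F ((T ^^ n) x) * G (S n x)) = (\<Sum>n=1..N. (F ((T ^^ n) x) - c ((T ^^ n) x)) * G (S n x))
      + ((\<Sum>n=1..N. (c ((T ^^ n) x) - w ((T ^^ n) x)) * G (S n x)) + (\<Sum>n=1..N. w ((T ^^ n) x) * G (S n x)))"
    unfolding sum.distrib[symmetric] by (intro sum.cong refl) (simp add: algebra_simps)
  then show "B F G N x = B (\<lambda>x. F x - c x) G N x + (B (\<lambda>x. c x - w x) G N x + B w G N x)"
    unfolding B_def by (simp only: add_divide_distrib)
qed

lemma joint_average_null:
  assumes disj: "rational_spectrum M T \<inter> pret_rational_spectrum_fractions M S = {0}"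
    and F: "F \<in> L2 M" and G: "G \<in> Linf M" "(LINT x|M. G x) = 0"
  shows "(\<lambda>N. L2_norm M (B F G N)) \<longlonglongrightarrow> 0"
proof -
  obtain C0 where Gm: "G \<in> borel_measurable M" and C0: "AE x in M. norm (G x) \<le> C0"
    using G(1) by (auto simp: Linf_def)
  define C where "C = max C0 1"
  have C: "C \<ge> 1" by (simp add: C_def)
  have GC: "AE x in M. norm (G x) \<le> C" using C0 by eventually_elim (simp add: C_def)
  have GL: "G \<in> L2 M" using G(1) Linf_subset_L2 by blast
  obtain p0 where p0: "p0 \<in> typical" using typical_nonempty by blast
  have p0': "p0 \<ge> 1" "\<not> (\<lambda>r. 1 / real r) summable_on {r. prime r \<and> colour r = colour p0}"
    using p0 typical_ge_1 by (auto simp: typical_def)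
  define a where "a = L2_norm M F"
  have a: "a \<ge> 0" by (simp add: a_def)
  show ?thesis
  proof (rule tendstoI)
    fix e :: real assume e: "e > 0"
    \<comment> \<open>Makes the bound 3 C (2 a + 1) / sqrt R from Katai's criterion smaller than e /
      3, where 2 a bounds the norm of F - c.\<close>
    define R where "R = (9 * C * (2 * a + 1) / e)\<^sup>2 + 1"
    have "1 / real r \<ge> 0" for r by simp
    then obtain P where P: "finite P" "P \<subseteq> {r. prime r \<and> colour r = colour p0}" "(\<Sum>p\<in>P. 1 / real p) \<ge> R"
      by (rule not_summable_on_nonneg_large[OF p0'(2)])
    have R: "R \<ge> 1" by (simp add: R_def)
    have Pne: "P \<noteq> {}" using P(3) R by auto
    define D :: nat where "D = fact (Max P)"
    have D: "D \<ge> 1" by (simp add: D_def)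
    have e3: "e / (3 * C) > 0" using e C by simp
    obtain c w where c: "c \<in> T_hull D F" and w: "w \<in> L2 M" "L2_norm M (\<lambda>x. c x - w x) < e / (3 * C)"
      "AE x in M. w ((T ^^ D) x) = w x" using T_decomposition[OF F e3] .
    from T_hull_props[OF c F] have cL: "c \<in> L2 M" "L2_norm M c \<le> a"
      and bs: "\<And>d. d dvd D \<Longrightarrow> bounded_sums d (\<lambda>x. F x - c x)" by (auto simp: a_def)
    have fL: "(\<lambda>x. F x - c x) \<in> L2 M" by (intro L2_diff F cL)
    have f_le: "L2_norm M (\<lambda>x. F x - c x) \<le> 2 * a"
      using L2_norm_triangle_diff[OF F cL(1)] cL(2) by (simp add: a_def)
    have kat: "\<forall>\<^sub>F N in sequentially. L2_norm M (B (\<lambda>x. F x - c x) G N)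
        \<le> 3 * C * (L2_norm M (\<lambda>x. F x - c x) + 1) / sqrt (\<Sum>p\<in>P. 1 / real p)"
    proof (rule katai[OF fL Gm GC _ P(1) Pne _ _ p0'(1)])
      fix d assume "1 \<le> d" "d \<le> Max P"
      then show "bounded_sums d (\<lambda>x. F x - c x)" by (intro bs) (simp add: D_def dvd_fact)
    qed (use P(2) C in auto)
    have kat_small: "3 * C * (L2_norm M (\<lambda>x. F x - c x) + 1) / sqrt (\<Sum>p\<in>P. 1 / real p) < e / 3"
    proof -
      have "9 * C * (2 * a + 1) / e < sqrt R" unfolding R_def by (intro real_less_rsqrt) simp
      also have "sqrt R \<le> sqrt (\<Sum>p\<in>P. 1 / real p)" using P(3) by simp
      finally have s: "9 * C * (2 * a + 1) < e * sqrt (\<Sum>p\<in>P. 1 / real p)" using e by (simp add: field_simps)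
      have "3 * C * (L2_norm M (\<lambda>x. F x - c x) + 1) \<le> 3 * C * (2 * a + 1)"
        using f_le C by (intro mult_left_mono) auto
      moreover have "sqrt (\<Sum>p\<in>P. 1 / real p) > 0" using P(3) R by simp
      ultimately show ?thesis using s by (simp add: pos_divide_less_eq)
    qed
    have "\<forall>\<^sub>F N in sequentially. L2_norm M (B w G N) < e / 3"
      using order_tendstoD(2)[OF periodic_average_null[OF disj D w(1,3) GL G(2) GC], of "e / 3"] e by simp
    with kat show "\<forall>\<^sub>F N in sequentially. dist (L2_norm M (B F G N)) 0 < e"
    proof eventually_elim
      case (elim N)
      have "L2_norm M (B F G N) \<le> L2_norm M (B (\<lambda>x. F x - c x) G N) + L2_norm M (\<lambda>x. B (\<lambda>x. c x - w x) G N x + B w G N x)"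
        unfolding B_split[of F G N c w] by (intro L2_norm_triangle L2_add B_L2[OF _ Gm GC] L2_diff F cL w)
      also have "L2_norm M (\<lambda>x. B (\<lambda>x. c x - w x) G N x + B w G N x) \<le> L2_norm M (B (\<lambda>x. c x - w x) G N) + L2_norm M (B w G N)"
        by (intro L2_norm_triangle B_L2[OF _ Gm GC] L2_diff cL w)
      also have "L2_norm M (B (\<lambda>x. c x - w x) G N) \<le> \<bar>C\<bar> * L2_norm M (\<lambda>x. c x - w x)"
        by (intro B_norm_le Gm GC L2_diff cL w)
      also have "\<dots> \<le> C * (e / (3 * C))" using w(2) C by (intro mult_mono) auto
      also have "\<dots> = e / 3" using C by simp
      finally show ?case using elim kat_small by simp
    qed
  qed
qed

text \<open>The case D = 1 of \<open>T_decomposition\<close>: bounded sums disappear after division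
  by N, the invariant part w is a constant b by ergodicity, and b is close to the mean of F because
  \<open>c\<close> has the same mean as F and is close to w.\<close>

lemma mean_ergodic:
  assumes F: "F \<in> L2 M"
  shows "(\<lambda>N. L2_norm M (\<lambda>x. (\<Sum>n=1..N. F ((T ^^ n) x)) / of_nat N - (LINT y|M. F y))) \<longlonglongrightarrow> 0"
proof (rule tendstoI)
  fix e :: real assume e: "e > 0"
  then have e4: "e / 4 > 0" by simp
  obtain c w where c: "c \<in> T_hull 1 F" and w: "w \<in> L2 M" "L2_norm M (\<lambda>x. c x - w x) < e / 4"
    "AE x in M. w ((T ^^ 1) x) = w x" using T_decomposition[OF F e4] .
  from T_hull_props[OF c F] have cL: "c \<in> L2 M" and ci: "(LINT x|M. c x) = (LINT x|M. F x)"
    and "bounded_sums 1 (\<lambda>x. F x - c x)" by auto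
  then obtain K where K: "\<And>N. L2_norm M (\<lambda>x. \<Sum>m=1..N. F ((T ^^ m) x) - c ((T ^^ m) x)) \<le> K"
    by (auto simp: bounded_sums_def)
  have "AE x in M. w (T x) = w x" using w(3) by simp
  then obtain b where b: "AE x in M. w x = b" using invariant_function_const[OF L2_measurable[OF w(1)]] by blast
  define I where "I = (LINT y|M. F y)"
  have "norm (I - b) \<le> L2_norm M (\<lambda>x. c x - w x)"
  proof -
    have "(LINT x|M. w x) = (LINT x|M. b)" using b w(1) by (intro integral_cong_AE) auto
    then have "I - b = (LINT x|M. c x - w x)"
      using L2_integrable1[OF cL] L2_integrable1[OF w(1)] ci by (simp add: I_def prob_space)
    then have "norm (I - b) = norm (LINT x|M. c x - w x)" by (rule arg_cong)
    also have "\<dots> \<le> (LINT x|M. norm (c x - w x))" by (rule integral_norm_bound)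
    also have "\<dots> \<le> L2_norm M (\<lambda>x. c x - w x)" by (rule L2_norm_integral_le[OF L2_diff[OF cL w(1)]])
    finally show ?thesis .
  qed
  then have Ib: "norm (I - b) < e / 4" using w(2) by simp
  have "\<forall>\<^sub>F N in sequentially. real N > 4 * \<bar>K\<bar> / e"
    by (rule eventually_compose_filterlim[OF eventually_gt_at_top filterlim_real_sequentially])
  then show "\<forall>\<^sub>F N in sequentially. dist (L2_norm M (\<lambda>x. (\<Sum>n=1..N. F ((T ^^ n) x)) / of_nat N - (LINT y|M. F y))) 0 < e"
  proof eventually_elim
    case (elim N)
    have "0 \<le> 4 * \<bar>K\<bar> / e" using e by simp
    with elim have N: "N > 0" by (cases N) auto
    define X where "X = (\<lambda>x. (1 / of_nat N) * (\<Sum>n=1..N. F ((T ^^ n) x) - c ((T ^^ n) x)))"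
    define Y where "Y = (\<lambda>x. (1 / of_nat N) * (\<Sum>n=1..N. c ((T ^^ n) x) - b))"
    have cbL: "(\<lambda>x. c x - b) \<in> L2 M" by (intro L2_diff cL L2_const)
    have XL: "X \<in> L2 M" unfolding X_def by (intro L2_scale L2_sum L2_diff Tn_L2 F cL)
    have YL: "Y \<in> L2 M" unfolding Y_def using Tn_L2[OF cbL] by (intro L2_scale L2_sum)
    have "(\<Sum>n=1..N. F ((T ^^ n) x)) / of_nat N - I = X x + (Y x - (I - b))" for x
    proof -
      have "(\<Sum>n=1..N. F ((T ^^ n) x)) = (\<Sum>n=1..N. F ((T ^^ n) x) - c ((T ^^ n) x)) + (\<Sum>n=1..N. c ((T ^^ n) x) - b) + of_nat N * b"
        by (simp add: sum_subtractf)
      then show ?thesis unfolding X_def Y_def using N by (simp add: add_divide_distrib)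
    qed
    then have "L2_norm M (\<lambda>x. (\<Sum>n=1..N. F ((T ^^ n) x)) / of_nat N - I) = L2_norm M (\<lambda>x. X x + (Y x - (I - b)))"
      by (simp only:)
    also have "\<dots> \<le> L2_norm M X + L2_norm M (\<lambda>x. Y x - (I - b))"
      by (intro L2_norm_triangle XL L2_diff YL L2_const)
    also have "L2_norm M (\<lambda>x. Y x - (I - b)) \<le> L2_norm M Y + norm (I - b)"
      using L2_norm_triangle_diff[OF YL L2_const[of "I - b"]] L2_norm_const[of "I - b"] by simp
    also have "L2_norm M X < e / 4"
    proof -
      have "L2_norm M X \<le> 1 / real N * \<bar>K\<bar>"
        unfolding X_def L2_norm_scale using K[of N] by (simp add: norm_divide divide_right_mono)
      also have "\<dots> < e / 4" using elim N e by (simp add: field_simps)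
      finally show ?thesis .
    qed
    also have "L2_norm M Y < e / 4"
    proof -
      have "L2_norm M (\<lambda>x. c x - b) = L2_norm M (\<lambda>x. c x - w x)"
        using cL w(1) b by (intro L2_norm_cong_AE) auto
      then have "L2_norm M (\<lambda>x. c ((T ^^ n) x) - b) < e / 4" for n
        using Tn_norm[OF cbL, of n] w(2) by simp
      then have s: "(\<Sum>n=1..N. L2_norm M (\<lambda>x. c ((T ^^ n) x) - b)) < (\<Sum>n=1..N. e / 4)"
        using N by (intro sum_strict_mono) auto
      have "L2_norm M Y = 1 / real N * L2_norm M (\<lambda>x. \<Sum>n=1..N. c ((T ^^ n) x) - b)"
        unfolding Y_def L2_norm_scale by (simp add: norm_divide)
      also have "\<dots> \<le> 1 / real N * (\<Sum>n=1..N. L2_norm M (\<lambda>x. c ((T ^^ n) x) - b))"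
        using Tn_L2[OF cbL] by (intro mult_left_mono L2_norm_sum_le) auto
      also have "\<dots> < 1 / real N * (\<Sum>n=1..N. e / 4)" using s N by (intro mult_strict_left_mono) auto
      also have "\<dots> = e / 4" using N by simp
      finally show ?thesis .
    qed
    finally show ?case using Ib e by (simp add: I_def)
  qed
qed

text \<open>G is split into its mean J and a part of mean 0; \<open>joint_average_null\<close>
  disposes of the latter, and the mean ergodic theorem for T gives the contribution of J.\<close>

lemma disjoint_spectra_imp_jointly_ergodic:
  assumes disj: "rational_spectrum M T \<inter> pret_rational_spectrum_fractions M S = {0}"
  shows "jointly_ergodic M T S"
  unfolding jointly_ergodic_def
proof (intro ballI)
  fix F G assume F: "F \<in> Linf M" and G: "G \<in> Linf M"
  have FL: "F \<in> L2 M" and GL: "G \<in> L2 M" using F G Linf_subset_L2 by auto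
  define I J where "I = (LINT y|M. F y)" and "J = (LINT y|M. G y)"
  define G0 where "G0 = (\<lambda>x. G x - J)"
  have G0: "G0 \<in> Linf M"
  proof -
    obtain C where "AE x in M. norm (G x) \<le> C" using G by (auto simp: Linf_def)
    then have "AE x in M. norm (G0 x) \<le> C + norm J"
    proof eventually_elim
      case (elim x)
      then show ?case using norm_triangle_ineq4[of "G x" J] by (simp add: G0_def)
    qed
    moreover have "G0 \<in> borel_measurable M" unfolding G0_def using GL by (intro borel_measurable_diff) auto
    ultimately show ?thesis by (auto simp: Linf_def)
  qed
  have G00: "(LINT x|M. G0 x) = 0"
    unfolding G0_def using L2_integrable1[OF GL] by (simp add: J_def prob_space)
  define A where "A = (\<lambda>N x. (\<Sum>n=1..N. F ((T ^^ n) x)) / of_nat N - I)"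
  have AL: "A N \<in> L2 M" for N
  proof -
    have "(\<lambda>x. (1 / of_nat N) * (\<Sum>n=1..N. F ((T ^^ n) x)) - I) \<in> L2 M"
      by (rule L2_diff[OF L2_scale[OF L2_sum[OF Tn_L2[OF FL]]] L2_const])
    then show ?thesis by (simp add: A_def)
  qed
  obtain C where G0m: "G0 \<in> borel_measurable M" and C: "AE x in M. norm (G0 x) \<le> C"
    using G0 by (auto simp: Linf_def)
  have lim: "(\<lambda>N. L2_norm M (B F G0 N) + norm J * L2_norm M (A N)) \<longlonglongrightarrow> 0"
    using tendsto_add[OF joint_average_null[OF disj FL G0 G00] tendsto_mult_left[OF mean_ergodic[OF FL], of "norm J"]]
    by (simp add: A_def I_def)
  have le: "L2_norm M (\<lambda>x. (\<Sum>n=1..N. F ((T ^^ n) x) * G (S n x)) / of_nat N - I * J)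
      \<le> L2_norm M (B F G0 N) + norm J * L2_norm M (A N)" for N
  proof -
    have "(\<Sum>n=1..N. F ((T ^^ n) x) * G (S n x)) / of_nat N - I * J = B F G0 N x + J * A N x" for x
    proof -
      have "(\<Sum>n=1..N. F ((T ^^ n) x) * G (S n x))
          = (\<Sum>n=1..N. F ((T ^^ n) x) * G0 (S n x)) + J * (\<Sum>n=1..N. F ((T ^^ n) x))"
        unfolding sum_distrib_left sum.distrib[symmetric] by (intro sum.cong refl) (simp add: G0_def algebra_simps)
      then show ?thesis by (simp add: B_def A_def add_divide_distrib right_diff_distrib mult.commute)
    qed
    then have "L2_norm M (\<lambda>x. (\<Sum>n=1..N. F ((T ^^ n) x) * G (S n x)) / of_nat N - I * J)
        = L2_norm M (\<lambda>x. B F G0 N x + J * A N x)" by (simp only:)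
    also have "\<dots> \<le> L2_norm M (B F G0 N) + L2_norm M (\<lambda>x. J * A N x)"
      by (intro L2_norm_triangle B_L2[OF FL G0m C] L2_scale AL)
    finally show ?thesis by (simp only: L2_norm_scale)
  qed
  show "(\<lambda>N. L2_norm M (\<lambda>x. (\<Sum>n=1..N. F ((T ^^ n) x) * G (S n x)) / of_nat N
          - (LINT y|M. F y) * (LINT y|M. G y))) \<longlonglongrightarrow> 0"
    unfolding I_def[symmetric] J_def[symmetric]
    by (rule tendsto_sandwich[OF _ always_eventually[OF allI[OF le]] tendsto_const lim]) simp
qed

end

section \<open>Joint ergodicity implies disjoint spectra\<close>

definition coprime_count :: "nat set \<Rightarrow> nat \<Rightarrow> nat" where
  "coprime_count A N = card {n\<in>{1..N}. \<forall>p\<in>A. \<not> p dvd n}"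

text \<open>Legendre's recursion: the survivors of A divisible by p are p k with k a survivor of A,
  because p is a prime outside A.\<close>

lemma coprime_count_insert:
  assumes A: "\<And>r. r \<in> A \<Longrightarrow> prime r" "p \<notin> A" and p: "prime p"
  shows "coprime_count A N = coprime_count (insert p A) N + coprime_count A (N div p)"
proof -
  have p1: "p \<ge> 1" using prime_ge_1_nat[OF p] .
  have dvd_iff: "r dvd p * k \<longleftrightarrow> r dvd k" if "r \<in> A" for r k
    using A(1)[OF that] A(2) p that by (metis prime_dvd_mult_iff primes_dvd_imp_eq)
  have "{n\<in>{1..N}. \<forall>r\<in>A. \<not> r dvd n} = {n\<in>{1..N}. \<forall>r\<in>insert p A. \<not> r dvd n} \<union> {n\<in>{n\<in>{1..N}. p dvd n}. \<forall>r\<in>A. \<not> r dvd n}"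
    by auto
  then have "coprime_count A N = coprime_count (insert p A) N + card {n\<in>{n\<in>{1..N}. p dvd n}. \<forall>r\<in>A. \<not> r dvd n}"
    unfolding coprime_count_def by (simp only:) (rule card_Un_disjoint, auto)
  also have "{n\<in>{n\<in>{1..N}. p dvd n}. \<forall>r\<in>A. \<not> r dvd n} = (\<lambda>k. p * k) ` {k\<in>{1..N div p}. \<forall>r\<in>A. \<not> r dvd k}"
    unfolding multiples_eq_image[OF p1] using dvd_iff by auto
  also have "card \<dots> = coprime_count A (N div p)"
    unfolding coprime_count_def using p1 by (intro card_image inj_onI) simp
  finally show ?thesis .
qed

text \<open>A further prime turns an error bound e >= 1 into at most 2 e + 1 <= 3 e. In the
  application the set is fixed while N grows, so exponential dependence on its size is
  affordable.\<close>

lemma coprime_count_approx: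
  assumes "finite A" "\<And>r. r \<in> A \<Longrightarrow> prime r"
  shows "\<bar>real (coprime_count A N) - real N * (\<Prod>p\<in>A. 1 - 1 / real p)\<bar> \<le> 3 ^ card A"
  using assms
proof (induction A arbitrary: N rule: finite_induct)
  case empty
  have "{n\<in>{1..N}. \<forall>p\<in>{}. \<not> p dvd n} = {1..N}" by auto
  then have "coprime_count {} N = N" unfolding coprime_count_def by (simp only: card_atLeastAtMost)
  then show ?case by simp
next
  case (insert p A)
  define c where "c = (\<Prod>p\<in>A. 1 - 1 / real p)"
  have p: "prime p" "p \<ge> 1" using insert.prems prime_ge_1_nat[of p] by auto
  have c01: "0 \<le> c" "c \<le> 1"
  proof -
    have "0 \<le> 1 - 1 / real r \<and> 1 - 1 / real r \<le> 1" if "r \<in> A" for r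
      using prime_ge_1_nat[of r] insert.prems[of r] that by simp
    then show "0 \<le> c" "c \<le> 1" unfolding c_def by (auto intro: prod_nonneg prod_le_1)
  qed
  have 1: "\<bar>real (coprime_count A N) - real N * c\<bar> \<le> 3 ^ card A" for N
    unfolding c_def using insert by auto
  have 2: "real (coprime_count (insert p A) N) = real (coprime_count A N) - real (coprime_count A (N div p))"
    using coprime_count_insert[of A p N] insert p by simp
  have "\<bar>real (N div p) - real N / real p\<bar> \<le> 1"
    using floor_mult_bounds[OF p(2), of N] p by (simp add: abs_le_iff field_simps)
  then have "\<bar>(real (N div p) - real N / real p) * c\<bar> \<le> 1 * 1"
    unfolding abs_mult using c01 by (intro mult_mono) auto
  then have 3: "\<bar>real (N div p) * c - real N / real p * c\<bar> \<le> 1" by (simp add: left_diff_distrib)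
  have "real N * (\<Prod>p\<in>insert p A. 1 - 1 / real p) = real N * c - real N / real p * c"
    using insert.hyps by (simp add: c_def algebra_simps)
  moreover have "(3::real) ^ card (insert p A) = 3 * 3 ^ card A" using insert.hyps by simp
  moreover have "(3::real) ^ card A \<ge> 1" by simp
  ultimately show ?case using 1[of N] 1[of "N div p"] 2 3 by linarith
qed

lemma exp_minus_le_one_minus: "exp (- 2 * x) \<le> 1 - x" if "0 \<le> x" "x \<le> 1 / 2" for x :: real
proof -
  have "(1 + 2 * x) * (1 - x) = 1 + x * (1 - 2 * x)" by (simp add: algebra_simps)
  also have "\<dots> \<ge> 1" using that by simp
  finally have "1 \<le> (1 + 2 * x) * (1 - x)" .
  also have "\<dots> \<le> exp (2 * x) * (1 - x)" using that exp_ge_add_one_self[of "2 * x"] by (intro mult_right_mono) auto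
  finally show ?thesis by (simp add: exp_minus field_simps)
qed

lemma prod_one_minus_ge:
  assumes "finite A" "\<And>p. p \<in> A \<Longrightarrow> prime (p::nat)"
  shows "exp (- 2 * (\<Sum>p\<in>A. 1 / real p)) \<le> (\<Prod>p\<in>A. 1 - 1 / real p)"
proof -
  have "exp (- 2 * (\<Sum>p\<in>A. 1 / real p)) = (\<Prod>p\<in>A. exp (- 2 * (1 / real p)))"
    by (simp add: exp_sum[OF assms(1), symmetric] sum_distrib_left)
  also have "\<dots> \<le> (\<Prod>p\<in>A. 1 - 1 / real p)"
  proof (intro prod_mono conjI)
    fix p assume "p \<in> A"
    then have "p \<ge> 2" using assms(2) prime_ge_2_nat by blast
    then show "exp (- 2 * (1 / real p)) \<le> 1 - 1 / real p"
      by (intro exp_minus_le_one_minus) (auto simp: field_simps)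
  qed simp
  finally show ?thesis .
qed

context full_system
begin

text \<open>Sieving out p subtracts the terms n = p k, where complete multiplicativity gives h (p k)
  = h p * h k; the correction is a dilate, covered by \<open>null_dilate\<close>.\<close>

lemma null_sieve:
  assumes G: "G \<in> L2 M" and h: "null h G" "\<And>m n. h (m * n) = h m * h n"
    and A: "finite A" "\<And>p. p \<in> A \<Longrightarrow> prime p"
  shows "null (\<lambda>n. if \<forall>p\<in>A. \<not> p dvd n then h n else 0) G"
  using A
proof (induction A rule: finite_induct)
  case (insert p A)
  have p: "prime p" "p \<ge> 1" using insert.prems prime_ge_1_nat[of p] by auto
  define g where "g = (\<lambda>n. if \<forall>p\<in>A. \<not> p dvd n then h n else 0)"
  have g: "null g G" unfolding g_def using insert by auto
  have dvd_iff: "r dvd p * k \<longleftrightarrow> r dvd k" if "r \<in> A" for r k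
    using insert.prems insert.hyps p that by (metis insert_iff prime_dvd_mult_iff primes_dvd_imp_eq)
  have "null (\<lambda>n. g n + (if p dvd n then - h p * g (n div p) else 0)) G"
    by (intro null_add null_dilate G g p)
  also have "(\<lambda>n. g n + (if p dvd n then - h p * g (n div p) else 0)) = (\<lambda>n. if \<forall>p\<in>insert p A. \<not> p dvd n then h n else 0)"
  proof
    fix n
    show "g n + (if p dvd n then - h p * g (n div p) else 0) = (if \<forall>p\<in>insert p A. \<not> p dvd n then h n else 0)"
    proof (cases "p dvd n")
      case True
      then obtain k where k: "n = p * k" by blast
      have "g n = h p * g k" unfolding g_def k using dvd_iff h(2) by auto
      then show ?thesis using True k p by simp
    qed (simp add: g_def)
  qed
  finally show ?case .
qed (use h in simp)

lemma eigenfunction_of_good_integer: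
  assumes eig: "\<And>p. prime p \<Longrightarrow> p \<notin> E \<Longrightarrow> AE x in M. h p * G (S p x) = G x"
    and h: "\<And>m n. h (m * n) = h m * h n" "h 1 = 1"
    and n: "n \<ge> 1" "\<And>p. prime p \<Longrightarrow> p dvd n \<Longrightarrow> p \<notin> E"
  shows "AE x in M. h n * G (S n x) = (G x :: complex)"
  using n
proof (induction n rule: prime_divisors_induct)
  case (unit n)
  then have "n = 1" by simp
  \<comment> \<open>The action law gives only S 1 (S 1 x) = S 1 x; injectivity makes S 1 the
    identity.\<close>
  have "S 1 x = x" if "x \<in> space M" for x
  proof -
    have "S 1 (S 1 x) = S 1 x" using S_mult[of 1 1 x] that by simp
    moreover have "inj_on (S 1) (space M)"
      using S_imp[of 1] by (auto simp: invertible_measure_preserving_def bij_betw_def)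
    ultimately show ?thesis using that S_space[of 1 x] by (auto dest: inj_onD)
  qed
  then show ?case using \<open>n = 1\<close> h(2) by (auto intro!: AE_I2)
next
  case (factor p n)
  have n1: "n \<ge> 1" and p1: "p \<ge> 1" using factor.prems(1) by (cases n; cases p; simp)+
  have "AE x in M. h n * G (S n x) = G x"
    by (rule factor.IH[OF n1]) (use factor.prems in auto)
  moreover have "AE x in M. h p * G (S p (S n x)) = G (S n x)"
    using S_AE[OF n1 eig[OF factor.hyps]] factor.prems(2)[OF factor.hyps] by simp
  ultimately show ?case using AE_space
  proof eventually_elim
    case (elim x)
    have "h (p * n) * G (S (p * n) x) = h n * (h p * G (S p (S n x)))"
      using S_mult[OF n1 p1 elim(3)] h by simp
    then show ?case using elim by simp
  qed
qed simp

text \<open>A finite sieve removes the exceptional primes that carry most of the mass of \<open>E\<close>. It leaves a positive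
  proportion of integers, and \<open>h n * G (S n x) = G x\<close> on most of them, so the sieved average is close to a
  positive multiple of \<open>G\<close>.\<close>

lemma pretentious_eigenfunction_not_null:
  assumes G: "G \<in> L2 M" "\<not> (AE x in M. G x = 0)"
    and E: "(\<lambda>p. 1 / real p) summable_on E" "\<And>p. p \<in> E \<Longrightarrow> prime p"
    and eig: "\<And>p. prime p \<Longrightarrow> p \<notin> E \<Longrightarrow> AE x in M. h p * G (S p x) = G x"
    and h: "\<And>m n. h (m * n) = h m * h n" "h 1 = 1" "\<And>n. norm (h n) \<le> 1"
  shows "\<not> null h G"
proof
  assume null: "null h G"
  define a where "a = L2_norm M G"
  have a: "a > 0" using G L2_norm_eq_0_iff[OF G(1)] L2_norm_nonneg[of M G] unfolding a_def by linarith
  define s where "s = infsum (\<lambda>p. 1 / real p) E"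
  have sum_le: "(\<Sum>p\<in>A. 1 / real p) \<le> s" if "finite A" "A \<subseteq> E" for A
    unfolding s_def using E(1) that by (intro finite_sum_le_infsum) auto
  \<comment> \<open>By 1 - x >= exp (-2 x) this bounds from below the density of the integers free
    of any finite set of primes from \<open>E\<close>.\<close>
  define \<kappa> where "\<kappa> = exp (- 2 * s)"
  have \<kappa>: "\<kappa> > 0" by (simp add: \<kappa>_def)
  \<comment> \<open>The primes of \<open>E\<close> outside \<open>A\<close> spoil at most N \<kappa>
    / 8 survivors, and rounding costs less than N \<kappa> / 8. Good survivors then outnumber bad
    ones by at least 5/8 N \<kappa>, of which N \<kappa> / 2 is used.\<close>
  obtain A where A: "finite A" "A \<subseteq> E" "(\<Sum>p\<in>A. 1 / real p) > s - \<kappa> / 8"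
  proof -
    have "((\<lambda>A. \<Sum>p\<in>A. 1 / real p) \<longlongrightarrow> s) (finite_subsets_at_top E)"
      using E(1) has_sum_infsum unfolding s_def has_sum_def by blast
    then have "\<forall>\<^sub>F A in finite_subsets_at_top E. (\<Sum>p\<in>A. 1 / real p) > s - \<kappa> / 8"
      by (rule order_tendstoD) (use \<kappa> in simp)
    then show thesis using that unfolding eventually_finite_subsets_at_top by blast
  qed
  have Ap: "prime p" if "p \<in> A" for p using that A(2) E(2) by blast
  have tail: "(\<Sum>p\<in>F. 1 / real p) \<le> \<kappa> / 8" if "finite F" "F \<subseteq> E - A" for F
  proof -
    have "(\<Sum>p\<in>A. 1 / real p) + (\<Sum>p\<in>F. 1 / real p) = (\<Sum>p\<in>A \<union> F. 1 / real p)"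
      using that A(1) by (intro sum.union_disjoint[symmetric]) auto
    also have "\<dots> \<le> s" using that A by (intro sum_le) auto
    finally show ?thesis using A(3) by simp
  qed
  have prod_ge: "(\<Prod>p\<in>A. 1 - 1 / real p) \<ge> \<kappa>"
  proof -
    have "\<kappa> \<le> exp (- 2 * (\<Sum>p\<in>A. 1 / real p))" unfolding \<kappa>_def using sum_le[OF A(1,2)] by simp
    also have "\<dots> \<le> (\<Prod>p\<in>A. 1 - 1 / real p)" by (rule prod_one_minus_ge[OF A(1) Ap])
    finally show ?thesis .
  qed
  define g where "g = (\<lambda>n. if \<forall>p\<in>A. \<not> p dvd n then h n else 0)"
  have "null g G" unfolding g_def by (rule null_sieve[OF G(1) null h(1) A(1) Ap])
  then have "\<forall>\<^sub>F N in sequentially. L2_norm M (W g G N) < a * \<kappa> / 2"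
    unfolding null_def by (rule order_tendstoD) (use a \<kappa> in simp)
  moreover have "\<forall>\<^sub>F N in sequentially. real N > 8 * 3 ^ card A / \<kappa>"
    by (rule eventually_compose_filterlim[OF eventually_gt_at_top filterlim_real_sequentially])
  ultimately have "\<forall>\<^sub>F N in sequentially. False"
  proof eventually_elim
    case (elim N)
    have "0 < 8 * 3 ^ card A / \<kappa>" using \<kappa> by simp
    then have N: "real N > 0" using elim by linarith
    define U where "U = {n\<in>{1..N}. \<forall>p\<in>A. \<not> p dvd n}"
    define Bd where "Bd = {n\<in>U. \<exists>p\<in>E. p dvd n}"
    have finU: "finite U" "finite Bd" by (auto simp: U_def Bd_def)
    have "real (card Bd) \<le> real N * (\<kappa> / 8)"
    proof -
      define F where "F = {p\<in>E - A. p \<le> N}"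
      have F: "finite F" "F \<subseteq> E - A" by (auto simp: F_def)
      have "Bd \<subseteq> (\<Union>p\<in>F. {n\<in>{1..N}. p dvd n})"
      proof
        fix n assume "n \<in> Bd"
        then obtain p where p: "p \<in> E" "p dvd n" and n: "n \<in> {1..N}" "\<forall>p\<in>A. \<not> p dvd n"
          by (auto simp: Bd_def U_def)
        have "p \<le> n" using p(2) n(1) by (intro dvd_imp_le) auto
        then have "p \<in> F" using p n by (auto simp: F_def)
        then show "n \<in> (\<Union>p\<in>F. {n\<in>{1..N}. p dvd n})" using p(2) n(1) by auto
      qed
      then have "card Bd \<le> card (\<Union>p\<in>F. {n\<in>{1..N}. p dvd n})" using F by (intro card_mono) auto
      also have "\<dots> \<le> (\<Sum>p\<in>F. card {n\<in>{1..N}. p dvd n})" by (rule card_UN_le[OF F(1)])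
      also have "\<dots> = (\<Sum>p\<in>F. N div p)"
        using E(2) prime_ge_1_nat by (intro sum.cong refl card_multiples) (auto simp: F_def)
      finally have "real (card Bd) \<le> (\<Sum>p\<in>F. real (N div p))" by (metis of_nat_le_iff of_nat_sum)
      also have "\<dots> \<le> (\<Sum>p\<in>F. real N * (1 / real p))"
        using of_nat_div_le_of_nat[of N, where ?'a = real] by (intro sum_mono) simp
      also have "\<dots> \<le> real N * (\<kappa> / 8)" unfolding sum_distrib_left[symmetric] using tail[OF F] by (intro mult_left_mono) auto
      finally show ?thesis .
    qed
    moreover have "real (card U) \<ge> real N * \<kappa> - 3 ^ card A"
      using coprime_count_approx[OF A(1) Ap, of N] mult_left_mono[OF prod_ge, of "real N"]
      unfolding coprime_count_def U_def by (simp add: abs_le_iff)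
    moreover have "3 ^ card A < real N * (\<kappa> / 8)" using elim \<kappa> by (simp add: field_simps)
    moreover have "real (card (U - Bd)) = real (card U) - real (card Bd)"
      using finU by (subst card_Diff_subset) (auto simp: Bd_def card_mono of_nat_diff)
    ultimately have cards: "real (card (U - Bd)) - real (card Bd) \<ge> real N * (\<kappa> / 2)" by (simp add: field_simps)
    define Y where "Y = (\<lambda>x. \<Sum>n\<in>Bd. h n * G (S n x))"
    have tL: "(\<lambda>x. h n * G (S n x)) \<in> L2 M" "L2_norm M (\<lambda>x. h n * G (S n x)) \<le> a" if "n \<ge> 1" for n
    proof -
      show "(\<lambda>x. h n * G (S n x)) \<in> L2 M" by (intro L2_scale L2_comp(1)[OF S_imp[OF that]] G)
      have "L2_norm M (\<lambda>x. h n * G (S n x)) = norm (h n) * a"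
        unfolding L2_norm_scale a_def using L2_comp(2)[OF S_imp[OF that] G(1)] by simp
      also have "\<dots> \<le> 1 * a" using h(3) a by (intro mult_right_mono) auto
      finally show "L2_norm M (\<lambda>x. h n * G (S n x)) \<le> a" by simp
    qed
    have YL: "Y \<in> L2 M" unfolding Y_def by (intro L2_sum tL) (auto simp: Bd_def U_def)
    have Yle: "L2_norm M Y \<le> real (card Bd) * a"
    proof -
      have "L2_norm M Y \<le> (\<Sum>n\<in>Bd. L2_norm M (\<lambda>x. h n * G (S n x)))"
        unfolding Y_def by (intro L2_norm_sum_le tL) (auto simp: Bd_def U_def)
      also have "\<dots> \<le> (\<Sum>n\<in>Bd. a)" by (intro sum_mono tL) (auto simp: Bd_def U_def)
      finally show ?thesis by simp
    qed
    have "AE x in M. \<forall>n\<in>U - Bd. h n * G (S n x) = G x"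
    proof (rule AE_finite_allI)
      fix n assume n: "n \<in> U - Bd"
      show "AE x in M. h n * G (S n x) = G x"
        by (rule eigenfunction_of_good_integer[OF eig h(1,2)]) (use n in \<open>auto simp: Bd_def U_def\<close>)
    qed (use finU in simp)
    then have ae: "AE x in M. of_real (real N) * W g G N x = of_real (real (card (U - Bd))) * G x + Y x"
    proof eventually_elim
      case (elim x)
      have "of_real (real N) * W g G N x = (\<Sum>n=1..N. g n * G (S n x))" using N by (simp add: W_def)
      also have "\<dots> = (\<Sum>n\<in>U. h n * G (S n x))"
        unfolding U_def by (subst sum.inter_filter) (auto simp: g_def intro!: sum.cong)
      also have "\<dots> = (\<Sum>n\<in>U - Bd. h n * G (S n x)) + (\<Sum>n\<in>Bd. h n * G (S n x))"
        using finU by (intro sum.subset_diff) (auto simp: Bd_def)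
      also have "(\<Sum>n\<in>U - Bd. h n * G (S n x)) = (\<Sum>n\<in>U - Bd. G x)" using elim by (intro sum.cong) auto
      finally show ?case by (simp add: Y_def)
    qed
    have WL: "(\<lambda>x. of_real (real N) * W g G N x) \<in> L2 M" by (intro L2_scale W_L2 G)
    have GL: "(\<lambda>x. of_real (real (card (U - Bd))) * G x) \<in> L2 M" by (intro L2_scale G)
    have "real (card (U - Bd)) * a = L2_norm M (\<lambda>x. of_real (real (card (U - Bd))) * G x)"
      unfolding L2_norm_scale by (simp add: a_def)
    also have "\<dots> = L2_norm M (\<lambda>x. of_real (real N) * W g G N x - Y x)"
      by (rule L2_norm_cong_AE) (use ae WL GL YL in \<open>auto intro!: borel_measurable_diff L2_measurable\<close>)
    also have "\<dots> \<le> L2_norm M (\<lambda>x. of_real (real N) * W g G N x) + L2_norm M Y"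
      by (rule L2_norm_triangle_diff[OF WL YL])
    also have "L2_norm M (\<lambda>x. of_real (real N) * W g G N x) = real N * L2_norm M (W g G N)"
      unfolding L2_norm_scale by simp
    finally have "(real (card (U - Bd)) - real (card Bd)) * a \<le> real N * L2_norm M (W g G N)"
      using Yle by (simp add: algebra_simps)
    also have "\<dots> < real N * (a * \<kappa> / 2)" using elim N by (intro mult_strict_left_mono) auto
    finally have "(real (card (U - Bd)) - real (card Bd)) * a < real N * (\<kappa> / 2) * a" by (simp add: mult_ac)
    then show False using cards a by (simp add: mult_less_cancel_right)
  qed
  then show False by simp
qed

lemma jointly_ergodic_imp_disjoint_spectra:
  assumes je: "jointly_ergodic M T S"
  shows "rational_spectrum M T \<inter> pret_rational_spectrum_fractions M S = {0}"
proof (intro equalityI subsetI)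
  fix \<alpha> :: real assume "\<alpha> \<in> {0}"
  then have \<alpha>: "\<alpha> = 0" by simp
  have "L2_eigenvalue M T 1"
    unfolding L2_eigenvalue_def by (intro bexI[of _ "\<lambda>_. 1"]) (auto simp: L2_const AE_const)
  then show "\<alpha> \<in> rational_spectrum M T \<inter> pret_rational_spectrum_fractions M S"
    by (simp add: \<alpha> rational_spectrum_def pret_rational_spectrum_fractions_def)
next
  fix \<alpha> :: real assume \<alpha>: "\<alpha> \<in> rational_spectrum M T \<inter> pret_rational_spectrum_fractions M S"
  show "\<alpha> \<in> {0}"
  proof (rule ccontr)
    assume "\<alpha> \<notin> {0}"
    then have \<alpha>0: "\<alpha> \<noteq> 0" by simp
    from \<alpha> have \<alpha>1: "0 \<le> \<alpha>" "\<alpha> < 1" "L2_eigenvalue M T (cis (2 * pi * \<alpha>))"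
      by (auto simp: rational_spectrum_def)
    from \<alpha> \<alpha>0 obtain r0 q chi where rq: "\<alpha> = real_of_int r0 / real q" "q \<ge> 1" "coprime r0 (int q)"
      and chi: "primitive_character q chi" "modified_character chi \<in> pret_rational_spectrum M S"
      by (auto simp: pret_rational_spectrum_fractions_def)
    have "r0 \<ge> 0" using \<alpha>1(1) rq by (simp add: zero_le_divide_iff)
    then obtain r where r: "r0 = int r" using nonneg_int_cases by blast
    have cop: "coprime r q" using rq(3) by (simp add: r)
    have q1: "q > 1"
    proof (rule ccontr)
      assume "\<not> q > 1"
      then have "q = 1" using rq(2) by simp
      then have "\<alpha> = real r" using rq by (simp add: r)
      then show False using \<alpha>1 \<alpha>0 by simp
    qed
    have chiD: "dirichlet_character q chi" using chi(1) by (simp add: primitive_character_def)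
    from chi(2) obtain G E0 where G: "G \<in> L2 M" "\<not> (AE x in M. G x = 0)"
      and E0: "(\<lambda>p. 1 / real p) summable_on E0" "\<And>p. prime p \<Longrightarrow> p \<notin> E0 \<Longrightarrow> AE x in M. G (S p x) = chi p * G x"
      unfolding modified_character_in_spectrum_iff[OF chiD] by blast
    define E where "E = {p. prime p \<and> (p \<in> E0 \<or> \<not> coprime p q)}"
    have E: "(\<lambda>p. 1 / real p) summable_on E"
      by (rule summable_on_subset_banach[OF summable_on_Un_real[OF E0(1) summable_on_finite[OF finite_primes_not_coprime[OF rq(2)]]]])
         (auto simp: E_def)
    have chi1: "norm (chi p) = 1" if "prime p" "p \<notin> E" for p
      using that dirichlet_character_norm[OF chiD] by (simp add: E_def)
    have eig: "AE x in M. cnj (chi p) * G (S p x) = G x" if p: "prime p" "p \<notin> E" for p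
    proof -
      have c1: "cnj (chi p) * chi p = 1" using chi1[OF p] by (metis complex_norm_square mult.commute of_real_1 power_one)
      have "AE x in M. G (S p x) = chi p * G x" using E0(2)[OF p(1)] p by (simp add: E_def)
      then show ?thesis by eventually_elim (simp add: mult.assoc[symmetric] c1)
    qed
    \<comment> \<open>The modulus of G is invariant off the sparse set \<open>E\<close>, hence
      constant by pretentious ergodicity. This makes G bounded and so admissible as a test
      function.\<close>
    have "AE x in M. complex_of_real (norm (G (S p x))) = of_real (norm (G x))" if p: "prime p" "p \<notin> E" for p
    proof -
      have "AE x in M. G (S p x) = chi p * G x" using E0(2)[OF p(1)] p by (simp add: E_def)
      then show ?thesis by eventually_elim (simp add: norm_mult chi1[OF p])
    qed
    then obtain b where b: "AE x in M. complex_of_real (norm (G x)) = b"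
      using pretentiously_invariant_const[OF pret_ergodic _ E, of "\<lambda>x. of_real (norm (G x))"] L2_measurable[OF G(1)] by auto
    then have "AE x in M. norm (G x) \<le> norm b" by eventually_elim (metis norm_ge_zero norm_of_real abs_of_nonneg order_refl)
    then have GI: "G \<in> Linf M" using L2_measurable[OF G(1)] by (auto simp: Linf_def)

    obtain F where F: "F \<in> L2 M" "\<not> (AE x in M. F x = 0)" "AE x in M. F (T x) = cis (2 * pi * \<alpha>) * F x"
      using \<alpha>1(3) by (auto simp: L2_eigenvalue_def)
    have Fm: "F \<in> borel_measurable M" using F(1) by simp
    have cis_ez: "cis (2 * pi * \<alpha>) = ez q (int r)" by (simp add: ez_def rq r)
    obtain d where d: "d \<ge> 0" "AE x in M. norm (F x) = d"
      using eigenfunction_norm_const[OF Fm F(3)] by auto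
    have d0: "d \<noteq> 0" using F(2) d(2) by auto
    have null_exp: "null (\<lambda>n. ez q (int a * int n)) G" if a: "0 < a" "a < q" for a
    proof -
      \<comment> \<open>With k inverse to r modulo q, the power m = k a of F is an eigenfunction for
        e(a/q). Thus one eigenfunction reaches all nonzero frequencies, and there its power has
        integral 0.\<close>
      obtain k where "[r * k = 1] (mod q)" using cong_solve_coprime_nat[OF cop] by auto
      then have "[r * k * a = 1 * a] (mod q)" by (rule cong_mult) simp
      define m where "m = k * a"
      have rm: "[int (r * m) = int a] (mod int q)"
        unfolding cong_int_iff m_def using \<open>[r * k * a = 1 * a] (mod q)\<close> by (simp add: mult.assoc)
      have ez_m: "ez q (int r) ^ m = ez q (int a)"
        unfolding ez_power[symmetric] using q1 rm by (intro ez_cong) (auto simp: mult.commute)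
      have "ez q (int a) \<noteq> 1" using a q1 by (auto simp: ez_eq_1_iff dest: zdvd_imp_le)
      define f where "f = (\<lambda>x. F x ^ m)"
      have fe: "AE x in M. f (T x) = ez q (int a) * f x"
        using F(3) by eventually_elim (simp add: f_def power_mult_distrib cis_ez ez_m)
      have fm: "f \<in> borel_measurable M" unfolding f_def using Fm by (intro borel_measurable_power)
      have fI: "f \<in> Linf M" by (rule eigenfunction_Linf[OF fm fe]) simp
      have fL: "f \<in> L2 M" using fI Linf_subset_L2 by blast
      have fd: "AE x in M. norm (f x) = d ^ m" using d(2) by eventually_elim (simp add: f_def norm_power)
      have int0: "(LINT x|M. f x) = 0"
      proof -
        have "(LINT x|M. f x) = (LINT x|M. f ((T ^^ 1) x))" by (rule Tn_integral[OF fm, symmetric])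
        also have "\<dots> = (LINT x|M. ez q (int a) * f x)"
          using fe measurable_compose[OF T_meas fm] fm by (intro integral_cong_AE) auto
        finally have "(1 - ez q (int a)) * (LINT x|M. f x) = 0" by (simp add: algebra_simps)
        then show ?thesis using \<open>ez q (int a) \<noteq> 1\<close> by simp
      qed
      have lim: "(\<lambda>N. L2_norm M (B f G N)) \<longlonglongrightarrow> 0"
        using je[unfolded jointly_ergodic_def, rule_format, OF fI GI] int0 by (simp add: B_def[abs_def])
      have "L2_norm M (B f G N) = d ^ m * L2_norm M (W (\<lambda>n. ez q (int a * int n)) G N)" for N
      proof -
        have "AE x in M. \<forall>n. f ((T ^^ n) x) = ez q (int a) ^ n * f x"
          unfolding AE_all_countable using eigenfunction_funpow[OF fe] by simp
        with fd have "AE x in M. norm (B f G N x) = norm (of_real (d ^ m) * W (\<lambda>n. ez q (int a * int n)) G N x)"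
        proof eventually_elim
          case (elim x)
          have "(\<Sum>n=1..N. f ((T ^^ n) x) * G (S n x)) = (\<Sum>n=1..N. ez q (int a * int n) * G (S n x)) * f x"
            unfolding sum_distrib_right
            using elim(2) by (intro sum.cong refl) (simp add: ez_power mult.commute[of "int a"] mult_ac)
          then have "B f G N x = W (\<lambda>n. ez q (int a * int n)) G N x * f x" unfolding B_def W_def by simp
          then show ?case using elim(1) d(1) by (simp add: norm_mult norm_power mult.commute)
        qed
        moreover have "B f G N \<in> L2 M"
        proof -
          obtain C where "AE x in M. norm (G x) \<le> C" using GI by (auto simp: Linf_def)
          then show ?thesis by (rule B_L2[OF fL L2_measurable[OF G(1)]])
        qed
        moreover have "(\<lambda>x. of_real (d ^ m) * W (\<lambda>n. ez q (int a * int n)) G N x) \<in> L2 M" by (intro L2_scale W_L2 G)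
        ultimately have "L2_norm M (B f G N) = L2_norm M (\<lambda>x. of_real (d ^ m) * W (\<lambda>n. ez q (int a * int n)) G N x)"
          by (intro antisym L2_mono(2)) (auto elim: eventually_mono)
        then show ?thesis unfolding L2_norm_scale using d(1) by (simp add: norm_power)
      qed
      with lim have "(\<lambda>N. 1 / d ^ m * (d ^ m * L2_norm M (W (\<lambda>n. ez q (int a * int n)) G N))) \<longlonglongrightarrow> 1 / d ^ m * 0"
        by (intro tendsto_intros) simp
      then show ?thesis unfolding null_def using d0 by simp
    qed
    \<comment> \<open>Frequency 0, the only one that \<open>null_exp\<close> does not reach, is
      absent because a primitive character modulo q > 1 has sum 0 over a period.\<close>
    have "null (\<lambda>n. cnj (chi n)) G"
    proof (rule periodic_fourier_induct[where q = q and h = "\<lambda>n. cnj (chi n)" and P = "\<lambda>h. null h G"])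
      show "(\<Sum>n<q. cnj (chi n)) = 0" using primitive_character_sum_zero[OF chi(1) q1] by (simp flip: cnj_sum)
      show "cnj (chi (n + q)) = cnj (chi n)" for n using dirichlet_characterD(3)[OF chiD] by simp
    qed (use rq(2) in \<open>auto intro: null_zero null_add null_scale null_exp G\<close>)
    moreover have "\<not> null (\<lambda>n. cnj (chi n)) G"
      by (rule pretentious_eigenfunction_not_null[OF G E _ eig])
         (use dirichlet_characterD(2)[OF chiD] dirichlet_character_1[OF chiD] dirichlet_character_norm_le[OF chiD] in \<open>auto simp: E_def\<close>)
    ultimately show False by blast
  qed
qed

end

theorem theoremB:
  fixes M :: "'a::metric_space measure"
    and T :: "'a \<Rightarrow> 'a"
    and S :: "nat \<Rightarrow> 'a \<Rightarrow> 'a"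
  assumes "regular_prob_space M"
    and "additive_action M T" and "ergodic M T"
    and "multiplicative_action M S" and "pretentiously_ergodic M S" and "finitely_generated M S"
  shows "jointly_ergodic M T S \<longleftrightarrow>
           rational_spectrum M T \<inter> pret_rational_spectrum_fractions M S = {0}"
proof -
  have M: "prob_space M" using assms(1) by (simp add: regular_prob_space_def)
  interpret prob_space M by (rule M)
  interpret full_system M T S
    using assms by unfold_locales (auto simp: additive_action_def)
  show ?thesis
    using jointly_ergodic_imp_disjoint_spectra disjoint_spectra_imp_jointly_ergodic by blast
qed

end
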